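(* Let $T$ be a recursive theory in the pure language of category theory (no constant symbols) that proves the axioms of a constructively well-pointed Heyting pretopos, and assume the metatheoretic model $\mathbf{Tiny}$ of $T$ described in the context exists. Let $T^*$, $M$ and $FP=FP_{T^*,M}$ be constructed from $T$ and $\mathbf{Tiny}$ as in the context (every sentence of $T$ is a sentence of $T^*$). If $FP(\phi)$ holds for every axiom $\phi$ of $T$, then $T$ is consistent and has the existence property and the disjunction property.
   Context: Language: dependently sorted first-order language of category theory (intuitionistic), with object sort, arrow sorts $X\to Y$, identities, composition, equality only between arrows of the same sort; theories may have object and arrow constants and contain category and equality axioms. Contexts are lists of typed variables; $\exists\Delta$, variable assignments $c:\Theta\to\mathcal C(T)_\Delta$ (terms in context $\Delta$), context isomorphisms (componentwise isomorphisms on object variables commuting with the arrow variables) and $\exists!\Delta\,P(\Delta)$ (existence plus a unique context isomorphism between any two witnesses) are as usual. Existence property: whenever $T\vdash\exists\Theta\,P(\Theta)$ there are a context $\Delta$, an assignment $c:\Theta\to\mathcal C(T)_\Delta$ and $Q(\Delta)$ with $T\vdash\exists!\Delta\,Q(\Delta)$ and $T\vdash\exists\Delta(Q(\Delta)\wedge P(c))$. Disjunction property: $T\vdash P\vee Q$ implies $T\vdash P$ or $T\vdash Q$ for sentences. Well-pointed Heyting pretopos axioms: finite limits; finite coproducts, disjoint and pullback-stable; pullback-stable images; coequalizers of equivalence relations; right adjoints to $f^{-1}:\mathrm{Sub}(B)\to\mathrm{Sub}(A)$; with $1$ terminal: $1$ is a strong generator, indecomposable, projective, and there is no arrow $1\to0$.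 $\mathbf{Tiny}$: a small subcategory of the metatheoretic $\mathrm{Set}$ with terminal object and parametrized natural numbers object preserved by the inclusion, containing all maps $1\to A$ of $\mathrm{Set}$ for its objects $A$, which is a constructively well-pointed Heyting pretopos and a model of $T$. $T_c$: extend $T$ by (i) for each context $\Delta$ and formula $P(\Delta)$ with $T\vdash\exists!\Delta\,P(\Delta)$, new constants for the variables of $\Delta$ with axiom $P$ of them; (ii) then, for each formula $P(f)$ in one arrow variable $f:A\to B$ between object constants with the resulting theory proving $\exists! f\,P(f)$, a new arrow constant with axiom $P$ of it; (iii) then identifying provably equal arrow constants. Then each closed arrow-term $f:A\to B$ of $T_c$ is provably equal to exactly one arrow constant, so the constants of $T_c$ form a category (also denoted $T_c$); $T_c$ is recursive, hence lies in $\mathbf{Tiny}$. Fix an object constant $1$ provably terminal; let $\mathrm{Gl}:T_c\to\mathbf{Tiny}$ send $A$ to the set of arrow constants $1\to A$. $F$ is the comma category: objects $(X,S,f)$ with $X$ in $\mathbf{Tiny}$, $S$ an object constant of $T_c$, $f:X\to\mathrm{Gl}(S)$; arrows $(X,S,f)\to(Y,R,g)$ are pairs $(h:X\to Y,\varphi:S\to R)$ with $\mathrm{Gl}(\varphi)\circ f=g\circ h$; write $(X,S,f)^-=S$, $(h,\varphi)^-=\varphi$. $T^*$ has as object constants the objects of $F$ and as arrow constants the arrows of $F$, and $T^*\vdash\phi$ iff $T_c\vdash\phi^-$ where $\phi^-$ replaces each constant by its image under $(-)^-$. $M$ is the set of $f_1=f_2$ with $f_1,f_2$ closed arrow-terms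 of $T^*$ of the same sort denoting the same arrow of $F$. $FP$ is defined recursively: $FP(f_1=f_2)$ iff $(f_1=f_2)\in M$; commutes with $\wedge,\vee$; $FP(\phi\to\xi)$ iff ($FP(\phi)\Rightarrow FP(\xi)$) and $T^*\vdash\phi\to\xi$; $FP(\top)$ true, $FP(\bot)$ false; $FP(\exists x{:}W\,P)$ iff $FP(P(t))$ for some closed term $t$; $FP(\forall x{:}W\,P)$ iff $FP(P(t))$ for all closed terms $t$ of sort $W$ and $T^*\vdash\forall x{:}W\,P$. *)

theory Defs
  imports Main "HOL-Library.FuncSet" "HOL-Library.Nat_Bijection"
begin

section \<open>The dependently sorted language of category theory\<close>

text \<open>
  Raw terms over object constants \<open>'o\<close> and arrow constants \<open>'a\<close>, with de Bruijn indices shared by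
  object and arrow variables. \<open>Cmp g f\<close> is the composite \<open>g \<circ> f\<close>.
\<close>

datatype ('o, 'a) tm = Var nat | OCon 'o | ACon 'a | Idn "('o, 'a) tm" | Cmp "('o, 'a) tm" "('o, 'a) tm"

datatype ('o, 'a) srt = Ob | Hom "('o, 'a) tm" "('o, 'a) tm"

datatype ('o, 'a) fm =
    FEq "('o, 'a) tm" "('o, 'a) tm"
  | FTop
  | FBot
  | FAnd "('o, 'a) fm" "('o, 'a) fm"
  | FOr "('o, 'a) fm" "('o, 'a) fm"
  | FImp "('o, 'a) fm" "('o, 'a) fm"
  | FAll "('o, 'a) srt" "('o, 'a) fm"
  | FEx "('o, 'a) srt" "('o, 'a) fm"

text \<open>
  The head of a context is the variable declared last, i.e. \<open>Var 0\<close>; the sort at position \<open>i\<close> lives in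
  the context \<open>drop (Suc i) \<Gamma>\<close>.
\<close>

type_synonym ('o, 'a) ctx = "('o, 'a) srt list"

primrec subst_tm :: "(nat \<Rightarrow> ('o, 'a) tm) \<Rightarrow> ('o, 'a) tm \<Rightarrow> ('o, 'a) tm" where
  "subst_tm \<sigma> (Var i) = \<sigma> i"
| "subst_tm \<sigma> (OCon c) = OCon c"
| "subst_tm \<sigma> (ACon a) = ACon a"
| "subst_tm \<sigma> (Idn t) = Idn (subst_tm \<sigma> t)"
| "subst_tm \<sigma> (Cmp g f) = Cmp (subst_tm \<sigma> g) (subst_tm \<sigma> f)"

primrec subst_srt :: "(nat \<Rightarrow> ('o, 'a) tm) \<Rightarrow> ('o, 'a) srt \<Rightarrow> ('o, 'a) srt" where
  "subst_srt \<sigma> Ob = Ob"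
| "subst_srt \<sigma> (Hom X Y) = Hom (subst_tm \<sigma> X) (subst_tm \<sigma> Y)"

definition shift :: "nat \<Rightarrow> nat \<Rightarrow> ('o, 'a) tm" where
  "shift k = (\<lambda>i. Var (i + k))"

definition up :: "(nat \<Rightarrow> ('o, 'a) tm) \<Rightarrow> nat \<Rightarrow> ('o, 'a) tm" where
  "up \<sigma> = case_nat (Var 0) (\<lambda>i. subst_tm (shift 1) (\<sigma> i))"

primrec subst_fm :: "(nat \<Rightarrow> ('o, 'a) tm) \<Rightarrow> ('o, 'a) fm \<Rightarrow> ('o, 'a) fm" where
  "subst_fm \<sigma> (FEq s t) = FEq (subst_tm \<sigma> s) (subst_tm \<sigma> t)"
| "subst_fm \<sigma> FTop = FTop"
| "subst_fm \<sigma> FBot = FBot"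
| "subst_fm \<sigma> (FAnd P Q) = FAnd (subst_fm \<sigma> P) (subst_fm \<sigma> Q)"
| "subst_fm \<sigma> (FOr P Q) = FOr (subst_fm \<sigma> P) (subst_fm \<sigma> Q)"
| "subst_fm \<sigma> (FImp P Q) = FImp (subst_fm \<sigma> P) (subst_fm \<sigma> Q)"
| "subst_fm \<sigma> (FAll s P) = FAll (subst_srt \<sigma> s) (subst_fm (up \<sigma>) P)"
| "subst_fm \<sigma> (FEx s P) = FEx (subst_srt \<sigma> s) (subst_fm (up \<sigma>) P)"

definition inst :: "('o, 'a) tm \<Rightarrow> ('o, 'a) fm \<Rightarrow> ('o, 'a) fm" where
  "inst t = subst_fm (case_nat t Var)"

record ('o, 'a) sig =
  ocons :: "'o set"
  acons :: "'a set"
  cdom :: "'a \<Rightarrow> 'o"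
  ccod :: "'a \<Rightarrow> 'o"

record ('o, 'a) thy =
  sg :: "('o, 'a) sig"
  axms :: "('o, 'a) fm set"

inductive has_sort :: "('o, 'a) sig \<Rightarrow> ('o, 'a) ctx \<Rightarrow> ('o, 'a) tm \<Rightarrow> ('o, 'a) srt \<Rightarrow> bool"
  for \<Sigma> \<Gamma> where
  "i < length \<Gamma> \<Longrightarrow> has_sort \<Sigma> \<Gamma> (Var i) (subst_srt (shift (Suc i)) (\<Gamma> ! i))"
| "c \<in> ocons \<Sigma> \<Longrightarrow> has_sort \<Sigma> \<Gamma> (OCon c) Ob"
| "a \<in> acons \<Sigma> \<Longrightarrow> has_sort \<Sigma> \<Gamma> (ACon a) (Hom (OCon (cdom \<Sigma> a)) (OCon (ccod \<Sigma> a)))"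
| "has_sort \<Sigma> \<Gamma> X Ob \<Longrightarrow> has_sort \<Sigma> \<Gamma> (Idn X) (Hom X X)"
| "has_sort \<Sigma> \<Gamma> f (Hom X Y) \<Longrightarrow> has_sort \<Sigma> \<Gamma> g (Hom Y Z) \<Longrightarrow> has_sort \<Sigma> \<Gamma> (Cmp g f) (Hom X Z)"

primrec wf_srt :: "('o, 'a) sig \<Rightarrow> ('o, 'a) ctx \<Rightarrow> ('o, 'a) srt \<Rightarrow> bool" where
  "wf_srt \<Sigma> \<Gamma> Ob \<longleftrightarrow> True"
| "wf_srt \<Sigma> \<Gamma> (Hom X Y) \<longleftrightarrow> has_sort \<Sigma> \<Gamma> X Ob \<and> has_sort \<Sigma> \<Gamma> Y Ob"

primrec wf_ctx :: "('o, 'a) sig \<Rightarrow> ('o, 'a) ctx \<Rightarrow> bool" where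
  "wf_ctx \<Sigma> [] \<longleftrightarrow> True"
| "wf_ctx \<Sigma> (s # \<Gamma>) \<longleftrightarrow> wf_srt \<Sigma> \<Gamma> s \<and> wf_ctx \<Sigma> \<Gamma>"

primrec wf_fm :: "('o, 'a) sig \<Rightarrow> ('o, 'a) ctx \<Rightarrow> ('o, 'a) fm \<Rightarrow> bool" where
  "wf_fm \<Sigma> \<Gamma> (FEq s t) \<longleftrightarrow> (\<exists>X Y. has_sort \<Sigma> \<Gamma> s (Hom X Y) \<and> has_sort \<Sigma> \<Gamma> t (Hom X Y))"
| "wf_fm \<Sigma> \<Gamma> FTop \<longleftrightarrow> True"
| "wf_fm \<Sigma> \<Gamma> FBot \<longleftrightarrow> True"
| "wf_fm \<Sigma> \<Gamma> (FAnd P Q) \<longleftrightarrow> wf_fm \<Sigma> \<Gamma> P \<and> wf_fm \<Sigma> \<Gamma> Q"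
| "wf_fm \<Sigma> \<Gamma> (FOr P Q) \<longleftrightarrow> wf_fm \<Sigma> \<Gamma> P \<and> wf_fm \<Sigma> \<Gamma> Q"
| "wf_fm \<Sigma> \<Gamma> (FImp P Q) \<longleftrightarrow> wf_fm \<Sigma> \<Gamma> P \<and> wf_fm \<Sigma> \<Gamma> Q"
| "wf_fm \<Sigma> \<Gamma> (FAll s P) \<longleftrightarrow> wf_srt \<Sigma> \<Gamma> s \<and> wf_fm \<Sigma> (s # \<Gamma>) P"
| "wf_fm \<Sigma> \<Gamma> (FEx s P) \<longleftrightarrow> wf_srt \<Sigma> \<Gamma> s \<and> wf_fm \<Sigma> (s # \<Gamma>) P"

abbreviation sentence :: "('o, 'a) sig \<Rightarrow> ('o, 'a) fm \<Rightarrow> bool" where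
  "sentence \<Sigma> \<equiv> wf_fm \<Sigma> []"


section \<open>Intuitionistic deduction in context\<close>

text \<open>
  The variable context is explicit since sorts may be empty. Equality has no rules of its own: the
  equality and category axioms are required to be among the axioms of a theory.
\<close>

definition wf_hyps :: "('o, 'a) thy \<Rightarrow> ('o, 'a) ctx \<Rightarrow> ('o, 'a) fm set \<Rightarrow> bool" where
  "wf_hyps T \<Gamma> \<Phi> \<longleftrightarrow> wf_ctx (sg T) \<Gamma> \<and> (\<forall>\<phi>\<in>\<Phi>. wf_fm (sg T) \<Gamma> \<phi>)"

inductive deriv :: "('o, 'a) thy \<Rightarrow> ('o, 'a) ctx \<Rightarrow> ('o, 'a) fm set \<Rightarrow> ('o, 'a) fm \<Rightarrow> bool"
  for T where
  Axiom: "wf_hyps T \<Gamma> \<Phi> \<Longrightarrow> \<phi> \<in> axms T \<Longrightarrow> sentence (sg T) \<phi> \<Longrightarrow> deriv T \<Gamma> \<Phi> \<phi>"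
| Hyp: "wf_hyps T \<Gamma> \<Phi> \<Longrightarrow> \<phi> \<in> \<Phi> \<Longrightarrow> deriv T \<Gamma> \<Phi> \<phi>"
| TopI: "wf_hyps T \<Gamma> \<Phi> \<Longrightarrow> deriv T \<Gamma> \<Phi> FTop"
| BotE: "deriv T \<Gamma> \<Phi> FBot \<Longrightarrow> wf_fm (sg T) \<Gamma> \<phi> \<Longrightarrow> deriv T \<Gamma> \<Phi> \<phi>"
| AndI: "deriv T \<Gamma> \<Phi> \<phi> \<Longrightarrow> deriv T \<Gamma> \<Phi> \<psi> \<Longrightarrow> deriv T \<Gamma> \<Phi> (FAnd \<phi> \<psi>)"
| AndE1: "deriv T \<Gamma> \<Phi> (FAnd \<phi> \<psi>) \<Longrightarrow> deriv T \<Gamma> \<Phi> \<phi>"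
| AndE2: "deriv T \<Gamma> \<Phi> (FAnd \<phi> \<psi>) \<Longrightarrow> deriv T \<Gamma> \<Phi> \<psi>"
| OrI1: "deriv T \<Gamma> \<Phi> \<phi> \<Longrightarrow> wf_fm (sg T) \<Gamma> \<psi> \<Longrightarrow> deriv T \<Gamma> \<Phi> (FOr \<phi> \<psi>)"
| OrI2: "deriv T \<Gamma> \<Phi> \<psi> \<Longrightarrow> wf_fm (sg T) \<Gamma> \<phi> \<Longrightarrow> deriv T \<Gamma> \<Phi> (FOr \<phi> \<psi>)"
| OrE: "deriv T \<Gamma> \<Phi> (FOr \<phi> \<psi>) \<Longrightarrow> deriv T \<Gamma> (insert \<phi> \<Phi>) \<chi> \<Longrightarrow> deriv T \<Gamma> (insert \<psi> \<Phi>) \<chi>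
    \<Longrightarrow> deriv T \<Gamma> \<Phi> \<chi>"
| ImpI: "deriv T \<Gamma> (insert \<phi> \<Phi>) \<psi> \<Longrightarrow> deriv T \<Gamma> \<Phi> (FImp \<phi> \<psi>)"
| ImpE: "deriv T \<Gamma> \<Phi> (FImp \<phi> \<psi>) \<Longrightarrow> deriv T \<Gamma> \<Phi> \<phi> \<Longrightarrow> deriv T \<Gamma> \<Phi> \<psi>"
| AllI: "deriv T (s # \<Gamma>) (subst_fm (shift 1) ` \<Phi>) \<phi> \<Longrightarrow> deriv T \<Gamma> \<Phi> (FAll s \<phi>)"
| AllE: "deriv T \<Gamma> \<Phi> (FAll s \<phi>) \<Longrightarrow> has_sort (sg T) \<Gamma> t s \<Longrightarrow> deriv T \<Gamma> \<Phi> (inst t \<phi>)"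
| ExI: "wf_fm (sg T) \<Gamma> (FEx s \<phi>) \<Longrightarrow> has_sort (sg T) \<Gamma> t s \<Longrightarrow> deriv T \<Gamma> \<Phi> (inst t \<phi>)
    \<Longrightarrow> deriv T \<Gamma> \<Phi> (FEx s \<phi>)"
| ExE: "deriv T \<Gamma> \<Phi> (FEx s \<phi>) \<Longrightarrow> wf_fm (sg T) \<Gamma> \<psi>
    \<Longrightarrow> deriv T (s # \<Gamma>) (insert \<phi> (subst_fm (shift 1) ` \<Phi>)) (subst_fm (shift 1) \<psi>)
    \<Longrightarrow> deriv T \<Gamma> \<Phi> \<psi>"

definition prov :: "('o, 'a) thy \<Rightarrow> ('o, 'a) fm \<Rightarrow> bool" where
  "prov T \<phi> \<longleftrightarrow> deriv T [] {} \<phi>"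


section \<open>Contexts: quantification, isomorphism, unique existence\<close>

primrec exs :: "('o, 'a) ctx \<Rightarrow> ('o, 'a) fm \<Rightarrow> ('o, 'a) fm" where
  "exs [] P = P"
| "exs (s # \<Delta>) P = exs \<Delta> (FEx s P)"

primrec alls :: "('o, 'a) ctx \<Rightarrow> ('o, 'a) fm \<Rightarrow> ('o, 'a) fm" where
  "alls [] P = P"
| "alls (s # \<Delta>) P = alls \<Delta> (FAll s P)"

primrec conjs :: "('o, 'a) fm list \<Rightarrow> ('o, 'a) fm" where
  "conjs [] = FTop"
| "conjs (P # Ps) = FAnd P (conjs Ps)"

definition iso_fm :: "('o, 'a) tm \<Rightarrow> ('o, 'a) tm \<Rightarrow> ('o, 'a) tm \<Rightarrow> ('o, 'a) fm" where
  "iso_fm X Y f = (let l = subst_tm (shift 1) in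
     FEx (Hom Y X) (FAnd (FEq (Cmp (Var 0) (l f)) (Idn (l X))) (FEq (Cmp (l f) (Var 0)) (Idn (l Y)))))"

text \<open>
  \<open>ctx_iso \<Delta> v w h\<close>: the object components \<open>h i : v i \<rightarrow> w i\<close> are isomorphisms from the
  interpretation \<open>v\<close> of the variables of \<open>\<Delta>\<close> to the interpretation \<open>w\<close>, commuting with the arrow variables.
  The component at an object term \<open>X\<close> occurring in the sort at position \<open>i\<close> is \<open>comp_at h i X\<close>; it is an
  identity at constants.
\<close>

definition comp_at :: "(nat \<Rightarrow> ('o, 'a) tm) \<Rightarrow> nat \<Rightarrow> ('o, 'a) tm \<Rightarrow> ('o, 'a) tm" where
  "comp_at h i X = (case X of Var j \<Rightarrow> h (Suc (i + j)) | _ \<Rightarrow> Idn X)"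

definition ctx_iso ::
    "('o, 'a) ctx \<Rightarrow> (nat \<Rightarrow> ('o, 'a) tm) \<Rightarrow> (nat \<Rightarrow> ('o, 'a) tm) \<Rightarrow> (nat \<Rightarrow> ('o, 'a) tm) \<Rightarrow> ('o, 'a) fm" where
  "ctx_iso \<Delta> v w h = conjs (map (\<lambda>i. case \<Delta> ! i of
       Ob \<Rightarrow> iso_fm (v i) (w i) (h i)
     | Hom X Y \<Rightarrow> FEq (Cmp (comp_at h i Y) (v i)) (Cmp (w i) (comp_at h i X))) [0..<length \<Delta>])"

definition obj_vars :: "('o, 'a) ctx \<Rightarrow> nat list" where
  "obj_vars \<Delta> = filter (\<lambda>i. \<Delta> ! i = Ob) [0..<length \<Delta>]"

text \<open>The position of the \<open>i\<close>-th variable in \<open>obj_vars \<Delta>\<close>, if it is an object variable.\<close>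

definition obj_rank :: "('o, 'a) ctx \<Rightarrow> nat \<Rightarrow> nat" where
  "obj_rank \<Delta> i = length (filter (\<lambda>s. s = Ob) (take i \<Delta>))"

text \<open>
  The context of the components of an isomorphism, over the context \<open>\<Delta> @ \<Delta>\<close>. There the source copy of
  variable \<open>i\<close> of \<open>\<Delta>\<close> is \<open>Var (length \<Delta> + i)\<close> and the target copy is \<open>Var i\<close>; the component at an object
  variable \<open>i\<close> is declared at position \<open>obj_rank \<Delta> i\<close>.
\<close>

definition iso_ctx :: "('o, 'a) ctx \<Rightarrow> ('o, 'a) ctx" where
  "iso_ctx \<Delta> = (let m = length (obj_vars \<Delta>) in
     map (\<lambda>k. let i = obj_vars \<Delta> ! k; e = m - Suc k in Hom (Var (e + length \<Delta> + i)) (Var (e + i))) [0..<m])"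

definition ex_unique_iso :: "('o, 'a) ctx \<Rightarrow> ('o, 'a) fm" where
  "ex_unique_iso \<Delta> = (let n = length \<Delta>; H = iso_ctx \<Delta>; m = length H;
       h1 = (\<lambda>i. Var (obj_rank \<Delta> i)); h2 = (\<lambda>i. Var (m + obj_rank \<Delta> i)) in
     FAnd (exs H (ctx_iso \<Delta> (\<lambda>i. Var (m + n + i)) (\<lambda>i. Var (m + i)) h1))
          (alls (map (subst_srt (shift m)) H @ H)
             (FImp (FAnd (ctx_iso \<Delta> (\<lambda>i. Var (m + m + n + i)) (\<lambda>i. Var (m + m + i)) h2)
                         (ctx_iso \<Delta> (\<lambda>i. Var (m + m + n + i)) (\<lambda>i. Var (m + m + i)) h1))
                   (conjs (map (\<lambda>i. FEq (h2 i) (h1 i)) (obj_vars \<Delta>))))))"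

definition ex_unique :: "('o, 'a) ctx \<Rightarrow> ('o, 'a) fm \<Rightarrow> ('o, 'a) fm" where
  "ex_unique \<Delta> P =
     FAnd (exs \<Delta> P)
          (alls (\<Delta> @ \<Delta>) (FImp (FAnd (subst_fm (shift (length \<Delta>)) P) P) (ex_unique_iso \<Delta>)))"

definition assignment :: "('o, 'a) sig \<Rightarrow> ('o, 'a) ctx \<Rightarrow> ('o, 'a) ctx \<Rightarrow> ('o, 'a) tm list \<Rightarrow> bool" where
  "assignment \<Sigma> \<Theta> \<Delta> c \<longleftrightarrow> length c = length \<Theta> \<and>
     (\<forall>i<length \<Theta>. has_sort \<Sigma> \<Delta> (c ! i) (subst_srt (\<lambda>j. c ! (Suc (i + j))) (\<Theta> ! i)))"

definition consistent :: "('o, 'a) thy \<Rightarrow> bool" where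
  "consistent T \<longleftrightarrow> \<not> prov T FBot"

definition disjunction_property :: "('o, 'a) thy \<Rightarrow> bool" where
  "disjunction_property T \<longleftrightarrow>
     (\<forall>P Q. sentence (sg T) P \<and> sentence (sg T) Q \<and> prov T (FOr P Q) \<longrightarrow> prov T P \<or> prov T Q)"

definition existence_property :: "('o, 'a) thy \<Rightarrow> bool" where
  "existence_property T \<longleftrightarrow>
     (\<forall>\<Theta> P. wf_ctx (sg T) \<Theta> \<and> wf_fm (sg T) \<Theta> P \<and> prov T (exs \<Theta> P) \<longrightarrow>
       (\<exists>\<Delta> c Q. wf_ctx (sg T) \<Delta> \<and> assignment (sg T) \<Theta> \<Delta> c \<and> wf_fm (sg T) \<Delta> Q \<and>
          prov T (ex_unique \<Delta> Q) \<and> prov T (exs \<Delta> (FAnd Q (subst_fm (\<lambda>i. c ! i) P)))))"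


section \<open>Axioms of categories and of constructively well-pointed Heyting pretoposes\<close>

text \<open>
  To write concrete formulas with named bound variables, a term or formula is given as a function of
  the number of enclosing binders. The variable bound at depth \<open>k\<close> is \<open>lev k\<close>; a formula without free
  variables is read off at depth \<open>0\<close>.
\<close>

type_synonym ('o, 'a) btm = "nat \<Rightarrow> ('o, 'a) tm"
type_synonym ('o, 'a) bfm = "nat \<Rightarrow> ('o, 'a) fm"

definition lev :: "nat \<Rightarrow> ('o, 'a) btm" where
  "lev k = (\<lambda>d. Var (d - Suc k))"

definition allO :: "(('o, 'a) btm \<Rightarrow> ('o, 'a) bfm) \<Rightarrow> ('o, 'a) bfm"  (binder \<open>\<forall>\<^sub>O\<close> 10) where
  "allO K = (\<lambda>d. FAll Ob (K (lev d) (Suc d)))"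

definition exO :: "(('o, 'a) btm \<Rightarrow> ('o, 'a) bfm) \<Rightarrow> ('o, 'a) bfm"  (binder \<open>\<exists>\<^sub>O\<close> 10) where
  "exO K = (\<lambda>d. FEx Ob (K (lev d) (Suc d)))"

definition allA :: "('o, 'a) btm \<Rightarrow> ('o, 'a) btm \<Rightarrow> (('o, 'a) btm \<Rightarrow> ('o, 'a) bfm) \<Rightarrow> ('o, 'a) bfm" where
  "allA X Y K = (\<lambda>d. FAll (Hom (X d) (Y d)) (K (lev d) (Suc d)))"

definition exA :: "('o, 'a) btm \<Rightarrow> ('o, 'a) btm \<Rightarrow> (('o, 'a) btm \<Rightarrow> ('o, 'a) bfm) \<Rightarrow> ('o, 'a) bfm" where
  "exA X Y K = (\<lambda>d. FEx (Hom (X d) (Y d)) (K (lev d) (Suc d)))"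

definition bId :: "('o, 'a) btm \<Rightarrow> ('o, 'a) btm" where
  "bId X = (\<lambda>d. Idn (X d))"

definition bCmp :: "('o, 'a) btm \<Rightarrow> ('o, 'a) btm \<Rightarrow> ('o, 'a) btm"  (infixr \<open>\<odot>\<close> 75) where
  "(g \<odot> f) = (\<lambda>d. Cmp (g d) (f d))"

definition bEq :: "('o, 'a) btm \<Rightarrow> ('o, 'a) btm \<Rightarrow> ('o, 'a) bfm"  (infix \<open>\<doteq>\<close> 50) where
  "(s \<doteq> t) = (\<lambda>d. FEq (s d) (t d))"

definition bTop :: "('o, 'a) bfm" where
  "bTop = (\<lambda>d. FTop)"

definition bBot :: "('o, 'a) bfm" where
  "bBot = (\<lambda>d. FBot)"

definition bAnd :: "('o, 'a) bfm \<Rightarrow> ('o, 'a) bfm \<Rightarrow> ('o, 'a) bfm"  (infixr \<open>\<^bold>\<and>\<close> 35) where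
  "(P \<^bold>\<and> Q) = (\<lambda>d. FAnd (P d) (Q d))"

definition bOr :: "('o, 'a) bfm \<Rightarrow> ('o, 'a) bfm \<Rightarrow> ('o, 'a) bfm"  (infixr \<open>\<^bold>\<or>\<close> 30) where
  "(P \<^bold>\<or> Q) = (\<lambda>d. FOr (P d) (Q d))"

definition bImp :: "('o, 'a) bfm \<Rightarrow> ('o, 'a) bfm \<Rightarrow> ('o, 'a) bfm"  (infixr \<open>\<^bold>\<longrightarrow>\<close> 25) where
  "(P \<^bold>\<longrightarrow> Q) = (\<lambda>d. FImp (P d) (Q d))"

definition ex1A :: "('o, 'a) btm \<Rightarrow> ('o, 'a) btm \<Rightarrow> (('o, 'a) btm \<Rightarrow> ('o, 'a) bfm) \<Rightarrow> ('o, 'a) bfm" where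
  "ex1A X Y K = exA X Y (\<lambda>f. K f \<^bold>\<and> allA X Y (\<lambda>g. K g \<^bold>\<longrightarrow> g \<doteq> f))"

definition cat_eq_axioms :: "('o, 'a) fm set" where
  "cat_eq_axioms = (\<lambda>P. P 0) ` {
     \<forall>\<^sub>OX. \<forall>\<^sub>OY. allA X Y (\<lambda>f. f \<doteq> f),
     \<forall>\<^sub>OX. \<forall>\<^sub>OY. allA X Y (\<lambda>f. allA X Y (\<lambda>g. f \<doteq> g \<^bold>\<longrightarrow> g \<doteq> f)),
     \<forall>\<^sub>OX. \<forall>\<^sub>OY. allA X Y (\<lambda>f. allA X Y (\<lambda>g. allA X Y (\<lambda>h. f \<doteq> g \<^bold>\<and> g \<doteq> h \<^bold>\<longrightarrow> f \<doteq> h))),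
     \<forall>\<^sub>OX. \<forall>\<^sub>OY. \<forall>\<^sub>OZ. allA X Y (\<lambda>f. allA X Y (\<lambda>f'. allA Y Z (\<lambda>g. allA Y Z (\<lambda>g'.
        f \<doteq> f' \<^bold>\<and> g \<doteq> g' \<^bold>\<longrightarrow> g \<odot> f \<doteq> g' \<odot> f')))),
     \<forall>\<^sub>OX. \<forall>\<^sub>OY. allA X Y (\<lambda>f. f \<odot> bId X \<doteq> f),
     \<forall>\<^sub>OX. \<forall>\<^sub>OY. allA X Y (\<lambda>f. bId Y \<odot> f \<doteq> f),
     \<forall>\<^sub>OW. \<forall>\<^sub>OX. \<forall>\<^sub>OY. \<forall>\<^sub>OZ. allA W X (\<lambda>f. allA X Y (\<lambda>g. allA Y Z (\<lambda>h.
        (h \<odot> g) \<odot> f \<doteq> h \<odot> (g \<odot> f)))) }"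

definition bMono :: "('o, 'a) btm \<Rightarrow> ('o, 'a) btm \<Rightarrow> ('o, 'a) btm \<Rightarrow> ('o, 'a) bfm" where
  "bMono X Y m = (\<forall>\<^sub>OW. allA W X (\<lambda>u. allA W X (\<lambda>v. m \<odot> u \<doteq> m \<odot> v \<^bold>\<longrightarrow> u \<doteq> v)))"

definition bIso :: "('o, 'a) btm \<Rightarrow> ('o, 'a) btm \<Rightarrow> ('o, 'a) btm \<Rightarrow> ('o, 'a) bfm" where
  "bIso X Y f = exA Y X (\<lambda>g. g \<odot> f \<doteq> bId X \<^bold>\<and> f \<odot> g \<doteq> bId Y)"

definition bTerminal :: "('o, 'a) btm \<Rightarrow> ('o, 'a) bfm" where
  "bTerminal I = (\<forall>\<^sub>OX. ex1A X I (\<lambda>_. bTop))"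

definition bInitial :: "('o, 'a) btm \<Rightarrow> ('o, 'a) bfm" where
  "bInitial Z = (\<forall>\<^sub>OX. ex1A Z X (\<lambda>_. bTop))"

definition bProduct ::
    "('o, 'a) btm \<Rightarrow> ('o, 'a) btm \<Rightarrow> ('o, 'a) btm \<Rightarrow> ('o, 'a) btm \<Rightarrow> ('o, 'a) btm \<Rightarrow> ('o, 'a) bfm" where
  "bProduct A B P p q = (\<forall>\<^sub>OW. allA W A (\<lambda>u. allA W B (\<lambda>v.
     ex1A W P (\<lambda>h. p \<odot> h \<doteq> u \<^bold>\<and> q \<odot> h \<doteq> v))))"

definition bCoproduct ::
    "('o, 'a) btm \<Rightarrow> ('o, 'a) btm \<Rightarrow> ('o, 'a) btm \<Rightarrow> ('o, 'a) btm \<Rightarrow> ('o, 'a) btm \<Rightarrow> ('o, 'a) bfm" where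
  "bCoproduct A B C i j = (\<forall>\<^sub>OW. allA A W (\<lambda>u. allA B W (\<lambda>v.
     ex1A C W (\<lambda>h. h \<odot> i \<doteq> u \<^bold>\<and> h \<odot> j \<doteq> v))))"

text \<open>\<open>e : E \<rightarrow> A\<close> is an equalizer of \<open>f, g : A \<rightarrow> B\<close>.\<close>

definition bEqualizer ::
    "('o, 'a) btm \<Rightarrow> ('o, 'a) btm \<Rightarrow> ('o, 'a) btm \<Rightarrow> ('o, 'a) btm \<Rightarrow> ('o, 'a) btm \<Rightarrow> ('o, 'a) bfm" where
  "bEqualizer A f g E e = (f \<odot> e \<doteq> g \<odot> e \<^bold>\<and>
     (\<forall>\<^sub>OW. allA W A (\<lambda>u. f \<odot> u \<doteq> g \<odot> u \<^bold>\<longrightarrow> ex1A W E (\<lambda>h. e \<odot> h \<doteq> u))))"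

text \<open>\<open>q : B \<rightarrow> Q\<close> is a coequalizer of \<open>f, g : A \<rightarrow> B\<close>.\<close>

definition bCoequalizer ::
    "('o, 'a) btm \<Rightarrow> ('o, 'a) btm \<Rightarrow> ('o, 'a) btm \<Rightarrow> ('o, 'a) btm \<Rightarrow> ('o, 'a) btm \<Rightarrow> ('o, 'a) bfm" where
  "bCoequalizer B f g Q q = (q \<odot> f \<doteq> q \<odot> g \<^bold>\<and>
     (\<forall>\<^sub>OW. allA B W (\<lambda>u. u \<odot> f \<doteq> u \<odot> g \<^bold>\<longrightarrow> ex1A Q W (\<lambda>h. h \<odot> q \<doteq> u))))"

text \<open>\<open>p : P \<rightarrow> A\<close>, \<open>q : P \<rightarrow> B\<close> is a pullback of \<open>f : A \<rightarrow> C\<close> and \<open>g : B \<rightarrow> C\<close>.\<close>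

definition bPullback ::
    "('o, 'a) btm \<Rightarrow> ('o, 'a) btm \<Rightarrow> ('o, 'a) btm \<Rightarrow> ('o, 'a) btm \<Rightarrow> ('o, 'a) btm \<Rightarrow> ('o, 'a) btm \<Rightarrow> ('o, 'a) btm
      \<Rightarrow> ('o, 'a) bfm" where
  "bPullback A B f g P p q = (f \<odot> p \<doteq> g \<odot> q \<^bold>\<and>
     (\<forall>\<^sub>OW. allA W A (\<lambda>u. allA W B (\<lambda>v. f \<odot> u \<doteq> g \<odot> v \<^bold>\<longrightarrow>
        ex1A W P (\<lambda>h. p \<odot> h \<doteq> u \<^bold>\<and> q \<odot> h \<doteq> v)))))"

text \<open>\<open>f : A \<rightarrow> B\<close> factors through \<open>m : S \<rightarrow> B\<close>.\<close>

definition bFactors :: "('o, 'a) btm \<Rightarrow> ('o, 'a) btm \<Rightarrow> ('o, 'a) btm \<Rightarrow> ('o, 'a) btm \<Rightarrow> ('o, 'a) bfm" where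
  "bFactors A f S m = exA A S (\<lambda>g. m \<odot> g \<doteq> f)"

text \<open>\<open>m : I \<rightarrow> B\<close> is the image of \<open>f : A \<rightarrow> B\<close>.\<close>

definition bImage ::
    "('o, 'a) btm \<Rightarrow> ('o, 'a) btm \<Rightarrow> ('o, 'a) btm \<Rightarrow> ('o, 'a) btm \<Rightarrow> ('o, 'a) btm \<Rightarrow> ('o, 'a) bfm" where
  "bImage A B f I m = (bMono I B m \<^bold>\<and> bFactors A f I m \<^bold>\<and>
     (\<forall>\<^sub>OJ. allA J B (\<lambda>n. bMono J B n \<^bold>\<and> bFactors A f J n \<^bold>\<longrightarrow> bFactors I m J n)))"

definition bEquivRel :: "('o, 'a) btm \<Rightarrow> ('o, 'a) btm \<Rightarrow> ('o, 'a) btm \<Rightarrow> ('o, 'a) btm \<Rightarrow> ('o, 'a) bfm" where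
  "bEquivRel R A r s =
    ((\<forall>\<^sub>OW. allA W R (\<lambda>u. allA W R (\<lambda>v. r \<odot> u \<doteq> r \<odot> v \<^bold>\<and> s \<odot> u \<doteq> s \<odot> v \<^bold>\<longrightarrow> u \<doteq> v))) \<^bold>\<and>
     exA A R (\<lambda>d. r \<odot> d \<doteq> bId A \<^bold>\<and> s \<odot> d \<doteq> bId A) \<^bold>\<and>
     exA R R (\<lambda>t. r \<odot> t \<doteq> s \<^bold>\<and> s \<odot> t \<doteq> r) \<^bold>\<and>
     (\<forall>\<^sub>OP. allA P R (\<lambda>p. allA P R (\<lambda>q. bPullback R R s r P p q \<^bold>\<longrightarrow>
        exA P R (\<lambda>t. r \<odot> t \<doteq> r \<odot> p \<^bold>\<and> s \<odot> t \<doteq> s \<odot> q)))))"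

definition bRegularEpi :: "('o, 'a) btm \<Rightarrow> ('o, 'a) btm \<Rightarrow> ('o, 'a) btm \<Rightarrow> ('o, 'a) bfm" where
  "bRegularEpi A B e = (\<exists>\<^sub>OR. exA R A (\<lambda>r. exA R A (\<lambda>s. bCoequalizer A r s B e)))"

definition finite_limits_axioms :: "('o, 'a) bfm set" where
  "finite_limits_axioms = {
     \<exists>\<^sub>OI. bTerminal I,
     \<forall>\<^sub>OA. \<forall>\<^sub>OB. \<exists>\<^sub>OP. exA P A (\<lambda>p. exA P B (\<lambda>q. bProduct A B P p q)),
     \<forall>\<^sub>OA. \<forall>\<^sub>OB. allA A B (\<lambda>f. allA A B (\<lambda>g. \<exists>\<^sub>OE. exA E A (\<lambda>e. bEqualizer A f g E e))) }"

text \<open>Pullback stability of the empty coproduct says that every arrow into an initial object has initial domain.\<close>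

definition coproduct_axioms :: "('o, 'a) bfm set" where
  "coproduct_axioms = {
     \<exists>\<^sub>OZ. bInitial Z,
     \<forall>\<^sub>OA. \<forall>\<^sub>OB. \<exists>\<^sub>OC. exA A C (\<lambda>i. exA B C (\<lambda>j. bCoproduct A B C i j)),
     \<forall>\<^sub>OA. \<forall>\<^sub>OB. \<forall>\<^sub>OC. allA A C (\<lambda>i. allA B C (\<lambda>j. bCoproduct A B C i j \<^bold>\<longrightarrow>
        bMono A C i \<^bold>\<and> bMono B C j \<^bold>\<and>
        (\<forall>\<^sub>OP. allA P A (\<lambda>p. allA P B (\<lambda>q. bPullback A B i j P p q \<^bold>\<longrightarrow> bInitial P))))),
     \<forall>\<^sub>OZ. \<forall>\<^sub>OD. allA D Z (\<lambda>_. bInitial Z \<^bold>\<longrightarrow> bInitial D),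
     \<forall>\<^sub>OA. \<forall>\<^sub>OB. \<forall>\<^sub>OC. allA A C (\<lambda>i. allA B C (\<lambda>j. bCoproduct A B C i j \<^bold>\<longrightarrow>
        (\<forall>\<^sub>OD. allA D C (\<lambda>h. \<forall>\<^sub>OP. allA P A (\<lambda>p. allA P D (\<lambda>p'. \<forall>\<^sub>OQ. allA Q B (\<lambda>q. allA Q D (\<lambda>q'.
           bPullback A D i h P p p' \<^bold>\<and> bPullback B D j h Q q q' \<^bold>\<longrightarrow> bCoproduct P Q D p' q')))))))) }"

definition image_axioms :: "('o, 'a) bfm set" where
  "image_axioms = {
     \<forall>\<^sub>OA. \<forall>\<^sub>OB. allA A B (\<lambda>f. \<exists>\<^sub>OI. exA I B (\<lambda>m. bImage A B f I m)),
     \<forall>\<^sub>OA. \<forall>\<^sub>OB. \<forall>\<^sub>OI. allA A B (\<lambda>f. allA I B (\<lambda>m. bImage A B f I m \<^bold>\<longrightarrow>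
        (\<forall>\<^sub>OD. allA D B (\<lambda>h. \<forall>\<^sub>OP. allA P A (\<lambda>p. allA P D (\<lambda>f'. \<forall>\<^sub>OQ. allA Q I (\<lambda>q. allA Q D (\<lambda>m'.
           bPullback A D f h P p f' \<^bold>\<and> bPullback I D m h Q q m' \<^bold>\<longrightarrow> bImage P D f' Q m')))))))) }"

definition quotient_axioms :: "('o, 'a) bfm set" where
  "quotient_axioms = {
     \<forall>\<^sub>OA. \<forall>\<^sub>OR. allA R A (\<lambda>r. allA R A (\<lambda>s. bEquivRel R A r s \<^bold>\<longrightarrow>
        (\<exists>\<^sub>OQ. exA A Q (\<lambda>q. bCoequalizer A r s Q q)))) }"

text \<open>For \<open>f : A \<rightarrow> B\<close> and a subobject \<open>m\<close> of \<open>A\<close>, the value \<open>n\<close> at \<open>m\<close> of the right adjoint to pullback along \<open>f\<close>.\<close>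

definition dual_image_axioms :: "('o, 'a) bfm set" where
  "dual_image_axioms = {
     \<forall>\<^sub>OA. \<forall>\<^sub>OB. \<forall>\<^sub>OS. allA A B (\<lambda>f. allA S A (\<lambda>m. bMono S A m \<^bold>\<longrightarrow>
        (\<exists>\<^sub>OV. exA V B (\<lambda>n. bMono V B n \<^bold>\<and>
           (\<forall>\<^sub>OK. allA K B (\<lambda>k. bMono K B k \<^bold>\<longrightarrow>
              (\<forall>\<^sub>OP. allA P A (\<lambda>p. allA P K (\<lambda>q. bPullback A K f k P p q \<^bold>\<longrightarrow>
                 (bFactors P p S m \<^bold>\<longrightarrow> bFactors K k V n) \<^bold>\<and>
                 (bFactors K k V n \<^bold>\<longrightarrow> bFactors P p S m)))))))))) }"

text \<open>In order: the terminal object is a strong generator, indecomposable, projective, and has no arrow to an initial object.\<close>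

definition well_pointed_axioms :: "('o, 'a) bfm set" where
  "well_pointed_axioms = {
     \<forall>\<^sub>OI. bTerminal I \<^bold>\<longrightarrow> (\<forall>\<^sub>OA. \<forall>\<^sub>OB. allA A B (\<lambda>m.
        bMono A B m \<^bold>\<and> allA I B (\<lambda>b. bFactors I b A m) \<^bold>\<longrightarrow> bIso A B m)),
     \<forall>\<^sub>OI. bTerminal I \<^bold>\<longrightarrow> (\<forall>\<^sub>OU. \<forall>\<^sub>OV. allA U I (\<lambda>u. allA V I (\<lambda>v.
        bMono U I u \<^bold>\<and> bMono V I v \<^bold>\<and>
        (\<forall>\<^sub>OW. allA W I (\<lambda>w. bMono W I w \<^bold>\<and> bFactors U u W w \<^bold>\<and> bFactors V v W w \<^bold>\<longrightarrow> bIso W I w))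
        \<^bold>\<longrightarrow> bIso U I u \<^bold>\<or> bIso V I v))),
     \<forall>\<^sub>OI. bTerminal I \<^bold>\<longrightarrow> (\<forall>\<^sub>OA. \<forall>\<^sub>OB. allA A B (\<lambda>e.
        bRegularEpi A B e \<^bold>\<longrightarrow> allA I B (\<lambda>b. bFactors I b A e))),
     \<forall>\<^sub>OI. bTerminal I \<^bold>\<longrightarrow> (\<forall>\<^sub>OZ. bInitial Z \<^bold>\<longrightarrow> exA I Z (\<lambda>_. bTop) \<^bold>\<longrightarrow> bBot) }"

definition cwp_heyting_pretopos_axioms :: "('o, 'a) fm set" where
  "cwp_heyting_pretopos_axioms = (\<lambda>P. P 0) `
     (finite_limits_axioms \<union> coproduct_axioms \<union> image_axioms \<union> quotient_axioms \<union>
      dual_image_axioms \<union> well_pointed_axioms)"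

text \<open>
  Parametrized natural numbers object \<open>z : I \<rightarrow> N\<close>, \<open>s : N \<rightarrow> N\<close>, with \<open>I\<close> terminal: for \<open>a : A \<rightarrow> X\<close> and
  \<open>t : X \<rightarrow> X\<close> there is a unique \<open>h : A \<times> N \<rightarrow> X\<close> with \<open>h (x, 0) = a x\<close> and \<open>h (x, s n) = t (h (x, n))\<close>.
\<close>

definition bPNNO :: "('o, 'a) btm \<Rightarrow> ('o, 'a) btm \<Rightarrow> ('o, 'a) btm \<Rightarrow> ('o, 'a) btm \<Rightarrow> ('o, 'a) bfm" where
  "bPNNO I N z s = (bTerminal I \<^bold>\<and>
     (\<forall>\<^sub>OA. \<forall>\<^sub>OX. allA A X (\<lambda>a. allA X X (\<lambda>t. \<forall>\<^sub>OP. allA P A (\<lambda>p. allA P N (\<lambda>q. bProduct A N P p q \<^bold>\<longrightarrow>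
        ex1A P X (\<lambda>h.
          allA A I (\<lambda>k. allA A P (\<lambda>u. p \<odot> u \<doteq> bId A \<^bold>\<and> q \<odot> u \<doteq> z \<odot> k \<^bold>\<longrightarrow> h \<odot> u \<doteq> a)) \<^bold>\<and>
          allA P P (\<lambda>v. p \<odot> v \<doteq> p \<^bold>\<and> q \<odot> v \<doteq> s \<odot> q \<^bold>\<longrightarrow> h \<odot> v \<doteq> t \<odot> h))))))))"


section \<open>Recursive theories in the pure language\<close>

text \<open>The pure language has an empty signature; its constants formally have type \<open>unit\<close>.\<close>

type_synonym ptm = "(unit, unit) tm"
type_synonym psrt = "(unit, unit) srt"
type_synonym pctx = "(unit, unit) ctx"
type_synonym pfm = "(unit, unit) fm"

definition pure_thy :: "pfm set \<Rightarrow> (unit, unit) thy" where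
  "pure_thy Ax = \<lparr>sg = \<lparr>ocons = {}, acons = {}, cdom = id, ccod = id\<rparr>, axms = Ax\<rparr>"

text \<open>The reading of a formula of the pure language as a formula over other constants.\<close>

definition emb :: "pfm \<Rightarrow> ('o, 'a) fm" where
  "emb = map_fm (\<lambda>_. undefined) (\<lambda>_. undefined)"

text \<open>
  Total recursive functions of \<open>n\<close> arguments, as functions on lists of length \<open>n\<close>: minimization is
  restricted to functions for which the search always succeeds.
\<close>

inductive recfn :: "nat \<Rightarrow> (nat list \<Rightarrow> nat) \<Rightarrow> bool" where
  Zero: "recfn n (\<lambda>_. 0)"
| Succ: "recfn 1 (\<lambda>xs. Suc (hd xs))"
| Proj: "i < n \<Longrightarrow> recfn n (\<lambda>xs. xs ! i)"
| Comp: "recfn (length gs) f \<Longrightarrow> (\<forall>g\<in>set gs. recfn n g) \<Longrightarrow> recfn n (\<lambda>xs. f (map (\<lambda>g. g xs) gs))"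
| Prec: "recfn n f \<Longrightarrow> recfn (Suc (Suc n)) g
    \<Longrightarrow> recfn (Suc n) (\<lambda>xs. rec_nat (f (tl xs)) (\<lambda>k r. g (k # r # tl xs)) (hd xs))"
| Min: "recfn (Suc n) f \<Longrightarrow> (\<forall>xs. length xs = n \<longrightarrow> (\<exists>y. f (y # xs) = 0))
    \<Longrightarrow> recfn n (\<lambda>xs. LEAST y. f (y # xs) = 0)"

definition recursive_set :: "nat set \<Rightarrow> bool" where
  "recursive_set A \<longleftrightarrow> (\<exists>f. recfn 1 f \<and> (\<forall>x. x \<in> A \<longleftrightarrow> f [x] = 0))"

primrec gn_tm :: "ptm \<Rightarrow> nat" where
  "gn_tm (Var i) = prod_encode (0, i)"
| "gn_tm (OCon c) = prod_encode (1, 0)"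
| "gn_tm (ACon a) = prod_encode (2, 0)"
| "gn_tm (Idn t) = prod_encode (3, gn_tm t)"
| "gn_tm (Cmp g f) = prod_encode (4, prod_encode (gn_tm g, gn_tm f))"

primrec gn_srt :: "psrt \<Rightarrow> nat" where
  "gn_srt Ob = 0"
| "gn_srt (Hom X Y) = Suc (prod_encode (gn_tm X, gn_tm Y))"

primrec gn_fm :: "pfm \<Rightarrow> nat" where
  "gn_fm (FEq s t) = prod_encode (0, prod_encode (gn_tm s, gn_tm t))"
| "gn_fm FTop = prod_encode (1, 0)"
| "gn_fm FBot = prod_encode (2, 0)"
| "gn_fm (FAnd P Q) = prod_encode (3, prod_encode (gn_fm P, gn_fm Q))"
| "gn_fm (FOr P Q) = prod_encode (4, prod_encode (gn_fm P, gn_fm Q))"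
| "gn_fm (FImp P Q) = prod_encode (5, prod_encode (gn_fm P, gn_fm Q))"
| "gn_fm (FAll s P) = prod_encode (6, prod_encode (gn_srt s, gn_fm P))"
| "gn_fm (FEx s P) = prod_encode (7, prod_encode (gn_srt s, gn_fm P))"

definition recursive_pure_theory :: "pfm set \<Rightarrow> bool" where
  "recursive_pure_theory Ax \<longleftrightarrow>
     (\<forall>\<phi>\<in>Ax. sentence (sg (pure_thy Ax)) \<phi>) \<and> cat_eq_axioms \<subseteq> Ax \<and> recursive_set (gn_fm ` Ax)"


section \<open>Categories of sets as structures, and \<open>Tiny\<close>\<close>

text \<open>
  The metatheoretic category of sets consists of the subsets of a type \<open>'u\<close> and the extensional
  functions between them.
\<close>

record 'u setcat =
  cob :: "'u set set"
  chom :: "'u set \<Rightarrow> 'u set \<Rightarrow> ('u \<Rightarrow> 'u) set"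

definition Set_cat :: "'u setcat" where
  "Set_cat = \<lparr>cob = UNIV, chom = (\<lambda>X Y. X \<rightarrow>\<^sub>E Y)\<rparr>"

definition subcategory_of_Set :: "'u setcat \<Rightarrow> bool" where
  "subcategory_of_Set C \<longleftrightarrow>
     (\<forall>X\<in>cob C. \<forall>Y\<in>cob C. chom C X Y \<subseteq> X \<rightarrow>\<^sub>E Y) \<and>
     (\<forall>X\<in>cob C. (\<lambda>x\<in>X. x) \<in> chom C X X) \<and>
     (\<forall>X\<in>cob C. \<forall>Y\<in>cob C. \<forall>Z\<in>cob C. \<forall>f\<in>chom C X Y. \<forall>g\<in>chom C Y Z. compose X g f \<in> chom C X Z)"

datatype 'u val = ObV "'u set" | ArrV "'u set" "'u set" "'u \<Rightarrow> 'u"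

primrec eval :: "(nat \<Rightarrow> 'u val) \<Rightarrow> ptm \<Rightarrow> 'u val" where
  "eval e (Var i) = e i"
| "eval e (OCon c) = undefined"
| "eval e (ACon a) = undefined"
| "eval e (Idn t) = (case eval e t of ObV X \<Rightarrow> ArrV X X (\<lambda>x\<in>X. x) | _ \<Rightarrow> undefined)"
| "eval e (Cmp s t) = (case (eval e s, eval e t) of
     (ArrV _ Z g, ArrV X _ f) \<Rightarrow> ArrV X Z (compose X g f) | _ \<Rightarrow> undefined)"

primrec sort_vals :: "'u setcat \<Rightarrow> (nat \<Rightarrow> 'u val) \<Rightarrow> psrt \<Rightarrow> 'u val set" where
  "sort_vals C e Ob = ObV ` cob C"
| "sort_vals C e (Hom X Y) = {ArrV A B f | A B f. eval e X = ObV A \<and> eval e Y = ObV B \<and> f \<in> chom C A B}"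

primrec sat :: "'u setcat \<Rightarrow> (nat \<Rightarrow> 'u val) \<Rightarrow> pfm \<Rightarrow> bool" where
  "sat C e (FEq s t) \<longleftrightarrow> eval e s = eval e t"
| "sat C e FTop \<longleftrightarrow> True"
| "sat C e FBot \<longleftrightarrow> False"
| "sat C e (FAnd P Q) \<longleftrightarrow> sat C e P \<and> sat C e Q"
| "sat C e (FOr P Q) \<longleftrightarrow> sat C e P \<or> sat C e Q"
| "sat C e (FImp P Q) \<longleftrightarrow> (sat C e P \<longrightarrow> sat C e Q)"
| "sat C e (FAll s P) \<longleftrightarrow> (\<forall>v\<in>sort_vals C e s. sat C (case_nat v e) P)"
| "sat C e (FEx s P) \<longleftrightarrow> (\<exists>v\<in>sort_vals C e s. sat C (case_nat v e) P)"

definition models :: "'u setcat \<Rightarrow> pfm set \<Rightarrow> bool" where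
  "models C A \<longleftrightarrow> (\<forall>\<phi>\<in>A. \<forall>e. sat C e \<phi>)"

definition is_terminal :: "'u setcat \<Rightarrow> 'u set \<Rightarrow> bool" where
  "is_terminal C I \<longleftrightarrow> (\<forall>e. sat C (case_nat (ObV I) e) (bTerminal (lev 0) 1))"

definition is_pnno :: "'u setcat \<Rightarrow> 'u set \<Rightarrow> 'u set \<Rightarrow> ('u \<Rightarrow> 'u) \<Rightarrow> ('u \<Rightarrow> 'u) \<Rightarrow> bool" where
  "is_pnno C I N z s \<longleftrightarrow>
     (\<forall>e. sat C (case_nat (ArrV N N s) (case_nat (ArrV I N z) (case_nat (ObV N) (case_nat (ObV I) e))))
        (bPNNO (lev 0) (lev 1) (lev 2) (lev 3) 4))"

definition tiny_model :: "pfm set \<Rightarrow> 'u setcat \<Rightarrow> bool" where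
  "tiny_model Ax C \<longleftrightarrow>
     subcategory_of_Set C \<and>
     (\<exists>I\<in>cob C. is_terminal C I \<and> is_terminal Set_cat I \<and>
        (\<forall>A\<in>cob C. I \<rightarrow>\<^sub>E A \<subseteq> chom C I A) \<and>
        (\<exists>N\<in>cob C. \<exists>z\<in>chom C I N. \<exists>s\<in>chom C N N. is_pnno C I N z s \<and> is_pnno Set_cat I N z s)) \<and>
     models C cwp_heyting_pretopos_axioms \<and>
     models C Ax"


section \<open>The theory \<open>T\<^sub>c\<close> and its category of constants\<close>

text \<open>
  \<open>Cst \<Delta> P i\<close> is the constant for the \<open>i\<close>-th variable of \<open>\<Delta>\<close> introduced for a \<open>P\<close> with \<open>\<exists>!\<Delta> P\<close> provable.
  In the pure language the source and target of an arrow variable are variables of the same context.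
\<close>

datatype cst = Cst pctx pfm nat

definition uniquely_exists :: "pfm set \<Rightarrow> pctx \<Rightarrow> pfm \<Rightarrow> bool" where
  "uniquely_exists Ax \<Delta> P \<longleftrightarrow> wf_ctx (sg (pure_thy Ax)) \<Delta> \<and> wf_fm (sg (pure_thy Ax)) \<Delta> P \<and>
     prov (pure_thy Ax) (ex_unique \<Delta> P)"

fun cst_dom :: "cst \<Rightarrow> cst" where
  "cst_dom (Cst \<Delta> P i) = (case \<Delta> ! i of Hom (Var j) _ \<Rightarrow> Cst \<Delta> P (Suc (i + j)) | _ \<Rightarrow> undefined)"

fun cst_cod :: "cst \<Rightarrow> cst" where
  "cst_cod (Cst \<Delta> P i) = (case \<Delta> ! i of Hom _ (Var j) \<Rightarrow> Cst \<Delta> P (Suc (i + j)) | _ \<Rightarrow> undefined)"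

definition cst_tm :: "pctx \<Rightarrow> pfm \<Rightarrow> nat \<Rightarrow> (cst, cst) tm" where
  "cst_tm \<Delta> P i = (if \<Delta> ! i = Ob then OCon (Cst \<Delta> P i) else ACon (Cst \<Delta> P i))"

definition thy1 :: "pfm set \<Rightarrow> (cst, cst) thy" where
  "thy1 Ax = \<lparr>
     sg = \<lparr>ocons = {Cst \<Delta> P i | \<Delta> P i. uniquely_exists Ax \<Delta> P \<and> i < length \<Delta> \<and> \<Delta> ! i = Ob},
           acons = {Cst \<Delta> P i | \<Delta> P i. uniquely_exists Ax \<Delta> P \<and> i < length \<Delta> \<and> \<Delta> ! i \<noteq> Ob},
           cdom = cst_dom, ccod = cst_cod\<rparr>,
     axms = emb ` Ax \<union> {subst_fm (cst_tm \<Delta> P) (emb P) | \<Delta> P. uniquely_exists Ax \<Delta> P}\<rparr>"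

text \<open>\<open>Def A B P\<close> is the constant \<open>f : A \<rightarrow> B\<close> introduced for a \<open>P\<close> with \<open>\<exists>!f P\<close> provable.\<close>

datatype acst = Old cst | Def cst cst "(cst, cst) fm"

definition thy2 :: "pfm set \<Rightarrow> (cst, acst) thy" where
  "thy2 Ax = (let
       D = {(A, B, P). A \<in> ocons (sg (thy1 Ax)) \<and> B \<in> ocons (sg (thy1 Ax)) \<and>
              wf_fm (sg (thy1 Ax)) [Hom (OCon A) (OCon B)] P \<and>
              prov (thy1 Ax) (ex_unique [Hom (OCon A) (OCon B)] P)} in \<lparr>
     sg = \<lparr>ocons = ocons (sg (thy1 Ax)),
           acons = Old ` acons (sg (thy1 Ax)) \<union> {Def A B P | A B P. (A, B, P) \<in> D},
           cdom = (\<lambda>a. case a of Old c \<Rightarrow> cst_dom c | Def A B P \<Rightarrow> A),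
           ccod = (\<lambda>a. case a of Old c \<Rightarrow> cst_cod c | Def A B P \<Rightarrow> B)\<rparr>,
     axms = map_fm id Old ` axms (thy1 Ax) \<union>
            {inst (ACon (Def A B P)) (map_fm id Old P) | A B P. (A, B, P) \<in> D}\<rparr>)"

definition eq_acst :: "pfm set \<Rightarrow> acst rel" where
  "eq_acst Ax = {(a, b). a \<in> acons (sg (thy2 Ax)) \<and> b \<in> acons (sg (thy2 Ax)) \<and>
     cdom (sg (thy2 Ax)) a = cdom (sg (thy2 Ax)) b \<and> ccod (sg (thy2 Ax)) a = ccod (sg (thy2 Ax)) b \<and>
     prov (thy2 Ax) (FEq (ACon a) (ACon b))}"

definition thyc :: "pfm set \<Rightarrow> (cst, acst set) thy" where
  "thyc Ax = \<lparr>
     sg = \<lparr>ocons = ocons (sg (thy2 Ax)),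
           acons = acons (sg (thy2 Ax)) // eq_acst Ax,
           cdom = (\<lambda>u. cdom (sg (thy2 Ax)) (SOME a. a \<in> u)),
           ccod = (\<lambda>u. ccod (sg (thy2 Ax)) (SOME a. a \<in> u))\<rparr>,
     axms = map_fm id (\<lambda>a. eq_acst Ax `` {a}) ` axms (thy2 Ax)\<rparr>"

definition Tc_hom :: "pfm set \<Rightarrow> cst \<Rightarrow> cst \<Rightarrow> acst set set" where
  "Tc_hom Ax A B = {a \<in> acons (sg (thyc Ax)). cdom (sg (thyc Ax)) a = A \<and> ccod (sg (thyc Ax)) a = B}"

definition Tc_id :: "pfm set \<Rightarrow> cst \<Rightarrow> acst set" where
  "Tc_id Ax A = (THE c. c \<in> Tc_hom Ax A A \<and> prov (thyc Ax) (FEq (Idn (OCon A)) (ACon c)))"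

definition Tc_comp :: "pfm set \<Rightarrow> acst set \<Rightarrow> acst set \<Rightarrow> acst set" where
  "Tc_comp Ax b a = (THE c. c \<in> Tc_hom Ax (cdom (sg (thyc Ax)) a) (ccod (sg (thyc Ax)) b) \<and>
     prov (thyc Ax) (FEq (Cmp (ACon b) (ACon a)) (ACon c)))"

definition provably_terminal :: "pfm set \<Rightarrow> cst \<Rightarrow> bool" where
  "provably_terminal Ax one \<longleftrightarrow>
     one \<in> ocons (sg (thyc Ax)) \<and> prov (thyc Ax) (bTerminal (\<lambda>_. OCon one) 0)"


section \<open>Global sections, the comma category \<open>F\<close>, the theory \<open>T\<^sup>*\<close>\<close>

text \<open>
  The elements of objects of \<open>Tiny\<close> have type \<open>'u\<close>, so the set of arrow constants \<open>1 \<rightarrow> S\<close> is named in \<open>'u\<close>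
  by an injection \<open>gl S\<close>. That \<open>T\<^sub>c\<close> lies in \<open>Tiny\<close> means that, so named, these sets and the
  functions between them given by composition are objects and arrows of \<open>Tiny\<close>.
\<close>

definition Gl_ob :: "pfm set \<Rightarrow> cst \<Rightarrow> (cst \<Rightarrow> acst set \<Rightarrow> 'u) \<Rightarrow> cst \<Rightarrow> 'u set" where
  "Gl_ob Ax one gl S = gl S ` Tc_hom Ax one S"

definition Gl_map :: "pfm set \<Rightarrow> cst \<Rightarrow> (cst \<Rightarrow> acst set \<Rightarrow> 'u) \<Rightarrow> acst set \<Rightarrow> 'u \<Rightarrow> 'u" where
  "Gl_map Ax one gl \<phi> = (let S = cdom (sg (thyc Ax)) \<phi>; R = ccod (sg (thyc Ax)) \<phi> in
     (\<lambda>x\<in>Gl_ob Ax one gl S. gl R (Tc_comp Ax \<phi> (inv_into (Tc_hom Ax one S) (gl S) x))))"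

definition Gl_into :: "pfm set \<Rightarrow> 'u setcat \<Rightarrow> cst \<Rightarrow> (cst \<Rightarrow> acst set \<Rightarrow> 'u) \<Rightarrow> bool" where
  "Gl_into Ax C one gl \<longleftrightarrow>
     (\<forall>S\<in>ocons (sg (thyc Ax)). inj_on (gl S) (Tc_hom Ax one S) \<and> Gl_ob Ax one gl S \<in> cob C) \<and>
     (\<forall>\<phi>\<in>acons (sg (thyc Ax)).
        Gl_map Ax one gl \<phi> \<in>
          chom C (Gl_ob Ax one gl (cdom (sg (thyc Ax)) \<phi>)) (Gl_ob Ax one gl (ccod (sg (thyc Ax)) \<phi>)))"

text \<open>An arrow of \<open>F\<close> is recorded as \<open>(source, target, h, \<phi>)\<close>.\<close>

type_synonym 'u fobj = "'u set \<times> cst \<times> ('u \<Rightarrow> 'u)"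
type_synonym 'u farr = "'u fobj \<times> 'u fobj \<times> ('u \<Rightarrow> 'u) \<times> acst set"

definition F_obj :: "pfm set \<Rightarrow> 'u setcat \<Rightarrow> cst \<Rightarrow> (cst \<Rightarrow> acst set \<Rightarrow> 'u) \<Rightarrow> 'u fobj set" where
  "F_obj Ax C one gl =
     {(X, S, f). X \<in> cob C \<and> S \<in> ocons (sg (thyc Ax)) \<and> f \<in> chom C X (Gl_ob Ax one gl S)}"

definition F_arr :: "pfm set \<Rightarrow> 'u setcat \<Rightarrow> cst \<Rightarrow> (cst \<Rightarrow> acst set \<Rightarrow> 'u) \<Rightarrow> 'u farr set" where
  "F_arr Ax C one gl =
     {((X, S, f), (Y, R, g), h, \<phi>) | X S f Y R g h \<phi>.
        (X, S, f) \<in> F_obj Ax C one gl \<and> (Y, R, g) \<in> F_obj Ax C one gl \<and>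
        h \<in> chom C X Y \<and> \<phi> \<in> Tc_hom Ax S R \<and>
        compose X (Gl_map Ax one gl \<phi>) f = compose X g h}"

definition F_id :: "pfm set \<Rightarrow> 'u fobj \<Rightarrow> 'u farr" where
  "F_id Ax A = (case A of (X, S, f) \<Rightarrow> (A, A, (\<lambda>x\<in>X. x), Tc_id Ax S))"

definition F_comp :: "pfm set \<Rightarrow> 'u farr \<Rightarrow> 'u farr \<Rightarrow> 'u farr" where
  "F_comp Ax b a = (case (b, a) of ((_, Z, k, \<psi>), (A, _, h, \<phi>)) \<Rightarrow>
     (A, Z, compose (fst A) k h, Tc_comp Ax \<psi> \<phi>))"

definition obj_minus :: "'u fobj \<Rightarrow> cst" where
  "obj_minus = (\<lambda>(X, S, f). S)"

definition arr_minus :: "'u farr \<Rightarrow> acst set" where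
  "arr_minus = (\<lambda>(A, B, h, \<phi>). \<phi>)"

definition Tstar_sig :: "pfm set \<Rightarrow> 'u setcat \<Rightarrow> cst \<Rightarrow> (cst \<Rightarrow> acst set \<Rightarrow> 'u) \<Rightarrow> ('u fobj, 'u farr) sig" where
  "Tstar_sig Ax C one gl =
     \<lparr>ocons = F_obj Ax C one gl, acons = F_arr Ax C one gl, cdom = fst, ccod = fst \<circ> snd\<rparr>"

definition Tstar_prov :: "pfm set \<Rightarrow> ('u fobj, 'u farr) fm \<Rightarrow> bool" where
  "Tstar_prov Ax \<phi> \<longleftrightarrow> prov (thyc Ax) (map_fm obj_minus arr_minus \<phi>)"

fun den :: "pfm set \<Rightarrow> ('u fobj, 'u farr) tm \<Rightarrow> 'u farr" where
  "den Ax (ACon a) = a"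
| "den Ax (Idn (OCon A)) = F_id Ax A"
| "den Ax (Cmp g f) = F_comp Ax (den Ax g) (den Ax f)"
| "den Ax _ = undefined"

definition Tstar_M :: "pfm set \<Rightarrow> 'u setcat \<Rightarrow> cst \<Rightarrow> (cst \<Rightarrow> acst set \<Rightarrow> 'u) \<Rightarrow> ('u fobj, 'u farr) fm set" where
  "Tstar_M Ax C one gl = {FEq f1 f2 | f1 f2. \<exists>A B.
     has_sort (Tstar_sig Ax C one gl) [] f1 (Hom A B) \<and>
     has_sort (Tstar_sig Ax C one gl) [] f2 (Hom A B) \<and> den Ax f1 = den Ax f2}"


section \<open>The predicate \<open>FP\<close>\<close>

primrec fm_depth :: "('o, 'a) fm \<Rightarrow> nat" where
  "fm_depth (FEq s t) = 0"
| "fm_depth FTop = 0"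
| "fm_depth FBot = 0"
| "fm_depth (FAnd P Q) = Suc (max (fm_depth P) (fm_depth Q))"
| "fm_depth (FOr P Q) = Suc (max (fm_depth P) (fm_depth Q))"
| "fm_depth (FImp P Q) = Suc (max (fm_depth P) (fm_depth Q))"
| "fm_depth (FAll s P) = Suc (fm_depth P)"
| "fm_depth (FEx s P) = Suc (fm_depth P)"

lemma fm_depth_subst [simp]: "fm_depth (subst_fm \<sigma> P) = fm_depth P"
  by (induction P arbitrary: \<sigma>) simp_all

lemma fm_depth_inst [simp]: "fm_depth (inst t P) = fm_depth P"
  by (simp add: inst_def)

text \<open>\<open>FP \<Sigma> pr M\<close>: here \<open>\<Sigma>\<close> is the signature and \<open>pr\<close> the provability predicate of the theory.\<close>

function FP ::
    "('o, 'a) sig \<Rightarrow> (('o, 'a) fm \<Rightarrow> bool) \<Rightarrow> ('o, 'a) fm set \<Rightarrow> ('o, 'a) fm \<Rightarrow> bool" where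
  "FP \<Sigma> pr M (FEq s t) \<longleftrightarrow> FEq s t \<in> M"
| "FP \<Sigma> pr M FTop \<longleftrightarrow> True"
| "FP \<Sigma> pr M FBot \<longleftrightarrow> False"
| "FP \<Sigma> pr M (FAnd P Q) \<longleftrightarrow> FP \<Sigma> pr M P \<and> FP \<Sigma> pr M Q"
| "FP \<Sigma> pr M (FOr P Q) \<longleftrightarrow> FP \<Sigma> pr M P \<or> FP \<Sigma> pr M Q"
| "FP \<Sigma> pr M (FImp P Q) \<longleftrightarrow> (FP \<Sigma> pr M P \<longrightarrow> FP \<Sigma> pr M Q) \<and> pr (FImp P Q)"
| "FP \<Sigma> pr M (FAll s P) \<longleftrightarrow> (\<forall>t. has_sort \<Sigma> [] t s \<longrightarrow> FP \<Sigma> pr M (inst t P)) \<and> pr (FAll s P)"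
| "FP \<Sigma> pr M (FEx s P) \<longleftrightarrow> (\<exists>t. has_sort \<Sigma> [] t s \<and> FP \<Sigma> pr M (inst t P))"
  by pat_completeness auto
termination
  by (relation "measure (\<lambda>(\<Sigma>, pr, M, \<phi>). fm_depth \<phi>)") auto

definition FP_star :: "pfm set \<Rightarrow> 'u setcat \<Rightarrow> cst \<Rightarrow> (cst \<Rightarrow> acst set \<Rightarrow> 'u) \<Rightarrow> ('u fobj, 'u farr) fm \<Rightarrow> bool" where
  "FP_star Ax C one gl = FP (Tstar_sig Ax C one gl) (Tstar_prov Ax) (Tstar_M Ax C one gl)"

end

theory Submission
  imports Defs
begin

text \<open>
  The predicate \<open>FP\<close> is sound for \<open>T\<close> and implies provability in \<open>T\<^sup>*\<close>, that is, in \<open>T\<^sub>c\<close>; this gives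
  consistency at once. For the other two properties one has to come back from \<open>T\<^sub>c\<close> to \<open>T\<close>. A derivation
  uses finitely many constants. Those of the form \<open>Cst \<Delta> P i\<close> become variables of the concatenation of the
  contexts \<open>\<Delta>\<close>, and every defined arrow becomes one more variable of this context. The resulting context
  still exists uniquely: since objects are never compared for equality, formulas are invariant under
  isomorphism, so the unique isomorphism between two witnesses carries a defined arrow to a solution of
  the same definition, and solutions are unique. The witnesses that \<open>FP\<close> provides for an existential
  sentence thereby become terms in a context that exists uniquely.
\<close>

section \<open>Simultaneous substitution\<close>

text \<open>
  These substitutions act on variables and constants at once, possibly changing the signature, and so
  subsume \<open>subst_fm\<close>, \<open>map_fm\<close>, \<open>emb\<close> and the replacement of constants by terms. Terms over
  atoms form a monad with unit \<open>atom_tm\<close>, which is therefore the identity substitution.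
\<close>

datatype ('o, 'a) atom = AVar nat | AObj 'o | AArr 'a

primrec atom_tm :: "('o, 'a) atom \<Rightarrow> ('o, 'a) tm" where
  "atom_tm (AVar i) = Var i"
| "atom_tm (AObj c) = OCon c"
| "atom_tm (AArr a) = ACon a"

primrec bind_tm :: "(('o, 'a) atom \<Rightarrow> ('p, 'b) tm) \<Rightarrow> ('o, 'a) tm \<Rightarrow> ('p, 'b) tm" where
  "bind_tm I (Var i) = I (AVar i)"
| "bind_tm I (OCon c) = I (AObj c)"
| "bind_tm I (ACon a) = I (AArr a)"
| "bind_tm I (Idn t) = Idn (bind_tm I t)"
| "bind_tm I (Cmp g f) = Cmp (bind_tm I g) (bind_tm I f)"

primrec bind_srt :: "(('o, 'a) atom \<Rightarrow> ('p, 'b) tm) \<Rightarrow> ('o, 'a) srt \<Rightarrow> ('p, 'b) srt" where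
  "bind_srt I Ob = Ob"
| "bind_srt I (Hom X Y) = Hom (bind_tm I X) (bind_tm I Y)"

definition var_subst :: "(nat \<Rightarrow> ('o, 'a) tm) \<Rightarrow> ('o, 'a) atom \<Rightarrow> ('o, 'a) tm" where
  "var_subst \<sigma> x = (case x of AVar i \<Rightarrow> \<sigma> i | AObj c \<Rightarrow> OCon c | AArr a \<Rightarrow> ACon a)"

definition con_map :: "('o \<Rightarrow> 'p) \<Rightarrow> ('a \<Rightarrow> 'b) \<Rightarrow> ('o, 'a) atom \<Rightarrow> ('p, 'b) tm" where
  "con_map f g x = (case x of AVar i \<Rightarrow> Var i | AObj c \<Rightarrow> OCon (f c) | AArr a \<Rightarrow> ACon (g a))"

definition weaken :: "nat \<Rightarrow> ('o, 'a) atom \<Rightarrow> ('o, 'a) tm" where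
  "weaken k = var_subst (\<lambda>i. Var (i + k))"

abbreviation weaken1 :: "('o, 'a) atom \<Rightarrow> ('o, 'a) tm" where
  "weaken1 \<equiv> weaken (Suc 0)"

definition scons :: "('p, 'b) tm \<Rightarrow> (('o, 'a) atom \<Rightarrow> ('p, 'b) tm) \<Rightarrow> ('o, 'a) atom \<Rightarrow> ('p, 'b) tm" where
  "scons t I x = (case x of
     AVar i \<Rightarrow> (case i of 0 \<Rightarrow> t | Suc j \<Rightarrow> I (AVar j)) | AObj c \<Rightarrow> I (AObj c) | AArr a \<Rightarrow> I (AArr a))"

definition lift :: "(('o, 'a) atom \<Rightarrow> ('p, 'b) tm) \<Rightarrow> ('o, 'a) atom \<Rightarrow> ('p, 'b) tm" where
  "lift I = scons (Var 0) (\<lambda>x. bind_tm weaken1 (I x))"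

primrec bind_fm :: "(('o, 'a) atom \<Rightarrow> ('p, 'b) tm) \<Rightarrow> ('o, 'a) fm \<Rightarrow> ('p, 'b) fm" where
  "bind_fm I (FEq s t) = FEq (bind_tm I s) (bind_tm I t)"
| "bind_fm I FTop = FTop"
| "bind_fm I FBot = FBot"
| "bind_fm I (FAnd P Q) = FAnd (bind_fm I P) (bind_fm I Q)"
| "bind_fm I (FOr P Q) = FOr (bind_fm I P) (bind_fm I Q)"
| "bind_fm I (FImp P Q) = FImp (bind_fm I P) (bind_fm I Q)"
| "bind_fm I (FAll s P) = FAll (bind_srt I s) (bind_fm (lift I) P)"
| "bind_fm I (FEx s P) = FEx (bind_srt I s) (bind_fm (lift I) P)"

lemma atom_fun_eqI:
  assumes "\<And>i. I (AVar i) = J (AVar i)" "\<And>c. I (AObj c) = J (AObj c)" "\<And>a. I (AArr a) = J (AArr a)"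
  shows "I = J"
proof
  show "I x = J x" for x using assms by (cases x) auto
qed

lemma atom_tm_inject [simp]: "atom_tm x = atom_tm y \<longleftrightarrow> x = y"
  by (cases x; cases y) auto

lemma var_subst_simps [simp]:
  "var_subst \<sigma> (AVar i) = \<sigma> i" "var_subst \<sigma> (AObj c) = OCon c" "var_subst \<sigma> (AArr a) = ACon a"
  by (simp_all add: var_subst_def)

lemma con_map_simps [simp]:
  "con_map f g (AVar i) = Var i" "con_map f g (AObj c) = OCon (f c)" "con_map f g (AArr a) = ACon (g a)"
  by (simp_all add: con_map_def)

lemma weaken_simps [simp]:
  "weaken k (AVar i) = Var (i + k)" "weaken k (AObj c) = OCon c" "weaken k (AArr a) = ACon a"
  by (simp_all add: weaken_def)

lemma scons_simps [simp]:
  "scons t I (AVar 0) = t" "scons t I (AVar (Suc i)) = I (AVar i)"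
  "scons t I (AObj c) = I (AObj c)" "scons t I (AArr a) = I (AArr a)"
  by (simp_all add: scons_def)

lemma scons_AVar: "scons t I (AVar i) = (case i of 0 \<Rightarrow> t | Suc j \<Rightarrow> I (AVar j))"
  by (simp add: scons_def)

lemma weaken_0 [simp]: "weaken 0 = atom_tm"
  by (rule atom_fun_eqI) auto

lemma var_subst_Var [simp]: "var_subst Var = atom_tm"
  by (rule atom_fun_eqI) auto

lemma bind_tm_atom_tm [simp]: "bind_tm I (atom_tm x) = I x"
  by (cases x) auto

lemma bind_tm_bind_tm [simp]: "bind_tm J (bind_tm I t) = bind_tm (\<lambda>x. bind_tm J (I x)) t"
  by (induction t) auto

lemma bind_srt_bind_srt [simp]: "bind_srt J (bind_srt I s) = bind_srt (\<lambda>x. bind_tm J (I x)) s"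
  by (cases s) auto

lemma bind_tm_scons [simp]: "(\<lambda>x. bind_tm J (scons t I x)) = scons (bind_tm J t) (\<lambda>x. bind_tm J (I x))"
  by (auto simp: scons_def fun_eq_iff split: atom.splits nat.splits)

lemma bind_tm_scons_weaken [simp]: "bind_tm (scons t I) (weaken (Suc k) x) = bind_tm I (weaken k x)"
  by (cases x) auto

lemma var_subst_comp: "(\<lambda>x. bind_tm (var_subst \<tau>) (var_subst \<sigma> x)) =
    var_subst (\<lambda>i. bind_tm (var_subst \<tau>) (\<sigma> i))"
  by (rule atom_fun_eqI) auto

lemma weaken_var_subst [simp]:
  "(\<lambda>x. bind_tm (weaken k) (var_subst \<sigma> x)) = var_subst (\<lambda>i. bind_tm (weaken k) (\<sigma> i))"
  unfolding weaken_def by (rule var_subst_comp)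

lemma var_subst_Suc: "var_subst \<sigma> = scons (\<sigma> 0) (var_subst (\<lambda>i. \<sigma> (Suc i)))"
  by (rule atom_fun_eqI) (auto simp: scons_AVar split: nat.splits)

lemma bind_tm_id [simp]: "bind_tm atom_tm t = t"
  by (induction t) auto

lemma bind_srt_id [simp]: "bind_srt atom_tm s = s"
  by (cases s) auto

lemma bind_srt_eq_Ob [simp]: "bind_srt I s = Ob \<longleftrightarrow> s = Ob" "Ob = bind_srt I s \<longleftrightarrow> s = Ob"
  by (cases s; simp)+

lemma scons_weaken1 [simp]: "scons (Var 0) weaken1 = atom_tm"
  by (rule atom_fun_eqI) (auto simp: scons_AVar split: nat.splits)

lemma lift_id [simp]: "lift atom_tm = atom_tm"
  by (simp add: lift_def)

lemma lift_comp [simp]: "(\<lambda>x. bind_tm (lift J) (lift I x)) = lift (\<lambda>x. bind_tm J (I x))"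
  by (simp add: lift_def)

lemma bind_fm_bind_fm [simp]: "bind_fm J (bind_fm I P) = bind_fm (\<lambda>x. bind_tm J (I x)) P"
  by (induction P arbitrary: I J) auto

lemma bind_fm_id [simp]: "bind_fm atom_tm P = P"
  by (induction P) auto

lemma bind_tm_lift_weaken1 [simp]: "bind_tm (lift I) (weaken1 x) = bind_tm weaken1 (I x)"
  by (simp add: lift_def)

lemma weaken_weaken [simp]: "bind_tm (weaken j) (weaken k x) = weaken (j + k) x"
  by (cases x) (auto simp: add_ac)

lemma subst_tm_bind: "subst_tm \<sigma> t = bind_tm (var_subst \<sigma>) t"
  by (induction t) auto

lemma subst_srt_bind: "subst_srt \<sigma> s = bind_srt (var_subst \<sigma>) s"
  by (cases s) (auto simp: subst_tm_bind)

lemma var_subst_shift [simp]: "var_subst (shift k) = weaken k"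
  by (simp add: weaken_def shift_def)

lemma var_subst_up [simp]: "var_subst (up \<sigma>) = lift (var_subst \<sigma>)"
  by (rule atom_fun_eqI) (auto simp: up_def lift_def scons_AVar subst_tm_bind split: nat.splits)

lemma subst_fm_bind: "subst_fm \<sigma> P = bind_fm (var_subst \<sigma>) P"
  by (induction P arbitrary: \<sigma>) (auto simp: subst_tm_bind subst_srt_bind)

lemma subst_fm_shift1: "subst_fm (shift 1) = bind_fm weaken1" "subst_fm (shift (Suc 0)) = bind_fm weaken1"
  by (auto simp: subst_fm_bind fun_eq_iff)

lemma var_subst_case_nat: "var_subst (case_nat t Var) = scons t atom_tm"
  by (rule atom_fun_eqI) (auto simp: scons_AVar split: nat.splits)

lemma inst_bind: "inst t P = bind_fm (scons t atom_tm) P"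
  by (simp add: inst_def subst_fm_bind var_subst_case_nat)

lemma lift_con_map [simp]: "lift (con_map f g) = con_map f g"
  by (rule atom_fun_eqI) (auto simp: lift_def scons_AVar split: nat.splits)

lemma map_tm_bind: "map_tm f g t = bind_tm (con_map f g) t"
  by (induction t) auto

lemma map_srt_bind: "map_srt f g s = bind_srt (con_map f g) s"
  by (cases s) (auto simp: map_tm_bind)

lemma map_fm_bind: "map_fm f g P = bind_fm (con_map f g) P"
  by (induction P) (auto simp: map_tm_bind map_srt_bind)

lemma emb_bind: "emb P = bind_fm (con_map (\<lambda>_. undefined) (\<lambda>_. undefined)) P"
  by (simp add: emb_def map_fm_bind)

section \<open>Interpretations between signatures in context\<close>

definition interp :: "('o, 'a) sig \<Rightarrow> ('o, 'a) ctx \<Rightarrow> ('p, 'b) sig \<Rightarrow> ('p, 'b) ctx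
    \<Rightarrow> (('o, 'a) atom \<Rightarrow> ('p, 'b) tm) \<Rightarrow> bool" where
  "interp \<Sigma> \<Gamma> \<Sigma>' \<Gamma>' I \<longleftrightarrow> (\<forall>x s. has_sort \<Sigma> \<Gamma> (atom_tm x) s \<longrightarrow> has_sort \<Sigma>' \<Gamma>' (I x) (bind_srt I s))"

definition agree_on :: "('o, 'a) sig \<Rightarrow> ('o, 'a) ctx \<Rightarrow> (('o, 'a) atom \<Rightarrow> ('p, 'b) tm)
    \<Rightarrow> (('o, 'a) atom \<Rightarrow> ('p, 'b) tm) \<Rightarrow> bool" where
  "agree_on \<Sigma> \<Gamma> I J \<longleftrightarrow> (\<forall>x s. has_sort \<Sigma> \<Gamma> (atom_tm x) s \<longrightarrow> I x = J x)"

inductive_simps has_sort_Var_subst_iff: "has_sort \<Sigma> \<Gamma> (Var i) s"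
inductive_simps has_sort_OCon_iff: "has_sort \<Sigma> \<Gamma> (OCon c) s"
inductive_simps has_sort_ACon_iff: "has_sort \<Sigma> \<Gamma> (ACon a) s"
inductive_simps has_sort_Idn_iff: "has_sort \<Sigma> \<Gamma> (Idn t) s"
inductive_simps has_sort_Cmp_iff: "has_sort \<Sigma> \<Gamma> (Cmp g f) s"

lemma has_sort_Var_iff: "has_sort \<Sigma> \<Gamma> (Var i) s \<longleftrightarrow> i < length \<Gamma> \<and> s = bind_srt (weaken (Suc i)) (\<Gamma> ! i)"
  by (auto simp: has_sort_Var_subst_iff subst_srt_bind)

lemmas has_sort_iffs = has_sort_Var_iff has_sort_OCon_iff has_sort_ACon_iff has_sort_Idn_iff has_sort_Cmp_iff

lemmas has_sort_Idn = has_sort.intros(4)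
lemmas has_sort_Cmp = has_sort.intros(5)

lemma has_sort_Var_0 [simp]: "has_sort \<Sigma> (s # \<Gamma>) (Var 0) u \<longleftrightarrow> u = bind_srt weaken1 s"
  by (simp add: has_sort_Var_iff)

lemma has_sort_Var_Suc:
  "has_sort \<Sigma> (s # \<Gamma>) (Var (Suc i)) u \<longleftrightarrow> (\<exists>v. u = bind_srt weaken1 v \<and> has_sort \<Sigma> \<Gamma> (Var i) v)"
  by (auto simp: has_sort_Var_iff)

lemma has_sort_Ob_atom: "has_sort \<Sigma> \<Gamma> t Ob \<Longrightarrow> \<exists>x. t = atom_tm x"
  by (cases t) (auto simp: has_sort_iffs intro: exI[of _ "AVar _"] exI[of _ "AObj _"])

lemma has_sort_unique: "has_sort \<Sigma> \<Gamma> t s \<Longrightarrow> has_sort \<Sigma> \<Gamma> t s' \<Longrightarrow> s = s'"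
  by (induction t arbitrary: s s') (auto simp: has_sort_iffs)

lemma all_atom_iff: "(\<forall>x. P x) \<longleftrightarrow> (\<forall>i. P (AVar i)) \<and> (\<forall>c. P (AObj c)) \<and> (\<forall>a. P (AArr a))"
proof (intro iffI allI)
  fix x assume "(\<forall>i. P (AVar i)) \<and> (\<forall>c. P (AObj c)) \<and> (\<forall>a. P (AArr a))"
  then show "P x" by (cases x) simp_all
qed simp

lemma interp_iff: "interp \<Sigma> \<Gamma> \<Sigma>' \<Gamma>' I \<longleftrightarrow>
    (\<forall>i<length \<Gamma>. has_sort \<Sigma>' \<Gamma>' (I (AVar i)) (bind_srt I (bind_srt (weaken (Suc i)) (\<Gamma> ! i)))) \<and>
    (\<forall>c\<in>ocons \<Sigma>. has_sort \<Sigma>' \<Gamma>' (I (AObj c)) Ob) \<and>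
    (\<forall>a\<in>acons \<Sigma>. has_sort \<Sigma>' \<Gamma>' (I (AArr a)) (Hom (I (AObj (cdom \<Sigma> a))) (I (AObj (ccod \<Sigma> a)))))"
  unfolding interp_def all_atom_iff[where 'a = 'a and 'b = 'b] by (auto simp: has_sort_iffs)

lemma agree_on_iff: "agree_on \<Sigma> \<Gamma> I J \<longleftrightarrow> (\<forall>i<length \<Gamma>. I (AVar i) = J (AVar i)) \<and>
    (\<forall>c\<in>ocons \<Sigma>. I (AObj c) = J (AObj c)) \<and> (\<forall>a\<in>acons \<Sigma>. I (AArr a) = J (AArr a))"
  unfolding agree_on_def all_atom_iff[where 'a = 'a and 'b = 'b] by (auto simp: has_sort_iffs)

lemma has_sort_bind: "has_sort \<Sigma> \<Gamma> t s \<Longrightarrow> interp \<Sigma> \<Gamma> \<Sigma>' \<Gamma>' I \<Longrightarrow> has_sort \<Sigma>' \<Gamma>' (bind_tm I t) (bind_srt I s)"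
proof (induction t arbitrary: s)
  case (Idn t) then show ?case by (fastforce simp: has_sort_iffs)
next
  case (Cmp g f) then show ?case by (fastforce simp: has_sort_iffs)
qed (auto simp: interp_iff has_sort_iffs simp del: bind_srt_bind_srt)

lemma interp_id: "interp \<Sigma> \<Gamma> \<Sigma> \<Gamma> atom_tm"
  by (simp add: interp_def)

lemma interp_comp: "interp \<Sigma> \<Gamma> \<Sigma>' \<Gamma>' I \<Longrightarrow> interp \<Sigma>' \<Gamma>' \<Sigma>'' \<Gamma>'' J \<Longrightarrow> interp \<Sigma> \<Gamma> \<Sigma>'' \<Gamma>'' (\<lambda>x. bind_tm J (I x))"
  unfolding interp_def[of \<Sigma> \<Gamma> \<Sigma>'' \<Gamma>''] by (metis has_sort_bind interp_def bind_srt_bind_srt)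

lemma interp_weaken: "interp \<Sigma> \<Gamma> \<Sigma> (\<Delta> @ \<Gamma>) (weaken (length \<Delta>))"
  by (auto simp: interp_iff has_sort_iffs nth_append add_ac)

lemma interp_weaken1: "interp \<Sigma> \<Gamma> \<Sigma> (s # \<Gamma>) weaken1"
  using interp_weaken[of \<Sigma> \<Gamma> "[s]"] by simp

lemma interp_append_id: "interp \<Sigma> \<Delta> \<Sigma> (\<Delta> @ \<Gamma>) atom_tm"
  by (auto simp: interp_iff has_sort_iffs nth_append)

lemma interp_closed_id: "interp \<Sigma> [] \<Sigma> \<Gamma> atom_tm"
  using interp_append_id[of \<Sigma> "[]"] by simp

lemma interp_scons:
  assumes "interp \<Sigma> \<Gamma> \<Sigma>' \<Gamma>' I" "has_sort \<Sigma>' \<Gamma>' t (bind_srt I s)"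
  shows "interp \<Sigma> (s # \<Gamma>) \<Sigma>' \<Gamma>' (scons t I)"
  unfolding interp_iff
proof (intro conjI allI impI)
  fix i assume "i < length (s # \<Gamma>)"
  then show "has_sort \<Sigma>' \<Gamma>' (scons t I (AVar i))
      (bind_srt (scons t I) (bind_srt (weaken (Suc i)) ((s # \<Gamma>) ! i)))"
    using assms by (cases i) (auto simp: interp_iff)
qed (use assms(1) in \<open>auto simp: interp_iff\<close>)

lemma interp_lift: "interp \<Sigma> \<Gamma> \<Sigma>' \<Gamma>' I \<Longrightarrow> interp \<Sigma> (s # \<Gamma>) \<Sigma>' (bind_srt I s # \<Gamma>') (lift I)"
  unfolding lift_def by (rule interp_scons[OF interp_comp[OF _ interp_weaken1]]) auto

lemma wf_srt_bind: "wf_srt \<Sigma> \<Gamma> s \<Longrightarrow> interp \<Sigma> \<Gamma> \<Sigma>' \<Gamma>' I \<Longrightarrow> wf_srt \<Sigma>' \<Gamma>' (bind_srt I s)"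
  by (cases s) (auto dest: has_sort_bind)

lemma wf_fm_bind: "wf_fm \<Sigma> \<Gamma> P \<Longrightarrow> interp \<Sigma> \<Gamma> \<Sigma>' \<Gamma>' I \<Longrightarrow> wf_fm \<Sigma>' \<Gamma>' (bind_fm I P)"
proof (induction P arbitrary: \<Gamma> \<Gamma>' I)
  case (FEq s t) then show ?case by (fastforce dest: has_sort_bind)
next
  case (FAll s P) then show ?case by (auto intro: wf_srt_bind interp_lift)
next
  case (FEx s P) then show ?case by (auto intro: wf_srt_bind interp_lift)
qed auto

lemma wf_fm_append: "wf_fm \<Sigma> \<Delta> P \<Longrightarrow> wf_fm \<Sigma> (\<Delta> @ \<Gamma>) P"
  using wf_fm_bind[OF _ interp_append_id] by fastforce

lemma wf_srt_append: "wf_srt \<Sigma> \<Delta> s \<Longrightarrow> wf_srt \<Sigma> (\<Delta> @ \<Gamma>) s"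
  using wf_srt_bind[OF _ interp_append_id] by fastforce

lemma sentence_wf_fm: "sentence \<Sigma> P \<Longrightarrow> wf_fm \<Sigma> \<Gamma> P"
  using wf_fm_append[of \<Sigma> "[]"] by simp

lemma wf_ctx_append: "wf_ctx \<Sigma> \<Delta> \<Longrightarrow> wf_ctx \<Sigma> \<Gamma> \<Longrightarrow> wf_ctx \<Sigma> (\<Delta> @ \<Gamma>)"
  by (induction \<Delta>) (auto simp: wf_srt_append)

lemma agree_on_lift: "agree_on \<Sigma> \<Gamma> I J \<Longrightarrow> agree_on \<Sigma> (s # \<Gamma>) (lift I) (lift J)"
  by (auto simp: agree_on_iff lift_def scons_AVar split: nat.splits)

lemma bind_tm_cong: "has_sort \<Sigma> \<Gamma> t s \<Longrightarrow> agree_on \<Sigma> \<Gamma> I J \<Longrightarrow> bind_tm I t = bind_tm J t"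
  by (induction t arbitrary: s) (auto simp: has_sort_iffs agree_on_iff)

lemma bind_srt_cong: "wf_srt \<Sigma> \<Gamma> s \<Longrightarrow> agree_on \<Sigma> \<Gamma> I J \<Longrightarrow> bind_srt I s = bind_srt J s"
  by (cases s) (auto intro: bind_tm_cong)

lemma bind_fm_cong: "wf_fm \<Sigma> \<Gamma> P \<Longrightarrow> agree_on \<Sigma> \<Gamma> I J \<Longrightarrow> bind_fm I P = bind_fm J P"
proof (induction P arbitrary: \<Gamma> I J)
  case (FAll s P) then show ?case by (auto intro: bind_srt_cong agree_on_lift)
next
  case (FEx s P) then show ?case by (auto intro: bind_srt_cong agree_on_lift)
qed (auto intro: bind_tm_cong)

lemma bind_fm_var_subst_sentence: "sentence \<Sigma> P \<Longrightarrow> bind_fm (var_subst \<sigma>) P = P"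
  using bind_fm_cong[of \<Sigma> "[]" P "var_subst \<sigma>" atom_tm] by (simp add: agree_on_iff)

lemma bind_fm_weaken_sentence: "sentence \<Sigma> P \<Longrightarrow> bind_fm (weaken k) P = P"
  unfolding weaken_def by (rule bind_fm_var_subst_sentence)

lemma bind_fm_lift_sentence: "sentence \<Sigma> P \<Longrightarrow> bind_fm (lift I) P = bind_fm weaken1 (bind_fm I P)"
  by (simp, rule bind_fm_cong) (auto simp: agree_on_iff lift_def)

section \<open>Strengthening\<close>

text \<open>
  The premise of the rule for universal quantifier introduction only says that the weakened hypotheses
  are well-formed. Hence the converse of weakening is needed.
\<close>

definition rename_vars :: "(nat \<Rightarrow> nat) \<Rightarrow> ('o, 'a) atom \<Rightarrow> ('o, 'a) tm" where
  "rename_vars \<rho> = var_subst (\<lambda>i. Var (\<rho> i))"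

lemma rename_vars_simps [simp]:
  "rename_vars \<rho> (AVar i) = Var (\<rho> i)" "rename_vars \<rho> (AObj c) = OCon c" "rename_vars \<rho> (AArr a) = ACon a"
  by (simp_all add: rename_vars_def)

lemma lift_rename_vars: "lift (rename_vars \<rho>) = rename_vars (case_nat 0 (Suc \<circ> \<rho>))"
  by (rule atom_fun_eqI) (auto simp: lift_def scons_AVar split: nat.splits)

definition reflects_sorts :: "('o, 'a) sig \<Rightarrow> ('o, 'a) ctx \<Rightarrow> ('o, 'a) ctx \<Rightarrow> (nat \<Rightarrow> nat) \<Rightarrow> bool" where
  "reflects_sorts \<Sigma> \<Gamma> \<Gamma>' \<rho> \<longleftrightarrow> inj \<rho> \<and> (\<forall>i s'. has_sort \<Sigma> \<Gamma>' (Var (\<rho> i)) s' \<longrightarrow>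
     (\<exists>s. s' = bind_srt (rename_vars \<rho>) s \<and> has_sort \<Sigma> \<Gamma> (Var i) s))"

lemma bind_tm_rename_vars_inject: "inj \<rho> \<Longrightarrow> bind_tm (rename_vars \<rho>) s = bind_tm (rename_vars \<rho>) t \<longleftrightarrow> s = t"
proof (induction s arbitrary: t)
  case (Var i) then show ?case by (cases t) (auto dest: injD)
next
  case (OCon c) then show ?case by (cases t) auto
next
  case (ACon a) then show ?case by (cases t) auto
next
  case (Idn s) then show ?case by (cases t) auto
next
  case (Cmp g f) then show ?case by (cases t) auto
qed

lemma bind_srt_rename_vars_inject: "inj \<rho> \<Longrightarrow> bind_srt (rename_vars \<rho>) s = bind_srt (rename_vars \<rho>) u \<longleftrightarrow> s = u"
  by (cases s; cases u) (auto simp: bind_tm_rename_vars_inject)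

lemma bind_srt_eq_HomE:
  assumes "Hom X' Y' = bind_srt I s"
  obtains X Y where "s = Hom X Y" "X' = bind_tm I X" "Y' = bind_tm I Y"
  using assms by (cases s) auto

lemma has_sort_reflect:
  assumes \<rho>: "reflects_sorts \<Sigma> \<Gamma> \<Gamma>' \<rho>"
  shows "has_sort \<Sigma> \<Gamma>' (bind_tm (rename_vars \<rho>) t) s' \<Longrightarrow>
      \<exists>s. s' = bind_srt (rename_vars \<rho>) s \<and> has_sort \<Sigma> \<Gamma> t s"
proof (induction t arbitrary: s')
  case (Var i) then show ?case using \<rho> by (auto simp: reflects_sorts_def)
next
  case (Idn t)
  then have s': "s' = bind_srt (rename_vars \<rho>) (Hom t t)"
    and t: "has_sort \<Sigma> \<Gamma>' (bind_tm (rename_vars \<rho>) t) Ob"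
    by (auto simp: has_sort_Idn_iff)
  have "has_sort \<Sigma> \<Gamma> t Ob" using Idn.IH[OF t] by simp
  then show ?case using s' has_sort_Idn by blast
next
  case (Cmp g f)
  then obtain X' Y' Z' where f': "has_sort \<Sigma> \<Gamma>' (bind_tm (rename_vars \<rho>) f) (Hom X' Y')"
      and g': "has_sort \<Sigma> \<Gamma>' (bind_tm (rename_vars \<rho>) g) (Hom Y' Z')" and s': "s' = Hom X' Z'"
    by (auto simp: has_sort_Cmp_iff)
  obtain X Y where f: "has_sort \<Sigma> \<Gamma> f (Hom X Y)" "X' = bind_tm (rename_vars \<rho>) X"
    "Y' = bind_tm (rename_vars \<rho>) Y"
    using Cmp.IH(2)[OF f'] by (auto elim: bind_srt_eq_HomE)
  obtain Y\<^sub>2 Z where g: "has_sort \<Sigma> \<Gamma> g (Hom Y\<^sub>2 Z)" "Y' = bind_tm (rename_vars \<rho>) Y\<^sub>2"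
    "Z' = bind_tm (rename_vars \<rho>) Z"
    using Cmp.IH(1)[OF g'] by (auto elim: bind_srt_eq_HomE)
  have "Y\<^sub>2 = Y" using f(3) g(2) \<rho> by (simp add: reflects_sorts_def bind_tm_rename_vars_inject)
  then have "has_sort \<Sigma> \<Gamma> (Cmp g f) (Hom X Z)" using f(1) g(1) by (simp add: has_sort_Cmp)
  then show ?case using s' f(2) g(3) by (intro exI[of _ "Hom X Z"]) simp
qed (auto simp: has_sort_iffs)

lemma has_sort_rename_varsD:
  assumes "reflects_sorts \<Sigma> \<Gamma> \<Gamma>' \<rho>" "has_sort \<Sigma> \<Gamma>' (bind_tm (rename_vars \<rho>) t) (bind_srt (rename_vars \<rho>) s)"
  shows "has_sort \<Sigma> \<Gamma> t s"
  using has_sort_reflect[OF assms] assms(1) by (auto simp: reflects_sorts_def bind_srt_rename_vars_inject)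

lemma reflects_sorts_lift:
  assumes \<rho>: "reflects_sorts \<Sigma> \<Gamma> \<Gamma>' \<rho>"
  shows "reflects_sorts \<Sigma> (s # \<Gamma>) (bind_srt (rename_vars \<rho>) s # \<Gamma>') (case_nat 0 (Suc \<circ> \<rho>))"
    (is "reflects_sorts _ _ _ ?\<rho>")
  unfolding reflects_sorts_def
proof (intro conjI allI impI)
  have "inj \<rho>" using \<rho> by (simp add: reflects_sorts_def)
  then show "inj ?\<rho>" by (intro injI) (auto simp: inj_eq split: nat.splits)
next
  fix i u' assume i: "has_sort \<Sigma> (bind_srt (rename_vars \<rho>) s # \<Gamma>') (Var (?\<rho> i)) u'"
  show "\<exists>u. u' = bind_srt (rename_vars ?\<rho>) u \<and> has_sort \<Sigma> (s # \<Gamma>) (Var i) u"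
  proof (cases i)
    case 0
    then show ?thesis using i by (simp flip: lift_rename_vars)
  next
    case (Suc j)
    then obtain v' where v': "u' = bind_srt weaken1 v'" "has_sort \<Sigma> \<Gamma>' (Var (\<rho> j)) v'"
      using i by (auto simp: has_sort_Var_Suc)
    then obtain v where v: "v' = bind_srt (rename_vars \<rho>) v" "has_sort \<Sigma> \<Gamma> (Var j) v"
      using \<rho> by (auto simp: reflects_sorts_def)
    have "u' = bind_srt (rename_vars ?\<rho>) (bind_srt weaken1 v)"
      using v v' by (simp flip: lift_rename_vars)
    then show ?thesis using v(2) Suc has_sort_Var_Suc by blast
  qed
qed

lemma wf_srt_reflect: "reflects_sorts \<Sigma> \<Gamma> \<Gamma>' \<rho> \<Longrightarrow> wf_srt \<Sigma> \<Gamma>' (bind_srt (rename_vars \<rho>) s) \<Longrightarrow> wf_srt \<Sigma> \<Gamma> s"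
  by (cases s) (auto intro: has_sort_rename_varsD[where s = Ob, simplified])

lemma wf_fm_reflect: "reflects_sorts \<Sigma> \<Gamma> \<Gamma>' \<rho> \<Longrightarrow> wf_fm \<Sigma> \<Gamma>' (bind_fm (rename_vars \<rho>) P) \<Longrightarrow> wf_fm \<Sigma> \<Gamma> P"
proof (induction P arbitrary: \<Gamma> \<Gamma>' \<rho>)
  case (FEq t u)
  then obtain X' Y' where t': "has_sort \<Sigma> \<Gamma>' (bind_tm (rename_vars \<rho>) t) (Hom X' Y')"
      and u': "has_sort \<Sigma> \<Gamma>' (bind_tm (rename_vars \<rho>) u) (Hom X' Y')" by auto
  obtain X Y where t: "has_sort \<Sigma> \<Gamma> t (Hom X Y)" and XY: "Hom X' Y' = bind_srt (rename_vars \<rho>) (Hom X Y)"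
    using has_sort_reflect[OF FEq.prems(1) t'] by (auto elim: bind_srt_eq_HomE)
  have "has_sort \<Sigma> \<Gamma> u (Hom X Y)" using has_sort_rename_varsD[OF FEq.prems(1)] u' unfolding XY .
  then show ?case using t by auto
next
  case (FAll s P)
  then show ?case using wf_srt_reflect FAll.IH[OF reflects_sorts_lift] by (auto simp: lift_rename_vars)
next
  case (FEx s P)
  then show ?case using wf_srt_reflect FEx.IH[OF reflects_sorts_lift] by (auto simp: lift_rename_vars)
qed auto

lemma wf_fm_weaken1_iff: "wf_fm \<Sigma> (s # \<Gamma>) (bind_fm weaken1 P) \<longleftrightarrow> wf_fm \<Sigma> \<Gamma> P"
proof
  have weaken1: "weaken1 = (rename_vars Suc :: ('a, 'b) atom \<Rightarrow> _)" by (simp add: weaken_def rename_vars_def)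
  have "reflects_sorts \<Sigma> \<Gamma> (s # \<Gamma>) Suc"
    by (auto simp: reflects_sorts_def has_sort_Var_Suc simp flip: weaken1)
  then show "wf_fm \<Sigma> \<Gamma> P" if "wf_fm \<Sigma> (s # \<Gamma>) (bind_fm weaken1 P)"
    using that wf_fm_reflect unfolding weaken1 by blast
qed (rule wf_fm_bind[OF _ interp_weaken1])

section \<open>Translation of derivations\<close>

lemma wf_hyps_weaken1: "wf_hyps T \<Gamma> \<Phi> \<Longrightarrow> wf_srt (sg T) \<Gamma> s \<Longrightarrow> wf_hyps T (s # \<Gamma>) (bind_fm weaken1 ` \<Phi>)"
  by (auto simp: wf_hyps_def wf_fm_weaken1_iff)

lemma wf_hyps_weaken1D: "wf_hyps T (s # \<Gamma>) (bind_fm weaken1 ` \<Phi>) \<Longrightarrow> wf_hyps T \<Gamma> \<Phi> \<and> wf_srt (sg T) \<Gamma> s"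
  by (auto simp: wf_hyps_def wf_fm_weaken1_iff)

lemma wf_hyps_insert: "wf_hyps T \<Gamma> (insert \<phi> \<Phi>) \<longleftrightarrow> wf_fm (sg T) \<Gamma> \<phi> \<and> wf_hyps T \<Gamma> \<Phi>"
  by (auto simp: wf_hyps_def)

lemma wf_hyps_Nil: "wf_hyps T [] {}"
  by (simp add: wf_hyps_def)

lemma deriv_wf: "deriv T \<Gamma> \<Phi> \<phi> \<Longrightarrow> wf_hyps T \<Gamma> \<Phi> \<and> wf_fm (sg T) \<Gamma> \<phi>"
proof (induction rule: deriv.induct)
  case (Axiom \<Gamma> \<Phi> \<phi>) then show ?case by (auto intro: sentence_wf_fm)
next
  case (Hyp \<Gamma> \<Phi> \<phi>) then show ?case by (auto simp: wf_hyps_def)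
next
  case (AllI s \<Gamma> \<Phi> \<phi>) then show ?case by (auto simp: subst_fm_shift1 dest: wf_hyps_weaken1D)
next
  case (AllE \<Gamma> \<Phi> s \<phi> t)
  then show ?case by (auto simp: inst_bind intro!: wf_fm_bind interp_scons interp_id)
qed (auto simp: wf_hyps_insert)

lemmas deriv_wf_fm = deriv_wf[THEN conjunct2]
lemmas deriv_wf_hyps = deriv_wf[THEN conjunct1]

lemma deriv_AllI: "deriv T (s # \<Gamma>) (bind_fm weaken1 ` \<Phi>) \<phi> \<Longrightarrow> deriv T \<Gamma> \<Phi> (FAll s \<phi>)"
  by (rule deriv.AllI) (simp add: subst_fm_shift1)

lemma deriv_AllE:
  "deriv T \<Gamma> \<Phi> (FAll s \<phi>) \<Longrightarrow> has_sort (sg T) \<Gamma> t s \<Longrightarrow> deriv T \<Gamma> \<Phi> (bind_fm (scons t atom_tm) \<phi>)"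
  using deriv.AllE by (metis inst_bind)

lemma deriv_ExI: "wf_fm (sg T) \<Gamma> (FEx s \<phi>) \<Longrightarrow> has_sort (sg T) \<Gamma> t s
    \<Longrightarrow> deriv T \<Gamma> \<Phi> (bind_fm (scons t atom_tm) \<phi>) \<Longrightarrow> deriv T \<Gamma> \<Phi> (FEx s \<phi>)"
  using deriv.ExI by (metis inst_bind)

lemma deriv_ExE: "deriv T \<Gamma> \<Phi> (FEx s \<phi>) \<Longrightarrow> wf_fm (sg T) \<Gamma> \<psi>
    \<Longrightarrow> deriv T (s # \<Gamma>) (insert \<phi> (bind_fm weaken1 ` \<Phi>)) (bind_fm weaken1 \<psi>) \<Longrightarrow> deriv T \<Gamma> \<Phi> \<psi>"
  by (rule deriv.ExE) (simp_all add: subst_fm_shift1)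

text \<open>
  \<open>avail\<close> says how the translated hypotheses and axioms are available in the target theory. It is first
  instantiated to membership, which yields weakening, and then, with weakening at hand, to derivability.
\<close>

locale availability =
  fixes T' :: "('p, 'b) thy" and avail :: "('p, 'b) ctx \<Rightarrow> ('p, 'b) fm set \<Rightarrow> ('p, 'b) fm \<Rightarrow> bool"
  assumes avail_deriv: "\<And>\<Gamma> \<Phi> \<chi>. avail \<Gamma> \<Phi> \<chi> \<Longrightarrow> wf_hyps T' \<Gamma> \<Phi> \<Longrightarrow> deriv T' \<Gamma> \<Phi> \<chi>"
    and avail_weaken1: "\<And>\<Gamma> \<Phi> \<chi> s. avail \<Gamma> \<Phi> \<chi> \<Longrightarrow> wf_hyps T' \<Gamma> \<Phi> \<Longrightarrow> wf_srt (sg T') \<Gamma> s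
      \<Longrightarrow> avail (s # \<Gamma>) (bind_fm weaken1 ` \<Phi>) (bind_fm weaken1 \<chi>)"
    and avail_insert: "\<And>\<Gamma> \<Phi> \<chi> \<psi>. avail \<Gamma> \<Phi> \<chi> \<Longrightarrow> wf_hyps T' \<Gamma> (insert \<psi> \<Phi>) \<Longrightarrow> avail \<Gamma> (insert \<psi> \<Phi>) \<chi>"
    and avail_hyp: "\<And>\<Gamma> \<Phi> \<psi>. wf_hyps T' \<Gamma> (insert \<psi> \<Phi>) \<Longrightarrow> avail \<Gamma> (insert \<psi> \<Phi>) \<psi>"
begin

definition translates :: "('o, 'a) thy \<Rightarrow> (('o, 'a) atom \<Rightarrow> ('p, 'b) tm) \<Rightarrow> ('o, 'a) ctx \<Rightarrow> ('o, 'a) fm set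
    \<Rightarrow> ('p, 'b) ctx \<Rightarrow> ('p, 'b) fm set \<Rightarrow> bool" where
  "translates T I \<Gamma> \<Phi> \<Gamma>' \<Phi>' \<longleftrightarrow> interp (sg T) \<Gamma> (sg T') \<Gamma>' I \<and> wf_hyps T' \<Gamma>' \<Phi>' \<and>
     (\<forall>\<chi>\<in>\<Phi>. avail \<Gamma>' \<Phi>' (bind_fm I \<chi>)) \<and>
     (\<forall>\<alpha>\<in>axms T. sentence (sg T) \<alpha> \<longrightarrow> avail \<Gamma>' \<Phi>' (bind_fm I \<alpha>))"

lemma translates_insert:
  assumes "translates T I \<Gamma> \<Phi> \<Gamma>' \<Phi>'" "wf_fm (sg T) \<Gamma> \<psi>"
  shows "translates T I \<Gamma> (insert \<psi> \<Phi>) \<Gamma>' (insert (bind_fm I \<psi>) \<Phi>')"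
proof -
  have "wf_hyps T' \<Gamma>' (insert (bind_fm I \<psi>) \<Phi>')"
    using assms by (auto simp: translates_def wf_hyps_insert intro: wf_fm_bind)
  then show ?thesis using assms by (auto simp: translates_def intro: avail_insert avail_hyp)
qed

lemma translates_lift:
  assumes tr: "translates T I \<Gamma> \<Phi> \<Gamma>' \<Phi>'" and s: "wf_srt (sg T) \<Gamma> s"
  shows "translates T (lift I) (s # \<Gamma>) (bind_fm weaken1 ` \<Phi>) (bind_srt I s # \<Gamma>') (bind_fm weaken1 ` \<Phi>')"
proof -
  have I: "interp (sg T) \<Gamma> (sg T') \<Gamma>' I" and hyps: "wf_hyps T' \<Gamma>' \<Phi>'" using tr by (auto simp: translates_def)
  note s' = wf_srt_bind[OF s I]
  have "avail (bind_srt I s # \<Gamma>') (bind_fm weaken1 ` \<Phi>') (bind_fm (lift I) \<chi>')" if "\<chi>' \<in> bind_fm weaken1 ` \<Phi>"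
    for \<chi>'
    using that tr avail_weaken1[OF _ hyps s'] by (fastforce simp: translates_def)
  moreover have "avail (bind_srt I s # \<Gamma>') (bind_fm weaken1 ` \<Phi>') (bind_fm (lift I) \<alpha>)"
    if "\<alpha> \<in> axms T" "sentence (sg T) \<alpha>" for \<alpha>
    using that tr avail_weaken1[OF _ hyps s']
    unfolding bind_fm_lift_sentence[OF that(2)] by (auto simp: translates_def simp del: bind_fm_bind_fm)
  ultimately show ?thesis
    using interp_lift[OF I] wf_hyps_weaken1[OF hyps s'] by (auto simp: translates_def)
qed

lemma deriv_translates: "deriv T \<Gamma> \<Phi> \<phi> \<Longrightarrow> translates T I \<Gamma> \<Phi> \<Gamma>' \<Phi>' \<Longrightarrow> deriv T' \<Gamma>' \<Phi>' (bind_fm I \<phi>)"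
proof (induction arbitrary: \<Gamma>' \<Phi>' I rule: deriv.induct)
  case (Axiom \<Gamma> \<Phi> \<phi>) then show ?case using avail_deriv by (auto simp: translates_def)
next
  case (Hyp \<Gamma> \<Phi> \<phi>) then show ?case using avail_deriv by (auto simp: translates_def)
next
  case (TopI \<Gamma> \<Phi>) then show ?case by (simp add: translates_def deriv.TopI)
next
  case (BotE \<Gamma> \<Phi> \<phi>)
  then show ?case by (auto simp: translates_def intro: deriv.BotE wf_fm_bind)
next
  case (AndE1 \<Gamma> \<Phi> \<phi> \<psi>) then show ?case by (auto intro: deriv.AndE1)
next
  case (AndE2 \<Gamma> \<Phi> \<phi> \<psi>) then show ?case by (auto intro: deriv.AndE2)
next
  case (OrI1 \<Gamma> \<Phi> \<phi> \<psi>) then show ?case by (auto simp: translates_def intro: deriv.OrI1 wf_fm_bind)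
next
  case (OrI2 \<Gamma> \<Phi> \<psi> \<phi>) then show ?case by (auto simp: translates_def intro: deriv.OrI2 wf_fm_bind)
next
  case (OrE \<Gamma> \<Phi> \<phi> \<psi> \<chi>)
  have "wf_fm (sg T) \<Gamma> \<phi>" "wf_fm (sg T) \<Gamma> \<psi>" using deriv_wf_fm[OF OrE.hyps(1)] by auto
  from this[THEN translates_insert[OF OrE.prems]] show ?case
    using deriv.OrE[OF OrE.IH(1)[OF OrE.prems, simplified]] OrE.IH(2,3) by blast
next
  case (ImpI \<Gamma> \<phi> \<Phi> \<psi>)
  have "wf_fm (sg T) \<Gamma> \<phi>" using deriv_wf_hyps[OF ImpI.hyps(1)] by (simp add: wf_hyps_insert)
  then show ?case using ImpI.IH translates_insert[OF ImpI.prems] by (simp add: deriv.ImpI)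
next
  case (ImpE \<Gamma> \<Phi> \<phi> \<psi>)
  show ?case using deriv.ImpE[OF ImpE.IH(1)[OF ImpE.prems, simplified] ImpE.IH(2)[OF ImpE.prems]] .
next
  case (AllI s \<Gamma> \<Phi> \<phi>)
  have "wf_srt (sg T) \<Gamma> s" using deriv_wf_hyps[OF AllI.hyps(1)] by (auto simp: wf_hyps_def)
  then show ?case
    using AllI.IH translates_lift[OF AllI.prems] by (simp add: subst_fm_shift1 deriv_AllI)
next
  case (AllE \<Gamma> \<Phi> s \<phi> t)
  have "has_sort (sg T') \<Gamma>' (bind_tm I t) (bind_srt I s)"
    using AllE.hyps(2) AllE.prems by (auto simp: translates_def intro: has_sort_bind)
  from deriv_AllE[OF AllE.IH[OF AllE.prems, simplified] this] show ?case by (simp add: inst_bind lift_def)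
next
  case (ExI \<Gamma> s \<phi> t \<Phi>)
  have "interp (sg T) \<Gamma> (sg T') \<Gamma>' I" using ExI.prems by (simp add: translates_def)
  then have "wf_fm (sg T') \<Gamma>' (bind_fm I (FEx s \<phi>))" "has_sort (sg T') \<Gamma>' (bind_tm I t) (bind_srt I s)"
    using ExI.hyps by (blast intro: wf_fm_bind has_sort_bind)+
  then show ?case using ExI.IH[OF ExI.prems] by (auto simp: inst_bind lift_def intro: deriv_ExI)
next
  case (ExE \<Gamma> \<Phi> s \<phi> \<psi>)
  have wf: "wf_srt (sg T) \<Gamma> s" "wf_fm (sg T) (s # \<Gamma>) \<phi>" using deriv_wf_fm[OF ExE.hyps(1)] by auto
  have "wf_fm (sg T') \<Gamma>' (bind_fm I \<psi>)"
    using ExE.hyps(2) ExE.prems by (auto simp: translates_def intro: wf_fm_bind)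
  moreover from ExE.IH(2)[unfolded subst_fm_shift1,
      OF translates_insert[OF translates_lift[OF ExE.prems wf(1)] wf(2)]]
  have "deriv T' (bind_srt I s # \<Gamma>') (insert (bind_fm (lift I) \<phi>) (bind_fm weaken1 ` \<Phi>'))
      (bind_fm weaken1 (bind_fm I \<psi>))"
    by simp
  ultimately show ?case using deriv_ExE[OF ExE.IH(1)[OF ExE.prems, simplified]] by blast
qed (auto intro: deriv.AndI)

end

lemma deriv_var_subst_subset:
  assumes derivation: "deriv T \<Gamma> \<Phi> \<phi>" and \<sigma>: "interp (sg T) \<Gamma> (sg T) \<Gamma>' (var_subst \<sigma>)"
    and hyps: "wf_hyps T \<Gamma>' \<Phi>'" "bind_fm (var_subst \<sigma>) ` \<Phi> \<subseteq> \<Phi>'"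
  shows "deriv T \<Gamma>' \<Phi>' (bind_fm (var_subst \<sigma>) \<phi>)"
proof -
  interpret availability T "\<lambda>\<Gamma> \<Phi> \<chi>. \<chi> \<in> \<Phi> \<or> (\<chi> \<in> axms T \<and> sentence (sg T) \<chi>)"
    by standard (auto intro: deriv.Axiom deriv.Hyp simp: bind_fm_weaken_sentence)
  show ?thesis
    using deriv_translates[OF derivation, of "var_subst \<sigma>"] \<sigma> hyps
    by (auto simp: translates_def bind_fm_var_subst_sentence)
qed

lemma deriv_mono: "deriv T \<Gamma> \<Phi> \<phi> \<Longrightarrow> \<Phi> \<subseteq> \<Phi>' \<Longrightarrow> wf_hyps T \<Gamma> \<Phi>' \<Longrightarrow> deriv T \<Gamma> \<Phi>' \<phi>"
  using deriv_var_subst_subset[of T \<Gamma> \<Phi> \<phi> \<Gamma> Var \<Phi>'] by (simp add: interp_id)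

lemma deriv_insert: "deriv T \<Gamma> \<Phi> \<phi> \<Longrightarrow> wf_fm (sg T) \<Gamma> \<psi> \<Longrightarrow> deriv T \<Gamma> (insert \<psi> \<Phi>) \<phi>"
  by (rule deriv_mono) (auto simp: wf_hyps_insert dest: deriv_wf)

lemma deriv_weaken1:
  assumes "deriv T \<Gamma> \<Phi> \<phi>" "wf_srt (sg T) \<Gamma> s"
  shows "deriv T (s # \<Gamma>) (bind_fm weaken1 ` \<Phi>) (bind_fm weaken1 \<phi>)"
  unfolding weaken_def
  by (rule deriv_var_subst_subset[OF assms(1) interp_weaken1[unfolded weaken_def] _ order_refl])
     (rule wf_hyps_weaken1[OF deriv_wf_hyps[OF assms(1)] assms(2), unfolded weaken_def])

lemma deriv_bind:
  assumes "deriv T \<Gamma> \<Phi> \<phi>" "interp (sg T) \<Gamma> (sg T') \<Gamma>' I" "wf_hyps T' \<Gamma>' \<Phi>'"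
    "\<And>\<chi>. \<chi> \<in> \<Phi> \<Longrightarrow> deriv T' \<Gamma>' \<Phi>' (bind_fm I \<chi>)"
    "\<And>\<alpha>. \<alpha> \<in> axms T \<Longrightarrow> sentence (sg T) \<alpha> \<Longrightarrow> deriv T' \<Gamma>' \<Phi>' (bind_fm I \<alpha>)"
  shows "deriv T' \<Gamma>' \<Phi>' (bind_fm I \<phi>)"
proof -
  interpret availability T' "deriv T'"
    by standard (auto simp: wf_hyps_insert intro: deriv_weaken1 deriv_insert deriv.Hyp)
  show ?thesis using deriv_translates[OF assms(1)] assms(2-) by (auto simp: translates_def)
qed

lemma deriv_var_subst:
  assumes "deriv T \<Gamma> \<Phi> \<phi>" "interp (sg T) \<Gamma> (sg T) \<Gamma>' (var_subst \<sigma>)" "wf_hyps T \<Gamma>' \<Phi>'"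
    "\<And>\<chi>. \<chi> \<in> \<Phi> \<Longrightarrow> deriv T \<Gamma>' \<Phi>' (bind_fm (var_subst \<sigma>) \<chi>)"
  shows "deriv T \<Gamma>' \<Phi>' (bind_fm (var_subst \<sigma>) \<phi>)"
  by (rule deriv_bind[OF assms]) (auto simp: bind_fm_var_subst_sentence intro: deriv.Axiom assms(3))

lemma deriv_weaken_closed:
  assumes "deriv T [] {} \<phi>" "wf_hyps T \<Gamma> \<Phi>"
  shows "deriv T \<Gamma> \<Phi> \<phi>"
  using deriv_var_subst[of T "[]" "{}" \<phi> \<Gamma> Var \<Phi>] assms by (simp add: interp_closed_id)

definition extends :: "('o, 'a) thy \<Rightarrow> ('o, 'a) ctx \<Rightarrow> ('o, 'a) fm set \<Rightarrow> ('o, 'a) ctx \<Rightarrow> ('o, 'a) fm set \<Rightarrow> bool"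
  where
  "extends T L \<Phi>' \<Gamma> \<Phi> \<longleftrightarrow> bind_fm (weaken (length L)) ` \<Phi> \<subseteq> \<Phi>' \<and> wf_hyps T (L @ \<Gamma>) \<Phi>'"

lemma extends_wf_hyps: "extends T L \<Phi>' \<Gamma> \<Phi> \<Longrightarrow> wf_hyps T (L @ \<Gamma>) \<Phi>'"
  by (simp add: extends_def)

lemma extends_trans:
  assumes "extends T L \<Phi>' \<Gamma> \<Phi>" "extends T L' \<Phi>'' (L @ \<Gamma>) \<Phi>'"
  shows "extends T (L' @ L) \<Phi>'' \<Gamma> \<Phi>"
proof -
  have "bind_fm (weaken (length (L' @ L))) ` \<Phi> =
      bind_fm (weaken (length L')) ` bind_fm (weaken (length L)) ` \<Phi>"
    by (simp add: image_image)
  then show ?thesis using assms by (fastforce simp: extends_def)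
qed

lemma extends_insert: "wf_hyps T \<Gamma> \<Phi> \<Longrightarrow> wf_fm (sg T) \<Gamma> \<phi> \<Longrightarrow> extends T [] (insert \<phi> \<Phi>) \<Gamma> \<Phi>"
  by (auto simp: extends_def wf_hyps_insert)

lemma extends_weaken1: "wf_hyps T \<Gamma> \<Phi> \<Longrightarrow> wf_srt (sg T) \<Gamma> s \<Longrightarrow> extends T [s] (bind_fm weaken1 ` \<Phi>) \<Gamma> \<Phi>"
  by (auto simp: extends_def wf_hyps_weaken1)

lemma extends_weaken1_insert:
  "wf_hyps T \<Gamma> \<Phi> \<Longrightarrow> wf_fm (sg T) \<Gamma> (FEx s \<phi>) \<Longrightarrow> extends T [s] (insert \<phi> (bind_fm weaken1 ` \<Phi>)) \<Gamma> \<Phi>"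
  by (auto simp: extends_def wf_hyps_weaken1 wf_hyps_insert)

lemma deriv_extends:
  assumes "deriv T \<Gamma> \<Phi> \<phi>" "extends T L \<Phi>' \<Gamma> \<Phi>"
  shows "deriv T (L @ \<Gamma>) \<Phi>' (bind_fm (weaken (length L)) \<phi>)"
  using assms interp_weaken[of "sg T" \<Gamma> L] unfolding extends_def weaken_def
  by (blast intro: deriv_var_subst_subset)

section \<open>Compactness\<close>

locale exhausted_theory =
  fixes T :: "('o, 'a) thy" and R :: "'k \<Rightarrow> ('o, 'a) thy" and F :: "'k filter"
  assumes cdom_R: "\<And>k. cdom (sg (R k)) = cdom (sg T)" and ccod_R: "\<And>k. ccod (sg (R k)) = ccod (sg T)"
    and eventually_ocons: "\<And>c. c \<in> ocons (sg T) \<Longrightarrow> eventually (\<lambda>k. c \<in> ocons (sg (R k))) F"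
    and eventually_acons: "\<And>a. a \<in> acons (sg T) \<Longrightarrow> eventually (\<lambda>k. a \<in> acons (sg (R k))) F"
    and eventually_axms: "\<And>\<alpha>. \<alpha> \<in> axms T \<Longrightarrow> eventually (\<lambda>k. \<alpha> \<in> axms (R k)) F"
begin

lemma eventually_has_sort: "has_sort (sg T) \<Gamma> t s \<Longrightarrow> eventually (\<lambda>k. has_sort (sg (R k)) \<Gamma> t s) F"
proof (induction rule: has_sort.induct)
  case (1 i)
  then show ?case by (intro always_eventually allI has_sort.intros)
next
  case (2 c)
  show ?case using eventually_ocons[OF 2] by eventually_elim (rule has_sort.intros)
next
  case (3 a)
  show ?case using eventually_acons[OF 3] by eventually_elim (simp add: has_sort_ACon_iff cdom_R ccod_R)
next
  case (4 X)
  show ?case using 4(2) by eventually_elim (rule has_sort_Idn)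
next
  case (5 f X Y g Z)
  show ?case using 5(3,4) by eventually_elim (rule has_sort_Cmp)
qed

lemma eventually_wf_srt: "wf_srt (sg T) \<Gamma> s \<Longrightarrow> eventually (\<lambda>k. wf_srt (sg (R k)) \<Gamma> s) F"
  by (cases s) (auto intro!: eventually_conj eventually_has_sort)

lemma eventually_wf_ctx: "wf_ctx (sg T) \<Gamma> \<Longrightarrow> eventually (\<lambda>k. wf_ctx (sg (R k)) \<Gamma>) F"
  by (induction \<Gamma>) (auto intro!: eventually_conj eventually_wf_srt)

lemma eventually_wf_fm: "wf_fm (sg T) \<Gamma> P \<Longrightarrow> eventually (\<lambda>k. wf_fm (sg (R k)) \<Gamma> P) F"
proof (induction P arbitrary: \<Gamma>)
  case (FEq s t)
  then obtain X Y where "has_sort (sg T) \<Gamma> s (Hom X Y)" "has_sort (sg T) \<Gamma> t (Hom X Y)" by auto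
  from eventually_conj[OF this[THEN eventually_has_sort]] show ?case by eventually_elim auto
qed (auto intro!: eventually_conj eventually_wf_srt)

lemma eventually_wf_hyps: "wf_hyps T \<Gamma> \<Phi> \<Longrightarrow> finite \<Phi> \<Longrightarrow> eventually (\<lambda>k. wf_hyps (R k) \<Gamma> \<Phi>) F"
  unfolding wf_hyps_def
  by (intro eventually_conj eventually_ball_finite ballI) (auto intro: eventually_wf_ctx eventually_wf_fm)

lemma eventually_deriv: "deriv T \<Gamma> \<Phi> \<phi> \<Longrightarrow> finite \<Phi> \<Longrightarrow> eventually (\<lambda>k. deriv (R k) \<Gamma> \<Phi> \<phi>) F"
proof (induction rule: deriv.induct)
  case (Axiom \<Gamma> \<Phi> \<phi>)
  from eventually_wf_hyps[OF Axiom(1,4)] eventually_axms[OF Axiom(2)] eventually_wf_fm[OF Axiom(3)]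
  show ?case by eventually_elim (rule deriv.Axiom)
next
  case (Hyp \<Gamma> \<Phi> \<phi>)
  from eventually_wf_hyps[OF Hyp(1,3)] show ?case by eventually_elim (rule deriv.Hyp[OF _ Hyp(2)])
next
  case (TopI \<Gamma> \<Phi>)
  from eventually_wf_hyps[OF TopI] show ?case by eventually_elim (rule deriv.TopI)
next
  case (BotE \<Gamma> \<Phi> \<phi>)
  from BotE.IH[OF BotE.prems] eventually_wf_fm[OF BotE.hyps(2)] show ?case
    by eventually_elim (rule deriv.BotE)
next
  case AndI then show ?case by (auto elim: eventually_elim2 intro: deriv.AndI)
next
  case AndE1 then show ?case by (auto elim: eventually_mono intro: deriv.AndE1)
next
  case AndE2 then show ?case by (auto elim: eventually_mono intro: deriv.AndE2)
next
  case OrI1 then show ?case by (auto dest!: eventually_wf_fm elim: eventually_elim2 intro: deriv.OrI1)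
next
  case OrI2 then show ?case by (auto dest!: eventually_wf_fm elim: eventually_elim2 intro: deriv.OrI2)
next
  case (OrE \<Gamma> \<Phi> \<phi> \<psi> \<chi>)
  have "finite (insert \<phi> \<Phi>)" "finite (insert \<psi> \<Phi>)" using OrE.prems by auto
  from OrE.IH(1)[OF OrE.prems] OrE.IH(2)[OF this(1)] OrE.IH(3)[OF this(2)]
  show ?case by eventually_elim (rule deriv.OrE)
next
  case ImpI then show ?case by (auto elim: eventually_mono intro: deriv.ImpI)
next
  case ImpE then show ?case by (auto elim: eventually_elim2 intro: deriv.ImpE)
next
  case (AllI s \<Gamma> \<Phi> \<phi>)
  have "finite (subst_fm (shift 1) ` \<Phi>)" using AllI.prems by auto
  from AllI.IH[OF this] show ?case by eventually_elim (rule deriv.AllI)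
next
  case (AllE \<Gamma> \<Phi> s \<phi> t)
  from AllE.IH[OF AllE.prems] eventually_has_sort[OF AllE.hyps(2)] show ?case
    by eventually_elim (rule deriv.AllE)
next
  case (ExI \<Gamma> s \<phi> t \<Phi>)
  from eventually_wf_fm[OF ExI.hyps(1)] eventually_has_sort[OF ExI.hyps(2)] ExI.IH[OF ExI.prems]
  show ?case by eventually_elim (rule deriv.ExI)
next
  case (ExE \<Gamma> \<Phi> s \<phi> \<psi>)
  have "finite (insert \<phi> (subst_fm (shift 1) ` \<Phi>))" using ExE.prems by auto
  from ExE.IH(1)[OF ExE.prems] eventually_wf_fm[OF ExE.hyps(2)] ExE.IH(2)[OF this]
  show ?case by eventually_elim (rule deriv.ExE)
qed

end

section \<open>Derivability of conjunctions, implications and blocks of quantifiers\<close>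

lemma deriv_And_iff: "deriv T \<Gamma> \<Phi> (FAnd P Q) \<longleftrightarrow> deriv T \<Gamma> \<Phi> P \<and> deriv T \<Gamma> \<Phi> Q"
  by (blast intro: deriv.AndI deriv.AndE1 deriv.AndE2)

lemma deriv_Top_iff: "deriv T \<Gamma> \<Phi> FTop \<longleftrightarrow> wf_hyps T \<Gamma> \<Phi>"
  by (blast intro: deriv.TopI deriv_wf_hyps)

lemma deriv_Imp_iff: "deriv T \<Gamma> \<Phi> (FImp P Q) \<longleftrightarrow> deriv T \<Gamma> (insert P \<Phi>) Q"
proof
  assume imp: "deriv T \<Gamma> \<Phi> (FImp P Q)"
  have "wf_fm (sg T) \<Gamma> P" using deriv_wf_fm[OF imp] by simp
  then have "deriv T \<Gamma> (insert P \<Phi>) P" "deriv T \<Gamma> (insert P \<Phi>) (FImp P Q)"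
    using deriv_wf_hyps[OF imp] deriv_insert[OF imp] by (auto intro: deriv.Hyp simp: wf_hyps_insert)
  then show "deriv T \<Gamma> (insert P \<Phi>) Q" by (rule deriv.ImpE[rotated])
qed (rule deriv.ImpI)

lemma deriv_All_iff: "deriv T \<Gamma> \<Phi> (FAll s P) \<longleftrightarrow> deriv T (s # \<Gamma>) (bind_fm weaken1 ` \<Phi>) P"
proof
  assume all: "deriv T \<Gamma> \<Phi> (FAll s P)"
  have "wf_srt (sg T) \<Gamma> s" using deriv_wf_fm[OF all] by simp
  from deriv_weaken1[OF all this]
  have "deriv T (s # \<Gamma>) (bind_fm weaken1 ` \<Phi>) (FAll (bind_srt weaken1 s) (bind_fm (lift weaken1) P))" by simp
  from deriv_AllE[OF this, of "Var 0"] show "deriv T (s # \<Gamma>) (bind_fm weaken1 ` \<Phi>) P" by (simp add: lift_def)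
qed (rule deriv_AllI)

lemma deriv_conjs_iff: "deriv T \<Gamma> \<Phi> (conjs L) \<longleftrightarrow> wf_hyps T \<Gamma> \<Phi> \<and> (\<forall>P\<in>set L. deriv T \<Gamma> \<Phi> P)"
  by (induction L) (auto simp: deriv_And_iff deriv_Top_iff dest: deriv_wf_hyps)

lemma bind_fm_conjs: "bind_fm I (conjs L) = conjs (map (bind_fm I) L)"
  by (induction L) auto

lemma wf_fm_conjs_iff: "wf_fm \<Sigma> \<Gamma> (conjs L) \<longleftrightarrow> (\<forall>P\<in>set L. wf_fm \<Sigma> \<Gamma> P)"
  by (induction L) auto

lemma deriv_alls_iff: "deriv T \<Gamma> \<Phi> (alls \<Delta> P) \<longleftrightarrow> deriv T (\<Delta> @ \<Gamma>) (bind_fm (weaken (length \<Delta>)) ` \<Phi>) P"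
  by (induction \<Delta> arbitrary: P) (auto simp: deriv_All_iff image_image)

lemma wf_fm_exs_iff: "wf_ctx \<Sigma> \<Gamma> \<Longrightarrow> wf_fm \<Sigma> \<Gamma> (exs \<Delta> P) \<longleftrightarrow> wf_ctx \<Sigma> (\<Delta> @ \<Gamma>) \<and> wf_fm \<Sigma> (\<Delta> @ \<Gamma>) P"
  by (induction \<Delta> arbitrary: P) auto

lemma exs_append: "exs (\<Delta> @ \<Delta>') P = exs \<Delta>' (exs \<Delta> P)"
  by (induction \<Delta> arbitrary: P) auto

lemma deriv_exsE:
  assumes "deriv T \<Gamma> \<Phi> (exs \<Delta> P)" "wf_fm (sg T) \<Gamma> \<psi>"
    "deriv T (\<Delta> @ \<Gamma>) (insert P (bind_fm (weaken (length \<Delta>)) ` \<Phi>)) (bind_fm (weaken (length \<Delta>)) \<psi>)"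
  shows "deriv T \<Gamma> \<Phi> \<psi>"
  using assms(1,3)
proof (induction \<Delta> arbitrary: P)
  case Nil
  then show ?case using deriv.ImpE[OF deriv.ImpI] by simp
next
  case (Cons s \<Delta>)
  let ?\<Phi> = "insert (FEx s P) (bind_fm (weaken (length \<Delta>)) ` \<Phi>)"
  have ex: "deriv T \<Gamma> \<Phi> (exs \<Delta> (FEx s P))" using Cons.prems(1) by simp
  have hyps: "wf_hyps T \<Gamma> \<Phi>" using deriv_wf_hyps[OF ex] .
  have wf: "wf_ctx (sg T) (\<Delta> @ \<Gamma>)" "wf_fm (sg T) (\<Delta> @ \<Gamma>) (FEx s P)"
    using wf_fm_exs_iff[of "sg T" \<Gamma> \<Delta> "FEx s P"] deriv_wf_fm[OF ex] hyps by (auto simp: wf_hyps_def)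
  have hyps': "wf_hyps T (\<Delta> @ \<Gamma>) ?\<Phi>"
    using wf hyps interp_weaken[of "sg T" \<Gamma> \<Delta>] by (auto simp: wf_hyps_def intro: wf_fm_bind)
  have "deriv T (s # \<Delta> @ \<Gamma>) (insert P (bind_fm weaken1 ` ?\<Phi>))
      (bind_fm weaken1 (bind_fm (weaken (length \<Delta>)) \<psi>))"
  proof (rule deriv_mono)
    show "deriv T (s # \<Delta> @ \<Gamma>) (insert P (bind_fm (weaken (Suc (length \<Delta>))) ` \<Phi>))
        (bind_fm weaken1 (bind_fm (weaken (length \<Delta>)) \<psi>))"
      using Cons.prems(2) by simp
    show "wf_hyps T (s # \<Delta> @ \<Gamma>) (insert P (bind_fm weaken1 ` ?\<Phi>))"
      unfolding wf_hyps_insert[of _ _ P] using wf_hyps_weaken1[OF hyps'] wf by simp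
  qed (auto simp: image_image)
  then have "deriv T (\<Delta> @ \<Gamma>) ?\<Phi> (bind_fm (weaken (length \<Delta>)) \<psi>)"
    by (rule deriv_ExE[OF deriv.Hyp[OF hyps' insertI1] wf_fm_bind[OF assms(2) interp_weaken]])
  then show ?case by (rule Cons.IH[OF ex])
qed

primrec scons_list :: "('p, 'b) tm list \<Rightarrow> (('o, 'a) atom \<Rightarrow> ('p, 'b) tm) \<Rightarrow> ('o, 'a) atom \<Rightarrow> ('p, 'b) tm" where
  "scons_list [] I = I"
| "scons_list (t # c) I = scons t (scons_list c I)"

lemma scons_list_AVar: "scons_list c I (AVar i) = (if i < length c then c ! i else I (AVar (i - length c)))"
proof (induction c arbitrary: i)
  case (Cons t c) then show ?case by (cases i) auto
qed simp

lemma scons_list_con [simp]: "scons_list c I (AObj k) = I (AObj k)" "scons_list c I (AArr a) = I (AArr a)"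
  by (induction c) auto

lemma scons_list_append: "scons_list (c @ c') I = scons_list c (scons_list c' I)"
  by (induction c) auto

lemma bind_tm_scons_list_weaken [simp]: "length c = m \<Longrightarrow> bind_tm (scons_list c I) (weaken m x) = I x"
  by (cases x) (auto simp: scons_list_AVar)

lemma scons_list_atom_tm: "scons_list c atom_tm = var_subst (\<lambda>i. scons_list c atom_tm (AVar i))"
  by (rule atom_fun_eqI) auto

lemma interp_scons_list:
  assumes "interp \<Sigma> \<Gamma> \<Sigma>' \<Gamma>' I" "length c = length L"
    "\<And>k. k < length L \<Longrightarrow> has_sort \<Sigma>' \<Gamma>' (c ! k)
        (bind_srt (scons_list c I) (bind_srt (weaken (Suc k)) (L ! k)))"
  shows "interp \<Sigma> (L @ \<Gamma>) \<Sigma>' \<Gamma>' (scons_list c I)"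
  unfolding interp_iff
proof (intro conjI allI impI)
  fix i assume i: "i < length (L @ \<Gamma>)"
  show "has_sort \<Sigma>' \<Gamma>' (scons_list c I (AVar i))
      (bind_srt (scons_list c I) (bind_srt (weaken (Suc i)) ((L @ \<Gamma>) ! i)))"
  proof (cases "i < length L")
    case True
    then show ?thesis using assms by (simp add: scons_list_AVar nth_append)
  next
    case False
    then obtain j where j: "i = length c + j" using assms(2) by (metis le_add_diff_inverse not_less)
    have "bind_tm (scons_list c I) (weaken (Suc i) x) = bind_tm I (weaken (Suc j) x)" for x
      unfolding j by (cases x) (auto simp: scons_list_AVar)
    then show ?thesis using assms(1,2) i j by (auto simp: interp_iff scons_list_AVar nth_append)
  qed
qed (use assms(1) in \<open>auto simp: interp_iff\<close>)

lemma deriv_alls_elim: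
  assumes "deriv T \<Gamma> \<Phi> (alls \<Delta> P)" "length c = length \<Delta>"
    "interp (sg T) (\<Delta> @ \<Gamma>) (sg T) \<Gamma> (scons_list c atom_tm)"
  shows "deriv T \<Gamma> \<Phi> (bind_fm (scons_list c atom_tm) P)"
proof -
  obtain \<sigma> where \<sigma>: "scons_list c atom_tm = var_subst \<sigma>" using scons_list_atom_tm by blast
  have "deriv T (\<Delta> @ \<Gamma>) (bind_fm (weaken (length \<Delta>)) ` \<Phi>) P" using assms(1) by (simp add: deriv_alls_iff)
  from deriv_var_subst_subset[OF this assms(3)[unfolded \<sigma>] deriv_wf_hyps[OF assms(1)]]
  show ?thesis using assms(2) unfolding \<sigma>[symmetric] by (simp add: image_image)
qed

lemma prov_alls_elim:
  assumes "prov T (alls \<Delta> P)" "interp (sg T) \<Delta> (sg T) \<Gamma> (var_subst \<sigma>)" "wf_hyps T \<Gamma> \<Phi>"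
  shows "deriv T \<Gamma> \<Phi> (bind_fm (var_subst \<sigma>) P)"
proof -
  have "deriv T \<Delta> {} P" using assms(1) by (simp add: prov_def deriv_alls_iff)
  then show ?thesis using deriv_var_subst assms(2,3) by blast
qed

lemma deriv_exsI:
  assumes "wf_fm (sg T) \<Gamma> (exs \<Delta> P)" "length c = length \<Delta>"
    "interp (sg T) (\<Delta> @ \<Gamma>) (sg T) \<Gamma> (scons_list c atom_tm)" "deriv T \<Gamma> \<Phi> (bind_fm (scons_list c atom_tm) P)"
  shows "deriv T \<Gamma> \<Phi> (exs \<Delta> P)"
  using assms
proof (induction \<Delta> arbitrary: P c)
  case (Cons s \<Delta>)
  obtain t c' where c: "c = t # c'" using Cons.prems(2) by (cases c) auto
  let ?I = "scons_list c' atom_tm"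
  have I: "interp (sg T) (\<Delta> @ \<Gamma>) (sg T) \<Gamma> ?I"
    using interp_comp[OF interp_weaken1 Cons.prems(3)[simplified]] c by simp
  have "wf_fm (sg T) (\<Delta> @ \<Gamma>) (FEx s P)"
    using wf_fm_exs_iff[of "sg T" \<Gamma> \<Delta> "FEx s P"] Cons.prems(1) deriv_wf_hyps[OF Cons.prems(4)]
    by (auto simp: wf_hyps_def)
  then have wf: "wf_fm (sg T) \<Gamma> (bind_fm ?I (FEx s P))" using I by (rule wf_fm_bind)
  have t: "has_sort (sg T) \<Gamma> t (bind_srt ?I s)"
    using Cons.prems(3)[unfolded interp_def, rule_format, of "AVar 0" "bind_srt weaken1 s"] c by simp
  have "deriv T \<Gamma> \<Phi> (FEx (bind_srt ?I s) (bind_fm (lift ?I) P))"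
    by (rule deriv_ExI[OF _ t]) (use wf Cons.prems(4) c in \<open>simp_all add: lift_def\<close>)
  then show ?case using Cons.IH[of "FEx s P" c'] Cons.prems(1,2) I c by simp
qed simp

lemma deriv_Ex_mono:
  assumes imp: "deriv T (s # \<Gamma>) (insert P (bind_fm weaken1 ` \<Phi>)) P'"
  shows "deriv T \<Gamma> (insert (FEx s P) \<Phi>) (FEx s P')"
proof -
  let ?\<Phi> = "insert (FEx s P) \<Phi>"
  let ?\<Phi>' = "insert P (bind_fm weaken1 ` ?\<Phi>)"
  have wf: "wf_srt (sg T) \<Gamma> s" "wf_fm (sg T) (s # \<Gamma>) P" "wf_fm (sg T) (s # \<Gamma>) P'" "wf_hyps T \<Gamma> \<Phi>"
    using deriv_wf[OF imp] by (auto simp: wf_hyps_insert dest: wf_hyps_weaken1D)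
  then have hyps: "wf_hyps T \<Gamma> ?\<Phi>" by (simp add: wf_hyps_insert)
  then have "wf_hyps T (s # \<Gamma>) ?\<Phi>'" using wf wf_hyps_weaken1[OF hyps] by (simp add: wf_hyps_insert[of _ _ P])
  then have "deriv T (s # \<Gamma>) ?\<Phi>' P'" by (rule deriv_mono[OF imp, rotated]) auto
  then have inst: "deriv T (s # \<Gamma>) ?\<Phi>' (bind_fm (scons (Var 0) atom_tm) (bind_fm (lift weaken1) P'))"
    by (simp add: lift_def)
  have "wf_fm (sg T) (s # \<Gamma>) (bind_fm weaken1 (FEx s P'))"
    using wf by (simp add: wf_fm_weaken1_iff del: bind_fm.simps)
  from deriv_ExI[OF this[unfolded bind_fm.simps] _ inst]
  have "deriv T (s # \<Gamma>) ?\<Phi>' (bind_fm weaken1 (FEx s P'))" by simp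
  then show ?thesis using wf by (intro deriv_ExE[OF deriv.Hyp[OF hyps insertI1]]) simp_all
qed

lemma deriv_exs_mono:
  assumes "deriv T \<Gamma> \<Phi> (exs \<Delta> P)" "deriv T (\<Delta> @ \<Gamma>) (insert P (bind_fm (weaken (length \<Delta>)) ` \<Phi>)) P'"
  shows "deriv T \<Gamma> \<Phi> (exs \<Delta> P')"
  using assms
proof (induction \<Delta> arbitrary: P P')
  case Nil
  then show ?case using deriv.ImpE[OF deriv.ImpI] by simp
next
  case (Cons s \<Delta>)
  have "deriv T (\<Delta> @ \<Gamma>) (insert (FEx s P) (bind_fm (weaken (length \<Delta>)) ` \<Phi>)) (FEx s P')"
    by (rule deriv_Ex_mono) (use Cons.prems(2) in \<open>simp add: image_image\<close>)
  then show ?case using Cons.IH[of "FEx s P" "FEx s P'"] Cons.prems(1) by simp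
qed

lemma deriv_Ex_list_elim:
  fixes T :: "('o, 'a) thy" and xs :: "'i list"
  assumes \<psi>: "wf_fm (sg T) \<Gamma> \<psi>" and hyps: "wf_hyps T \<Gamma> \<Phi>"
    and ex: "\<And>i. i \<in> set xs \<Longrightarrow> deriv T \<Gamma> \<Phi> (FEx (s i) (B i))"
    and step: "\<And>L \<Phi>' t. extends T L \<Phi>' \<Gamma> \<Phi> \<Longrightarrow>
      (\<And>i. i \<in> set xs \<Longrightarrow> has_sort (sg T) (L @ \<Gamma>) (t i) (bind_srt (weaken (length L)) (s i)) \<and>
        deriv T (L @ \<Gamma>) \<Phi>' (bind_fm (scons (t i) (weaken (length L))) (B i))) \<Longrightarrow>
      deriv T (L @ \<Gamma>) \<Phi>' (bind_fm (weaken (length L)) \<psi>)"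
  shows "deriv T \<Gamma> \<Phi> \<psi>"
  using ex step
proof (induction xs)
  case Nil
  then show ?case using hyps Nil(2)[of "[]" \<Phi>] by (simp add: extends_def)
next
  case (Cons x xs)
  show ?case
  proof (rule Cons.IH)
    fix L :: "('o, 'a) ctx" and \<Phi>' and t :: "'i \<Rightarrow> ('o, 'a) tm"
    let ?s = "bind_srt (weaken (length L)) (s x)" and ?B = "bind_fm (lift (weaken (length L))) (B x)"
    let ?\<Phi> = "insert ?B (bind_fm weaken1 ` \<Phi>')" and ?L = "?s # L"
      and ?t = "\<lambda>i. if i = x then Var 0 else bind_tm weaken1 (t i)"
    assume ext: "extends T L \<Phi>' \<Gamma> \<Phi>"
      and t: "\<And>i. i \<in> set xs \<Longrightarrow> has_sort (sg T) (L @ \<Gamma>) (t i) (bind_srt (weaken (length L)) (s i)) \<and>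
        deriv T (L @ \<Gamma>) \<Phi>' (bind_fm (scons (t i) (weaken (length L))) (B i))"
    have ex_x: "deriv T (L @ \<Gamma>) \<Phi>' (FEx ?s ?B)" using deriv_extends[OF Cons.prems(1)[of x] ext] by simp
    have ext1: "extends T [?s] ?\<Phi> (L @ \<Gamma>) \<Phi>'"
      by (rule extends_weaken1_insert[OF extends_wf_hyps[OF ext] deriv_wf_fm[OF ex_x]])
    have "deriv T (?L @ \<Gamma>) ?\<Phi> (bind_fm (weaken (length ?L)) \<psi>)"
    proof (rule Cons.prems(2)[where t = ?t])
      show "extends T ?L ?\<Phi> \<Gamma> \<Phi>" using extends_trans[OF ext ext1] by simp
      fix i assume i: "i \<in> set (x # xs)"
      show "has_sort (sg T) (?L @ \<Gamma>) (?t i) (bind_srt (weaken (length ?L)) (s i)) \<and>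
          deriv T (?L @ \<Gamma>) ?\<Phi> (bind_fm (scons (?t i) (weaken (length ?L))) (B i))"
      proof (cases "i = x")
        case True
        have "deriv T (?L @ \<Gamma>) ?\<Phi> ?B" using extends_wf_hyps[OF ext1] by (auto intro: deriv.Hyp)
        then show ?thesis using True by (simp add: lift_def)
      next
        case False
        then have "i \<in> set xs" using i by simp
        from t[OF this] show ?thesis
          using False has_sort_bind[OF _ interp_weaken1, of _ _ "t i"] deriv_extends[OF _ ext1] by fastforce
      qed
    qed
    then show "deriv T (L @ \<Gamma>) \<Phi>' (bind_fm (weaken (length L)) \<psi>)"
      using deriv_ExE[OF ex_x wf_fm_bind[OF \<psi> interp_weaken]] by simp
  qed (use Cons.prems(1) in simp)
qed

section \<open>Equational reasoning\<close>

definition wf_sig :: "('o, 'a) sig \<Rightarrow> bool" where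
  "wf_sig \<Sigma> \<longleftrightarrow> (\<forall>a\<in>acons \<Sigma>. cdom \<Sigma> a \<in> ocons \<Sigma> \<and> ccod \<Sigma> a \<in> ocons \<Sigma>)"

lemma wf_ctx_nth: "wf_ctx \<Sigma> \<Gamma> \<Longrightarrow> i < length \<Gamma> \<Longrightarrow> wf_srt \<Sigma> (drop (Suc i) \<Gamma>) (\<Gamma> ! i)"
proof (induction \<Gamma> arbitrary: i)
  case (Cons s \<Gamma>) then show ?case by (cases i) auto
qed simp

lemma wf_ctx_nth_weaken:
  assumes "wf_ctx \<Sigma> \<Gamma>" "i < length \<Gamma>"
  shows "wf_srt \<Sigma> \<Gamma> (bind_srt (weaken (Suc i)) (\<Gamma> ! i))"
proof -
  have "interp \<Sigma> (drop (Suc i) \<Gamma>) \<Sigma> (take (Suc i) \<Gamma> @ drop (Suc i) \<Gamma>) (weaken (length (take (Suc i) \<Gamma>)))"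
    by (rule interp_weaken)
  then have "interp \<Sigma> (drop (Suc i) \<Gamma>) \<Sigma> \<Gamma> (weaken (Suc i))"
    using assms(2) by (simp add: min.absorb2 Suc_le_eq)
  then show ?thesis using wf_ctx_nth[OF assms] by (auto intro: wf_srt_bind)
qed

lemma has_sort_wf_srt: "has_sort \<Sigma> \<Gamma> t s \<Longrightarrow> wf_sig \<Sigma> \<Longrightarrow> wf_ctx \<Sigma> \<Gamma> \<Longrightarrow> wf_srt \<Sigma> \<Gamma> s"
  by (induction rule: has_sort.induct)
     (auto simp: subst_srt_bind wf_ctx_nth_weaken has_sort_iffs wf_sig_def)

lemma has_sort_dom_cod:
  assumes "has_sort \<Sigma> \<Gamma> t (Hom X Y)" "wf_sig \<Sigma>" "wf_ctx \<Sigma> \<Gamma>"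
  shows "has_sort \<Sigma> \<Gamma> X Ob" "has_sort \<Sigma> \<Gamma> Y Ob"
  using has_sort_wf_srt[OF assms] by auto

lemmas cat_eq_axioms_unfold =
  cat_eq_axioms_def allO_def allA_def bEq_def bImp_def bAnd_def bId_def bCmp_def lev_def

lemma sentence_cat_eq_axioms: "\<alpha> \<in> cat_eq_axioms \<Longrightarrow> sentence \<Sigma> \<alpha>"
  by (auto simp: cat_eq_axioms_unfold has_sort_iffs intro!: exI)

locale eq_theory =
  fixes T :: "('o, 'a) thy"
  assumes cat_eq: "cat_eq_axioms \<subseteq> axms T" and sig: "wf_sig (sg T)"
begin

lemma arrow_ends:
  assumes "wf_hyps T \<Gamma> \<Phi>" "has_sort (sg T) \<Gamma> f (Hom X Y)"
  shows "has_sort (sg T) \<Gamma> X Ob" "has_sort (sg T) \<Gamma> Y Ob"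
  using has_sort_dom_cod[OF assms(2) sig] assms(1) by (auto simp: wf_hyps_def)

lemma eq_sorts:
  assumes "deriv T \<Gamma> \<Phi> (FEq f g)"
  obtains X Y where "has_sort (sg T) \<Gamma> f (Hom X Y)" "has_sort (sg T) \<Gamma> g (Hom X Y)"
  using deriv_wf_fm[OF assms] by auto

lemma eq_sort_right:
  assumes "deriv T \<Gamma> \<Phi> (FEq f g)" "has_sort (sg T) \<Gamma> f s"
  shows "has_sort (sg T) \<Gamma> g s"
  using assms(2) by (blast intro: eq_sorts[OF assms(1)] dest: has_sort_unique)

lemma cat_eq_inst:
  assumes "alls \<Delta> P \<in> cat_eq_axioms" "interp (sg T) \<Delta> (sg T) \<Gamma> (scons_list c atom_tm)" "wf_hyps T \<Gamma> \<Phi>"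
  shows "deriv T \<Gamma> \<Phi> (bind_fm (scons_list c atom_tm) P)"
proof -
  obtain \<sigma> where \<sigma>: "scons_list c atom_tm = var_subst \<sigma>" using scons_list_atom_tm by blast
  have "prov T (alls \<Delta> P)"
    unfolding prov_def using assms(1) cat_eq sentence_cat_eq_axioms wf_hyps_Nil by (blast intro: deriv.Axiom)
  then show ?thesis using prov_alls_elim assms(2,3) unfolding \<sigma> by blast
qed

lemmas interp_closed_ctx = interp_scons interp_closed_id

lemma eq_refl:
  assumes hyps: "wf_hyps T \<Gamma> \<Phi>" and f: "has_sort (sg T) \<Gamma> f (Hom X Y)"
  shows "deriv T \<Gamma> \<Phi> (FEq f f)"
proof -
  have "deriv T \<Gamma> \<Phi> (bind_fm (scons_list [f, Y, X] atom_tm) (FEq (Var 0) (Var 0)))"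
    by (rule cat_eq_inst[where \<Delta> = "[Hom (Var 1) (Var 0), Ob, Ob]", OF _ _ hyps])
       (use f arrow_ends[OF hyps f] in \<open>auto simp: cat_eq_axioms_unfold intro!: interp_closed_ctx\<close>)
  then show ?thesis by simp
qed

lemma eq_sym:
  assumes eq: "deriv T \<Gamma> \<Phi> (FEq f g)"
  shows "deriv T \<Gamma> \<Phi> (FEq g f)"
proof -
  note hyps = deriv_wf_hyps[OF eq]
  obtain X Y where sorts: "has_sort (sg T) \<Gamma> f (Hom X Y)" "has_sort (sg T) \<Gamma> g (Hom X Y)"
    by (rule eq_sorts[OF eq])
  have "deriv T \<Gamma> \<Phi> (bind_fm (scons_list [g, f, Y, X] atom_tm)
      (FImp (FEq (Var 1) (Var 0)) (FEq (Var 0) (Var 1))))"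
    by (rule cat_eq_inst[where \<Delta> = "[Hom (Var 2) (Var 1), Hom (Var 1) (Var 0), Ob, Ob]", OF _ _ hyps])
       (use sorts arrow_ends[OF hyps sorts(1)] in
        \<open>auto simp: cat_eq_axioms_unfold numeral_eq_Suc intro!: interp_closed_ctx\<close>)
  then have "deriv T \<Gamma> \<Phi> (FImp (FEq f g) (FEq g f))" by simp
  then show ?thesis using eq by (rule deriv.ImpE)
qed

lemma eq_trans [trans]:
  assumes fg: "deriv T \<Gamma> \<Phi> (FEq f g)" and gk: "deriv T \<Gamma> \<Phi> (FEq g k)"
  shows "deriv T \<Gamma> \<Phi> (FEq f k)"
proof -
  note hyps = deriv_wf_hyps[OF fg]
  obtain X Y where sorts: "has_sort (sg T) \<Gamma> f (Hom X Y)" "has_sort (sg T) \<Gamma> g (Hom X Y)"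
    by (rule eq_sorts[OF fg])
  note k = eq_sort_right[OF gk sorts(2)]
  have "deriv T \<Gamma> \<Phi> (bind_fm (scons_list [k, g, f, Y, X] atom_tm)
      (FImp (FAnd (FEq (Var 2) (Var 1)) (FEq (Var 1) (Var 0))) (FEq (Var 2) (Var 0))))"
    by (rule cat_eq_inst[where \<Delta> = "[Hom (Var 3) (Var 2), Hom (Var 2) (Var 1), Hom (Var 1) (Var 0), Ob, Ob]",
        OF _ _ hyps])
       (use sorts k arrow_ends[OF hyps k] in
        \<open>auto simp: cat_eq_axioms_unfold numeral_eq_Suc intro!: interp_closed_ctx\<close>)
  then have "deriv T \<Gamma> \<Phi> (FImp (FAnd (FEq f g) (FEq g k)) (FEq f k))" by (simp add: numeral_eq_Suc)
  then show ?thesis using deriv.AndI[OF fg gk] by (rule deriv.ImpE)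
qed

lemma cmp_cong:
  assumes gg': "deriv T \<Gamma> \<Phi> (FEq g g')" and ff': "deriv T \<Gamma> \<Phi> (FEq f f')"
    and gf: "has_sort (sg T) \<Gamma> (Cmp g f) s"
  shows "deriv T \<Gamma> \<Phi> (FEq (Cmp g f) (Cmp g' f'))"
proof -
  note hyps = deriv_wf_hyps[OF gg']
  obtain X Y Z where f: "has_sort (sg T) \<Gamma> f (Hom X Y)" and g: "has_sort (sg T) \<Gamma> g (Hom Y Z)"
    using gf by (auto simp: has_sort_Cmp_iff)
  have sorts: "has_sort (sg T) \<Gamma> f' (Hom X Y)" "has_sort (sg T) \<Gamma> g' (Hom Y Z)"
    using eq_sort_right[OF ff' f] eq_sort_right[OF gg' g] .
  have "deriv T \<Gamma> \<Phi> (bind_fm (scons_list [g', g, f', f, Z, Y, X] atom_tm)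
      (FImp (FAnd (FEq (Var 3) (Var 2)) (FEq (Var 1) (Var 0)))
          (FEq (Cmp (Var 1) (Var 3)) (Cmp (Var 0) (Var 2)))))"
    by (rule cat_eq_inst[where \<Delta> = "[Hom (Var 4) (Var 3), Hom (Var 3) (Var 2), Hom (Var 3) (Var 2),
        Hom (Var 2) (Var 1),
          Ob, Ob, Ob]", OF _ _ hyps])
       (use f g sorts arrow_ends[OF hyps f] arrow_ends[OF hyps g] in
        \<open>auto simp: cat_eq_axioms_unfold numeral_eq_Suc intro!: interp_closed_ctx\<close>)
  then have "deriv T \<Gamma> \<Phi> (FImp (FAnd (FEq f f') (FEq g g')) (FEq (Cmp g f) (Cmp g' f')))"
    by (simp add: numeral_eq_Suc)
  then show ?thesis using deriv.AndI[OF ff' gg'] by (rule deriv.ImpE)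
qed

lemma cmp_cong_left:
  assumes gg': "deriv T \<Gamma> \<Phi> (FEq g g')" and gf: "has_sort (sg T) \<Gamma> (Cmp g f) s"
  shows "deriv T \<Gamma> \<Phi> (FEq (Cmp g f) (Cmp g' f))"
proof -
  obtain X Y where "has_sort (sg T) \<Gamma> f (Hom X Y)" using gf by (auto simp: has_sort_Cmp_iff)
  from cmp_cong[OF gg' eq_refl[OF deriv_wf_hyps[OF gg'] this] gf] show ?thesis .
qed

lemma cmp_cong_right:
  assumes ff': "deriv T \<Gamma> \<Phi> (FEq f f')" and gf: "has_sort (sg T) \<Gamma> (Cmp g f) s"
  shows "deriv T \<Gamma> \<Phi> (FEq (Cmp g f) (Cmp g f'))"
proof -
  obtain X Y where "has_sort (sg T) \<Gamma> g (Hom X Y)" using gf by (auto simp: has_sort_Cmp_iff)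
  from cmp_cong[OF eq_refl[OF deriv_wf_hyps[OF ff'] this] ff' gf] show ?thesis .
qed

lemma cmp_Idn_right:
  assumes hyps: "wf_hyps T \<Gamma> \<Phi>" and f: "has_sort (sg T) \<Gamma> f (Hom X Y)"
  shows "deriv T \<Gamma> \<Phi> (FEq (Cmp f (Idn X)) f)"
proof -
  have "deriv T \<Gamma> \<Phi> (bind_fm (scons_list [f, Y, X] atom_tm) (FEq (Cmp (Var 0) (Idn (Var 2))) (Var 0)))"
    by (rule cat_eq_inst[where \<Delta> = "[Hom (Var 1) (Var 0), Ob, Ob]", OF _ _ hyps])
       (use f arrow_ends[OF hyps f] in \<open>auto simp: cat_eq_axioms_unfold numeral_eq_Suc
           intro!: interp_closed_ctx\<close>)
  then show ?thesis by (simp add: numeral_eq_Suc)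
qed

lemma cmp_Idn_left:
  assumes hyps: "wf_hyps T \<Gamma> \<Phi>" and f: "has_sort (sg T) \<Gamma> f (Hom X Y)"
  shows "deriv T \<Gamma> \<Phi> (FEq (Cmp (Idn Y) f) f)"
proof -
  have "deriv T \<Gamma> \<Phi> (bind_fm (scons_list [f, Y, X] atom_tm) (FEq (Cmp (Idn (Var 1)) (Var 0)) (Var 0)))"
    by (rule cat_eq_inst[where \<Delta> = "[Hom (Var 1) (Var 0), Ob, Ob]", OF _ _ hyps])
       (use f arrow_ends[OF hyps f] in \<open>auto simp: cat_eq_axioms_unfold numeral_eq_Suc
           intro!: interp_closed_ctx\<close>)
  then show ?thesis by (simp add: numeral_eq_Suc)
qed

lemma cmp_assoc:
  assumes hyps: "wf_hyps T \<Gamma> \<Phi>" and kgf: "has_sort (sg T) \<Gamma> (Cmp (Cmp k g) f) s"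
  shows "deriv T \<Gamma> \<Phi> (FEq (Cmp (Cmp k g) f) (Cmp k (Cmp g f)))"
proof -
  obtain W X Y Z where f: "has_sort (sg T) \<Gamma> f (Hom W X)" and g: "has_sort (sg T) \<Gamma> g (Hom X Y)"
      and k: "has_sort (sg T) \<Gamma> k (Hom Y Z)"
    using kgf by (auto simp: has_sort_Cmp_iff)
  have "deriv T \<Gamma> \<Phi> (bind_fm (scons_list [k, g, f, Z, Y, X, W] atom_tm)
      (FEq (Cmp (Cmp (Var 0) (Var 1)) (Var 2)) (Cmp (Var 0) (Cmp (Var 1) (Var 2)))))"
    by (rule cat_eq_inst[where \<Delta> = "[Hom (Var 3) (Var 2), Hom (Var 3) (Var 2), Hom (Var 3) (Var 2),
          Ob, Ob, Ob, Ob]", OF _ _ hyps])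
       (use f g k arrow_ends[OF hyps f] arrow_ends[OF hyps k] in
        \<open>auto simp: cat_eq_axioms_unfold numeral_eq_Suc intro!: interp_closed_ctx\<close>)
  then show ?thesis by (simp add: numeral_eq_Suc)
qed

section \<open>Isomorphism invariance\<close>

definition inverse_arrows :: "('o, 'a) ctx \<Rightarrow> ('o, 'a) fm set \<Rightarrow> ('o, 'a) tm \<Rightarrow> ('o, 'a) tm
    \<Rightarrow> ('o, 'a) tm \<Rightarrow> ('o, 'a) tm \<Rightarrow> bool" where
  "inverse_arrows \<Gamma> \<Phi> X Y h k \<longleftrightarrow> has_sort (sg T) \<Gamma> h (Hom X Y) \<and> has_sort (sg T) \<Gamma> k (Hom Y X) \<and>
     deriv T \<Gamma> \<Phi> (FEq (Cmp k h) (Idn X)) \<and> deriv T \<Gamma> \<Phi> (FEq (Cmp h k) (Idn Y))"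

lemma inverse_arrows_sym: "inverse_arrows \<Gamma> \<Phi> X Y h k \<Longrightarrow> inverse_arrows \<Gamma> \<Phi> Y X k h"
  by (simp add: inverse_arrows_def)

lemma inverse_arrows_Idn:
  assumes "wf_hyps T \<Gamma> \<Phi>" "has_sort (sg T) \<Gamma> X Ob"
  shows "inverse_arrows \<Gamma> \<Phi> X X (Idn X) (Idn X)"
  using has_sort_Idn[OF assms(2)] cmp_Idn_left[OF assms(1)] by (simp add: inverse_arrows_def)

lemma inverse_arrows_extends:
  assumes "inverse_arrows \<Gamma> \<Phi> X Y h k" "extends T L \<Phi>' \<Gamma> \<Phi>"
  shows "inverse_arrows (L @ \<Gamma>) \<Phi>' (bind_tm (weaken (length L)) X) (bind_tm (weaken (length L)) Y)
    (bind_tm (weaken (length L)) h) (bind_tm (weaken (length L)) k)"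
  using assms(1) deriv_extends[OF _ assms(2)] has_sort_bind[OF _ interp_weaken]
  unfolding inverse_arrows_def by fastforce

lemma cmp_cancel_right:
  assumes inv: "inverse_arrows \<Gamma> \<Phi> X Y h k" and f: "has_sort (sg T) \<Gamma> f (Hom X Z)"
  shows "deriv T \<Gamma> \<Phi> (FEq (Cmp (Cmp f k) h) f)"
proof -
  have kh: "deriv T \<Gamma> \<Phi> (FEq (Cmp k h) (Idn X))" and h: "has_sort (sg T) \<Gamma> h (Hom X Y)"
      and k: "has_sort (sg T) \<Gamma> k (Hom Y X)" using inv by (simp_all add: inverse_arrows_def)
  note hyps = deriv_wf_hyps[OF kh] and f_k_h = has_sort_Cmp[OF h has_sort_Cmp[OF k f]]
  have "deriv T \<Gamma> \<Phi> (FEq (Cmp (Cmp f k) h) (Cmp f (Cmp k h)))" by (rule cmp_assoc[OF hyps f_k_h])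
  also have "deriv T \<Gamma> \<Phi> (FEq (Cmp f (Cmp k h)) (Cmp f (Idn X)))"
    by (rule cmp_cong_right[OF kh has_sort_Cmp[OF has_sort_Cmp[OF h k] f]])
  also have "deriv T \<Gamma> \<Phi> (FEq (Cmp f (Idn X)) f)" by (rule cmp_Idn_right[OF hyps f])
  finally show ?thesis .
qed

lemma cmp_cancel_left:
  assumes inv: "inverse_arrows \<Gamma> \<Phi> X Y h k" and f: "has_sort (sg T) \<Gamma> f (Hom Z X)"
  shows "deriv T \<Gamma> \<Phi> (FEq (Cmp k (Cmp h f)) f)"
proof -
  have kh: "deriv T \<Gamma> \<Phi> (FEq (Cmp k h) (Idn X))" and h: "has_sort (sg T) \<Gamma> h (Hom X Y)"
      and k: "has_sort (sg T) \<Gamma> k (Hom Y X)" using inv by (simp_all add: inverse_arrows_def)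
  note hyps = deriv_wf_hyps[OF kh] and kh_f = has_sort_Cmp[OF f has_sort_Cmp[OF h k]]
  have "deriv T \<Gamma> \<Phi> (FEq (Cmp k (Cmp h f)) (Cmp (Cmp k h) f))" by (rule eq_sym[OF cmp_assoc[OF hyps kh_f]])
  also have "deriv T \<Gamma> \<Phi> (FEq (Cmp (Cmp k h) f) (Cmp (Idn X) f))" by (rule cmp_cong_left[OF kh kh_f])
  also have "deriv T \<Gamma> \<Phi> (FEq (Cmp (Idn X) f) f)" by (rule cmp_Idn_left[OF hyps f])
  finally show ?thesis .
qed

text \<open>The square of \<open>f : X \<rightarrow> Y\<close> and \<open>g : X' \<rightarrow> Y'\<close> with \<open>h : X \<rightarrow> X'\<close> and \<open>l : Y \<rightarrow> Y'\<close> commutes.\<close>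

definition commutes :: "('o, 'a) ctx \<Rightarrow> ('o, 'a) fm set \<Rightarrow> ('o, 'a) tm \<Rightarrow> ('o, 'a) tm
    \<Rightarrow> ('o, 'a) tm \<Rightarrow> ('o, 'a) tm \<Rightarrow> bool" where
  "commutes \<Gamma> \<Phi> h l f g \<longleftrightarrow> deriv T \<Gamma> \<Phi> (FEq (Cmp l f) (Cmp g h))"

lemma commutes_iff_conj:
  assumes inv: "inverse_arrows \<Gamma> \<Phi> X X' h k"
    and f: "has_sort (sg T) \<Gamma> f (Hom X Y)" and g: "has_sort (sg T) \<Gamma> g (Hom X' Y')"
    and l: "has_sort (sg T) \<Gamma> l (Hom Y Y')"
  shows "commutes \<Gamma> \<Phi> h l f g \<longleftrightarrow> deriv T \<Gamma> \<Phi> (FEq g (Cmp (Cmp l f) k))"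
proof
  have h: "has_sort (sg T) \<Gamma> h (Hom X X')" and k: "has_sort (sg T) \<Gamma> k (Hom X' X)"
    using inv by (simp_all add: inverse_arrows_def)
  note lf = has_sort_Cmp[OF f l]
  show "deriv T \<Gamma> \<Phi> (FEq g (Cmp (Cmp l f) k))" if "commutes \<Gamma> \<Phi> h l f g"
  proof -
    have "deriv T \<Gamma> \<Phi> (FEq (Cmp (Cmp l f) k) (Cmp (Cmp g h) k))"
      by (rule cmp_cong_left[OF that[unfolded commutes_def] has_sort_Cmp[OF k lf]])
    also have "deriv T \<Gamma> \<Phi> (FEq (Cmp (Cmp g h) k) g)"
      by (rule cmp_cancel_right[OF inverse_arrows_sym[OF inv] g])
    finally show ?thesis by (rule eq_sym)
  qed
  show "commutes \<Gamma> \<Phi> h l f g" if eq: "deriv T \<Gamma> \<Phi> (FEq g (Cmp (Cmp l f) k))"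
  proof -
    have "deriv T \<Gamma> \<Phi> (FEq (Cmp g h) (Cmp (Cmp (Cmp l f) k) h))"
      by (rule cmp_cong_left[OF eq has_sort_Cmp[OF h g]])
    also have "deriv T \<Gamma> \<Phi> (FEq (Cmp (Cmp (Cmp l f) k) h) (Cmp l f))" by (rule cmp_cancel_right[OF inv lf])
    finally show ?thesis unfolding commutes_def by (rule eq_sym)
  qed
qed

lemma commutes_inverse:
  assumes h: "inverse_arrows \<Gamma> \<Phi> X X' h k" and l: "inverse_arrows \<Gamma> \<Phi> Y Y' l m"
    and f: "has_sort (sg T) \<Gamma> f (Hom X Y)" and g: "has_sort (sg T) \<Gamma> g (Hom X' Y')"
    and comm: "commutes \<Gamma> \<Phi> h l f g"
  shows "commutes \<Gamma> \<Phi> k m g f"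
proof -
  have l_arr: "has_sort (sg T) \<Gamma> l (Hom Y Y')" and m_arr: "has_sort (sg T) \<Gamma> m (Hom Y' Y)"
      and k_arr: "has_sort (sg T) \<Gamma> k (Hom X' X)" using h l by (simp_all add: inverse_arrows_def)
  have hyps: "wf_hyps T \<Gamma> \<Phi>" using comm by (auto simp: commutes_def dest: deriv_wf_hyps)
  note fk = has_sort_Cmp[OF k_arr f] and lf_k = has_sort_Cmp[OF k_arr has_sort_Cmp[OF f l_arr]]
  have "deriv T \<Gamma> \<Phi> (FEq g (Cmp (Cmp l f) k))" using commutes_iff_conj[OF h f g l_arr] comm by simp
  also have "deriv T \<Gamma> \<Phi> (FEq (Cmp (Cmp l f) k) (Cmp l (Cmp f k)))" by (rule cmp_assoc[OF hyps lf_k])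
  finally have "deriv T \<Gamma> \<Phi> (FEq (Cmp m g) (Cmp m (Cmp l (Cmp f k))))"
    by (rule cmp_cong_right) (rule has_sort_Cmp[OF g m_arr])
  also have "deriv T \<Gamma> \<Phi> (FEq (Cmp m (Cmp l (Cmp f k))) (Cmp f k))" by (rule cmp_cancel_left[OF l fk])
  finally show ?thesis unfolding commutes_def .
qed

lemma commutes_Cmp:
  assumes f: "commutes \<Gamma> \<Phi> h l f f'" "has_sort (sg T) \<Gamma> f (Hom X Y)" "has_sort (sg T) \<Gamma> f' (Hom X' Y')"
    and g: "commutes \<Gamma> \<Phi> l m g g'" "has_sort (sg T) \<Gamma> g (Hom Y Z)" "has_sort (sg T) \<Gamma> g' (Hom Y' Z')"
    and hlm: "has_sort (sg T) \<Gamma> h (Hom X X')" "has_sort (sg T) \<Gamma> l (Hom Y Y')"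
        "has_sort (sg T) \<Gamma> m (Hom Z Z')"
  shows "commutes \<Gamma> \<Phi> h m (Cmp g f) (Cmp g' f')"
proof -
  have hyps: "wf_hyps T \<Gamma> \<Phi>" using f(1) by (auto simp: commutes_def dest: deriv_wf_hyps)
  note m_g_f = has_sort_Cmp[OF f(2) has_sort_Cmp[OF g(2) hlm(3)]]
    and g'_l_f = has_sort_Cmp[OF f(2) has_sort_Cmp[OF hlm(2) g(3)]]
    and l_f = has_sort_Cmp[OF f(2) hlm(2)] and g'_f'_h = has_sort_Cmp[OF hlm(1) has_sort_Cmp[OF f(3) g(3)]]
  have "deriv T \<Gamma> \<Phi> (FEq (Cmp m (Cmp g f)) (Cmp (Cmp m g) f))" by (rule eq_sym[OF cmp_assoc[OF hyps m_g_f]])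
  also have "deriv T \<Gamma> \<Phi> (FEq (Cmp (Cmp m g) f) (Cmp (Cmp g' l) f))"
    by (rule cmp_cong_left[OF g(1)[unfolded commutes_def] m_g_f])
  also have "deriv T \<Gamma> \<Phi> (FEq (Cmp (Cmp g' l) f) (Cmp g' (Cmp l f)))" by (rule cmp_assoc[OF hyps g'_l_f])
  also have "deriv T \<Gamma> \<Phi> (FEq (Cmp g' (Cmp l f)) (Cmp g' (Cmp f' h)))"
    by (rule cmp_cong_right[OF f(1)[unfolded commutes_def] has_sort_Cmp[OF l_f g(3)]])
  also have "deriv T \<Gamma> \<Phi> (FEq (Cmp g' (Cmp f' h)) (Cmp (Cmp g' f') h))"
    by (rule eq_sym[OF cmp_assoc[OF hyps g'_f'_h]])
  finally show ?thesis unfolding commutes_def .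
qed

lemma commutes_extends:
  assumes "commutes \<Gamma> \<Phi> h l f g" "extends T L \<Phi>' \<Gamma> \<Phi>"
  shows "commutes (L @ \<Gamma>) \<Phi>' (bind_tm (weaken (length L)) h) (bind_tm (weaken (length L)) l)
    (bind_tm (weaken (length L)) f) (bind_tm (weaken (length L)) g)"
  using deriv_extends[OF assms(1)[unfolded commutes_def] assms(2)] by (simp add: commutes_def)

definition nat_iso :: "('p, 'b) sig \<Rightarrow> ('p, 'b) ctx \<Rightarrow> ('o, 'a) ctx \<Rightarrow> ('o, 'a) fm set \<Rightarrow>
    (('p, 'b) atom \<Rightarrow> ('o, 'a) tm) \<Rightarrow> (('p, 'b) atom \<Rightarrow> ('o, 'a) tm) \<Rightarrow>
    (('p, 'b) atom \<Rightarrow> ('o, 'a) tm) \<Rightarrow> (('p, 'b) atom \<Rightarrow> ('o, 'a) tm) \<Rightarrow> bool" where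
  "nat_iso \<Sigma> \<Delta> \<Gamma> \<Phi> I J h k \<longleftrightarrow> wf_sig \<Sigma> \<and> wf_ctx \<Sigma> \<Delta> \<and> wf_hyps T \<Gamma> \<Phi> \<and>
     interp \<Sigma> \<Delta> (sg T) \<Gamma> I \<and> interp \<Sigma> \<Delta> (sg T) \<Gamma> J \<and>
     (\<forall>x. has_sort \<Sigma> \<Delta> (atom_tm x) Ob \<longrightarrow> inverse_arrows \<Gamma> \<Phi> (I x) (J x) (h x) (k x)) \<and>
     (\<forall>x y z. has_sort \<Sigma> \<Delta> (atom_tm x) (Hom (atom_tm y) (atom_tm z)) \<longrightarrow> commutes \<Gamma> \<Phi> (h y) (h z) (I x) (J x))"

lemma nat_isoD:
  assumes "nat_iso \<Sigma> \<Delta> \<Gamma> \<Phi> I J h k"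
  shows "wf_sig \<Sigma>" "wf_ctx \<Sigma> \<Delta>" "wf_hyps T \<Gamma> \<Phi>" "interp \<Sigma> \<Delta> (sg T) \<Gamma> I" "interp \<Sigma> \<Delta> (sg T) \<Gamma> J"
    "\<And>x. has_sort \<Sigma> \<Delta> (atom_tm x) Ob \<Longrightarrow> inverse_arrows \<Gamma> \<Phi> (I x) (J x) (h x) (k x)"
    "\<And>x. has_sort \<Sigma> \<Delta> (atom_tm x) Ob \<Longrightarrow> has_sort (sg T) \<Gamma> (h x) (Hom (I x) (J x))"
    "\<And>x y z. has_sort \<Sigma> \<Delta> (atom_tm x) (Hom (atom_tm y) (atom_tm z)) \<Longrightarrow> commutes \<Gamma> \<Phi> (h y) (h z) (I x) (J x)"
  using assms unfolding nat_iso_def inverse_arrows_def by blast+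

lemma interp_Hom:
  assumes "interp \<Sigma> \<Delta> (sg T) \<Gamma> I" "has_sort \<Sigma> \<Delta> t (Hom (atom_tm y) (atom_tm z))"
  shows "has_sort (sg T) \<Gamma> (bind_tm I t) (Hom (I y) (I z))"
  using has_sort_bind[OF assms(2,1)] by simp

lemma nat_iso_sym:
  assumes iso: "nat_iso \<Sigma> \<Delta> \<Gamma> \<Phi> I J h k"
  shows "nat_iso \<Sigma> \<Delta> \<Gamma> \<Phi> J I k h"
  unfolding nat_iso_def
proof (intro conjI allI impI nat_isoD(1-5)[OF iso])
  note iso = nat_isoD[OF iso]
  show "inverse_arrows \<Gamma> \<Phi> (J x) (I x) (k x) (h x)" if "has_sort \<Sigma> \<Delta> (atom_tm x) Ob" for x
    by (rule inverse_arrows_sym[OF iso(6)[OF that]])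
  fix x y z assume x: "has_sort \<Sigma> \<Delta> (atom_tm x) (Hom (atom_tm y) (atom_tm z))"
  note ends = has_sort_dom_cod[OF x iso(1,2)]
  have "has_sort (sg T) \<Gamma> (I x) (Hom (I y) (I z))" "has_sort (sg T) \<Gamma> (J x) (Hom (J y) (J z))"
    using interp_Hom[OF iso(4) x] interp_Hom[OF iso(5) x] by simp_all
  then show "commutes \<Gamma> \<Phi> (k y) (k z) (J x) (I x)"
    using iso(6)[OF ends(1)] iso(6)[OF ends(2)] iso(8)[OF x] by (blast intro: commutes_inverse)
qed

lemma nat_iso_extends:
  assumes iso: "nat_iso \<Sigma> \<Delta> \<Gamma> \<Phi> I J h k" and ext: "extends T L \<Phi>' \<Gamma> \<Phi>"
  defines "W \<equiv> bind_tm (weaken (length L))"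
  shows "nat_iso \<Sigma> \<Delta> (L @ \<Gamma>) \<Phi>' (\<lambda>x. W (I x)) (\<lambda>x. W (J x)) (\<lambda>x. W (h x)) (\<lambda>x. W (k x))"
  unfolding nat_iso_def W_def using nat_isoD[OF iso]
  by (intro conjI allI impI) (blast intro: interp_comp[OF _ interp_weaken] extends_wf_hyps[OF ext]
      inverse_arrows_extends[OF _ ext] commutes_extends[OF _ ext])+

lemma nat_iso_insert:
  assumes "nat_iso \<Sigma> \<Delta> \<Gamma> \<Phi> I J h k" "wf_fm (sg T) \<Gamma> \<phi>"
  shows "nat_iso \<Sigma> \<Delta> \<Gamma> (insert \<phi> \<Phi>) I J h k"
  using nat_iso_extends[OF assms(1) extends_insert[OF nat_isoD(3)[OF assms(1)] assms(2)]] by simp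

lemma nat_iso_natural:
  assumes iso: "nat_iso \<Sigma> \<Delta> \<Gamma> \<Phi> I J h k"
  shows "has_sort \<Sigma> \<Delta> t (Hom (atom_tm y) (atom_tm z)) \<Longrightarrow> commutes \<Gamma> \<Phi> (h y) (h z) (bind_tm I t) (bind_tm J t)"
proof (induction t arbitrary: y z)
  case (Var i) then show ?case using nat_isoD(8)[OF iso, of "AVar i"] by simp
next
  case (OCon c) then show ?case by (simp add: has_sort_iffs)
next
  case (ACon a) then show ?case using nat_isoD(8)[OF iso, of "AArr a"] by simp
next
  case (Idn t)
  then have y: "has_sort \<Sigma> \<Delta> (atom_tm y) Ob" "t = atom_tm y" "z = y" by (auto simp: has_sort_iffs)
  note hy = nat_isoD(7)[OF iso y(1)] and hyps = nat_isoD(3)[OF iso]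
  show ?case using eq_trans[OF cmp_Idn_right[OF hyps hy] eq_sym[OF cmp_Idn_left[OF hyps hy]]] y(2,3)
    by (simp add: commutes_def)
next
  case (Cmp g f)
  note sig_ctx = nat_isoD(1,2)[OF iso] and I = nat_isoD(4)[OF iso] and J = nat_isoD(5)[OF iso]
    and arrow = nat_isoD(7)[OF iso]
  from Cmp.prems obtain Y where f: "has_sort \<Sigma> \<Delta> f (Hom (atom_tm y) Y)"
    and g: "has_sort \<Sigma> \<Delta> g (Hom Y (atom_tm z))"
    by (auto simp: has_sort_Cmp_iff)
  obtain u where u: "Y = atom_tm u" using has_sort_Ob_atom has_sort_dom_cod(2)[OF f sig_ctx] by blast
  note f = f[unfolded u] and g = g[unfolded u]
  show ?case
    using commutes_Cmp[OF Cmp.IH(2)[OF f] interp_Hom[OF I f] interp_Hom[OF J f]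
        Cmp.IH(1)[OF g] interp_Hom[OF I g] interp_Hom[OF J g]]
      arrow[OF has_sort_dom_cod(1)[OF f sig_ctx]] arrow[OF has_sort_dom_cod(1)[OF g sig_ctx]]
      arrow[OF has_sort_dom_cod(2)[OF g sig_ctx]] by simp
qed

lemma nat_iso_eq:
  assumes iso: "nat_iso \<Sigma> \<Delta> \<Gamma> \<Phi> I J h k" and t: "has_sort \<Sigma> \<Delta> t (Hom X Y)" and u: "has_sort \<Sigma> \<Delta> u (Hom X Y)"
    and eq: "deriv T \<Gamma> \<Phi> (FEq (bind_tm I t) (bind_tm I u))"
  shows "deriv T \<Gamma> \<Phi> (FEq (bind_tm J t) (bind_tm J u))"
proof -
  note sig_ctx = nat_isoD(1,2)[OF iso] and I = nat_isoD(4)[OF iso] and J = nat_isoD(5)[OF iso]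
  obtain x y where X: "X = atom_tm x" and Y: "Y = atom_tm y"
    using has_sort_Ob_atom has_sort_dom_cod[OF t sig_ctx] by blast
  note t = t[unfolded X Y] and u = u[unfolded X Y]
  note inv = nat_isoD(6)[OF iso has_sort_dom_cod(1)[OF t sig_ctx]]
    and hy = nat_isoD(7)[OF iso has_sort_dom_cod(2)[OF t sig_ctx]]
  have hy_t: "has_sort (sg T) \<Gamma> (Cmp (h y) (bind_tm I t)) (Hom (I x) (J y))"
    by (rule has_sort_Cmp[OF interp_Hom[OF I t] hy])
  have kx: "has_sort (sg T) \<Gamma> (k x) (Hom (J x) (I x))" using inv by (simp add: inverse_arrows_def)
  have "deriv T \<Gamma> \<Phi> (FEq (bind_tm J t) (Cmp (Cmp (h y) (bind_tm I t)) (k x)))"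
    using commutes_iff_conj[OF inv interp_Hom[OF I t] interp_Hom[OF J t] hy] nat_iso_natural[OF iso t] by simp
  also have "deriv T \<Gamma> \<Phi> (FEq (Cmp (Cmp (h y) (bind_tm I t)) (k x)) (Cmp (Cmp (h y) (bind_tm I u)) (k x)))"
    by (rule cmp_cong_left[OF cmp_cong_right[OF eq hy_t] has_sort_Cmp[OF kx hy_t]])
  also have "deriv T \<Gamma> \<Phi> (FEq (Cmp (Cmp (h y) (bind_tm I u)) (k x)) (bind_tm J u))"
    using commutes_iff_conj[OF inv interp_Hom[OF I u] interp_Hom[OF J u] hy] nat_iso_natural[OF iso u] eq_sym
    by simp
  finally show ?thesis .
qed

primrec shift_atom :: "('p, 'b) atom \<Rightarrow> ('p, 'b) atom" where
  "shift_atom (AVar i) = AVar (Suc i)"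
| "shift_atom (AObj c) = AObj c"
| "shift_atom (AArr a) = AArr a"

lemma scons_shift_atom [simp]: "scons t I (shift_atom x) = I x"
  by (cases x) simp_all

lemma has_sort_atom_ConsE:
  assumes "has_sort \<Sigma> (s # \<Delta>) (atom_tm x) u"
  obtains (head) "x = AVar 0" "u = bind_srt weaken1 s"
  | (tail) x' u' where "x = shift_atom x'" "u = bind_srt weaken1 u'" "has_sort \<Sigma> \<Delta> (atom_tm x') u'"
proof (cases x)
  case (AVar i)
  show ?thesis
  proof (cases i)
    case 0
    then show ?thesis using AVar assms head by simp
  next
    case (Suc j)
    then show ?thesis using AVar assms tail[of "AVar j"] by (auto simp: has_sort_Var_Suc)
  qed
next
  case (AObj c)
  then show ?thesis using assms tail[of "AObj c" Ob] by (simp add: has_sort_iffs)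
next
  case (AArr a)
  then show ?thesis using assms tail[of "AArr a" "Hom (OCon (cdom \<Sigma> a)) (OCon (ccod \<Sigma> a))"]
    by (simp add: has_sort_iffs)
qed

lemma atom_tm_eq_weaken1E:
  assumes "atom_tm x = bind_tm weaken1 t"
  obtains y where "t = atom_tm y" "x = shift_atom y"
proof (cases x)
  case (AVar i)
  then show thesis using assms that[of "AVar (i - 1)"] by (cases t) auto
next
  case (AObj c)
  then show thesis using assms that[of "AObj c"] by (cases t) auto
next
  case (AArr a)
  then show thesis using assms that[of "AArr a"] by (cases t) auto
qed

lemma Hom_atoms_eq_weaken1E:
  assumes "Hom (atom_tm y) (atom_tm z) = bind_srt weaken1 s"
  obtains y' z' where "s = Hom (atom_tm y') (atom_tm z')" "y = shift_atom y'" "z = shift_atom z'"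
  using assms by (auto elim!: bind_srt_eq_HomE atom_tm_eq_weaken1E)

lemma nat_iso_scons:
  assumes iso: "nat_iso \<Sigma> \<Delta> \<Gamma> \<Phi> I J h k" and s: "wf_srt \<Sigma> \<Delta> s"
    and f: "has_sort (sg T) \<Gamma> f (bind_srt I s)" and g: "has_sort (sg T) \<Gamma> g (bind_srt J s)"
    and object: "s = Ob \<Longrightarrow> inverse_arrows \<Gamma> \<Phi> f g hf kf"
    and arrow: "\<And>y z. s = Hom (atom_tm y) (atom_tm z) \<Longrightarrow> commutes \<Gamma> \<Phi> (h y) (h z) f g"
  shows "nat_iso \<Sigma> (s # \<Delta>) \<Gamma> \<Phi> (scons f I) (scons g J) (scons hf h) (scons kf k)"
  unfolding nat_iso_def
proof (intro conjI allI impI)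
  note iso = nat_isoD[OF iso]
  show "wf_sig \<Sigma>" "wf_ctx \<Sigma> (s # \<Delta>)" "wf_hyps T \<Gamma> \<Phi>" using iso s by simp_all
  show "interp \<Sigma> (s # \<Delta>) (sg T) \<Gamma> (scons f I)" "interp \<Sigma> (s # \<Delta>) (sg T) \<Gamma> (scons g J)"
    using iso f g by (blast intro: interp_scons)+
  show "inverse_arrows \<Gamma> \<Phi> (scons f I x) (scons g J x) (scons hf h x) (scons kf k x)"
    if "has_sort \<Sigma> (s # \<Delta>) (atom_tm x) Ob" for x
    using that by (cases rule: has_sort_atom_ConsE) (use object iso(6) in auto)
  show "commutes \<Gamma> \<Phi> (scons hf h y) (scons hf h z) (scons f I x) (scons g J x)"
    if "has_sort \<Sigma> (s # \<Delta>) (atom_tm x) (Hom (atom_tm y) (atom_tm z))" for x y z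
    using that
  proof (cases rule: has_sort_atom_ConsE)
    case head
    then show ?thesis using arrow by (auto elim!: Hom_atoms_eq_weaken1E)
  next
    case (tail x' u')
    then show ?thesis using iso(8) by (auto elim!: Hom_atoms_eq_weaken1E)
  qed
qed

lemma nat_iso_transport:
  assumes iso: "nat_iso \<Sigma> \<Delta> \<Gamma> \<Phi> I J h k" and s: "wf_srt \<Sigma> \<Delta> s" and f: "has_sort (sg T) \<Gamma> f (bind_srt I s)"
  obtains g hf kf where "has_sort (sg T) \<Gamma> g (bind_srt J s)"
    "nat_iso \<Sigma> (s # \<Delta>) \<Gamma> \<Phi> (scons f I) (scons g J) (scons hf h) (scons kf k)"
proof (cases s)
  case Ob
  then have "inverse_arrows \<Gamma> \<Phi> f f (Idn f) (Idn f)"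
    using inverse_arrows_Idn[OF nat_isoD(3)[OF iso]] f by simp
  then have "nat_iso \<Sigma> (s # \<Delta>) \<Gamma> \<Phi> (scons f I) (scons f J) (scons (Idn f) h) (scons (Idn f) k)"
    using f Ob by (intro nat_iso_scons[OF iso s]) simp_all
  then show thesis using that f Ob by simp
next
  case (Hom X Y)
  then obtain x y where XY: "s = Hom (atom_tm x) (atom_tm y)" using s has_sort_Ob_atom by fastforce
  then have inv: "inverse_arrows \<Gamma> \<Phi> (I x) (J x) (h x) (k x)"
    and hy: "has_sort (sg T) \<Gamma> (h y) (Hom (I y) (J y))"
    using s nat_isoD(6,7)[OF iso] by simp_all
  have kx: "has_sort (sg T) \<Gamma> (k x) (Hom (J x) (I x))" using inv by (simp add: inverse_arrows_def)
  have f': "has_sort (sg T) \<Gamma> f (Hom (I x) (I y))" using f XY by simp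
  let ?g = "Cmp (Cmp (h y) f) (k x)"
  have g: "has_sort (sg T) \<Gamma> ?g (Hom (J x) (J y))" by (rule has_sort_Cmp[OF kx has_sort_Cmp[OF f' hy]])
  then have "commutes \<Gamma> \<Phi> (h x) (h y) f ?g"
    using commutes_iff_conj[OF inv f' g hy] eq_refl[OF nat_isoD(3)[OF iso] g] by simp
  then have "nat_iso \<Sigma> (s # \<Delta>) \<Gamma> \<Phi> (scons f I) (scons ?g J) (scons undefined h) (scons undefined k)"
    using XY f g by (intro nat_iso_scons[OF iso s]) auto
  then show thesis using that g XY by simp
qed

definition iso_invariant :: "('p, 'b) sig \<Rightarrow> ('p, 'b) ctx \<Rightarrow> ('p, 'b) fm \<Rightarrow> bool" where
  "iso_invariant \<Sigma> \<Delta> P \<longleftrightarrow> (\<forall>\<Gamma> \<Phi> I J h k. nat_iso \<Sigma> \<Delta> \<Gamma> \<Phi> I J h k \<longrightarrow>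
     deriv T \<Gamma> \<Phi> (bind_fm I P) \<longrightarrow> deriv T \<Gamma> \<Phi> (bind_fm J P))"

lemma iso_invariantI:
  "(\<And>\<Gamma> \<Phi> I J h k. nat_iso \<Sigma> \<Delta> \<Gamma> \<Phi> I J h k \<Longrightarrow> deriv T \<Gamma> \<Phi> (bind_fm I P) \<Longrightarrow> deriv T \<Gamma> \<Phi> (bind_fm J P))
    \<Longrightarrow> iso_invariant \<Sigma> \<Delta> P"
  by (simp add: iso_invariant_def)

lemma iso_invariantD:
  "iso_invariant \<Sigma> \<Delta> P \<Longrightarrow> nat_iso \<Sigma> \<Delta> \<Gamma> \<Phi> I J h k \<Longrightarrow> deriv T \<Gamma> \<Phi> (bind_fm I P) \<Longrightarrow> deriv T \<Gamma> \<Phi> (bind_fm J P)"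
  unfolding iso_invariant_def by blast

lemma iso_invariant_Or:
  assumes wf: "wf_fm \<Sigma> \<Delta> (FOr P Q)" and P: "iso_invariant \<Sigma> \<Delta> P" and Q: "iso_invariant \<Sigma> \<Delta> Q"
  shows "iso_invariant \<Sigma> \<Delta> (FOr P Q)"
proof (rule iso_invariantI)
  fix \<Gamma> \<Phi> I J h k assume iso: "nat_iso \<Sigma> \<Delta> \<Gamma> \<Phi> I J h k" and disj: "deriv T \<Gamma> \<Phi> (bind_fm I (FOr P Q))"
  have wf: "wf_fm (sg T) \<Gamma> (bind_fm I P)" "wf_fm (sg T) \<Gamma> (bind_fm I Q)"
      "wf_fm (sg T) \<Gamma> (bind_fm J P)" "wf_fm (sg T) \<Gamma> (bind_fm J Q)"
    using wf nat_isoD(4,5)[OF iso] by (auto intro: wf_fm_bind)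
  have hyp: "deriv T \<Gamma> (insert \<phi> \<Phi>) \<phi>" if "wf_fm (sg T) \<Gamma> \<phi>" for \<phi>
    using that nat_isoD(3)[OF iso] by (auto simp: wf_hyps_insert intro: deriv.Hyp)
  have "deriv T \<Gamma> (insert (bind_fm I P) \<Phi>) (bind_fm J (FOr P Q))"
    using iso_invariantD[OF P nat_iso_insert[OF iso wf(1)] hyp[OF wf(1)]] wf(4) by (simp add: deriv.OrI1)
  moreover have "deriv T \<Gamma> (insert (bind_fm I Q) \<Phi>) (bind_fm J (FOr P Q))"
    using iso_invariantD[OF Q nat_iso_insert[OF iso wf(2)] hyp[OF wf(2)]] wf(3) by (simp add: deriv.OrI2)
  ultimately show "deriv T \<Gamma> \<Phi> (bind_fm J (FOr P Q))" using disj by (auto intro: deriv.OrE)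
qed

lemma iso_invariant_Imp:
  assumes wf: "wf_fm \<Sigma> \<Delta> (FImp P Q)" and P: "iso_invariant \<Sigma> \<Delta> P" and Q: "iso_invariant \<Sigma> \<Delta> Q"
  shows "iso_invariant \<Sigma> \<Delta> (FImp P Q)"
proof (rule iso_invariantI)
  fix \<Gamma> \<Phi> I J h k assume iso: "nat_iso \<Sigma> \<Delta> \<Gamma> \<Phi> I J h k" and imp: "deriv T \<Gamma> \<Phi> (bind_fm I (FImp P Q))"
  have wf: "wf_fm (sg T) \<Gamma> (bind_fm J P)" using wf nat_isoD(5)[OF iso] by (auto intro: wf_fm_bind)
  note iso' = nat_iso_insert[OF iso wf]
  have "deriv T \<Gamma> (insert (bind_fm J P) \<Phi>) (bind_fm J P)" using nat_isoD(3)[OF iso'] by (simp add: deriv.Hyp)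
  then have "deriv T \<Gamma> (insert (bind_fm J P) \<Phi>) (bind_fm I P)"
    by (rule iso_invariantD[OF P nat_iso_sym[OF iso']])
  then have "deriv T \<Gamma> (insert (bind_fm J P) \<Phi>) (bind_fm I Q)"
    using deriv.ImpE[OF deriv_insert[OF imp[simplified] wf]] by simp
  then show "deriv T \<Gamma> \<Phi> (bind_fm J (FImp P Q))" using iso_invariantD[OF Q iso'] by (simp add: deriv.ImpI)
qed

lemma iso_invariant_All:
  assumes wf: "wf_fm \<Sigma> \<Delta> (FAll s P)" and P: "iso_invariant \<Sigma> (s # \<Delta>) P"
  shows "iso_invariant \<Sigma> \<Delta> (FAll s P)"
proof (rule iso_invariantI)
  fix \<Gamma> \<Phi> I J h k assume iso: "nat_iso \<Sigma> \<Delta> \<Gamma> \<Phi> I J h k" and all: "deriv T \<Gamma> \<Phi> (bind_fm I (FAll s P))"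
  have s: "wf_srt \<Sigma> \<Delta> s" "wf_srt (sg T) \<Gamma> (bind_srt J s)"
    using wf nat_isoD(5)[OF iso] by (auto intro: wf_srt_bind)
  let ?\<Gamma> = "bind_srt J s # \<Gamma>" and ?\<Phi> = "bind_fm weaken1 ` \<Phi>"
  let ?I = "\<lambda>x. bind_tm weaken1 (I x)" and ?J = "\<lambda>x. bind_tm weaken1 (J x)"
  have weakened: "nat_iso \<Sigma> \<Delta> ?\<Gamma> ?\<Phi> ?J ?I (\<lambda>x. bind_tm weaken1 (k x)) (\<lambda>x. bind_tm weaken1 (h x))"
    using nat_iso_extends[OF nat_iso_sym[OF iso] extends_weaken1[OF nat_isoD(3)[OF iso] s(2)]] by simp
  obtain g where g: "has_sort (sg T) ?\<Gamma> g (bind_srt ?I s)"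
      and iso': "\<exists>h k. nat_iso \<Sigma> (s # \<Delta>) ?\<Gamma> ?\<Phi> (scons (Var 0) ?J) (scons g ?I) h k"
    by (rule nat_iso_transport[OF weakened s(1), of "Var 0"]) auto
  have "deriv T ?\<Gamma> ?\<Phi> (bind_fm (scons g ?I) P)"
    using deriv_AllE[OF deriv_weaken1[OF all s(2), simplified] g] by (simp add: lift_def)
  then have "deriv T ?\<Gamma> ?\<Phi> (bind_fm (lift J) P)" unfolding lift_def
    using iso' nat_iso_sym iso_invariantD[OF P] by blast
  then show "deriv T \<Gamma> \<Phi> (bind_fm J (FAll s P))" by (simp add: deriv_AllI)
qed

lemma iso_invariant_Ex:
  assumes wf: "wf_fm \<Sigma> \<Delta> (FEx s P)" and P: "iso_invariant \<Sigma> (s # \<Delta>) P"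
  shows "iso_invariant \<Sigma> \<Delta> (FEx s P)"
proof (rule iso_invariantI)
  fix \<Gamma> \<Phi> I J h k assume iso: "nat_iso \<Sigma> \<Delta> \<Gamma> \<Phi> I J h k" and "deriv T \<Gamma> \<Phi> (bind_fm I (FEx s P))"
  then have ex: "deriv T \<Gamma> \<Phi> (FEx (bind_srt I s) (bind_fm (lift I) P))" by simp
  have s: "wf_srt \<Sigma> \<Delta> s" using wf by simp
  let ?\<Gamma> = "bind_srt I s # \<Gamma>" and ?\<Phi> = "insert (bind_fm (lift I) P) (bind_fm weaken1 ` \<Phi>)"
  let ?I = "\<lambda>x. bind_tm weaken1 (I x)" and ?J = "\<lambda>x. bind_tm weaken1 (J x)"
  have wf_J: "wf_fm (sg T) \<Gamma> (bind_fm J (FEx s P))" by (rule wf_fm_bind[OF wf nat_isoD(5)[OF iso]])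
  have ext: "extends T [bind_srt I s] ?\<Phi> \<Gamma> \<Phi>"
    by (rule extends_weaken1_insert[OF nat_isoD(3)[OF iso] deriv_wf_fm[OF ex]])
  have weakened: "nat_iso \<Sigma> \<Delta> ?\<Gamma> ?\<Phi> ?I ?J (\<lambda>x. bind_tm weaken1 (h x)) (\<lambda>x. bind_tm weaken1 (k x))"
    using nat_iso_extends[OF iso ext] by simp
  obtain g where g: "has_sort (sg T) ?\<Gamma> g (bind_srt ?J s)"
      and iso': "\<exists>h k. nat_iso \<Sigma> (s # \<Delta>) ?\<Gamma> ?\<Phi> (scons (Var 0) ?I) (scons g ?J) h k"
    by (rule nat_iso_transport[OF weakened s, of "Var 0"]) auto
  have "deriv T ?\<Gamma> ?\<Phi> (bind_fm (scons (Var 0) ?I) P)"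
    using extends_wf_hyps[OF ext] by (simp add: deriv.Hyp lift_def)
  then have "deriv T ?\<Gamma> ?\<Phi> (bind_fm (scons g ?J) P)" using iso' iso_invariantD[OF P] by blast
  then have "deriv T ?\<Gamma> ?\<Phi> (bind_fm weaken1 (bind_fm J (FEx s P)))"
    using deriv_ExI[OF _ g] wf_fm_bind[OF wf_J interp_weaken1] by (simp add: lift_def)
  then show "deriv T \<Gamma> \<Phi> (bind_fm J (FEx s P))" by (rule deriv_ExE[OF ex wf_J])
qed

theorem wf_fm_iso_invariant: "wf_fm \<Sigma> \<Delta> P \<Longrightarrow> iso_invariant \<Sigma> \<Delta> P"
proof (induction P arbitrary: \<Delta>)
  case (FEq t u)
  then show ?case by (auto intro!: iso_invariantI intro: nat_iso_eq)
next
  case (FAnd P Q)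
  then have "iso_invariant \<Sigma> \<Delta> P" "iso_invariant \<Sigma> \<Delta> Q" by simp_all
  then show ?case unfolding iso_invariant_def bind_fm.simps deriv_And_iff by blast
next
  case (FOr P Q)
  then show ?case by (intro iso_invariant_Or) simp_all
next
  case (FImp P Q)
  then show ?case by (intro iso_invariant_Imp) simp_all
next
  case (FAll s P)
  then show ?case by (intro iso_invariant_All) simp_all
next
  case (FEx s P)
  then show ?case by (intro iso_invariant_Ex) simp_all
qed (simp_all add: iso_invariant_def)

lemma deriv_bind_eq_arrows:
  assumes sig_ctx: "wf_sig \<Sigma>" "wf_ctx \<Sigma> \<Delta>" and P: "wf_fm \<Sigma> \<Delta> P" and hyps: "wf_hyps T \<Gamma> \<Phi>"
    and I: "interp \<Sigma> \<Delta> (sg T) \<Gamma> I" and J: "interp \<Sigma> \<Delta> (sg T) \<Gamma> J"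
    and objects: "\<And>x. has_sort \<Sigma> \<Delta> (atom_tm x) Ob \<Longrightarrow> J x = I x"
    and arrows: "\<And>x Y Z. has_sort \<Sigma> \<Delta> (atom_tm x) (Hom Y Z) \<Longrightarrow> deriv T \<Gamma> \<Phi> (FEq (I x) (J x))"
    and IP: "deriv T \<Gamma> \<Phi> (bind_fm I P)"
  shows "deriv T \<Gamma> \<Phi> (bind_fm J P)"
proof (rule iso_invariantD[OF wf_fm_iso_invariant[OF P] _ IP])
  show "nat_iso \<Sigma> \<Delta> \<Gamma> \<Phi> I J (\<lambda>x. Idn (I x)) (\<lambda>x. Idn (I x))"
    unfolding nat_iso_def
  proof (intro conjI allI impI sig_ctx hyps I J)
    show "inverse_arrows \<Gamma> \<Phi> (I x) (J x) (Idn (I x)) (Idn (I x))" if x: "has_sort \<Sigma> \<Delta> (atom_tm x) Ob" for x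
      using inverse_arrows_Idn[OF hyps] I x unfolding objects[OF x] interp_def by fastforce
    fix x y z assume x: "has_sort \<Sigma> \<Delta> (atom_tm x) (Hom (atom_tm y) (atom_tm z))"
    have "has_sort (sg T) \<Gamma> (I x) (Hom (I y) (I z))" "has_sort (sg T) \<Gamma> (J x) (Hom (I y) (I z))"
      using interp_Hom[OF I x] interp_Hom[OF J x] objects has_sort_dom_cod[OF x sig_ctx] by simp_all
    then show "commutes \<Gamma> \<Phi> (Idn (I y)) (Idn (I z)) (I x) (J x)"
      unfolding commutes_def
      using eq_trans[OF cmp_Idn_left[OF hyps] eq_trans[OF arrows[OF x] eq_sym[OF cmp_Idn_right[OF hyps]]]]
      by blast
  qed
qed

end

section \<open>Isomorphisms between interpretations of a context\<close>

lemma obj_vars_Cons: "obj_vars (s # \<Delta>) = (if s = Ob then [0] else []) @ map Suc (obj_vars \<Delta>)"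
proof -
  have "[0..<length (s # \<Delta>)] = 0 # map Suc [0..<length \<Delta>]"
    by (simp add: upt_conv_Cons map_Suc_upt del: upt_Suc)
  then show ?thesis by (simp add: obj_vars_def filter_map comp_def del: upt_Suc)
qed

lemma obj_rank_simps [simp]:
  "obj_rank \<Delta> 0 = 0" "obj_rank (s # \<Delta>) (Suc i) = (if s = Ob then Suc (obj_rank \<Delta> i) else obj_rank \<Delta> i)"
  by (simp_all add: obj_rank_def)

lemma obj_rank_nth:
  "i < length \<Delta> \<Longrightarrow> \<Delta> ! i = Ob \<Longrightarrow> obj_rank \<Delta> i < length (obj_vars \<Delta>) \<and> obj_vars \<Delta> ! obj_rank \<Delta> i = i"
proof (induction \<Delta> arbitrary: i)
  case (Cons s \<Delta>) then show ?case by (cases i) (auto simp: obj_vars_Cons)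
qed simp

lemma set_obj_vars: "set (obj_vars \<Delta>) = {i. i < length \<Delta> \<and> \<Delta> ! i = Ob}"
  by (auto simp: obj_vars_def)

lemma obj_vars_nth: "k < length (obj_vars \<Delta>) \<Longrightarrow> obj_vars \<Delta> ! k < length \<Delta> \<and> \<Delta> ! (obj_vars \<Delta> ! k) = Ob"
  using nth_mem[of k "obj_vars \<Delta>"] by (simp add: set_obj_vars)

abbreviation lifts :: "nat \<Rightarrow> (('o, 'a) atom \<Rightarrow> ('p, 'b) tm) \<Rightarrow> ('o, 'a) atom \<Rightarrow> ('p, 'b) tm" where
  "lifts m I \<equiv> (lift ^^ m) I"

primrec bind_ctx :: "(('o, 'a) atom \<Rightarrow> ('p, 'b) tm) \<Rightarrow> ('o, 'a) ctx \<Rightarrow> ('p, 'b) ctx" where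
  "bind_ctx I [] = []"
| "bind_ctx I (s # \<Delta>) = bind_srt (lifts (length \<Delta>) I) s # bind_ctx I \<Delta>"

lemma length_bind_ctx [simp]: "length (bind_ctx I \<Delta>) = length \<Delta>"
  by (induction \<Delta>) auto

lemma bind_ctx_nth: "k < length \<Delta> \<Longrightarrow> bind_ctx I \<Delta> ! k = bind_srt (lifts (length \<Delta> - Suc k) I) (\<Delta> ! k)"
proof (induction \<Delta> arbitrary: k)
  case (Cons s \<Delta>) then show ?case by (cases k) auto
qed simp

lemma bind_ctx_append: "bind_ctx I (\<Delta> @ \<Delta>') = bind_ctx (lifts (length \<Delta>') I) \<Delta> @ bind_ctx I \<Delta>'"
  by (induction \<Delta>) (auto simp: funpow_add)

lemma bind_fm_exs: "bind_fm I (exs \<Delta> P) = exs (bind_ctx I \<Delta>) (bind_fm (lifts (length \<Delta>) I) P)"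
  by (induction \<Delta> arbitrary: P) auto

lemma bind_fm_alls: "bind_fm I (alls \<Delta> P) = alls (bind_ctx I \<Delta>) (bind_fm (lifts (length \<Delta>) I) P)"
  by (induction \<Delta> arbitrary: P) auto

lemma lifts_AVar: "lifts m I (AVar j) = (if j < m then Var j else bind_tm (weaken m) (I (AVar (j - m))))"
proof (induction m arbitrary: j)
  case (Suc m) then show ?case by (cases j) (auto simp: lift_def)
qed simp

lemma lifts_weaken [simp]: "bind_tm (lifts m I) (weaken m x) = bind_tm (weaken m) (I x)"
proof -
  have "lifts m I (AObj c) = bind_tm (weaken m) (I (AObj c))"
    "lifts m I (AArr a) = bind_tm (weaken m) (I (AArr a))" for c a
    by (induction m) (auto simp: lift_def)
  then show ?thesis by (cases x) (auto simp: lifts_AVar)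
qed

definition iso_ctx_between :: "('o, 'a) ctx \<Rightarrow> (nat \<Rightarrow> ('o, 'a) tm) \<Rightarrow> (nat \<Rightarrow> ('o, 'a) tm) \<Rightarrow> ('o, 'a) ctx" where
  "iso_ctx_between \<Delta> v w = (let m = length (obj_vars \<Delta>) in
     map (\<lambda>k. let i = obj_vars \<Delta> ! k; W = bind_tm (weaken (m - Suc k)) in Hom (W (v i)) (W (w i))) [0..<m])"

lemma length_iso_ctx_between [simp]: "length (iso_ctx_between \<Delta> v w) = length (obj_vars \<Delta>)"
  by (simp add: iso_ctx_between_def Let_def)

lemma iso_ctx_between_nth: "k < length (obj_vars \<Delta>) \<Longrightarrow> iso_ctx_between \<Delta> v w ! k =
   Hom (bind_tm (weaken (length (obj_vars \<Delta>) - Suc k)) (v (obj_vars \<Delta> ! k)))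
     (bind_tm (weaken (length (obj_vars \<Delta>) - Suc k)) (w (obj_vars \<Delta> ! k)))"
  by (simp add: iso_ctx_between_def Let_def)

lemma iso_ctx_between_cong:
  assumes "\<And>i. i < length \<Delta> \<Longrightarrow> v i = v' i" "\<And>i. i < length \<Delta> \<Longrightarrow> w i = w' i"
  shows "iso_ctx_between \<Delta> v w = iso_ctx_between \<Delta> v' w'"
  by (rule nth_equalityI) (auto simp: iso_ctx_between_nth assms obj_vars_nth)

lemma iso_ctx_eq_between: "iso_ctx \<Delta> = iso_ctx_between \<Delta> (\<lambda>i. Var (length \<Delta> + i)) Var"
  by (simp add: iso_ctx_between_def iso_ctx_def Let_def add_ac)

lemma bind_ctx_iso_ctx_between:
  "bind_ctx I (iso_ctx_between \<Delta> v w) = iso_ctx_between \<Delta> (\<lambda>i. bind_tm I (v i)) (\<lambda>i. bind_tm I (w i))"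
  by (rule nth_equalityI) (auto simp: bind_ctx_nth iso_ctx_between_nth)

lemma map_weaken_iso_ctx_between:
  "map (bind_srt (weaken k)) (iso_ctx_between \<Delta> v w) =
   iso_ctx_between \<Delta> (\<lambda>i. bind_tm (weaken k) (v i)) (\<lambda>i. bind_tm (weaken k) (w i))"
  by (rule nth_equalityI) (auto simp: iso_ctx_between_nth add_ac)

definition components :: "('o, 'a) sig \<Rightarrow> ('o, 'a) ctx \<Rightarrow> ('o, 'a) ctx \<Rightarrow> (nat \<Rightarrow> ('o, 'a) tm)
    \<Rightarrow> (nat \<Rightarrow> ('o, 'a) tm) \<Rightarrow> (nat \<Rightarrow> ('o, 'a) tm) \<Rightarrow> bool" where
  "components \<Sigma> \<Gamma> \<Delta> v w h \<longleftrightarrow> (\<forall>i<length \<Delta>. \<Delta> ! i = Ob \<longrightarrow> has_sort \<Sigma> \<Gamma> (h i) (Hom (v i) (w i)))"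

lemma components_weaken:
  "components \<Sigma> \<Gamma> \<Delta> v w h \<Longrightarrow> components \<Sigma> (L @ \<Gamma>) \<Delta> (\<lambda>i. bind_tm (weaken (length L)) (v i))
     (\<lambda>i. bind_tm (weaken (length L)) (w i)) (\<lambda>i. bind_tm (weaken (length L)) (h i))"
  unfolding components_def using has_sort_bind[OF _ interp_weaken] by fastforce

lemma components_iso_ctx_between:
  "components \<Sigma> (iso_ctx_between \<Delta> v w @ \<Gamma>) \<Delta> (\<lambda>i. bind_tm (weaken (length (obj_vars \<Delta>))) (v i))
     (\<lambda>i. bind_tm (weaken (length (obj_vars \<Delta>))) (w i)) (\<lambda>i. Var (obj_rank \<Delta> i))"
  unfolding components_def
proof (intro allI impI)
  fix i assume "i < length \<Delta>" "\<Delta> ! i = Ob"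
  then have rank: "obj_rank \<Delta> i < length (obj_vars \<Delta>)" "obj_vars \<Delta> ! obj_rank \<Delta> i = i"
    using obj_rank_nth by auto
  have "Suc (obj_rank \<Delta> i) + (length (obj_vars \<Delta>) - Suc (obj_rank \<Delta> i)) = length (obj_vars \<Delta>)"
    using rank by simp
  then show "has_sort \<Sigma> (iso_ctx_between \<Delta> v w @ \<Gamma>) (Var (obj_rank \<Delta> i))
     (Hom (bind_tm (weaken (length (obj_vars \<Delta>))) (v i)) (bind_tm (weaken (length (obj_vars \<Delta>))) (w i)))"
    using rank by (simp add: has_sort_Var_iff nth_append iso_ctx_between_nth del: add_Suc)
qed

lemma interp_iso_ctx_between:
  assumes "interp \<Sigma> \<Gamma> \<Sigma>' \<Gamma>' I" "components \<Sigma>' \<Gamma>' \<Delta> (\<lambda>i. bind_tm I (v i)) (\<lambda>i. bind_tm I (w i)) h"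
  shows "interp \<Sigma> (iso_ctx_between \<Delta> v w @ \<Gamma>) \<Sigma>' \<Gamma>' (scons_list (map h (obj_vars \<Delta>)) I)"
proof (rule interp_scons_list[OF assms(1)])
  fix k assume "k < length (iso_ctx_between \<Delta> v w)"
  then show "has_sort \<Sigma>' \<Gamma>' (map h (obj_vars \<Delta>) ! k)
      (bind_srt (scons_list (map h (obj_vars \<Delta>)) I) (bind_srt (weaken (Suc k)) (iso_ctx_between \<Delta> v w ! k)))"
    using assms(2) obj_vars_nth[of k \<Delta>] by (simp add: iso_ctx_between_nth components_def)
qed simp

lemma iso_fm_weaken1: "iso_fm X Y f = FEx (Hom Y X)
    (FAnd (FEq (Cmp (Var 0) (bind_tm weaken1 f)) (Idn (bind_tm weaken1 X)))
    (FEq (Cmp (bind_tm weaken1 f) (Var 0)) (Idn (bind_tm weaken1 Y))))"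
  by (simp add: iso_fm_def subst_tm_bind)

lemma bind_fm_iso_fm: "bind_fm I (iso_fm X Y f) = iso_fm (bind_tm I X) (bind_tm I Y) (bind_tm I f)"
  by (simp add: iso_fm_weaken1 lift_def)

lemma wf_iso_fm:
  assumes "has_sort \<Sigma> \<Gamma> X Ob" "has_sort \<Sigma> \<Gamma> Y Ob" "has_sort \<Sigma> \<Gamma> f (Hom X Y)"
  shows "wf_fm \<Sigma> \<Gamma> (iso_fm X Y f)"
proof -
  have sorts: "has_sort \<Sigma> (Hom Y X # \<Gamma>) (bind_tm weaken1 X) Ob"
    "has_sort \<Sigma> (Hom Y X # \<Gamma>) (bind_tm weaken1 Y) Ob"
    "has_sort \<Sigma> (Hom Y X # \<Gamma>) (bind_tm weaken1 f) (Hom (bind_tm weaken1 X) (bind_tm weaken1 Y))"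
    "has_sort \<Sigma> (Hom Y X # \<Gamma>) (Var 0) (Hom (bind_tm weaken1 Y) (bind_tm weaken1 X))"
    using assms[THEN has_sort_bind, OF interp_weaken1] by auto
  show ?thesis
    using assms has_sort_Idn[OF sorts(1)] has_sort_Idn[OF sorts(2)] has_sort_Cmp[OF sorts(3,4)]
        has_sort_Cmp[OF sorts(4,3)]
    by (auto simp: iso_fm_weaken1)
qed

definition iso_at :: "('o, 'a) ctx \<Rightarrow> (nat \<Rightarrow> ('o, 'a) tm) \<Rightarrow> (nat \<Rightarrow> ('o, 'a) tm) \<Rightarrow> (nat \<Rightarrow> ('o, 'a) tm)
    \<Rightarrow> nat \<Rightarrow> ('o, 'a) fm" where
  "iso_at \<Delta> v w h i = (case \<Delta> ! i of
       Ob \<Rightarrow> iso_fm (v i) (w i) (h i)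
     | Hom X Y \<Rightarrow> FEq (Cmp (comp_at h i Y) (v i)) (Cmp (w i) (comp_at h i X)))"

lemma ctx_iso_iso_at: "ctx_iso \<Delta> v w h = conjs (map (iso_at \<Delta> v w h) [0..<length \<Delta>])"
  by (simp add: ctx_iso_def iso_at_def[abs_def])

lemma iso_at_Ob [simp]: "\<Delta> ! i = Ob \<Longrightarrow> iso_at \<Delta> v w h i = iso_fm (v i) (w i) (h i)"
  by (simp add: iso_at_def)

lemma iso_at_Hom [simp]: "\<Delta> ! i = Hom (Var a) (Var b) \<Longrightarrow>
    iso_at \<Delta> v w h i = FEq (Cmp (h (Suc (i + b))) (v i)) (Cmp (w i) (h (Suc (i + a))))"
  by (simp add: iso_at_def comp_at_def)

lemma iso_at_append:
  "i < length \<Delta>' \<Longrightarrow> iso_at (\<Delta>' @ \<Delta>) v w h i = iso_at \<Delta>' v w h i"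
  "iso_at (\<Delta>' @ \<Delta>) v w h (length \<Delta>' + i) =
   iso_at \<Delta> (\<lambda>i. v (length \<Delta>' + i)) (\<lambda>i. w (length \<Delta>' + i)) (\<lambda>i. h (length \<Delta>' + i)) i"
  by (auto simp: iso_at_def comp_at_def nth_append add.assoc split: srt.splits tm.splits)

lemma deriv_ctx_iso_iff:
  "deriv T \<Gamma> \<Phi> (ctx_iso \<Delta> v w h) \<longleftrightarrow> wf_hyps T \<Gamma> \<Phi> \<and> (\<forall>i<length \<Delta>. deriv T \<Gamma> \<Phi> (iso_at \<Delta> v w h i))"
  by (auto simp: ctx_iso_iso_at deriv_conjs_iff)

lemma all_less_add_iff: "(\<forall>i<m + n. P i) \<longleftrightarrow> (\<forall>i<m. P i) \<and> (\<forall>i<n. P (m + i))" for m n :: nat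
  by (auto, metis add_less_cancel_left le_add_diff_inverse not_less)

definition ex_iso :: "('o, 'a) ctx \<Rightarrow> (nat \<Rightarrow> ('o, 'a) tm) \<Rightarrow> (nat \<Rightarrow> ('o, 'a) tm) \<Rightarrow> ('o, 'a) fm" where
  "ex_iso \<Delta> v w = (let W = bind_tm (weaken (length (obj_vars \<Delta>))) in
     exs (iso_ctx_between \<Delta> v w) (ctx_iso \<Delta> (\<lambda>i. W (v i)) (\<lambda>i. W (w i)) (\<lambda>i. Var (obj_rank \<Delta> i))))"

definition iso_unique :: "('o, 'a) ctx \<Rightarrow> (nat \<Rightarrow> ('o, 'a) tm) \<Rightarrow> (nat \<Rightarrow> ('o, 'a) tm) \<Rightarrow> ('o, 'a) fm" where
  "iso_unique \<Delta> v w = (let m = length (obj_vars \<Delta>); W = bind_tm (weaken m); WW = bind_tm (weaken (m + m));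
       h1 = (\<lambda>i. Var (obj_rank \<Delta> i)); h2 = (\<lambda>i. Var (m + obj_rank \<Delta> i)) in
     alls (iso_ctx_between \<Delta> (\<lambda>i. W (v i)) (\<lambda>i. W (w i)) @ iso_ctx_between \<Delta> v w)
       (FImp (FAnd (ctx_iso \<Delta> (\<lambda>i. WW (v i)) (\<lambda>i. WW (w i)) h2) (ctx_iso \<Delta> (\<lambda>i. WW (v i)) (\<lambda>i. WW (w i)) h1))
         (conjs (map (\<lambda>i. FEq (h2 i) (h1 i)) (obj_vars \<Delta>)))))"

lemma ex_unique_iso_eq:
  "ex_unique_iso \<Delta> = FAnd (ex_iso \<Delta> (\<lambda>i. Var (length \<Delta> + i)) Var) (iso_unique \<Delta> (\<lambda>i. Var (length \<Delta> + i)) Var)"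
proof -
  have shift: "subst_srt (shift k) = bind_srt (weaken k)" for k by (rule ext) (simp add: subst_srt_bind)
  show ?thesis
    by (simp add: ex_unique_iso_def ex_iso_def iso_unique_def Let_def iso_ctx_eq_between shift
        map_weaken_iso_ctx_between add_ac)
qed

section \<open>Theories in the pure language\<close>

lemma sig_pure_thy [simp]:
  "ocons (sg (pure_thy Ax)) = {}" "acons (sg (pure_thy Ax)) = {}" "axms (pure_thy Ax) = Ax"
  by (auto simp: pure_thy_def)

locale pure_theory =
  fixes Ax :: "pfm set"
  assumes sentences: "\<And>\<phi>. \<phi> \<in> Ax \<Longrightarrow> sentence (sg (pure_thy Ax)) \<phi>"
    and cat_eq_Ax: "cat_eq_axioms \<subseteq> Ax"
begin

abbreviation T :: "(unit, unit) thy" where "T \<equiv> pure_thy Ax"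
abbreviation \<Sigma> :: "(unit, unit) sig" where "\<Sigma> \<equiv> sg (pure_thy Ax)"

lemma wf_sig_pure: "wf_sig \<Sigma>"
  by (simp add: wf_sig_def)

sublocale eq_theory "pure_thy Ax"
  by standard (auto simp: cat_eq_Ax wf_sig_pure)

lemma has_sort_pure_Ob: "has_sort \<Sigma> \<Gamma> X Ob \<longleftrightarrow> (\<exists>j. X = Var j \<and> j < length \<Gamma> \<and> \<Gamma> ! j = Ob)"
  by (cases X) (auto simp: has_sort_iffs)

lemma pure_ctxE:
  assumes "wf_ctx \<Sigma> \<Delta>" "i < length \<Delta>"
  obtains (Ob) "\<Delta> ! i = Ob"
  | (Hom) a b where "\<Delta> ! i = Hom (Var a) (Var b)" "Suc (i + a) < length \<Delta>" "\<Delta> ! Suc (i + a) = Ob"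
    "Suc (i + b) < length \<Delta>" "\<Delta> ! Suc (i + b) = Ob"
  using wf_ctx_nth[OF assms] that assms by (cases "\<Delta> ! i") (auto simp: has_sort_pure_Ob)

lemma interp_pure_iff: "interp \<Sigma> \<Delta> \<Sigma>' \<Gamma> I \<longleftrightarrow>
    (\<forall>i<length \<Delta>. has_sort \<Sigma>' \<Gamma> (I (AVar i)) (bind_srt I (bind_srt (weaken (Suc i)) (\<Delta> ! i))))"
  by (simp add: interp_iff)

lemma interp_pure_closed: "interp \<Sigma> [] \<Sigma>' \<Gamma> I"
  by (simp add: interp_pure_iff)

lemma interp_pure_Ob: "interp \<Sigma> \<Delta> \<Sigma>' \<Gamma> I \<Longrightarrow> i < length \<Delta> \<Longrightarrow> \<Delta> ! i = Ob \<Longrightarrow> has_sort \<Sigma>' \<Gamma> (I (AVar i)) Ob"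
  by (auto simp: interp_pure_iff)

lemma interp_pure_Hom:
  "interp \<Sigma> \<Delta> \<Sigma>' \<Gamma> I \<Longrightarrow> i < length \<Delta> \<Longrightarrow> \<Delta> ! i = Hom (Var a) (Var b)
    \<Longrightarrow> has_sort \<Sigma>' \<Gamma> (I (AVar i)) (Hom (I (AVar (Suc (i + a)))) (I (AVar (Suc (i + b)))))"
  by (auto simp: interp_pure_iff add_ac)

lemma bind_fm_pure_cong: "wf_fm \<Sigma> \<Delta> P \<Longrightarrow> (\<And>i. i < length \<Delta> \<Longrightarrow> I (AVar i) = J (AVar i)) \<Longrightarrow>
    bind_fm I P = bind_fm J P"
  by (rule bind_fm_cong) (auto simp: agree_on_iff)

lemma bind_fm_pure_sentence: "sentence \<Sigma> P \<Longrightarrow> bind_fm I P = emb P"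
  unfolding emb_bind by (erule bind_fm_pure_cong) simp

lemma emb_pure [simp]: "emb P = (P :: pfm)"
proof -
  have "con_map (\<lambda>_. undefined) (\<lambda>_. undefined) = (atom_tm :: (unit, unit) atom \<Rightarrow> ptm)"
    by (rule atom_fun_eqI) auto
  then show ?thesis by (simp add: emb_bind)
qed

lemma interp_var_subst_weaken:
  "interp \<Sigma> \<Delta> \<Sigma> \<Gamma> (var_subst v) \<Longrightarrow> interp \<Sigma> \<Delta> \<Sigma> (L @ \<Gamma>) (var_subst (\<lambda>i. bind_tm (weaken (length L)) (v i)))"
  using interp_comp[OF _ interp_weaken, of \<Sigma> \<Delta> \<Sigma> \<Gamma> "var_subst v" L] by simp

lemma var_subst_weaken: "(\<lambda>x. bind_tm (var_subst v) (weaken n x)) = var_subst (\<lambda>i. v (n + i))"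
  by (rule atom_fun_eqI) (auto simp: add.commute)

lemma interp_var_subst_append:
  assumes "wf_ctx \<Sigma> \<Delta>'" "interp \<Sigma> \<Delta>' \<Sigma> \<Gamma> (var_subst w)" "interp \<Sigma> \<Delta> \<Sigma> \<Gamma> (var_subst v)"
  shows "interp \<Sigma> (\<Delta>' @ \<Delta>) \<Sigma> \<Gamma> (var_subst (\<lambda>k. if k < length \<Delta>' then w k else v (k - length \<Delta>')))"
    (is "interp _ _ _ _ (var_subst ?u)")
  unfolding interp_pure_iff
proof (intro allI impI)
  fix k assume k: "k < length (\<Delta>' @ \<Delta>)"
  show "has_sort \<Sigma> \<Gamma> (var_subst ?u (AVar k)) (bind_srt (var_subst ?u)
      (bind_srt (weaken (Suc k)) ((\<Delta>' @ \<Delta>) ! k)))"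
  proof (cases "k < length \<Delta>'")
    case True
    have "bind_srt (var_subst ?u) (bind_srt (weaken (Suc k)) (\<Delta>' ! k)) =
        bind_srt (var_subst w) (bind_srt (weaken (Suc k)) (\<Delta>' ! k))"
      by (rule bind_srt_cong[OF wf_ctx_nth_weaken[OF assms(1) True]]) (simp add: agree_on_iff)
    then show ?thesis using assms(2) True by (simp add: interp_pure_iff nth_append)
  next
    case False
    then obtain j where j: "k = length \<Delta>' + j" "j < length \<Delta>"
      using k by (metis add_less_cancel_left le_add_diff_inverse length_append not_less)
    have "bind_tm (var_subst ?u) (weaken (Suc k) x) = bind_tm (var_subst v) (weaken (Suc j) x)" for x
      unfolding j by (cases x) (auto simp: add.commute)
    then show ?thesis using assms(3) j by (simp add: interp_pure_iff nth_append)
  qed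
qed

lemma ctx_iso_cong:
  assumes \<Delta>: "wf_ctx \<Sigma> \<Delta>" and vw: "\<And>i. i < length \<Delta> \<Longrightarrow> v i = v' i" "\<And>i. i < length \<Delta> \<Longrightarrow> w i = w' i"
    and h: "\<And>i. i < length \<Delta> \<Longrightarrow> \<Delta> ! i = Ob \<Longrightarrow> h i = h' i"
  shows "ctx_iso \<Delta> v w h = ctx_iso \<Delta> v' w' h'"
proof -
  have "iso_at \<Delta> v w h i = iso_at \<Delta> v' w' h' i" if i: "i < length \<Delta>" for i
    using \<Delta> i by (cases rule: pure_ctxE) (use i vw h in simp_all)
  then show ?thesis unfolding ctx_iso_iso_at by (intro arg_cong[where f = conjs] map_cong) auto
qed

lemma bind_fm_ctx_iso:
  assumes \<Delta>: "wf_ctx \<Sigma> \<Delta>"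
  shows "bind_fm I (ctx_iso \<Delta> v w h) = ctx_iso \<Delta> (\<lambda>i. bind_tm I (v i)) (\<lambda>i. bind_tm I (w i))
      (\<lambda>i. bind_tm I (h i))"
proof -
  have "bind_fm I (iso_at \<Delta> v w h i) = iso_at \<Delta> (\<lambda>i. bind_tm I (v i)) (\<lambda>i. bind_tm I (w i))
      (\<lambda>i. bind_tm I (h i)) i"
    if i: "i < length \<Delta>" for i
    using \<Delta> i by (cases rule: pure_ctxE) (simp_all add: bind_fm_iso_fm)
  then show ?thesis unfolding ctx_iso_iso_at bind_fm_conjs map_map
    by (intro arg_cong[where f = conjs] map_cong) auto
qed

lemma bind_fm_ex_iso:
  assumes \<Delta>: "wf_ctx \<Sigma> \<Delta>"
  shows "bind_fm I (ex_iso \<Delta> v w) = ex_iso \<Delta> (\<lambda>i. bind_tm I (v i)) (\<lambda>i. bind_tm I (w i))"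
proof -
  let ?m = "length (obj_vars \<Delta>)"
  have "ctx_iso \<Delta> v' w' (\<lambda>i. lifts ?m I (AVar (obj_rank \<Delta> i))) = ctx_iso \<Delta> v' w' (\<lambda>i. Var (obj_rank \<Delta> i))"
    for v' w'
    by (rule ctx_iso_cong[OF \<Delta>]) (auto simp: lifts_AVar obj_rank_nth)
  then show ?thesis by (simp add: ex_iso_def Let_def bind_fm_exs bind_ctx_iso_ctx_between
      bind_fm_ctx_iso[OF \<Delta>])
qed

lemma bind_fm_iso_unique:
  assumes \<Delta>: "wf_ctx \<Sigma> \<Delta>"
  shows "bind_fm I (iso_unique \<Delta> v w) = iso_unique \<Delta> (\<lambda>i. bind_tm I (v i)) (\<lambda>i. bind_tm I (w i))"
proof -
  let ?m = "length (obj_vars \<Delta>)"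
  have h1: "lifts (?m + ?m) I (AVar (obj_rank \<Delta> i)) = Var (obj_rank \<Delta> i)"
    and h2: "lifts (?m + ?m) I (AVar (?m + obj_rank \<Delta> i)) = Var (?m + obj_rank \<Delta> i)"
    if "i < length \<Delta>" "\<Delta> ! i = Ob" for i
    using obj_rank_nth[OF that] by (auto simp: lifts_AVar)
  have "ctx_iso \<Delta> v' w' (\<lambda>i. lifts (?m + ?m) I (AVar (obj_rank \<Delta> i))) =
      ctx_iso \<Delta> v' w' (\<lambda>i. Var (obj_rank \<Delta> i))"
    and "ctx_iso \<Delta> v' w' (\<lambda>i. lifts (?m + ?m) I (AVar (?m + obj_rank \<Delta> i))) =
        ctx_iso \<Delta> v' w' (\<lambda>i. Var (?m + obj_rank \<Delta> i))"
    for v' w'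
    by (rule ctx_iso_cong[OF \<Delta>]; simp add: h1 h2)+
  moreover have "conjs (map (\<lambda>i. FEq (lifts (?m + ?m) I (AVar (?m + obj_rank \<Delta> i)))
      (lifts (?m + ?m) I (AVar (obj_rank \<Delta> i)))) (obj_vars \<Delta>))
      = conjs (map (\<lambda>i. FEq (Var (?m + obj_rank \<Delta> i)) (Var (obj_rank \<Delta> i))) (obj_vars \<Delta>))"
    by (intro arg_cong[where f = conjs] map_cong) (auto simp: set_obj_vars h1 h2)
  ultimately show ?thesis
    by (simp add: iso_unique_def Let_def bind_fm_alls bind_ctx_append bind_ctx_iso_ctx_between
        bind_fm_ctx_iso[OF \<Delta>]
        bind_fm_conjs comp_def)
qed

lemma wf_ctx_iso:
  assumes \<Delta>: "wf_ctx \<Sigma> \<Delta>" and v: "interp \<Sigma> \<Delta> \<Sigma> \<Gamma> (var_subst v)" and w: "interp \<Sigma> \<Delta> \<Sigma> \<Gamma> (var_subst w)"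
    and h: "components \<Sigma> \<Gamma> \<Delta> v w h"
  shows "wf_fm \<Sigma> \<Gamma> (ctx_iso \<Delta> v w h)"
proof -
  have "wf_fm \<Sigma> \<Gamma> (iso_at \<Delta> v w h i)" if i: "i < length \<Delta>" for i
    using \<Delta> i
  proof (cases rule: pure_ctxE)
    case Ob
    then show ?thesis
      using i h interp_pure_Ob[OF v i] interp_pure_Ob[OF w i] by (simp add: wf_iso_fm components_def)
  next
    case (Hom a b)
    have "has_sort \<Sigma> \<Gamma> (h (Suc (i + a))) (Hom (v (Suc (i + a))) (w (Suc (i + a))))"
      "has_sort \<Sigma> \<Gamma> (h (Suc (i + b))) (Hom (v (Suc (i + b))) (w (Suc (i + b))))"
      using Hom h by (auto simp: components_def)
    then show ?thesis
      using Hom(1) interp_pure_Hom[OF v i Hom(1)] interp_pure_Hom[OF w i Hom(1)]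
      by (auto intro!: exI has_sort_Cmp)
  qed
  then show ?thesis by (simp add: ctx_iso_iso_at wf_fm_conjs_iff)
qed

lemma wf_ctx_iso_ctx_between:
  assumes \<Gamma>: "wf_ctx \<Sigma> \<Gamma>" and v: "interp \<Sigma> \<Delta> \<Sigma> \<Gamma> (var_subst v)" and w: "interp \<Sigma> \<Delta> \<Sigma> \<Gamma> (var_subst w)"
  shows "wf_ctx \<Sigma> (iso_ctx_between \<Delta> v w @ \<Gamma>)"
proof -
  have "wf_ctx \<Sigma> (drop k (iso_ctx_between \<Delta> v w) @ \<Gamma>)" for k
  proof (induction "length (iso_ctx_between \<Delta> v w) - k" arbitrary: k)
    case 0
    then show ?case using \<Gamma> by simp
  next
    case (Suc n)
    let ?i = "obj_vars \<Delta> ! k" and ?L = "drop (Suc k) (iso_ctx_between \<Delta> v w)"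
    have k: "k < length (obj_vars \<Delta>)" using Suc.hyps(2) by simp
    have "has_sort \<Sigma> \<Gamma> (v ?i) Ob" "has_sort \<Sigma> \<Gamma> (w ?i) Ob"
      using obj_vars_nth[OF k] interp_pure_Ob[OF v, of ?i] interp_pure_Ob[OF w, of ?i] by auto
    from this[THEN has_sort_bind, OF interp_weaken[of _ _ ?L]]
    have "wf_srt \<Sigma> (?L @ \<Gamma>) (iso_ctx_between \<Delta> v w ! k)" using k by (simp add: iso_ctx_between_nth)
    moreover have "wf_ctx \<Sigma> (?L @ \<Gamma>)" using Suc.hyps(1)[of "Suc k"] Suc.hyps(2) by simp
    ultimately show ?case using k by (simp flip: Cons_nth_drop_Suc)
  qed
  from this[of 0] show ?thesis by simp
qed

lemma wf_ex_iso:
  assumes \<Delta>: "wf_ctx \<Sigma> \<Delta>" and \<Gamma>: "wf_ctx \<Sigma> \<Gamma>"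
    and v: "interp \<Sigma> \<Delta> \<Sigma> \<Gamma> (var_subst v)" and w: "interp \<Sigma> \<Delta> \<Sigma> \<Gamma> (var_subst w)"
  shows "wf_fm \<Sigma> \<Gamma> (ex_iso \<Delta> v w)"
  unfolding ex_iso_def Let_def wf_fm_exs_iff[OF \<Gamma>]
  using wf_ctx_iso_ctx_between[OF \<Gamma> v w] components_iso_ctx_between
    interp_var_subst_weaken[OF v, of "iso_ctx_between \<Delta> v w"]
        interp_var_subst_weaken[OF w, of "iso_ctx_between \<Delta> v w"]
  by (auto intro!: wf_ctx_iso[OF \<Delta>])

definition ctx_isomorphism :: "pctx \<Rightarrow> pfm set \<Rightarrow> pctx \<Rightarrow> (nat \<Rightarrow> ptm) \<Rightarrow> (nat \<Rightarrow> ptm) \<Rightarrow> (nat \<Rightarrow> ptm) \<Rightarrow> bool" where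
  "ctx_isomorphism \<Gamma> \<Phi> \<Delta> v w h \<longleftrightarrow> components \<Sigma> \<Gamma> \<Delta> v w h \<and> deriv T \<Gamma> \<Phi> (ctx_iso \<Delta> v w h)"

lemma ctx_isomorphism_extends:
  assumes "wf_ctx \<Sigma> \<Delta>" "ctx_isomorphism \<Gamma> \<Phi> \<Delta> v w h" "extends T L \<Phi>' \<Gamma> \<Phi>"
  defines "W \<equiv> bind_tm (weaken (length L))"
  shows "ctx_isomorphism (L @ \<Gamma>) \<Phi>' \<Delta> (\<lambda>i. W (v i)) (\<lambda>i. W (w i)) (\<lambda>i. W (h i))"
proof -
  have "components \<Sigma> \<Gamma> \<Delta> v w h" "deriv T \<Gamma> \<Phi> (ctx_iso \<Delta> v w h)"
    using assms(2) by (simp_all add: ctx_isomorphism_def)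
  from components_weaken[OF this(1), of L] deriv_extends[OF this(2) assms(3)]
  show ?thesis by (simp add: ctx_isomorphism_def W_def bind_fm_ctx_iso[OF assms(1)])
qed

lemma ctx_isomorphism_append:
  "ctx_isomorphism \<Gamma> \<Phi> (\<Delta>' @ \<Delta>) v w h \<longleftrightarrow> ctx_isomorphism \<Gamma> \<Phi> \<Delta>' v w h \<and>
   ctx_isomorphism \<Gamma> \<Phi> \<Delta> (\<lambda>i. v (length \<Delta>' + i)) (\<lambda>i. w (length \<Delta>' + i)) (\<lambda>i. h (length \<Delta>' + i))"
  by (auto simp: ctx_isomorphism_def components_def deriv_ctx_iso_iff all_less_add_iff nth_append
      iso_at_append)

lemma ctx_isomorphism_cong:
  assumes "wf_ctx \<Sigma> \<Delta>" "\<And>i. i < length \<Delta> \<Longrightarrow> h i = h' i"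
  shows "ctx_isomorphism \<Gamma> \<Phi> \<Delta> v w h \<longleftrightarrow> ctx_isomorphism \<Gamma> \<Phi> \<Delta> v w h'"
  using ctx_iso_cong[of \<Delta> v v w w h h'] assms by (simp add: ctx_isomorphism_def components_def)

lemma ctx_isomorphism_arrow:
  "ctx_isomorphism \<Gamma> \<Phi> [Hom (Var a) (Var b)] v w h \<longleftrightarrow> commutes \<Gamma> \<Phi> (h (Suc a)) (h (Suc b)) (v 0) (w 0)"
  by (auto simp: ctx_isomorphism_def components_def deriv_ctx_iso_iff commutes_def dest: deriv_wf_hyps)

lemma ex_iso_intro:
  assumes \<Delta>: "wf_ctx \<Sigma> \<Delta>" and v: "interp \<Sigma> \<Delta> \<Sigma> \<Gamma> (var_subst v)" and w: "interp \<Sigma> \<Delta> \<Sigma> \<Gamma> (var_subst w)"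
    and h: "ctx_isomorphism \<Gamma> \<Phi> \<Delta> v w h"
  shows "deriv T \<Gamma> \<Phi> (ex_iso \<Delta> v w)"
proof -
  let ?c = "map h (obj_vars \<Delta>)" and ?W = "bind_tm (weaken (length (obj_vars \<Delta>)))"
  have comps: "components \<Sigma> \<Gamma> \<Delta> v w h"
    and iso: "deriv T \<Gamma> \<Phi> (ctx_iso \<Delta> v w h)" using h by (simp_all add: ctx_isomorphism_def)
  have \<Gamma>: "wf_ctx \<Sigma> \<Gamma>" using deriv_wf_hyps[OF iso] by (simp add: wf_hyps_def)
  have "bind_fm (scons_list ?c atom_tm) (ctx_iso \<Delta> (\<lambda>i. ?W (v i)) (\<lambda>i. ?W (w i)) (\<lambda>i. Var (obj_rank \<Delta> i))) =
      ctx_iso \<Delta> v w h"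
    unfolding bind_fm_ctx_iso[OF \<Delta>] by (rule ctx_iso_cong[OF \<Delta>]) (auto simp: scons_list_AVar obj_rank_nth)
  moreover have "interp \<Sigma> (iso_ctx_between \<Delta> v w @ \<Gamma>) \<Sigma> \<Gamma> (scons_list ?c atom_tm)"
    by (rule interp_iso_ctx_between[OF interp_id]) (simp add: comps)
  ultimately show ?thesis
    using deriv_exsI[OF wf_ex_iso[OF \<Delta> \<Gamma> v w, unfolded ex_iso_def Let_def], of ?c] iso
    by (simp add: ex_iso_def Let_def)
qed

lemma ex_iso_elim:
  assumes \<Delta>: "wf_ctx \<Sigma> \<Delta>" and v: "interp \<Sigma> \<Delta> \<Sigma> \<Gamma> (var_subst v)" and w: "interp \<Sigma> \<Delta> \<Sigma> \<Gamma> (var_subst w)"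
    and ex: "deriv T \<Gamma> \<Phi> (ex_iso \<Delta> v w)" and \<psi>: "wf_fm \<Sigma> \<Gamma> \<psi>"
    and step: "\<And>L \<Phi>' h. extends T L \<Phi>' \<Gamma> \<Phi> \<Longrightarrow>
      ctx_isomorphism (L @ \<Gamma>) \<Phi>' \<Delta> (\<lambda>i. bind_tm (weaken (length L)) (v i))
          (\<lambda>i. bind_tm (weaken (length L)) (w i)) h \<Longrightarrow>
      deriv T (L @ \<Gamma>) \<Phi>' (bind_fm (weaken (length L)) \<psi>)"
  shows "deriv T \<Gamma> \<Phi> \<psi>"
proof (rule deriv_exsE[OF ex[unfolded ex_iso_def Let_def] \<psi>])
  let ?L = "iso_ctx_between \<Delta> v w" and ?h = "\<lambda>i. Var (obj_rank \<Delta> i)"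
    and ?W = "bind_tm (weaken (length (obj_vars \<Delta>)))"
  let ?iso = "ctx_iso \<Delta> (\<lambda>i. ?W (v i)) (\<lambda>i. ?W (w i)) ?h"
    and ?\<Phi> = "\<lambda>P. insert P (bind_fm (weaken (length ?L)) ` \<Phi>)"
  have hyps: "wf_hyps T \<Gamma> \<Phi>" using deriv_wf_hyps[OF ex] .
  have \<Gamma>: "wf_ctx \<Sigma> \<Gamma>" using hyps by (simp add: wf_hyps_def)
  have comps: "components \<Sigma> (?L @ \<Gamma>) \<Delta> (\<lambda>i. ?W (v i)) (\<lambda>i. ?W (w i)) ?h" by (rule components_iso_ctx_between)
  have "wf_fm \<Sigma> (?L @ \<Gamma>) ?iso"
    using wf_ctx_iso[OF \<Delta> _ _ comps] interp_var_subst_weaken[OF v, of ?L] interp_var_subst_weaken[OF w, of ?L]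
    by simp
  then have hyps': "wf_hyps T (?L @ \<Gamma>) (?\<Phi> ?iso)"
    using hyps wf_ctx_iso_ctx_between[OF \<Gamma> v w] interp_weaken[of \<Sigma> \<Gamma> ?L]
    by (auto simp: wf_hyps_def intro: wf_fm_bind)
  then have "ctx_isomorphism (?L @ \<Gamma>) (?\<Phi> ?iso) \<Delta> (\<lambda>i. ?W (v i)) (\<lambda>i. ?W (w i)) ?h"
    using comps by (simp add: ctx_isomorphism_def deriv.Hyp)
  moreover have "extends T ?L (?\<Phi> ?iso) \<Gamma> \<Phi>" using hyps' by (auto simp: extends_def)
  ultimately show "deriv T (?L @ \<Gamma>) (?\<Phi> ?iso) (bind_fm (weaken (length ?L)) \<psi>)"
    using step[of ?L "?\<Phi> ?iso" ?h] by simp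
qed

definition at_most_one_iso :: "pctx \<Rightarrow> pfm set \<Rightarrow> pctx \<Rightarrow> (nat \<Rightarrow> ptm) \<Rightarrow> (nat \<Rightarrow> ptm) \<Rightarrow> bool" where
  "at_most_one_iso \<Gamma> \<Phi> \<Delta> v w \<longleftrightarrow> (\<forall>h h'. ctx_isomorphism \<Gamma> \<Phi> \<Delta> v w h \<longrightarrow> ctx_isomorphism \<Gamma> \<Phi> \<Delta> v w h' \<longrightarrow>
     (\<forall>i<length \<Delta>. \<Delta> ! i = Ob \<longrightarrow> deriv T \<Gamma> \<Phi> (FEq (h i) (h' i))))"

lemma iso_unique_elim:
  assumes \<Delta>: "wf_ctx \<Sigma> \<Delta>" and unique: "deriv T \<Gamma> \<Phi> (iso_unique \<Delta> v w)"
  shows "at_most_one_iso \<Gamma> \<Phi> \<Delta> v w"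
  unfolding at_most_one_iso_def
proof (intro allI impI)
  fix h h' i
  assume h: "ctx_isomorphism \<Gamma> \<Phi> \<Delta> v w h" and h': "ctx_isomorphism \<Gamma> \<Phi> \<Delta> v w h'"
    and i: "i < length \<Delta>" "\<Delta> ! i = Ob"
  let ?m = "length (obj_vars \<Delta>)"
  let ?WW = "bind_tm (weaken (?m + ?m))" and ?h1 = "\<lambda>i. Var (obj_rank \<Delta> i)"
    and ?h2 = "\<lambda>i. Var (?m + obj_rank \<Delta> i)"
  let ?iso = "ctx_iso \<Delta> (\<lambda>i. ?WW (v i)) (\<lambda>i. ?WW (w i))"
  define c where "c = map h' (obj_vars \<Delta>) @ map h (obj_vars \<Delta>)"
  let ?I = "scons_list c atom_tm"
  have c: "length c = ?m + ?m" by (simp add: c_def)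
  have I_h1: "?I (AVar (obj_rank \<Delta> j)) = h' j"
    and I_h2: "?I (AVar (?m + obj_rank \<Delta> j)) = h j" if "j < length \<Delta>" "\<Delta> ! j = Ob" for j
    using obj_rank_nth[OF that] by (auto simp: scons_list_AVar c_def nth_append)
  have "interp \<Sigma> (iso_ctx_between \<Delta> v w @ \<Gamma>) \<Sigma> \<Gamma> (scons_list (map h (obj_vars \<Delta>)) atom_tm)"
    using h by (intro interp_iso_ctx_between[OF interp_id]) (simp add: ctx_isomorphism_def)
  then have "interp \<Sigma> (iso_ctx_between \<Delta> (\<lambda>i. bind_tm (weaken ?m) (v i))
      (\<lambda>i. bind_tm (weaken ?m) (w i)) @ iso_ctx_between \<Delta> v w @ \<Gamma>)
      \<Sigma> \<Gamma> ?I"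
    unfolding c_def scons_list_append
    by (rule interp_iso_ctx_between) (use h' in \<open>simp add: ctx_isomorphism_def\<close>)
  then have "deriv T \<Gamma> \<Phi> (bind_fm ?I (FImp (FAnd (?iso ?h2) (?iso ?h1))
      (conjs (map (\<lambda>i. FEq (?h2 i) (?h1 i)) (obj_vars \<Delta>)))))"
    using deriv_alls_elim[OF unique[unfolded iso_unique_def Let_def]] c by simp
  moreover have "bind_fm ?I (?iso ?h2) = ctx_iso \<Delta> v w h" "bind_fm ?I (?iso ?h1) = ctx_iso \<Delta> v w h'"
    unfolding bind_fm_ctx_iso[OF \<Delta>] by (rule ctx_iso_cong[OF \<Delta>]; use I_h1 I_h2 c in simp)+
  ultimately have "deriv T \<Gamma> \<Phi> (conjs (map (\<lambda>i. FEq (?I (AVar (?m + obj_rank \<Delta> i)))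
      (?I (AVar (obj_rank \<Delta> i)))) (obj_vars \<Delta>)))"
    using deriv.ImpE[OF _ deriv.AndI] h h' by (auto simp: ctx_isomorphism_def bind_fm_conjs comp_def)
  then show "deriv T \<Gamma> \<Phi> (FEq (h i) (h' i))"
    using I_h1[OF i] I_h2[OF i] i by (auto simp: deriv_conjs_iff set_obj_vars)
qed

lemma iso_unique_intro:
  assumes \<Delta>: "wf_ctx \<Sigma> \<Delta>" and v: "interp \<Sigma> \<Delta> \<Sigma> \<Gamma> (var_subst v)" and w: "interp \<Sigma> \<Delta> \<Sigma> \<Gamma> (var_subst w)"
    and hyps: "wf_hyps T \<Gamma> \<Phi>"
    and unique: "\<And>L \<Phi>'. extends T L \<Phi>' \<Gamma> \<Phi> \<Longrightarrow>
      at_most_one_iso (L @ \<Gamma>) \<Phi>' \<Delta> (\<lambda>i. bind_tm (weaken (length L)) (v i))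
          (\<lambda>i. bind_tm (weaken (length L)) (w i))"
  shows "deriv T \<Gamma> \<Phi> (iso_unique \<Delta> v w)"
proof -
  let ?m = "length (obj_vars \<Delta>)" and ?H = "iso_ctx_between \<Delta> v w"
  let ?W = "bind_tm (weaken ?m)" and ?WW = "bind_tm (weaken (?m + ?m))"
  let ?H' = "iso_ctx_between \<Delta> (\<lambda>i. ?W (v i)) (\<lambda>i. ?W (w i))"
  let ?L = "?H' @ ?H" and ?h1 = "\<lambda>i. Var (obj_rank \<Delta> i)" and ?h2 = "\<lambda>i. Var (?m + obj_rank \<Delta> i)"
  let ?iso = "ctx_iso \<Delta> (\<lambda>i. ?WW (v i)) (\<lambda>i. ?WW (w i))"
  let ?\<Phi> = "insert (FAnd (?iso ?h2) (?iso ?h1)) (bind_fm (weaken (length ?L)) ` \<Phi>)"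
  have \<Gamma>: "wf_ctx \<Sigma> \<Gamma>" using hyps by (simp add: wf_hyps_def)
  have Wv: "interp \<Sigma> \<Delta> \<Sigma> (?H @ \<Gamma>) (var_subst (\<lambda>i. ?W (v i)))"
    and Ww: "interp \<Sigma> \<Delta> \<Sigma> (?H @ \<Gamma>) (var_subst (\<lambda>i. ?W (w i)))"
    using interp_var_subst_weaken[OF v, of ?H] interp_var_subst_weaken[OF w, of ?H] by simp_all
  have L: "wf_ctx \<Sigma> (?L @ \<Gamma>)" using wf_ctx_iso_ctx_between[OF wf_ctx_iso_ctx_between[OF \<Gamma> v w] Wv Ww] by simp
  have h1: "components \<Sigma> (?L @ \<Gamma>) \<Delta> (\<lambda>i. ?WW (v i)) (\<lambda>i. ?WW (w i)) ?h1"
    using components_iso_ctx_between[of \<Sigma> \<Delta> "\<lambda>i. ?W (v i)" "\<lambda>i. ?W (w i)" "?H @ \<Gamma>"] by simp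
  have h2: "components \<Sigma> (?L @ \<Gamma>) \<Delta> (\<lambda>i. ?WW (v i)) (\<lambda>i. ?WW (w i)) ?h2"
    using components_weaken[OF components_iso_ctx_between[of \<Sigma> \<Delta> v w \<Gamma>], of ?H'] by (simp add: add.commute)
  have "wf_fm \<Sigma> (?L @ \<Gamma>) (FAnd (?iso ?h2) (?iso ?h1))"
    using wf_ctx_iso[OF \<Delta> _ _ h1] wf_ctx_iso[OF \<Delta> _ _ h2] interp_var_subst_weaken[OF v, of ?L]
        interp_var_subst_weaken[OF w, of ?L]
    by simp
  then have hyps': "wf_hyps T (?L @ \<Gamma>) ?\<Phi>"
    using hyps L interp_weaken[of \<Sigma> \<Gamma> ?L] by (auto simp: wf_hyps_def intro!: wf_fm_bind)
  have "deriv T (?L @ \<Gamma>) ?\<Phi> (FAnd (?iso ?h2) (?iso ?h1))" using hyps' by (simp add: deriv.Hyp)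
  then have "ctx_isomorphism (?L @ \<Gamma>) ?\<Phi> \<Delta> (\<lambda>i. ?WW (v i)) (\<lambda>i. ?WW (w i)) ?h1"
    "ctx_isomorphism (?L @ \<Gamma>) ?\<Phi> \<Delta> (\<lambda>i. ?WW (v i)) (\<lambda>i. ?WW (w i)) ?h2"
    using h1 h2 by (simp_all add: ctx_isomorphism_def deriv_And_iff)
  moreover have "at_most_one_iso (?L @ \<Gamma>) ?\<Phi> \<Delta> (\<lambda>i. ?WW (v i)) (\<lambda>i. ?WW (w i))"
    using unique[of ?L ?\<Phi>] hyps' by (auto simp: extends_def)
  ultimately have "deriv T (?L @ \<Gamma>) ?\<Phi> (conjs (map (\<lambda>i. FEq (?h2 i) (?h1 i)) (obj_vars \<Delta>)))"
    using hyps' by (auto simp: deriv_conjs_iff set_obj_vars at_most_one_iso_def)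
  then show ?thesis by (simp add: iso_unique_def Let_def deriv_alls_iff deriv_Imp_iff)
qed

end

section \<open>Contexts that exist uniquely\<close>

context pure_theory
begin

definition witness :: "pctx \<Rightarrow> pfm set \<Rightarrow> pctx \<Rightarrow> pfm \<Rightarrow> (nat \<Rightarrow> ptm) \<Rightarrow> bool" where
  "witness \<Gamma> \<Phi> \<Delta> Q v \<longleftrightarrow> interp \<Sigma> \<Delta> \<Sigma> \<Gamma> (var_subst v) \<and> deriv T \<Gamma> \<Phi> (bind_fm (var_subst v) Q)"

lemma witnessD:
  assumes "witness \<Gamma> \<Phi> \<Delta> Q v"
  shows "interp \<Sigma> \<Delta> \<Sigma> \<Gamma> (var_subst v)" "deriv T \<Gamma> \<Phi> (bind_fm (var_subst v) Q)"
  using assms by (simp_all add: witness_def)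

lemma witness_wf_ctx: "witness \<Gamma> \<Phi> \<Delta> Q v \<Longrightarrow> wf_ctx \<Sigma> \<Gamma>"
  by (auto simp: witness_def wf_hyps_def dest!: deriv_wf_hyps)

lemma witness_extends:
  assumes "witness \<Gamma> \<Phi> \<Delta> Q v" "extends T L \<Phi>' \<Gamma> \<Phi>"
  shows "witness (L @ \<Gamma>) \<Phi>' \<Delta> Q (\<lambda>i. bind_tm (weaken (length L)) (v i))"
  using deriv_extends[OF witnessD(2)[OF assms(1)] assms(2)]
      interp_var_subst_weaken[OF witnessD(1)[OF assms(1)]]
  by (simp add: witness_def)

lemma witness_hyp:
  assumes "wf_ctx \<Sigma> \<Delta>" "wf_fm \<Sigma> \<Delta> Q"
  shows "witness \<Delta> {Q} \<Delta> Q Var"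
  using assms by (auto simp: witness_def interp_id wf_hyps_def intro: deriv.Hyp)

lemma witness_deriv:
  assumes "deriv T \<Delta> {Q} P" "witness \<Gamma> \<Phi> \<Delta> Q v"
  shows "deriv T \<Gamma> \<Phi> (bind_fm (var_subst v) P)"
  using deriv_var_subst[OF assms(1) witnessD(1)[OF assms(2)] deriv_wf_hyps[OF witnessD(2)[OF assms(2)]]]
      witnessD(2)[OF assms(2)]
  by simp

lemma witness_append:
  assumes "witness \<Gamma> \<Phi> (\<Delta>' @ \<Delta>) (FAnd R (bind_fm (weaken (length \<Delta>')) Q)) v"
  shows "witness \<Gamma> \<Phi> (\<Delta>' @ \<Delta>) R v" "witness \<Gamma> \<Phi> \<Delta> Q (\<lambda>i. v (length \<Delta>' + i))"
  using assms interp_comp[OF interp_weaken[of \<Sigma> \<Delta> \<Delta>'], of \<Sigma> \<Gamma> "var_subst v"]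
  by (auto simp: witness_def deriv_And_iff var_subst_weaken)

lemma witness_closed: "witness \<Gamma> \<Phi> (\<Delta>' @ \<Delta>) Q v \<Longrightarrow> witness \<Gamma> \<Phi> \<Delta>' Q v"
  using interp_comp[OF interp_append_id[of \<Sigma> \<Delta>' \<Delta>], of \<Sigma> \<Gamma> "var_subst v"] by (simp add: witness_def)

lemma uniquely_existsD:
  assumes "uniquely_exists Ax \<Delta> Q"
  shows "wf_ctx \<Sigma> \<Delta>" "wf_fm \<Sigma> \<Delta> Q" "deriv T [] {} (exs \<Delta> Q)" "prov T (ex_unique \<Delta> Q)"
  using assms by (auto simp: uniquely_exists_def prov_def ex_unique_def deriv_And_iff)

lemma uniquely_exists_isos:
  assumes u: "uniquely_exists Ax \<Delta> Q" and v: "witness \<Gamma> \<Phi> \<Delta> Q v" and w: "witness \<Gamma> \<Phi> \<Delta> Q w"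
  shows "deriv T \<Gamma> \<Phi> (ex_iso \<Delta> v w)" "at_most_one_iso \<Gamma> \<Phi> \<Delta> v w"
proof -
  let ?n = "length \<Delta>"
  define u where "u k = (if k < ?n then w k else v (k - ?n))" for k
  note \<Delta> = uniquely_existsD(1)[OF u] and Q = uniquely_existsD(2)[OF u]
  have "prov T (alls (\<Delta> @ \<Delta>) (FImp (FAnd (bind_fm (weaken ?n) Q) Q) (ex_unique_iso \<Delta>)))"
    using uniquely_existsD(4)[OF u] by (simp add: ex_unique_def prov_def deriv_And_iff subst_fm_bind)
  moreover have "interp \<Sigma> (\<Delta> @ \<Delta>) \<Sigma> \<Gamma> (var_subst u)"
    unfolding u_def by (rule interp_var_subst_append[OF \<Delta> witnessD(1)[OF w] witnessD(1)[OF v]])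
  ultimately have "deriv T \<Gamma> \<Phi> (bind_fm (var_subst u)
      (FImp (FAnd (bind_fm (weaken ?n) Q) Q) (ex_unique_iso \<Delta>)))"
    using deriv_wf_hyps[OF witnessD(2)[OF v]] by (rule prov_alls_elim)
  moreover have "bind_fm (var_subst u) (bind_fm (weaken ?n) Q) = bind_fm (var_subst v) Q"
    "bind_fm (var_subst u) Q = bind_fm (var_subst w) Q"
    unfolding bind_fm_bind_fm var_subst_weaken by (rule bind_fm_pure_cong[OF Q]; simp add: u_def)+
  ultimately have "deriv T \<Gamma> \<Phi> (bind_fm (var_subst u) (ex_unique_iso \<Delta>))"
    using deriv.ImpE[OF _ deriv.AndI] witnessD(2)[OF v] witnessD(2)[OF w] by (metis bind_fm.simps(4,6))
  then have "deriv T \<Gamma> \<Phi> (ex_iso \<Delta> (\<lambda>i. u (?n + i)) u)"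
    and unique: "deriv T \<Gamma> \<Phi> (iso_unique \<Delta> (\<lambda>i. u (?n + i)) u)"
    by (simp_all add: ex_unique_iso_eq bind_fm_ex_iso[OF \<Delta>] bind_fm_iso_unique[OF \<Delta>] deriv_And_iff)
  moreover have "ctx_iso \<Delta> (\<lambda>i. W (u (?n + i))) (\<lambda>i. W (u i)) h = ctx_iso \<Delta> (\<lambda>i. W (v i)) (\<lambda>i. W (w i)) h"
    for W h
    by (rule ctx_iso_cong[OF \<Delta>]) (simp_all add: u_def)
  moreover have "iso_ctx_between \<Delta> (\<lambda>i. u (?n + i)) u = iso_ctx_between \<Delta> v w"
    by (rule iso_ctx_between_cong) (simp_all add: u_def)
  ultimately show "deriv T \<Gamma> \<Phi> (ex_iso \<Delta> v w)" by (simp add: ex_iso_def Let_def)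
  have "ctx_isomorphism \<Gamma> \<Phi> \<Delta> (\<lambda>i. u (?n + i)) u h \<longleftrightarrow> ctx_isomorphism \<Gamma> \<Phi> \<Delta> v w h" for h
    using ctx_iso_cong[OF \<Delta>, of "\<lambda>i. u (?n + i)" v u w h h]
    by (simp add: ctx_isomorphism_def components_def u_def)
  then show "at_most_one_iso \<Gamma> \<Phi> \<Delta> v w" using iso_unique_elim[OF \<Delta> unique] by (simp add: at_most_one_iso_def)
qed

lemma uniquely_existsI:
  assumes \<Delta>: "wf_ctx \<Sigma> \<Delta>" and Q: "wf_fm \<Sigma> \<Delta> Q" and ex: "deriv T [] {} (exs \<Delta> Q)"
    and isos: "\<And>\<Gamma> \<Phi> v w. witness \<Gamma> \<Phi> \<Delta> Q v \<Longrightarrow> witness \<Gamma> \<Phi> \<Delta> Q w \<Longrightarrow>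
      deriv T \<Gamma> \<Phi> (ex_iso \<Delta> v w) \<and> at_most_one_iso \<Gamma> \<Phi> \<Delta> v w"
  shows "uniquely_exists Ax \<Delta> Q"
proof -
  let ?n = "length \<Delta>"
  let ?v = "\<lambda>i. Var (?n + i) :: ptm" and ?\<Phi> = "{FAnd (bind_fm (weaken ?n) Q) Q}"
  have vs: "var_subst ?v = weaken ?n" by (simp add: weaken_def add.commute)
  have hyps: "wf_hyps T (\<Delta> @ \<Delta>) ?\<Phi>"
    using wf_ctx_append[OF \<Delta> \<Delta>] Q interp_weaken[of \<Sigma> \<Delta> \<Delta>]
    by (auto simp: wf_hyps_def wf_fm_append intro: wf_fm_bind)
  then have "deriv T (\<Delta> @ \<Delta>) ?\<Phi> (FAnd (bind_fm (weaken ?n) Q) Q)" by (simp add: deriv.Hyp)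
  then have v: "witness (\<Delta> @ \<Delta>) ?\<Phi> \<Delta> Q ?v" and w: "witness (\<Delta> @ \<Delta>) ?\<Phi> \<Delta> Q Var"
    by (auto simp: witness_def vs deriv_And_iff interp_weaken interp_append_id)
  have "deriv T (\<Delta> @ \<Delta>) ?\<Phi> (iso_unique \<Delta> ?v Var)"
    by (rule iso_unique_intro[OF \<Delta> witnessD(1)[OF v] witnessD(1)[OF w] hyps])
       (use isos v w witness_extends in blast)
  moreover have "deriv T (\<Delta> @ \<Delta>) ?\<Phi> (ex_iso \<Delta> ?v Var)" using isos[OF v w] by simp
  ultimately show ?thesis using \<Delta> Q ex
    by (simp add: uniquely_exists_def prov_def ex_unique_def ex_unique_iso_eq deriv_And_iff deriv_alls_iff
        deriv_Imp_iff subst_fm_bind)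
qed

lemma uniquely_exists_Nil: "uniquely_exists Ax [] FTop"
proof (rule uniquely_existsI)
  fix \<Gamma> \<Phi> v w assume "witness \<Gamma> \<Phi> [] FTop v"
  then show "deriv T \<Gamma> \<Phi> (ex_iso [] v w) \<and> at_most_one_iso \<Gamma> \<Phi> [] v w"
    by (simp add: witness_def at_most_one_iso_def ex_iso_def iso_ctx_between_def ctx_iso_def obj_vars_def
        deriv_Top_iff)
qed (simp_all add: deriv_Top_iff wf_hyps_Nil)

lemma uniquely_exists_extend:
  assumes u: "uniquely_exists Ax \<Delta> Q" and \<Delta>': "wf_ctx \<Sigma> (\<Delta>' @ \<Delta>)" and R: "wf_fm \<Sigma> (\<Delta>' @ \<Delta>) R"
    and ex: "deriv T \<Delta> {Q} (exs \<Delta>' R)"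
  defines "Q' \<equiv> FAnd R (bind_fm (weaken (length \<Delta>')) Q)"
  assumes extend_iso: "\<And>\<Gamma> \<Phi> v w h. witness \<Gamma> \<Phi> (\<Delta>' @ \<Delta>) Q' v \<Longrightarrow> witness \<Gamma> \<Phi> (\<Delta>' @ \<Delta>) Q' w \<Longrightarrow>
      ctx_isomorphism \<Gamma> \<Phi> \<Delta> (\<lambda>i. v (length \<Delta>' + i)) (\<lambda>i. w (length \<Delta>' + i)) h \<Longrightarrow>
          deriv T \<Gamma> \<Phi> (ex_iso (\<Delta>' @ \<Delta>) v w)"
    and unique: "\<And>\<Gamma> \<Phi> v w. witness \<Gamma> \<Phi> (\<Delta>' @ \<Delta>) Q' v \<Longrightarrow> witness \<Gamma> \<Phi> (\<Delta>' @ \<Delta>) Q' w \<Longrightarrow> at_most_one_iso \<Gamma> \<Phi> \<Delta>' v w"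
  shows "uniquely_exists Ax (\<Delta>' @ \<Delta>) Q'"
proof (rule uniquely_existsI[OF \<Delta>'])
  let ?n = "length \<Delta>'"
  note \<Delta> = uniquely_existsD(1)[OF u] and Q = uniquely_existsD(2)[OF u]
  show Q': "wf_fm \<Sigma> (\<Delta>' @ \<Delta>) Q'" using R wf_fm_bind[OF Q interp_weaken] by (simp add: Q'_def)
  have "deriv T (\<Delta>' @ \<Delta>) (insert R (bind_fm (weaken ?n) ` {Q})) Q'"
    unfolding Q'_def deriv_And_iff using Q' \<Delta>' by (auto simp: Q'_def wf_hyps_def intro!: deriv.Hyp)
  then have "deriv T \<Delta> {Q} (exs \<Delta>' Q')" by (rule deriv_exs_mono[OF ex])
  then show "deriv T [] {} (exs (\<Delta>' @ \<Delta>) Q')"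
    using deriv_exs_mono[OF uniquely_existsD(3)[OF u]] by (simp add: exs_append)
  fix \<Gamma> \<Phi> v w assume v: "witness \<Gamma> \<Phi> (\<Delta>' @ \<Delta>) Q' v" and w: "witness \<Gamma> \<Phi> (\<Delta>' @ \<Delta>) Q' w"
  note v\<Delta> = witness_append(2)[OF v[unfolded Q'_def]] and w\<Delta> = witness_append(2)[OF w[unfolded Q'_def]]
  have "deriv T \<Gamma> \<Phi> (ex_iso (\<Delta>' @ \<Delta>) v w)"
  proof (rule ex_iso_elim[OF \<Delta> witnessD(1)[OF v\<Delta>] witnessD(1)[OF w\<Delta>] uniquely_exists_isos(1)[OF u v\<Delta> w\<Delta>]])
    show "wf_fm \<Sigma> \<Gamma> (ex_iso (\<Delta>' @ \<Delta>) v w)"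
      by (rule wf_ex_iso[OF \<Delta>' witness_wf_ctx[OF v] witnessD(1)[OF v] witnessD(1)[OF w]])
    fix L \<Phi>' h
    assume "extends T L \<Phi>' \<Gamma> \<Phi>" "ctx_isomorphism (L @ \<Gamma>) \<Phi>' \<Delta> (\<lambda>i. bind_tm (weaken (length L)) (v (?n + i)))
      (\<lambda>i. bind_tm (weaken (length L)) (w (?n + i))) h"
    then show "deriv T (L @ \<Gamma>) \<Phi>' (bind_fm (weaken (length L)) (ex_iso (\<Delta>' @ \<Delta>) v w))"
      unfolding bind_fm_ex_iso[OF \<Delta>'] using extend_iso witness_extends v w by blast
  qed
  moreover have "at_most_one_iso \<Gamma> \<Phi> (\<Delta>' @ \<Delta>) v w"
    using unique[OF v w] uniquely_exists_isos(2)[OF u v\<Delta> w\<Delta>]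
    unfolding at_most_one_iso_def ctx_isomorphism_append length_append all_less_add_iff
    by (auto simp: nth_append) blast
  ultimately show "deriv T \<Gamma> \<Phi> (ex_iso (\<Delta>' @ \<Delta>) v w) \<and> at_most_one_iso \<Gamma> \<Phi> (\<Delta>' @ \<Delta>) v w" by blast
qed

lemma uniquely_exists_append:
  assumes u: "uniquely_exists Ax \<Delta> Q" and u': "uniquely_exists Ax \<Delta>' Q'"
  shows "uniquely_exists Ax (\<Delta>' @ \<Delta>) (FAnd Q' (bind_fm (weaken (length \<Delta>')) Q))"
proof (rule uniquely_exists_extend[OF u])
  let ?n = "length \<Delta>'" and ?QQ = "FAnd Q' (bind_fm (weaken (length \<Delta>')) Q)"
  note \<Delta> = uniquely_existsD(1)[OF u] and \<Delta>' = uniquely_existsD(1)[OF u']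
  show \<Delta>\<Delta>: "wf_ctx \<Sigma> (\<Delta>' @ \<Delta>)" by (rule wf_ctx_append[OF \<Delta>' \<Delta>])
  show "wf_fm \<Sigma> (\<Delta>' @ \<Delta>) Q'" by (rule wf_fm_append[OF uniquely_existsD(2)[OF u']])
  show "deriv T \<Delta> {Q} (exs \<Delta>' Q')"
    by (rule deriv_weaken_closed[OF uniquely_existsD(3)[OF u']])
       (simp add: wf_hyps_def \<Delta> uniquely_existsD(2)[OF u])
  fix \<Gamma> \<Phi> v w assume v: "witness \<Gamma> \<Phi> (\<Delta>' @ \<Delta>) ?QQ v" and w: "witness \<Gamma> \<Phi> (\<Delta>' @ \<Delta>) ?QQ w"
  note v' = witness_closed[OF witness_append(1)[OF v]] and w' = witness_closed[OF witness_append(1)[OF w]]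
  note isos = uniquely_exists_isos[OF u' v' w']
  show "at_most_one_iso \<Gamma> \<Phi> \<Delta>' v w" by (rule isos(2))
  fix h assume h: "ctx_isomorphism \<Gamma> \<Phi> \<Delta> (\<lambda>i. v (?n + i)) (\<lambda>i. w (?n + i)) h"
  show "deriv T \<Gamma> \<Phi> (ex_iso (\<Delta>' @ \<Delta>) v w)"
  proof (rule ex_iso_elim[OF \<Delta>' witnessD(1)[OF v'] witnessD(1)[OF w'] isos(1)])
    show "wf_fm \<Sigma> \<Gamma> (ex_iso (\<Delta>' @ \<Delta>) v w)"
      by (rule wf_ex_iso[OF \<Delta>\<Delta> witness_wf_ctx[OF v] witnessD(1)[OF v] witnessD(1)[OF w]])
    fix L :: pctx and \<Phi>' h'
    let ?W = "bind_tm (weaken (length L)) :: ptm \<Rightarrow> ptm"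
    let ?h = "\<lambda>i. if i < ?n then h' i else ?W (h (i - ?n))"
    assume ext: "extends T L \<Phi>' \<Gamma> \<Phi>" and h': "ctx_isomorphism (L @ \<Gamma>) \<Phi>' \<Delta>' (\<lambda>i. ?W (v i)) (\<lambda>i. ?W (w i)) h'"
    have "ctx_isomorphism (L @ \<Gamma>) \<Phi>' (\<Delta>' @ \<Delta>) (\<lambda>i. ?W (v i)) (\<lambda>i. ?W (w i)) ?h"
      unfolding ctx_isomorphism_append
      using ctx_isomorphism_extends[OF \<Delta> h ext] h' ctx_isomorphism_cong[OF \<Delta>', of h' ?h] by simp
    then show "deriv T (L @ \<Gamma>) \<Phi>' (bind_fm (weaken (length L)) (ex_iso (\<Delta>' @ \<Delta>) v w))"
      unfolding bind_fm_ex_iso[OF \<Delta>\<Delta>]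
      using ex_iso_intro[OF \<Delta>\<Delta>] witnessD(1)[OF witness_extends[OF v ext]]
          witnessD(1)[OF witness_extends[OF w ext]] by blast
  qed
qed

lemma ctx_isomorphism_inverses:
  assumes v: "interp \<Sigma> \<Delta> \<Sigma> \<Gamma> (var_subst v)" and h: "ctx_isomorphism \<Gamma> \<Phi> \<Delta> v w h" and \<psi>: "wf_fm \<Sigma> \<Gamma> \<psi>"
    and step: "\<And>L \<Phi>' k. extends T L \<Phi>' \<Gamma> \<Phi> \<Longrightarrow>
      (\<And>i. i < length \<Delta> \<Longrightarrow> \<Delta> ! i = Ob \<Longrightarrow> inverse_arrows (L @ \<Gamma>) \<Phi>' (bind_tm (weaken (length L)) (v i))
        (bind_tm (weaken (length L)) (w i)) (bind_tm (weaken (length L)) (h i)) (k i)) \<Longrightarrow>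
      deriv T (L @ \<Gamma>) \<Phi>' (bind_fm (weaken (length L)) \<psi>)"
  shows "deriv T \<Gamma> \<Phi> \<psi>"
proof (rule deriv_Ex_list_elim[OF \<psi>, where xs = "obj_vars \<Delta>"])
  have iso: "deriv T \<Gamma> \<Phi> (ctx_iso \<Delta> v w h)"
    and comps: "components \<Sigma> \<Gamma> \<Delta> v w h" using h by (simp_all add: ctx_isomorphism_def)
  show "wf_hyps T \<Gamma> \<Phi>" using deriv_wf_hyps[OF iso] .
  let ?B = "\<lambda>i. FAnd (FEq (Cmp (Var 0) (bind_tm weaken1 (h i))) (Idn (bind_tm weaken1 (v i))))
    (FEq (Cmp (bind_tm weaken1 (h i)) (Var 0)) (Idn (bind_tm weaken1 (w i))))"
  show "deriv T \<Gamma> \<Phi> (FEx (Hom (w i) (v i)) (?B i))" if "i \<in> set (obj_vars \<Delta>)" for i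
    using that iso by (auto simp: set_obj_vars deriv_ctx_iso_iff iso_fm_weaken1)
  fix L \<Phi>' k
  assume ext: "extends T L \<Phi>' \<Gamma> \<Phi>" and k: "\<And>i. i \<in> set (obj_vars \<Delta>) \<Longrightarrow>
      has_sort \<Sigma> (L @ \<Gamma>) (k i) (bind_srt (weaken (length L)) (Hom (w i) (v i))) \<and>
      deriv T (L @ \<Gamma>) \<Phi>' (bind_fm (scons (k i) (weaken (length L))) (?B i))"
  have "has_sort \<Sigma> (L @ \<Gamma>) (bind_tm (weaken (length L)) (h i))
      (bind_srt (weaken (length L)) (Hom (v i) (w i)))"
    if "i < length \<Delta>" "\<Delta> ! i = Ob" for i
    using that comps interp_weaken
    by (auto simp: components_def intro!: has_sort_bind simp del: bind_srt.simps)
  then show "deriv T (L @ \<Gamma>) \<Phi>' (bind_fm (weaken (length L)) \<psi>)"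
    using k by (intro step[OF ext, of k]) (simp add: inverse_arrows_def set_obj_vars deriv_And_iff)
qed

lemma ctx_isomorphism_nat_iso:
  assumes \<Delta>: "wf_ctx \<Sigma> \<Delta>" and v: "interp \<Sigma> \<Delta> \<Sigma> \<Gamma> (var_subst v)" and w: "interp \<Sigma> \<Delta> \<Sigma> \<Gamma> (var_subst w)"
    and h: "ctx_isomorphism \<Gamma> \<Phi> \<Delta> v w h"
    and k: "\<And>i. i < length \<Delta> \<Longrightarrow> \<Delta> ! i = Ob \<Longrightarrow> inverse_arrows \<Gamma> \<Phi> (v i) (w i) (h i) (k i)"
  shows "nat_iso \<Sigma> \<Delta> \<Gamma> \<Phi> (var_subst v) (var_subst w) (var_subst h) (var_subst k)"
  unfolding nat_iso_def
proof (intro conjI allI impI wf_sig_pure \<Delta> v w)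
  have iso: "deriv T \<Gamma> \<Phi> (ctx_iso \<Delta> v w h)" using h by (simp add: ctx_isomorphism_def)
  show "wf_hyps T \<Gamma> \<Phi>" using deriv_wf_hyps[OF iso] .
  show "inverse_arrows \<Gamma> \<Phi> (var_subst v x) (var_subst w x) (var_subst h x) (var_subst k x)"
    if "has_sort \<Sigma> \<Delta> (atom_tm x) Ob" for x
    using that k by (cases x) (auto simp: has_sort_iffs)
  fix x y z assume x: "has_sort \<Sigma> \<Delta> (atom_tm x) (Hom (atom_tm y) (atom_tm z))"
  then obtain i where i: "x = AVar i" "i < length \<Delta>"
    "Hom (atom_tm y) (atom_tm z) = bind_srt (weaken (Suc i)) (\<Delta> ! i)"
    by (cases x) (auto simp: has_sort_iffs)
  obtain a b where ab: "\<Delta> ! i = Hom (Var a) (Var b)"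
    using \<Delta> i(2) by (cases rule: pure_ctxE) (use i(3) in auto)
  have "y = AVar (Suc (i + a))" "z = AVar (Suc (i + b))" using i(3) ab by (cases y; cases z; simp)+
  then show "commutes \<Gamma> \<Phi> (var_subst h y) (var_subst h z) (var_subst v x) (var_subst w x)"
    using iso[unfolded deriv_ctx_iso_iff, THEN conjunct2, rule_format, OF i(2)] i(1) ab
    by (simp add: commutes_def)
qed

definition unique_solutions :: "pctx \<Rightarrow> pfm \<Rightarrow> nat \<Rightarrow> nat \<Rightarrow> pfm \<Rightarrow> bool" where
  "unique_solutions \<Delta> Q a b R \<longleftrightarrow> (\<forall>\<Gamma> \<Phi> v f g. witness \<Gamma> \<Phi> \<Delta> Q v \<longrightarrow>
     has_sort \<Sigma> \<Gamma> f (Hom (v a) (v b)) \<longrightarrow> has_sort \<Sigma> \<Gamma> g (Hom (v a) (v b)) \<longrightarrow>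
     deriv T \<Gamma> \<Phi> (bind_fm (scons f (var_subst v)) R) \<longrightarrow> deriv T \<Gamma> \<Phi> (bind_fm (scons g (var_subst v)) R) \<longrightarrow>
     deriv T \<Gamma> \<Phi> (FEq f g))"

text \<open>
  An arrow that is defined in terms of a context may be added to it: the isomorphism transports one
  solution of the definition to a solution, and solutions are unique.
\<close>

lemma unique_solutions_natural:
  fixes a b :: nat
  defines "s \<equiv> Hom (Var a) (Var b)"
  assumes \<Delta>: "wf_ctx \<Sigma> \<Delta>" and s: "wf_srt \<Sigma> \<Delta> s" and R: "wf_fm \<Sigma> (s # \<Delta>) R"
    and unique: "unique_solutions \<Delta> Q a b R"
    and v: "witness \<Gamma> \<Phi> (s # \<Delta>) (FAnd R (bind_fm weaken1 Q)) v"
    and w: "witness \<Gamma> \<Phi> (s # \<Delta>) (FAnd R (bind_fm weaken1 Q)) w"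
    and h: "ctx_isomorphism \<Gamma> \<Phi> \<Delta> (\<lambda>i. v (Suc i)) (\<lambda>i. w (Suc i)) h"
    and k: "\<And>i. i < length \<Delta> \<Longrightarrow> \<Delta> ! i = Ob \<Longrightarrow> inverse_arrows \<Gamma> \<Phi> (v (Suc i)) (w (Suc i)) (h i) (k i)"
  shows "commutes \<Gamma> \<Phi> (h a) (h b) (v 0) (w 0)"
proof -
  let ?v = "\<lambda>i. v (Suc i)" and ?w = "\<lambda>i. w (Suc i)"
  have v\<Delta>: "witness \<Gamma> \<Phi> \<Delta> Q ?v" and w\<Delta>: "witness \<Gamma> \<Phi> \<Delta> Q ?w"
    and vR: "witness \<Gamma> \<Phi> (s # \<Delta>) R v" and wR: "witness \<Gamma> \<Phi> (s # \<Delta>) R w"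
    using witness_append[of \<Gamma> \<Phi> "[s]"] v w by simp_all
  have v0: "has_sort \<Sigma> \<Gamma> (v 0) (Hom (?v a) (?v b))" and w0: "has_sort \<Sigma> \<Gamma> (w 0) (Hom (?w a) (?w b))"
    using interp_pure_Hom[OF witnessD(1)[OF v], of 0] interp_pure_Hom[OF witnessD(1)[OF w], of 0]
    by (simp_all add: s_def)
  have iso: "nat_iso \<Sigma> \<Delta> \<Gamma> \<Phi> (var_subst ?v) (var_subst ?w) (var_subst h) (var_subst k)"
    by (rule ctx_isomorphism_nat_iso[OF \<Delta> witnessD(1)[OF v\<Delta>] witnessD(1)[OF w\<Delta>] h k])
  obtain g hf kf where g: "has_sort \<Sigma> \<Gamma> g (Hom (?w a) (?w b))" and iso': "nat_iso \<Sigma> (s # \<Delta>) \<Gamma> \<Phi>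
      (scons (v 0) (var_subst ?v)) (scons g (var_subst ?w)) (scons hf (var_subst h)) (scons kf (var_subst k))"
    using nat_iso_transport[OF iso s, of "v 0"] v0 by (auto simp: s_def)
  have "deriv T \<Gamma> \<Phi> (bind_fm (scons g (var_subst ?w)) R)"
    using iso_invariantD[OF wf_fm_iso_invariant[OF R] iso'] witnessD(2)[OF vR] by (simp flip: var_subst_Suc)
  moreover have "deriv T \<Gamma> \<Phi> (bind_fm (scons (w 0) (var_subst ?w)) R)"
    using witnessD(2)[OF wR] by (simp flip: var_subst_Suc)
  ultimately have "deriv T \<Gamma> \<Phi> (FEq g (w 0))" using unique w\<Delta> g w0 unfolding unique_solutions_def by blast
  moreover have "commutes \<Gamma> \<Phi> (h a) (h b) (v 0) g"
    using nat_isoD(8)[OF iso', of "AVar 0" "AVar (Suc a)" "AVar (Suc b)"] by (simp add: s_def)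
  moreover have "has_sort \<Sigma> \<Gamma> (Cmp g (h a)) (Hom (?v a) (?w b))"
    using g nat_isoD(7)[OF iso, of "AVar a"] s has_sort_Cmp by (simp add: s_def)
  ultimately show ?thesis unfolding commutes_def using eq_trans cmp_cong_left by blast
qed

lemma uniquely_exists_arrow:
  fixes a b :: nat
  defines "s \<equiv> Hom (Var a) (Var b)"
  assumes u: "uniquely_exists Ax \<Delta> Q" and s: "wf_srt \<Sigma> \<Delta> s" and R: "wf_fm \<Sigma> (s # \<Delta>) R"
    and ex: "deriv T \<Delta> {Q} (FEx s R)" and unique: "unique_solutions \<Delta> Q a b R"
  shows "uniquely_exists Ax (s # \<Delta>) (FAnd R (bind_fm weaken1 Q))"
proof -
  note \<Delta> = uniquely_existsD(1)[OF u]
  have s\<Delta>: "wf_ctx \<Sigma> (s # \<Delta>)" using \<Delta> s by simp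
  have "uniquely_exists Ax ([s] @ \<Delta>) (FAnd R (bind_fm (weaken (length [s])) Q))"
  proof (rule uniquely_exists_extend[OF u])
    let ?Q = "FAnd R (bind_fm (weaken (length [s])) Q)"
    fix \<Gamma> \<Phi> v w h
    assume v: "witness \<Gamma> \<Phi> ([s] @ \<Delta>) ?Q v" and w: "witness \<Gamma> \<Phi> ([s] @ \<Delta>) ?Q w"
      and h: "ctx_isomorphism \<Gamma> \<Phi> \<Delta> (\<lambda>i. v (length [s] + i)) (\<lambda>i. w (length [s] + i)) h"
    show "deriv T \<Gamma> \<Phi> (ex_iso ([s] @ \<Delta>) v w)"
    proof (rule ctx_isomorphism_inverses[OF witnessD(1)[OF witness_append(2)[OF v]] h])
      show "wf_fm \<Sigma> \<Gamma> (ex_iso ([s] @ \<Delta>) v w)"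
        using wf_ex_iso[OF _ witness_wf_ctx[OF v] witnessD(1)[OF v] witnessD(1)[OF w]] s\<Delta> by simp
      fix L :: pctx and \<Phi>' k
      let ?W = "bind_tm (weaken (length L)) :: ptm \<Rightarrow> ptm"
      assume ext: "extends T L \<Phi>' \<Gamma> \<Phi>" and k: "\<And>i. i < length \<Delta> \<Longrightarrow> \<Delta> ! i = Ob \<Longrightarrow>
          inverse_arrows (L @ \<Gamma>) \<Phi>' (?W (v (length [s] + i))) (?W (w (length [s] + i))) (?W (h i)) (k i)"
      note Wv = witness_extends[OF v ext] and Ww = witness_extends[OF w ext]
        and Wh = ctx_isomorphism_extends[OF \<Delta> h ext]
      have "commutes (L @ \<Gamma>) \<Phi>' (?W (h a)) (?W (h b)) (?W (v 0)) (?W (w 0))"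
        by (rule unique_solutions_natural[OF \<Delta> s[unfolded s_def] R[unfolded s_def] unique,
              of _ _ "\<lambda>i. ?W (v i)" "\<lambda>i. ?W (w i)" "\<lambda>i. ?W (h i)" k])
           (use Wv Ww Wh k in \<open>simp_all add: s_def\<close>)
      then have "ctx_isomorphism (L @ \<Gamma>) \<Phi>' ([s] @ \<Delta>) (\<lambda>i. ?W (v i)) (\<lambda>i. ?W (w i)) (\<lambda>i. ?W (h (i - 1)))"
        unfolding ctx_isomorphism_append using Wh by (simp add: s_def ctx_isomorphism_arrow)
      then show "deriv T (L @ \<Gamma>) \<Phi>' (bind_fm (weaken (length L)) (ex_iso ([s] @ \<Delta>) v w))"
        using ex_iso_intro[OF _ witnessD(1)[OF Wv] witnessD(1)[OF Ww]] s\<Delta> by (simp add: bind_fm_ex_iso)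
    qed
  qed (use s\<Delta> R ex in \<open>simp_all add: at_most_one_iso_def s_def\<close>)
  then show ?thesis by simp
qed

end

section \<open>Unique existence of an arrow\<close>

lemma ex_unique_arrow:
  "ex_unique [Hom (OCon A) (OCon B)] P = FAnd (FEx (Hom (OCon A) (OCon B)) P)
    (FAll (Hom (OCon A) (OCon B)) (FAll (Hom (OCon A) (OCon B)) (FImp (FAnd (bind_fm weaken1 P) P)
      (let E = FAnd (FEq (Cmp (Idn (OCon B)) (Var 1)) (Cmp (Var 0) (Idn (OCon A)))) FTop in FAnd E
          (FImp (FAnd E E) FTop)))))"
  by (simp add: ex_unique_def ex_unique_iso_def iso_ctx_def obj_vars_def ctx_iso_def comp_at_def Let_def
      subst_fm_bind)

definition defines_arrow :: "('o, 'a) thy \<Rightarrow> 'o \<Rightarrow> 'o \<Rightarrow> ('o, 'a) fm \<Rightarrow> bool" where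
  "defines_arrow T A B P \<longleftrightarrow> prov T (ex_unique [Hom (OCon A) (OCon B)] P)"

lemma defines_arrow_wf:
  assumes "defines_arrow T A B P"
  shows "A \<in> ocons (sg T)" "B \<in> ocons (sg T)" "wf_fm (sg T) [Hom (OCon A) (OCon B)] P"
proof -
  have "sentence (sg T) (ex_unique [Hom (OCon A) (OCon B)] P)"
    using assms deriv_wf_fm by (auto simp: defines_arrow_def prov_def)
  then show "A \<in> ocons (sg T)" "B \<in> ocons (sg T)" "wf_fm (sg T) [Hom (OCon A) (OCon B)] P"
    by (auto simp: ex_unique_arrow has_sort_iffs)
qed

context eq_theory
begin

lemma ex_unique_arrow_ex:
  assumes "deriv T \<Gamma> \<Phi> (bind_fm J (ex_unique [Hom (OCon A) (OCon B)] P))"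
  shows "deriv T \<Gamma> \<Phi> (FEx (Hom (J (AObj A)) (J (AObj B))) (bind_fm (lift J) P))"
  using assms unfolding ex_unique_arrow by (simp add: deriv_And_iff)

lemma ex_unique_arrow_eq:
  assumes unique: "deriv T \<Gamma> \<Phi> (bind_fm J (ex_unique [Hom (OCon A) (OCon B)] P))"
    and P: "wf_fm \<Sigma> [Hom (OCon A) (OCon B)] P"
    and f: "has_sort (sg T) \<Gamma> f (Hom (J (AObj A)) (J (AObj B)))"
    and g: "has_sort (sg T) \<Gamma> g (Hom (J (AObj A)) (J (AObj B)))"
    and Pf: "deriv T \<Gamma> \<Phi> (bind_fm (scons f J) P)" and Pg: "deriv T \<Gamma> \<Phi> (bind_fm (scons g J) P)"
  shows "deriv T \<Gamma> \<Phi> (FEq f g)"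
proof -
  let ?s = "Hom (OCon A) (OCon B)"
    and ?E = "FAnd (FEq (Cmp (Idn (OCon B)) (Var 1)) (Cmp (Var 0) (Idn (OCon A)))) FTop"
  let ?B = "FImp (FAnd (bind_fm weaken1 P) P) (FAnd ?E (FImp (FAnd ?E ?E) FTop))"
  have "deriv T \<Gamma> \<Phi> (FAll (bind_srt J ?s) (bind_fm (lift J) (FAll ?s ?B)))"
    using unique unfolding ex_unique_arrow Let_def by (simp add: deriv_And_iff)
  from deriv_AllE[OF this[unfolded bind_srt.simps bind_tm.simps] f]
  have "deriv T \<Gamma> \<Phi> (FAll (bind_srt J ?s) (bind_fm (lift (scons f J)) ?B))"
    by (simp add: lift_def del: bind_fm.simps(1-6))
  from deriv_AllE[OF this[unfolded bind_srt.simps bind_tm.simps] g]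
  have imp: "deriv T \<Gamma> \<Phi> (bind_fm (scons g (scons f J)) ?B)" by (simp add: lift_def del: bind_fm.simps(1-6))
  have "bind_fm (scons g (scons f J)) P = bind_fm (scons g J) P"
    by (rule bind_fm_cong[OF P]) (simp add: agree_on_iff)
  then have "deriv T \<Gamma> \<Phi> (FEq (Cmp (Idn (J (AObj B))) f) (Cmp g (Idn (J (AObj A)))))"
    using deriv.ImpE[OF imp[unfolded bind_fm.simps]] Pf Pg by (simp add: deriv_And_iff)
  then show ?thesis
    using cmp_Idn_left[OF deriv_wf_hyps[OF Pf] f] cmp_Idn_right[OF deriv_wf_hyps[OF Pf] g]
    by (blast intro: eq_trans eq_sym)
qed

lemma defines_arrow_ex:
  assumes "defines_arrow T A B P" "wf_hyps T \<Gamma> \<Phi>"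
  shows "deriv T \<Gamma> \<Phi> (FEx (Hom (OCon A) (OCon B)) P)"
  using ex_unique_arrow_ex[of \<Gamma> \<Phi> atom_tm] deriv_weaken_closed[OF _ assms(2)] assms(1)
  by (simp add: defines_arrow_def prov_def)

lemma defines_arrow_unique:
  assumes P: "defines_arrow T A B P"
    and f: "has_sort (sg T) \<Gamma> f (Hom (OCon A) (OCon B))" "deriv T \<Gamma> \<Phi> (inst f P)"
    and g: "has_sort (sg T) \<Gamma> g (Hom (OCon A) (OCon B))" "deriv T \<Gamma> \<Phi> (inst g P)"
  shows "deriv T \<Gamma> \<Phi> (FEq f g)"
proof -
  have "deriv T \<Gamma> \<Phi> (bind_fm atom_tm (ex_unique [Hom (OCon A) (OCon B)] P))"
    using deriv_weaken_closed[OF _ deriv_wf_hyps[OF f(2)]] P by (simp add: defines_arrow_def prov_def)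
  then show ?thesis by (rule ex_unique_arrow_eq[OF _ defines_arrow_wf(3)[OF P]])
     (use f g in \<open>simp_all add: inst_bind\<close>)
qed

lemma defines_arrowI:
  assumes A: "A \<in> ocons (sg T)" and B: "B \<in> ocons (sg T)" and P: "wf_fm (sg T) [Hom (OCon A) (OCon B)] P"
    and ex: "deriv T [] {} (FEx (Hom (OCon A) (OCon B)) P)"
    and unique: "\<And>\<Gamma> \<Phi> f g. has_sort (sg T) \<Gamma> f (Hom (OCon A) (OCon B)) \<Longrightarrow>
        has_sort (sg T) \<Gamma> g (Hom (OCon A) (OCon B)) \<Longrightarrow>
      deriv T \<Gamma> \<Phi> (inst f P) \<Longrightarrow> deriv T \<Gamma> \<Phi> (inst g P) \<Longrightarrow> deriv T \<Gamma> \<Phi> (FEq f g)"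
  shows "defines_arrow T A B P"
proof -
  let ?s = "Hom (OCon A) (OCon B)"
    and ?E = "FAnd (FEq (Cmp (Idn (OCon B)) (Var 1)) (Cmp (Var 0) (Idn (OCon A)))) FTop"
  let ?\<Gamma> = "[?s, ?s]" and ?\<Phi> = "{FAnd (bind_fm weaken1 P) P}"
  have \<Gamma>: "wf_ctx (sg T) ?\<Gamma>" using A B by (auto simp: has_sort_iffs)
  have vars: "has_sort (sg T) ?\<Gamma> (Var 1) ?s" "has_sort (sg T) ?\<Gamma> (Var 0) ?s" by (auto simp: has_sort_Var_iff)
  have hyps: "wf_hyps T ?\<Gamma> ?\<Phi>"
    using \<Gamma> P wf_fm_append[of _ "[?s]" P "[?s]"] by (auto simp: wf_hyps_def wf_fm_weaken1_iff)
  have "deriv T ?\<Gamma> ?\<Phi> (FAnd (bind_fm weaken1 P) P)" using hyps by (auto intro: deriv.Hyp)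
  moreover have "inst (Var 1) P = bind_fm weaken1 P" "inst (Var 0) P = bind_fm atom_tm P"
    unfolding inst_bind by (rule bind_fm_cong[OF P]; auto simp: agree_on_iff scons_AVar split: nat.splits)+
  ultimately have "deriv T ?\<Gamma> ?\<Phi> (FEq (Var 1) (Var 0))" using unique[OF vars] by (simp add: deriv_And_iff)
  then have "deriv T ?\<Gamma> ?\<Phi> (FEq (Cmp (Idn (OCon B)) (Var 1)) (Cmp (Var 0) (Idn (OCon A))))"
    by (meson eq_trans eq_sym cmp_Idn_left[OF hyps vars(1)] cmp_Idn_right[OF hyps vars(2)])
  then have E: "deriv T ?\<Gamma> ?\<Phi> ?E" using hyps by (simp add: deriv_And_iff deriv_Top_iff)
  then have "wf_hyps T ?\<Gamma> (insert (FAnd ?E ?E) ?\<Phi>)"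
    unfolding wf_hyps_insert[of _ _ "FAnd ?E ?E"] using hyps deriv_wf_fm[OF E] by simp
  then have "deriv T ?\<Gamma> ?\<Phi> (FImp (FAnd ?E ?E) FTop)" by (intro deriv.ImpI deriv.TopI)
  with E show ?thesis using ex
    by (simp add: defines_arrow_def prov_def ex_unique_arrow Let_def deriv_And_iff deriv_All_iff
      deriv_Imp_iff)
qed

lemma defines_arrow_eq_tm:
  assumes A: "A \<in> ocons (sg T)" and B: "B \<in> ocons (sg T)"
    and t: "\<And>\<Gamma>. has_sort (sg T) \<Gamma> t (Hom (OCon A) (OCon B))" and closed: "\<And>u. bind_tm (scons u atom_tm) t = t"
  shows "defines_arrow T A B (FEq (Var 0) t)"
proof (rule defines_arrowI[OF A B])
  show wf: "wf_fm (sg T) [Hom (OCon A) (OCon B)] (FEq (Var 0) t)"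
    using t[of "[Hom (OCon A) (OCon B)]"] by auto
  show "deriv T [] {} (FEx (Hom (OCon A) (OCon B)) (FEq (Var 0) t))"
    by (rule deriv_ExI[OF _ t]) (use wf A B eq_refl[OF wf_hyps_Nil t] closed in \<open>simp_all add: has_sort_iffs\<close>)
qed (auto simp: inst_bind closed intro: eq_trans eq_sym)

end

section \<open>The theories with constants\<close>

definition pure_subst :: "(nat \<Rightarrow> ('p, 'b) tm) \<Rightarrow> (unit, unit) atom \<Rightarrow> ('p, 'b) tm" where
  "pure_subst \<sigma> x = (case x of AVar i \<Rightarrow> \<sigma> i | _ \<Rightarrow> undefined)"

lemma pure_subst_AVar [simp]: "pure_subst \<sigma> (AVar i) = \<sigma> i"
  by (simp add: pure_subst_def)

lemma cat_eq_axioms_map: "cat_eq_axioms \<subseteq> map_fm f g ` cat_eq_axioms"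
  unfolding cat_eq_axioms_def
  by (simp add: image_image allO_def allA_def bEq_def bImp_def bAnd_def bId_def bCmp_def lev_def)

lemma interp_con_map_closed:
  assumes "\<And>c. c \<in> ocons \<Sigma> \<Longrightarrow> f c \<in> ocons \<Sigma>'" "\<And>a. a \<in> acons \<Sigma> \<Longrightarrow> g a \<in> acons \<Sigma>'"
    "\<And>a. a \<in> acons \<Sigma> \<Longrightarrow> cdom \<Sigma>' (g a) = f (cdom \<Sigma> a) \<and> ccod \<Sigma>' (g a) = f (ccod \<Sigma> a)"
  shows "interp \<Sigma> [] \<Sigma>' [] (con_map f g)"
  using assms by (simp add: interp_iff has_sort_iffs)

definition cst_thy :: "pfm set \<Rightarrow> (pctx \<times> pfm) set \<Rightarrow> (cst, cst) thy" where
  "cst_thy Ax K = \<lparr>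
     sg = \<lparr>ocons = {Cst \<Delta> P i | \<Delta> P i. (\<Delta>, P) \<in> K \<and> i < length \<Delta> \<and> \<Delta> ! i = Ob},
           acons = {Cst \<Delta> P i | \<Delta> P i. (\<Delta>, P) \<in> K \<and> i < length \<Delta> \<and> \<Delta> ! i \<noteq> Ob},
           cdom = cst_dom, ccod = cst_cod\<rparr>,
     axms = emb ` Ax \<union> {subst_fm (cst_tm \<Delta> P) (emb P) | \<Delta> P. (\<Delta>, P) \<in> K}\<rparr>"

definition ctx_defs :: "pfm set \<Rightarrow> (pctx \<times> pfm) set" where
  "ctx_defs Ax = {(\<Delta>, P). uniquely_exists Ax \<Delta> P}"

definition arr_defs :: "pfm set \<Rightarrow> (cst \<times> cst \<times> (cst, cst) fm) set" where
  "arr_defs Ax = {(A, B, P). defines_arrow (thy1 Ax) A B P}"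

text \<open>The part of \<open>T\<^sub>c\<close>, before provably equal constants are identified, that comes from given definitions.\<close>

definition fragment :: "pfm set \<Rightarrow> (pctx \<times> pfm) set \<Rightarrow> (cst \<times> cst \<times> (cst, cst) fm) set \<Rightarrow> (cst, acst) thy" where
  "fragment Ax K D = \<lparr>
     sg = \<lparr>ocons = ocons (sg (cst_thy Ax K)),
           acons = Old ` acons (sg (cst_thy Ax K)) \<union> {Def A B P | A B P. (A, B, P) \<in> D},
           cdom = (\<lambda>a. case a of Old c \<Rightarrow> cst_dom c | Def A B P \<Rightarrow> A),
           ccod = (\<lambda>a. case a of Old c \<Rightarrow> cst_cod c | Def A B P \<Rightarrow> B)\<rparr>,
     axms = map_fm id Old ` axms (cst_thy Ax K) \<union> {inst (ACon (Def A B P)) (map_fm id Old P) | A B P.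
         (A, B, P) \<in> D}\<rparr>"

lemma thy1_eq_cst_thy: "thy1 Ax = cst_thy Ax (ctx_defs Ax)"
  by (simp add: thy1_def cst_thy_def ctx_defs_def)

lemma thy2_eq_fragment: "thy2 Ax = fragment Ax (ctx_defs Ax) (arr_defs Ax)"
proof -
  have "arr_defs Ax = {(A, B, P). A \<in> ocons (sg (thy1 Ax)) \<and> B \<in> ocons (sg (thy1 Ax)) \<and>
      wf_fm (sg (thy1 Ax)) [Hom (OCon A) (OCon B)] P \<and> prov (thy1 Ax) (ex_unique [Hom (OCon A) (OCon B)] P)}"
    using defines_arrow_wf[of "thy1 Ax"] by (auto simp: arr_defs_def defines_arrow_def)
  then show ?thesis by (simp add: thy2_def fragment_def thy1_eq_cst_thy Let_def)
qed

lemma cst_thy_simps: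
  "ocons (sg (cst_thy Ax K)) = {Cst \<Delta> P i | \<Delta> P i. (\<Delta>, P) \<in> K \<and> i < length \<Delta> \<and> \<Delta> ! i = Ob}"
  "acons (sg (cst_thy Ax K)) = {Cst \<Delta> P i | \<Delta> P i. (\<Delta>, P) \<in> K \<and> i < length \<Delta> \<and> \<Delta> ! i \<noteq> Ob}"
  "cdom (sg (cst_thy Ax K)) = cst_dom" "ccod (sg (cst_thy Ax K)) = cst_cod"
  "axms (cst_thy Ax K) = emb ` Ax \<union> {subst_fm (cst_tm \<Delta> P) (emb P) | \<Delta> P. (\<Delta>, P) \<in> K}"
  by (simp_all add: cst_thy_def)

lemma fragment_simps:
  "ocons (sg (fragment Ax K D)) = ocons (sg (cst_thy Ax K))"
  "acons (sg (fragment Ax K D)) = Old ` acons (sg (cst_thy Ax K)) \<union> {Def A B P | A B P. (A, B, P) \<in> D}"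
  "cdom (sg (fragment Ax K D)) (Old c) = cst_dom c" "cdom (sg (fragment Ax K D)) (Def A B P) = A"
  "ccod (sg (fragment Ax K D)) (Old c) = cst_cod c" "ccod (sg (fragment Ax K D)) (Def A B P) = B"
  "axms (fragment Ax K D) = map_fm id Old ` axms (cst_thy Ax K) \<union>
     {inst (ACon (Def A B P)) (map_fm id Old P) | A B P. (A, B, P) \<in> D}"
  by (simp_all add: fragment_def)

lemma interp_Old: "interp (sg (cst_thy Ax K)) [] (sg (fragment Ax K D)) [] (con_map id Old)"
  by (rule interp_con_map_closed) (auto simp: fragment_simps cst_thy_simps(3,4))

lemma wf_fm_map_Old:
  assumes "wf_fm (sg (cst_thy Ax K)) [Hom (OCon A) (OCon B)] P"
  shows "wf_fm (sg (fragment Ax K D)) [Hom (OCon A) (OCon B)] (map_fm id Old P)"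
  using wf_fm_bind[OF assms interp_lift[OF interp_Old]] by (simp add: map_fm_bind)

context pure_theory
begin

abbreviation T1 :: "(cst, cst) thy" where "T1 \<equiv> thy1 Ax"
abbreviation T2 :: "(cst, acst) thy" where "T2 \<equiv> thy2 Ax"
abbreviation Tc :: "(cst, acst set) thy" where "Tc \<equiv> thyc Ax"

lemma sentence_emb: "\<alpha> \<in> Ax \<Longrightarrow> sentence \<Sigma>' (emb \<alpha>)"
  unfolding emb_bind using sentences interp_pure_closed by (rule wf_fm_bind)

lemma bind_fm_emb: "\<alpha> \<in> Ax \<Longrightarrow> bind_fm I (emb \<alpha>) = emb \<alpha>"
  unfolding emb_bind bind_fm_bind_fm by (rule bind_fm_pure_cong[OF sentences]) simp_all

lemma bind_fm_emb_wf: "wf_fm \<Sigma> \<Delta> P \<Longrightarrow> bind_fm I (emb P) = bind_fm (pure_subst (\<lambda>i. I (AVar i))) P"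
  unfolding emb_bind bind_fm_bind_fm by (erule bind_fm_pure_cong) simp

lemma cst_axiom_eq:
  assumes "uniquely_exists Ax \<Delta> P"
  shows "subst_fm (cst_tm \<Delta> P) (emb P) = bind_fm (pure_subst (cst_tm \<Delta> P)) P"
  unfolding subst_fm_bind bind_fm_emb_wf[OF uniquely_existsD(2)[OF assms]] by simp

lemma acons_cst_thyE:
  assumes "c \<in> acons (sg (cst_thy Ax K))" "K \<subseteq> ctx_defs Ax"
  obtains \<Delta> P i a b where "c = Cst \<Delta> P i" "(\<Delta>, P) \<in> K" "uniquely_exists Ax \<Delta> P" "i < length \<Delta>"
    "\<Delta> ! i = Hom (Var a) (Var b)"
    "Suc (i + a) < length \<Delta>" "Suc (i + b) < length \<Delta>" "\<Delta> ! Suc (i + a) = Ob" "\<Delta> ! Suc (i + b) = Ob"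
    "cst_dom c = Cst \<Delta> P (Suc (i + a))" "cst_cod c = Cst \<Delta> P (Suc (i + b))"
proof -
  obtain \<Delta> P i where c: "c = Cst \<Delta> P i" "(\<Delta>, P) \<in> K" "i < length \<Delta>" "\<Delta> ! i \<noteq> Ob"
    using assms(1) by (auto simp: cst_thy_simps)
  then have u: "uniquely_exists Ax \<Delta> P" using assms(2) by (auto simp: ctx_defs_def)
  show thesis using uniquely_existsD(1)[OF u] c(3) by (cases rule: pure_ctxE) (use c u that in auto)
qed

lemma wf_sig_cst_thy:
  assumes "K \<subseteq> ctx_defs Ax" shows "wf_sig (sg (cst_thy Ax K))"
  unfolding wf_sig_def
proof
  fix c assume "c \<in> acons (sg (cst_thy Ax K))"
  then show "cdom (sg (cst_thy Ax K)) c \<in> ocons (sg (cst_thy Ax K)) \<and>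
      ccod (sg (cst_thy Ax K)) c \<in> ocons (sg (cst_thy Ax K))"
    using assms by (rule acons_cst_thyE) (simp add: cst_thy_simps)
qed

lemma interp_cst_tm:
  assumes K: "(\<Delta>, P) \<in> K" "K \<subseteq> ctx_defs Ax"
  shows "interp \<Sigma> \<Delta> (sg (cst_thy Ax K)) \<Gamma> (pure_subst (cst_tm \<Delta> P))" (is "interp _ _ _ _ ?I")
  unfolding interp_pure_iff
proof (intro allI impI)
  fix i assume i: "i < length \<Delta>"
  have "wf_ctx \<Sigma> \<Delta>" using K by (auto simp: ctx_defs_def dest: uniquely_existsD)
  then show "has_sort (sg (cst_thy Ax K)) \<Gamma> (?I (AVar i)) (bind_srt ?I (bind_srt (weaken (Suc i)) (\<Delta> ! i)))"
    using i
  proof (cases rule: pure_ctxE)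
    case Ob
    then show ?thesis using K i by (auto simp: cst_tm_def has_sort_iffs cst_thy_simps)
  next
    case (Hom a b)
    then have "Cst \<Delta> P i \<in> acons (sg (cst_thy Ax K))" using K i by (auto simp: cst_thy_simps)
    then show ?thesis using Hom by (auto simp: cst_tm_def has_sort_iffs cst_thy_simps(3,4) add_ac)
  qed
qed

lemma sentence_axms_cst_thy:
  assumes "K \<subseteq> ctx_defs Ax" "\<alpha> \<in> axms (cst_thy Ax K)"
  shows "sentence (sg (cst_thy Ax K)) \<alpha>"
proof -
  consider (emb) \<beta> where "\<beta> \<in> Ax" "\<alpha> = emb \<beta>"
    | (cst) \<Delta> P where "(\<Delta>, P) \<in> K" "\<alpha> = subst_fm (cst_tm \<Delta> P) (emb P)"
    using assms(2) by (auto simp: cst_thy_simps)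
  then show ?thesis
  proof cases
    case (cst \<Delta> P)
    then have "uniquely_exists Ax \<Delta> P" using assms(1) by (auto simp: ctx_defs_def)
    then show ?thesis
      using cst cst_axiom_eq wf_fm_bind[OF uniquely_existsD(2) interp_cst_tm[OF _ assms(1)]] by simp
  qed (simp add: sentence_emb)
qed

lemma cat_eq_axms_cst_thy: "cat_eq_axioms \<subseteq> axms (cst_thy Ax K)"
proof -
  have "cat_eq_axioms \<subseteq> (emb ` cat_eq_axioms :: (cst, cst) fm set)"
    unfolding emb_def by (rule cat_eq_axioms_map)
  then show ?thesis using cat_eq_Ax unfolding cst_thy_simps by blast
qed

lemma cat_eq_axms_fragment: "cat_eq_axioms \<subseteq> axms (fragment Ax K D)"
  unfolding fragment_simps using cat_eq_axioms_map[of id Old] cat_eq_axms_cst_thy[of K] by blast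

definition supports :: "(pctx \<times> pfm) set \<Rightarrow> (cst \<times> cst \<times> (cst, cst) fm) set \<Rightarrow> bool" where
  "supports K D \<longleftrightarrow> K \<subseteq> ctx_defs Ax \<and> (\<forall>(A, B, P)\<in>D. defines_arrow (cst_thy Ax K) A B P)"

lemma supportsD: "supports K D \<Longrightarrow> K \<subseteq> ctx_defs Ax"
  "supports K D \<Longrightarrow> (A, B, P) \<in> D \<Longrightarrow> defines_arrow (cst_thy Ax K) A B P"
  by (auto simp: supports_def)

lemma wf_sig_fragment:
  assumes "supports K D" shows "wf_sig (sg (fragment Ax K D))"
  using wf_sig_cst_thy[OF supportsD(1)[OF assms]] defines_arrow_wf[OF supportsD(2)[OF assms]]
  by (auto simp: wf_sig_def fragment_simps cst_thy_simps(3,4))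

lemma sentence_axms_fragment:
  assumes supp: "supports K D" and \<alpha>: "\<alpha> \<in> axms (fragment Ax K D)"
  shows "sentence (sg (fragment Ax K D)) \<alpha>"
proof -
  consider (old) \<beta> where "\<beta> \<in> axms (cst_thy Ax K)" "\<alpha> = map_fm id Old \<beta>"
    | (def) A B P where "(A, B, P) \<in> D" "\<alpha> = inst (ACon (Def A B P)) (map_fm id Old P)"
    using \<alpha> by (auto simp: fragment_simps)
  then show ?thesis
  proof cases
    case (old \<beta>)
    have "sentence (sg (cst_thy Ax K)) \<beta>" by (rule sentence_axms_cst_thy[OF supportsD(1)[OF supp] old(1)])
    then show ?thesis unfolding old(2) map_fm_bind by (rule wf_fm_bind[OF _ interp_Old])
  next
    case (def A B P)
    have "has_sort (sg (fragment Ax K D)) [] (ACon (Def A B P)) (bind_srt atom_tm (Hom (OCon A) (OCon B)))"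
      using def(1) by (simp add: has_sort_iffs fragment_simps)
    then show ?thesis
      unfolding def(2) inst_bind
      by (rule wf_fm_bind[OF wf_fm_map_Old[OF defines_arrow_wf(3)[OF supportsD(2)[OF supp def(1)]]]
          interp_scons[OF interp_id]])
  qed
qed

lemma supports_defs: "supports (ctx_defs Ax) (arr_defs Ax)"
  by (auto simp: supports_def arr_defs_def thy1_eq_cst_thy)

lemmas wf_sig_thy2 = wf_sig_fragment[OF supports_defs, folded thy2_eq_fragment]
lemmas sentence_axms_thy2 = sentence_axms_fragment[OF supports_defs, folded thy2_eq_fragment]

sublocale t1: eq_theory "thy1 Ax"
  by standard (use cat_eq_axms_cst_thy wf_sig_cst_thy in \<open>auto simp: thy1_eq_cst_thy\<close>)

sublocale t2: eq_theory "thy2 Ax"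
  by standard (use cat_eq_axms_fragment wf_sig_thy2 in \<open>auto simp: thy2_eq_fragment\<close>)

end

section \<open>Realizations of finitely many constants\<close>

context pure_theory
begin

definition realizes :: "('o, 'a) thy \<Rightarrow> pctx \<Rightarrow> pfm \<Rightarrow> (('o, 'a) atom \<Rightarrow> ptm) \<Rightarrow> bool" where
  "realizes U \<Delta> Q I \<longleftrightarrow> uniquely_exists Ax \<Delta> Q \<and> interp (sg U) [] \<Sigma> \<Delta> I \<and>
      (\<forall>\<alpha>\<in>axms U. deriv T \<Delta> {Q} (bind_fm I \<alpha>))"

lemma interp_pure_var_subst:
  assumes "wf_ctx \<Sigma> \<Theta>" "interp \<Sigma> \<Theta> \<Sigma>' \<Gamma> I"
  shows "interp \<Sigma> \<Theta> \<Sigma>' \<Gamma> (var_subst (\<lambda>i. I (AVar i)))"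
  unfolding interp_pure_iff
proof (intro allI impI)
  fix i assume i: "i < length \<Theta>"
  let ?s = "bind_srt (weaken (Suc i)) (\<Theta> ! i)" and ?J = "var_subst (\<lambda>i. I (AVar i))"
  have "bind_srt I ?s = bind_srt ?J ?s"
    by (rule bind_srt_cong[OF wf_ctx_nth_weaken[OF assms(1) i]]) (simp add: agree_on_iff)
  moreover have "has_sort \<Sigma>' \<Gamma> (I (AVar i)) (bind_srt I ?s)" using assms(2) i
    unfolding interp_pure_iff by blast
  ultimately show "has_sort \<Sigma>' \<Gamma> (?J (AVar i)) (bind_srt ?J ?s)" by (simp del: bind_srt_bind_srt)
qed

lemma uniquely_exists_wf_hyps: "uniquely_exists Ax \<Delta> Q \<Longrightarrow> wf_hyps T \<Delta> {Q}"
  by (simp add: wf_hyps_def uniquely_existsD)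

lemma uniquely_exists_witness: "uniquely_exists Ax \<Delta> Q \<Longrightarrow> witness \<Delta> {Q} \<Delta> Q Var"
  by (simp add: witness_hyp uniquely_existsD)

lemma witness_assignment:
  assumes \<Theta>: "wf_ctx \<Sigma> \<Theta>" and v: "witness \<Delta> {Q} \<Theta> P v"
  shows "assignment \<Sigma> \<Theta> \<Delta> (map v [0..<length \<Theta>])"
  unfolding assignment_def
proof (intro conjI allI impI)
  fix i assume i: "i < length \<Theta>"
  with \<Theta> show "has_sort \<Sigma> \<Delta> (map v [0..<length \<Theta>] ! i)
      (subst_srt (\<lambda>j. map v [0..<length \<Theta>] ! Suc (i + j)) (\<Theta> ! i))"
  proof (cases rule: pure_ctxE)
    case Ob
    then show ?thesis using interp_pure_Ob[OF witnessD(1)[OF v] i] i by simp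
  next
    case (Hom a b)
    then show ?thesis using interp_pure_Hom[OF witnessD(1)[OF v] i] i by simp
  qed
qed simp

lemma witness_prov_exs:
  assumes u: "uniquely_exists Ax \<Delta> Q" and P: "wf_fm \<Sigma> \<Theta> P" and v: "witness \<Delta> {Q} \<Theta> P v"
  shows "prov T (exs \<Delta> (FAnd Q (subst_fm (\<lambda>i. map v [0..<length \<Theta>] ! i) P)))"
proof -
  have "bind_fm (var_subst (\<lambda>i. map v [0..<length \<Theta>] ! i)) P = bind_fm (var_subst v) P"
    by (rule bind_fm_pure_cong[OF P]) simp
  moreover have "deriv T \<Delta> {Q} Q" using uniquely_exists_wf_hyps[OF u] by (simp add: deriv.Hyp)
  ultimately have "deriv T \<Delta> {Q} (FAnd Q (subst_fm (\<lambda>i. map v [0..<length \<Theta>] ! i) P))"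
    using witnessD(2)[OF v] by (simp add: deriv_And_iff subst_fm_bind)
  then show ?thesis unfolding prov_def by (intro deriv_exs_mono[OF uniquely_existsD(3)[OF u]]) simp
qed

lemma realizes_deriv:
  assumes "realizes U \<Delta> Q I" "deriv U [] {} \<phi>"
  shows "deriv T \<Delta> {Q} (bind_fm I \<phi>)"
  using assms by (auto simp: realizes_def intro: deriv_bind uniquely_exists_wf_hyps)

lemma witness_trans:
  assumes "witness \<Gamma> {R} \<Delta> Q v" "witness \<Gamma>' \<Phi> \<Gamma> R w"
  shows "witness \<Gamma>' \<Phi> \<Delta> Q (\<lambda>i. bind_tm (var_subst w) (v i))"
  using witness_deriv[OF witnessD(2)[OF assms(1)] assms(2)]
      interp_comp[OF witnessD(1)[OF assms(1)] witnessD(1)[OF assms(2)]]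
  by (simp add: witness_def var_subst_comp)

lemma realizes_witness:
  assumes "realizes U \<Delta> Q I" "uniquely_exists Ax \<Delta>' Q'" "witness \<Delta>' {Q'} \<Delta> Q v"
  shows "realizes U \<Delta>' Q' (\<lambda>x. bind_tm (var_subst v) (I x))"
  unfolding realizes_def
proof (intro conjI ballI assms(2))
  show "interp (sg U) [] \<Sigma> \<Delta>' (\<lambda>x. bind_tm (var_subst v) (I x))"
    using assms(1) by (auto simp: realizes_def intro: interp_comp witnessD(1)[OF assms(3)])
  fix \<alpha> assume "\<alpha> \<in> axms U"
  then have "deriv T \<Delta> {Q} (bind_fm I \<alpha>)" using assms(1) by (simp add: realizes_def)
  from witness_deriv[OF this assms(3)] show "deriv T \<Delta>' {Q'} (bind_fm (\<lambda>x. bind_tm (var_subst v) (I x)) \<alpha>)"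
    by simp
qed

lemma simultaneous_witnesses:
  assumes "finite K" "K \<subseteq> ctx_defs Ax"
  shows "\<exists>\<Gamma> R \<tau>. uniquely_exists Ax \<Gamma> R \<and> (\<forall>(\<Delta>, P)\<in>K. witness \<Gamma> {R} \<Delta> P (\<tau> \<Delta> P))"
  using assms
proof (induction K rule: finite_induct)
  case empty
  then show ?case using uniquely_exists_Nil by blast
next
  case (insert d K)
  obtain \<Delta> P where d: "d = (\<Delta>, P)" by (cases d)
  obtain \<Gamma> R \<tau> where \<Gamma>: "uniquely_exists Ax \<Gamma> R"
    and \<tau>: "\<forall>(\<Delta>, P)\<in>K. witness \<Gamma> {R} \<Delta> P (\<tau> \<Delta> P)" using insert by auto
  let ?\<Gamma> = "\<Delta> @ \<Gamma>" and ?R = "FAnd P (bind_fm (weaken (length \<Delta>)) R)"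
  let ?\<tau> = "\<lambda>\<Delta>' P'. if (\<Delta>', P') = d then Var else
      (\<lambda>i. bind_tm (var_subst (\<lambda>i. Var (length \<Delta> + i))) (\<tau> \<Delta>' P' i))"
  have u: "uniquely_exists Ax ?\<Gamma> ?R"
    using insert.prems d \<Gamma> by (auto simp: ctx_defs_def intro: uniquely_exists_append)
  note parts = witness_append[OF uniquely_exists_witness[OF u]]
  have witnesses: "witness ?\<Gamma> {?R} \<Delta>' P' (?\<tau> \<Delta>' P')" if "(\<Delta>', P') \<in> Set.insert d K" for \<Delta>' P'
    using that d \<tau> witness_closed[OF parts(1)] witness_trans[OF _ parts(2)] by auto
  show ?case by (intro exI[of _ ?\<Gamma>] exI[of _ ?R] exI[of _ ?\<tau>] conjI u ballI, clarify, rule witnesses)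
qed

lemma realizes_cst_thy:
  assumes K: "finite K" "K \<subseteq> ctx_defs Ax"
  shows "\<exists>\<Delta> Q I. realizes (cst_thy Ax K) \<Delta> Q I"
proof -
  obtain \<Gamma> R \<tau> where \<Gamma>: "uniquely_exists Ax \<Gamma> R" and \<tau>: "\<And>\<Delta> P. (\<Delta>, P) \<in> K \<Longrightarrow> witness \<Gamma> {R} \<Delta> P (\<tau> \<Delta> P)"
    using simultaneous_witnesses[OF K] by blast
  define I :: "(cst, cst) atom \<Rightarrow> ptm" where
    "I x = (case x of AVar i \<Rightarrow> Var i | AObj (Cst \<Delta> P i) \<Rightarrow> \<tau> \<Delta> P i | AArr (Cst \<Delta> P i) \<Rightarrow> \<tau> \<Delta> P i)" for x
  have I [simp]: "I (AObj (Cst \<Delta> P i)) = \<tau> \<Delta> P i" "I (AArr (Cst \<Delta> P i)) = \<tau> \<Delta> P i" for \<Delta> P i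
    by (simp_all add: I_def)
  have "has_sort \<Sigma> \<Gamma> (I (AObj c)) Ob" if c: "c \<in> ocons (sg (cst_thy Ax K))" for c
  proof -
    obtain \<Delta> P i where "c = Cst \<Delta> P i" "(\<Delta>, P) \<in> K" "i < length \<Delta>" "\<Delta> ! i = Ob"
      using c by (auto simp: cst_thy_simps)
    then show ?thesis using interp_pure_Ob[OF witnessD(1)[OF \<tau>]] by simp
  qed
  moreover have "has_sort \<Sigma> \<Gamma> (I (AArr c)) (Hom (I (AObj (cst_dom c))) (I (AObj (cst_cod c))))"
    if "c \<in> acons (sg (cst_thy Ax K))" for c
    using that K(2) by (rule acons_cst_thyE) (use interp_pure_Hom[OF witnessD(1)[OF \<tau>]] in simp)
  moreover have "deriv T \<Gamma> {R} (bind_fm I \<alpha>)" if \<alpha>: "\<alpha> \<in> axms (cst_thy Ax K)" for \<alpha>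
  proof -
    consider (emb) \<beta> where "\<beta> \<in> Ax" "\<alpha> = emb \<beta>"
      | (cst) \<Delta> P where "(\<Delta>, P) \<in> K" "\<alpha> = subst_fm (cst_tm \<Delta> P) (emb P)"
      using \<alpha> by (auto simp: cst_thy_simps)
    then show ?thesis
    proof cases
      case (emb \<beta>)
      then show ?thesis using sentences uniquely_exists_wf_hyps[OF \<Gamma>] by (simp add: bind_fm_emb deriv.Axiom)
    next
      case (cst \<Delta> P)
      then have u: "uniquely_exists Ax \<Delta> P" using K(2) by (auto simp: ctx_defs_def)
      have "bind_fm I (bind_fm (pure_subst (cst_tm \<Delta> P)) P) = bind_fm (var_subst (\<tau> \<Delta> P)) P"
        unfolding bind_fm_bind_fm
        by (rule bind_fm_pure_cong[OF uniquely_existsD(2)[OF u]]) (simp add: cst_tm_def)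
      then show ?thesis using witnessD(2)[OF \<tau>[OF cst(1)]] by (simp add: cst(2) cst_axiom_eq[OF u])
    qed
  qed
  ultimately have "realizes (cst_thy Ax K) \<Gamma> R I"
    using \<Gamma> by (simp add: realizes_def interp_iff cst_thy_simps(3,4))
  then show ?thesis by blast
qed

lemma realizes_old:
  assumes "realizes (fragment Ax K D) \<Delta> Q I"
  shows "realizes (cst_thy Ax K) \<Delta> Q (\<lambda>x. bind_tm I (con_map id Old x))"
  using assms interp_comp[OF interp_Old, of Ax K D \<Sigma> \<Delta> I]
  by (simp add: realizes_def fragment_simps map_fm_bind ball_Un)

lemma realizes_fragment_empty:
  assumes "realizes (cst_thy Ax K) \<Delta> Q I"
  shows "\<exists>I'. realizes (fragment Ax K {}) \<Delta> Q I'"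
proof -
  define I' where "I' x = (case x of AVar i \<Rightarrow> I (AVar i) | AObj c \<Rightarrow> I (AObj c) | AArr a \<Rightarrow> I
      (AArr (case a of Old c \<Rightarrow> c)))" for x
  have "(\<lambda>x. bind_tm I' (con_map id Old x)) = I" by (rule atom_fun_eqI) (simp_all add: I'_def)
  then have "realizes (fragment Ax K {}) \<Delta> Q I'"
    using assms by (auto simp: realizes_def fragment_simps map_fm_bind interp_iff cst_thy_simps(3,4) I'_def)
  then show ?thesis by blast
qed

lemma uniquely_exists_def_arrow:
  assumes I: "realizes (cst_thy Ax K) \<Delta> Q I" and supp: "supports K D" and ABP: "(A, B, P) \<in> D"
    and a: "I (AObj A) = Var a" and b: "I (AObj B) = Var b"
  shows "uniquely_exists Ax (Hom (Var a) (Var b) # \<Delta>) (FAnd (bind_fm (lift I) P) (bind_fm weaken1 Q))"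
proof (rule uniquely_exists_arrow)
  let ?R = "bind_fm (lift I) P"
  note wf = defines_arrow_wf[OF supportsD(2)[OF supp ABP]]
  have interp: "interp (sg (cst_thy Ax K)) [] \<Sigma> \<Delta> I" using I by (simp add: realizes_def)
  show "uniquely_exists Ax \<Delta> Q" using I by (simp add: realizes_def)
  show "wf_srt \<Sigma> \<Delta> (Hom (Var a) (Var b))" using interp wf(1,2) by (simp add: interp_iff flip: a b)
  show "wf_fm \<Sigma> (Hom (Var a) (Var b) # \<Delta>) ?R"
    using wf_fm_bind[OF wf(3) interp_lift[OF interp]] by (simp add: a b)
  have ex_unique: "deriv T \<Delta> {Q} (bind_fm I (ex_unique [Hom (OCon A) (OCon B)] P))"
    using supportsD(2)[OF supp ABP] by (intro realizes_deriv[OF I]) (simp add: defines_arrow_def prov_def)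
  then show "deriv T \<Delta> {Q} (FEx (Hom (Var a) (Var b)) ?R)" using ex_unique_arrow_ex by (simp flip: a b)
  show "unique_solutions \<Delta> Q a b ?R"
    unfolding unique_solutions_def
  proof (intro allI impI)
    fix \<Gamma> \<Phi> v f g assume v: "witness \<Gamma> \<Phi> \<Delta> Q v"
    let ?J = "\<lambda>x. bind_tm (var_subst v) (I x)"
    have "deriv T \<Gamma> \<Phi> (bind_fm ?J (ex_unique [Hom (OCon A) (OCon B)] P))"
      using witness_deriv[OF ex_unique v] by simp
    moreover assume "has_sort \<Sigma> \<Gamma> f (Hom (v a) (v b))" "has_sort \<Sigma> \<Gamma> g (Hom (v a) (v b))"
      "deriv T \<Gamma> \<Phi> (bind_fm (scons f (var_subst v)) ?R)" "deriv T \<Gamma> \<Phi> (bind_fm (scons g (var_subst v)) ?R)"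
    ultimately show "deriv T \<Gamma> \<Phi> (FEq f g)"
      by (intro ex_unique_arrow_eq[OF _ wf(3), where J = ?J]) (simp_all add: a b lift_def)
  qed
qed

lemma interp_fragment_insert:
  assumes I: "interp (sg (fragment Ax K D)) [] \<Sigma>' \<Gamma> I"
    and t: "has_sort \<Sigma>' \<Gamma> t (Hom (I (AObj A)) (I (AObj B)))"
  shows "interp (sg (fragment Ax K (insert (A, B, P) D))) [] \<Sigma>' \<Gamma> (I(AArr (Def A B P) := t))"
      (is "interp (sg ?U) _ _ _ ?I")
  unfolding interp_iff
proof (intro conjI ballI)
  show "has_sort \<Sigma>' \<Gamma> (?I (AObj c)) Ob" if "c \<in> ocons (sg ?U)" for c
    using I that by (simp add: interp_iff fragment_simps)
  fix x assume "x \<in> acons (sg ?U)"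
  then consider (new) "x = Def A B P"
    | (old) "x \<noteq> Def A B P" "x \<in> acons (sg (fragment Ax K D))" unfolding fragment_simps by blast
  then show "has_sort \<Sigma>' \<Gamma> (?I (AArr x)) (Hom (?I (AObj (cdom (sg ?U) x))) (?I (AObj (ccod (sg ?U) x))))"
  proof cases
    case new
    then show ?thesis using t by (simp add: fragment_simps)
  next
    case old
    moreover have "cdom (sg ?U) x = cdom (sg (fragment Ax K D)) x"
      "ccod (sg ?U) x = ccod (sg (fragment Ax K D)) x"
      by (simp_all add: fragment_def)
    ultimately show ?thesis using I by (simp add: interp_iff)
  qed
qed simp

lemma realizes_fragment_insert:
  assumes I: "realizes (fragment Ax K D) \<Delta> Q I" and supp: "supports K (insert (A, B, P) D)"
    and new: "(A, B, P) \<notin> D"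
  shows "\<exists>\<Delta>' Q' I'. realizes (fragment Ax K (insert (A, B, P) D)) \<Delta>' Q' I'"
proof -
  let ?J = "\<lambda>x. bind_tm I (con_map id Old x)" and ?U = "fragment Ax K D"
    and ?U' = "fragment Ax K (insert (A, B, P) D)"
  have supp_D: "supports K D" using supp by (simp add: supports_def)
  note J = realizes_old[OF I] and wf = defines_arrow_wf[OF supportsD(2)[OF supp insertI1]]
  have "has_sort \<Sigma> \<Delta> (?J (AObj A)) Ob" "has_sort \<Sigma> \<Delta> (?J (AObj B)) Ob"
    using J wf(1,2) by (simp_all add: realizes_def interp_iff)
  then obtain a b where a: "I (AObj A) = Var a" and b: "I (AObj B) = Var b" by (auto simp: has_sort_pure_Ob)
  let ?R = "bind_fm (lift ?J) P"
  let ?\<Delta> = "Hom (Var a) (Var b) # \<Delta>" and ?Q = "FAnd ?R (bind_fm weaken1 Q)"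
  define I' where "I' = (\<lambda>x. bind_tm weaken1 (I x))(AArr (Def A B P) := Var 0)"
  have u: "uniquely_exists Ax ?\<Delta> ?Q"
    by (rule uniquely_exists_def_arrow[OF J supp insertI1]) (simp_all add: a b)
  have parts: "witness ?\<Delta> {?Q} ?\<Delta> ?R Var" "witness ?\<Delta> {?Q} \<Delta> Q (\<lambda>i. Var (Suc i))"
    using witness_append[of _ _ "[Hom (Var a) (Var b)]"] uniquely_exists_witness[OF u] by simp_all
  have "realizes ?U ?\<Delta> ?Q (\<lambda>x. bind_tm (var_subst (\<lambda>i. Var (Suc i))) (I x))"
    by (rule realizes_witness[OF I u parts(2)])
  then have weakened: "realizes ?U ?\<Delta> ?Q (\<lambda>x. bind_tm weaken1 (I x))" by (simp add: weaken_def)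
  have "agree_on (sg ?U) [] I' (\<lambda>x. bind_tm weaken1 (I x))"
    using new by (auto simp: agree_on_iff fragment_simps I'_def)
  then have "bind_fm I' \<alpha> = bind_fm (\<lambda>x. bind_tm weaken1 (I x)) \<alpha>" if "\<alpha> \<in> axms ?U" for \<alpha>
    by (rule bind_fm_cong[OF sentence_axms_fragment[OF supp_D that]])
  then have "deriv T ?\<Delta> {?Q} (bind_fm I' \<alpha>)" if "\<alpha> \<in> axms ?U" for \<alpha>
    using weakened that by (simp add: realizes_def)
  moreover have "deriv T ?\<Delta> {?Q} (bind_fm I' (inst (ACon (Def A B P)) (map_fm id Old P)))"
  proof -
    have "(\<lambda>x. bind_tm I' (bind_tm (scons (ACon (Def A B P)) atom_tm) (con_map id Old x))) = lift ?J"
      by (rule atom_fun_eqI) (auto simp: I'_def lift_def scons_AVar split: nat.splits)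
    then show ?thesis using witnessD(2)[OF parts(1)] by (simp add: inst_bind map_fm_bind)
  qed
  moreover have "interp (sg ?U') [] \<Sigma> ?\<Delta> I'"
    unfolding I'_def by (rule interp_fragment_insert) (use weakened a b in \<open>simp_all add: realizes_def\<close>)
  moreover have "axms ?U' = insert (inst (ACon (Def A B P)) (map_fm id Old P)) (axms ?U)"
    by (auto simp: fragment_simps)
  ultimately show ?thesis using u by (auto simp: realizes_def)
qed

lemma realizes_fragment:
  assumes "finite K" "finite D" "supports K D"
  shows "\<exists>\<Delta> Q I. realizes (fragment Ax K D) \<Delta> Q I"
  using assms(2,3)
proof (induction D rule: finite_induct)
  case empty
  then show ?case using realizes_cst_thy[OF assms(1)] realizes_fragment_empty
    by (fastforce simp: supports_def)
next
  case (insert d D)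
  then have "supports K D" by (simp add: supports_def)
  then show ?case using insert realizes_fragment_insert by (cases d) blast
qed

lemma eventually_mem_finite_subsets: "x \<in> A \<Longrightarrow> eventually (\<lambda>X. x \<in> X) (finite_subsets_at_top A)"
  unfolding eventually_finite_subsets_at_top by (rule exI[of _ "{x}"]) auto

abbreviation finite_ctx_defs :: "(pctx \<times> pfm) set filter"
  where "finite_ctx_defs \<equiv> finite_subsets_at_top (ctx_defs Ax)"
abbreviation finite_arr_defs :: "(cst \<times> cst \<times> (cst, cst) fm) set filter" where
  "finite_arr_defs \<equiv> finite_subsets_at_top (arr_defs Ax)"

sublocale t1: exhausted_theory "thy1 Ax" "cst_thy Ax" finite_ctx_defs
proof
  have eventually_defs: "eventually P finite_ctx_defs" if "d \<in> ctx_defs Ax" "\<And>K. d \<in> K \<Longrightarrow> P K" for d P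
    by (rule eventually_mono[OF eventually_mem_finite_subsets[OF that(1)] that(2)])
  show "eventually (\<lambda>K. c \<in> ocons (sg (cst_thy Ax K))) finite_ctx_defs" if c: "c \<in> ocons (sg T1)" for c
  proof -
    obtain \<Delta> P i where \<Delta>P: "c = Cst \<Delta> P i" "(\<Delta>, P) \<in> ctx_defs Ax" "i < length \<Delta>" "\<Delta> ! i = Ob"
      using c by (auto simp: thy1_eq_cst_thy cst_thy_simps)
    show ?thesis by (rule eventually_defs[OF \<Delta>P(2)]) (simp add: cst_thy_simps \<Delta>P)
  qed
  show "eventually (\<lambda>K. c \<in> acons (sg (cst_thy Ax K))) finite_ctx_defs" if c: "c \<in> acons (sg T1)" for c
  proof -
    obtain \<Delta> P i where \<Delta>P: "c = Cst \<Delta> P i" "(\<Delta>, P) \<in> ctx_defs Ax" "i < length \<Delta>" "\<Delta> ! i \<noteq> Ob"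
      using c by (auto simp: thy1_eq_cst_thy cst_thy_simps)
    show ?thesis by (rule eventually_defs[OF \<Delta>P(2)]) (simp add: cst_thy_simps \<Delta>P)
  qed
  show "eventually (\<lambda>K. \<alpha> \<in> axms (cst_thy Ax K)) finite_ctx_defs" if \<alpha>: "\<alpha> \<in> axms T1" for \<alpha>
  proof -
    consider (emb) "\<alpha> \<in> emb ` Ax" | (cst) \<Delta> P where "(\<Delta>, P) \<in> ctx_defs Ax" "\<alpha> = subst_fm (cst_tm \<Delta> P) (emb P)"
      using \<alpha> by (auto simp: thy1_eq_cst_thy cst_thy_simps)
    then show ?thesis
    proof cases
      case (cst \<Delta> P)
      show ?thesis by (rule eventually_defs[OF cst(1)]) (use cst(2) in \<open>auto simp: cst_thy_simps\<close>)
    qed (simp add: cst_thy_simps)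
  qed
qed (simp_all add: thy1_eq_cst_thy cst_thy_simps(3,4))

sublocale t2: exhausted_theory "thy2 Ax" "case_prod (fragment Ax)" "finite_ctx_defs \<times>\<^sub>F finite_arr_defs"
proof
  have eventually_fst: "eventually (\<lambda>KD. P (fst KD)) (finite_ctx_defs \<times>\<^sub>F finite_arr_defs)"
    if "eventually P finite_ctx_defs" for P
    using eventually_prodI[OF that always_eventually[of "\<lambda>_. True"]] by simp
  have eventually_snd: "eventually (\<lambda>KD. d \<in> snd KD) (finite_ctx_defs \<times>\<^sub>F finite_arr_defs)"
    if "d \<in> arr_defs Ax" for d
    using eventually_prodI[OF always_eventually[of "\<lambda>_. True"] eventually_mem_finite_subsets[OF that]] by simp
  show "eventually (\<lambda>KD. c \<in> ocons (sg (case_prod (fragment Ax) KD))) (finite_ctx_defs \<times>\<^sub>F finite_arr_defs)"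
    if "c \<in> ocons (sg T2)" for c
    using eventually_fst[OF t1.eventually_ocons[of c]] that
    by (simp add: thy2_eq_fragment thy1_eq_cst_thy fragment_simps split_beta)
  show "eventually (\<lambda>KD. a \<in> acons (sg (case_prod (fragment Ax) KD))) (finite_ctx_defs \<times>\<^sub>F finite_arr_defs)"
    if "a \<in> acons (sg T2)" for a
  proof (cases a)
    case (Old c)
    then have "c \<in> acons (sg T1)" using that by (auto simp: thy2_eq_fragment thy1_eq_cst_thy fragment_simps)
    from eventually_fst[OF t1.eventually_acons[OF this]] show ?thesis
      by eventually_elim (auto simp: Old fragment_simps split_beta)
  next
    case (Def A B P)
    then have "(A, B, P) \<in> arr_defs Ax" using that by (auto simp: thy2_eq_fragment fragment_simps)
    from eventually_snd[OF this] show ?thesis by eventually_elim (auto simp: Def fragment_simps split_beta)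
  qed
  show "eventually (\<lambda>KD. \<alpha> \<in> axms (case_prod (fragment Ax) KD)) (finite_ctx_defs \<times>\<^sub>F finite_arr_defs)"
    if \<alpha>: "\<alpha> \<in> axms T2" for \<alpha>
  proof -
    consider (old) \<beta> where "\<beta> \<in> axms T1" "\<alpha> = map_fm id Old \<beta>"
      | (new) A B P where "(A, B, P) \<in> arr_defs Ax" "\<alpha> = inst (ACon (Def A B P)) (map_fm id Old P)"
      using \<alpha> by (auto simp: thy2_eq_fragment thy1_eq_cst_thy fragment_simps)
    then show ?thesis
    proof cases
      case (old \<beta>)
      from eventually_fst[OF t1.eventually_axms[OF old(1)]]
      show ?thesis by eventually_elim (auto simp: old(2) fragment_simps split_beta)
    next
      case (new A B P)
      from eventually_snd[OF new(1)]
      show ?thesis by eventually_elim (auto simp: new(2) fragment_simps split_beta)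
    qed
  qed
qed (auto simp: thy2_eq_fragment fragment_def)

lemma eventually_supports:
  assumes "finite D" "D \<subseteq> arr_defs Ax"
  shows "eventually (\<lambda>K. supports K D) finite_ctx_defs"
proof -
  have "eventually (\<lambda>K. \<forall>(A, B, P)\<in>D. defines_arrow (cst_thy Ax K) A B P) finite_ctx_defs"
    using assms by (intro eventually_ball_finite)
       (auto simp: arr_defs_def defines_arrow_def prov_def intro: t1.eventually_deriv)
  moreover have "eventually (\<lambda>K. K \<subseteq> ctx_defs Ax) finite_ctx_defs"
    by (auto simp: eventually_finite_subsets_at_top)
  ultimately show ?thesis by eventually_elim (simp add: supports_def)
qed

lemma realizes_eventually:
  assumes "eventually P (finite_ctx_defs \<times>\<^sub>F finite_arr_defs)"
  obtains K D \<Delta> Q I where "P (K, D)" "realizes (fragment Ax K D) \<Delta> Q I"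
proof -
  obtain PK PD where PK: "eventually PK finite_ctx_defs" and PD: "eventually PD finite_arr_defs"
    and P: "\<And>K D. PK K \<Longrightarrow> PD D \<Longrightarrow> P (K, D)" using assms unfolding eventually_prod_filter by blast
  obtain D where D: "finite D" "D \<subseteq> arr_defs Ax" "PD D" using PD
    unfolding eventually_finite_subsets_at_top by blast
  have "eventually (\<lambda>K. finite K) finite_ctx_defs" by (auto simp: eventually_finite_subsets_at_top)
  with PK eventually_supports[OF D(1,2)]
  have "eventually (\<lambda>K. PK K \<and> supports K D \<and> finite K) finite_ctx_defs"
    by eventually_elim simp
  then obtain K where K: "PK K" "supports K D" "finite K"
    using eventually_happens'[OF finite_subsets_at_top_neq_bot] by blast
  obtain \<Delta> Q I where "realizes (fragment Ax K D) \<Delta> Q I" using realizes_fragment[OF K(3) D(1) K(2)] by blast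
  with P[OF K(1) D(3)] show thesis by (rule that)
qed

lemma thy2_realization:
  assumes \<Theta>: "wf_ctx \<Sigma> \<Theta>" and P: "wf_fm \<Sigma> \<Theta> P" and J: "interp \<Sigma> \<Theta> (sg T2) [] J"
    and derivation: "deriv T2 [] {} (bind_fm J P)"
  obtains \<Delta> Q v where "uniquely_exists Ax \<Delta> Q" "witness \<Delta> {Q} \<Theta> P v"
proof -
  have "eventually (\<lambda>KD. interp \<Sigma> \<Theta> (sg (case_prod (fragment Ax) KD)) [] J)
      (finite_ctx_defs \<times>\<^sub>F finite_arr_defs)"
    using J unfolding interp_pure_iff lessThan_iff[symmetric, where k = "length \<Theta>"] Ball_def[symmetric]
    by (intro eventually_ball_finite ballI t2.eventually_has_sort) auto
  from eventually_conj[OF this t2.eventually_deriv[OF derivation finite.emptyI]]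
  obtain K D \<Delta> Q I where J': "interp \<Sigma> \<Theta> (sg (fragment Ax K D)) [] J"
    and fragment_derivation: "deriv (fragment Ax K D) [] {} (bind_fm J P)"
    and I: "realizes (fragment Ax K D) \<Delta> Q I"
    by (rule realizes_eventually) auto
  let ?v = "\<lambda>i. bind_tm I (J (AVar i))"
  have "interp \<Sigma> \<Theta> \<Sigma> \<Delta> (\<lambda>x. bind_tm I (J x))" using I by (auto simp: realizes_def intro: interp_comp[OF J'])
  then have "interp \<Sigma> \<Theta> \<Sigma> \<Delta> (var_subst ?v)" by (rule interp_pure_var_subst[OF \<Theta>])
  moreover have "bind_fm I (bind_fm J P) = bind_fm (var_subst ?v) P"
    unfolding bind_fm_bind_fm by (rule bind_fm_pure_cong[OF P]) simp
  ultimately have "witness \<Delta> {Q} \<Theta> P ?v"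
    using realizes_deriv[OF I fragment_derivation] by (simp add: witness_def)
  moreover have "uniquely_exists Ax \<Delta> Q" using I by (simp add: realizes_def)
  ultimately show thesis using that by blast
qed

end

section \<open>Composites of defined arrows\<close>

lemma bind_fm_inst:
  assumes "wf_fm \<Sigma> [s] P" "agree_on \<Sigma> [] I atom_tm"
  shows "bind_fm I (inst t P) = inst (bind_tm I t) P"
  unfolding inst_bind bind_fm_bind_fm
  by (rule bind_fm_cong[OF assms(1)]) (use assms(2) in \<open>auto simp: agree_on_iff\<close>)

lemma bind_fm_con_map_inst: "bind_fm (con_map f g) (inst t P) =
    inst (bind_tm (con_map f g) t) (bind_fm (con_map f g) P)"
proof -
  have "scons (bind_tm (con_map f g) t) (con_map f g) =
      (\<lambda>x. bind_tm (scons (bind_tm (con_map f g) t) atom_tm) (con_map f g x))"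
    by (rule atom_fun_eqI) (auto simp: scons_AVar split: nat.splits)
  then show ?thesis by (simp add: inst_bind)
qed

lemma wf_fm_inst:
  assumes "wf_fm \<Sigma> [s] P" "has_sort \<Sigma> \<Gamma> t s"
  shows "wf_fm \<Sigma> \<Gamma> (inst t P)"
  unfolding inst_bind using assms(2) by (intro wf_fm_bind[OF assms(1) interp_scons[OF interp_closed_id]]) simp

text \<open>
  A defined arrow constant must not occur in a further definition. So the composite of two defined arrows
  is described through the definitions \<open>P\<close> and \<open>Q\<close> of its factors.
\<close>

definition composite_fm :: "'o \<Rightarrow> 'o \<Rightarrow> 'o \<Rightarrow> ('o, 'a) fm \<Rightarrow> ('o, 'a) fm \<Rightarrow> ('o, 'a) fm" where
  "composite_fm A B C P Q = alls [Hom (OCon B) (OCon C), Hom (OCon A) (OCon B)]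
     (FImp (inst (Var 1) P) (FImp (inst (Var 0) Q) (FEq (Var 2) (Cmp (Var 0) (Var 1)))))"

lemma map_composite_fm:
  "bind_fm (con_map id g) (composite_fm A B C P Q) =
      composite_fm A B C (bind_fm (con_map id g) P) (bind_fm (con_map id g) Q)"
  by (simp add: composite_fm_def bind_fm_con_map_inst)

lemma inst_composite_fm:
  assumes "wf_fm \<Sigma> [s] P" "wf_fm \<Sigma> [s'] Q"
  shows "inst h (composite_fm A B C P Q) = alls [Hom (OCon B) (OCon C), Hom (OCon A) (OCon B)]
    (FImp (inst (Var 1) P) (FImp (inst (Var 0) Q) (FEq (bind_tm (weaken 2) h) (Cmp (Var 0) (Var 1)))))"
proof -
  have "agree_on \<Sigma> [] (lift (lift (scons h atom_tm))) atom_tm" by (simp add: agree_on_iff lift_def)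
  note inst = bind_fm_inst[OF assms(1) this] bind_fm_inst[OF assms(2) this]
  show ?thesis unfolding composite_fm_def inst_bind[of h] alls.simps bind_fm.simps inst
    by (simp add: lift_def numeral_2_eq_2)
qed

context eq_theory
begin

lemma wf_composite_fm:
  assumes P: "defines_arrow T A B P" and Q: "defines_arrow T B C Q"
  shows "wf_fm (sg T) [Hom (OCon A) (OCon C)] (composite_fm A B C P Q)"
proof -
  let ?\<Gamma> = "[Hom (OCon B) (OCon C), Hom (OCon A) (OCon B), Hom (OCon A) (OCon C)]"
  have "wf_fm (sg T) ?\<Gamma> (inst (Var 1) P)" "wf_fm (sg T) ?\<Gamma> (inst (Var 0) Q)"
    by (rule wf_fm_inst[OF defines_arrow_wf(3)[OF P]] wf_fm_inst[OF defines_arrow_wf(3)[OF Q]];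
        simp add: has_sort_Var_iff)+
  then show ?thesis using defines_arrow_wf[OF P] defines_arrow_wf[OF Q]
    by (auto simp: composite_fm_def has_sort_iffs numeral_2_eq_2)
qed

lemma composite_fm_elim:
  assumes P: "wf_fm (sg T) [Hom (OCon A) (OCon B)] P" and Q: "wf_fm (sg T) [Hom (OCon B) (OCon C)] Q"
    and h: "deriv T \<Gamma> \<Phi> (inst h (composite_fm A B C P Q))"
    and f: "has_sort (sg T) \<Gamma> f (Hom (OCon A) (OCon B))" "deriv T \<Gamma> \<Phi> (inst f P)"
    and g: "has_sort (sg T) \<Gamma> g (Hom (OCon B) (OCon C))" "deriv T \<Gamma> \<Phi> (inst g Q)"
  shows "deriv T \<Gamma> \<Phi> (FEq h (Cmp g f))"
proof -
  let ?I = "scons_list [g, f] atom_tm :: ('o, 'a) atom \<Rightarrow> ('o, 'a) tm"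
  have "interp (sg T) ([Hom (OCon B) (OCon C), Hom (OCon A) (OCon B)] @ \<Gamma>) (sg T) \<Gamma> ?I"
    using f(1) g(1) by (simp add: interp_scons interp_id)
  from deriv_alls_elim[OF h[unfolded inst_composite_fm[OF P Q]] _ this]
  have "deriv T \<Gamma> \<Phi> (bind_fm ?I (FImp (inst (Var 1) P)
      (FImp (inst (Var 0) Q) (FEq (bind_tm (weaken 2) h) (Cmp (Var 0) (Var 1))))))"
    by simp
  moreover have "agree_on (sg T) [] ?I atom_tm" by (simp add: agree_on_iff)
  ultimately have "deriv T \<Gamma> \<Phi> (FImp (inst f P) (FImp (inst g Q) (FEq h (Cmp g f))))"
    by (simp add: bind_fm_inst[OF P] bind_fm_inst[OF Q] numeral_2_eq_2 del: bind_fm_bind_fm)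
  then show ?thesis using f(2) g(2) by (blast intro: deriv.ImpE)
qed

lemma composite_fm_intro:
  assumes P: "defines_arrow T A B P" and Q: "defines_arrow T B C Q"
    and f: "has_sort (sg T) \<Gamma> f (Hom (OCon A) (OCon B))" "deriv T \<Gamma> \<Phi> (inst f P)"
    and g: "has_sort (sg T) \<Gamma> g (Hom (OCon B) (OCon C))" "deriv T \<Gamma> \<Phi> (inst g Q)"
  shows "deriv T \<Gamma> \<Phi> (inst (Cmp g f) (composite_fm A B C P Q))"
proof -
  let ?\<Delta> = "[Hom (OCon B) (OCon C), Hom (OCon A) (OCon B)] :: ('o, 'a) ctx"
  let ?\<Phi> = "insert (inst (Var 0) Q) (insert (inst (Var 1) P) (bind_fm (weaken 2) ` \<Phi>))"
  let ?W = "bind_tm (weaken 2) :: ('o, 'a) tm \<Rightarrow> ('o, 'a) tm"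
  note wf = defines_arrow_wf[OF P] defines_arrow_wf[OF Q]
  have vars: "has_sort (sg T) (?\<Delta> @ \<Gamma>) (Var 1) (Hom (OCon A) (OCon B))"
    "has_sort (sg T) (?\<Delta> @ \<Gamma>) (Var 0) (Hom (OCon B) (OCon C))"
    by (simp_all add: has_sort_Var_iff)
  have "wf_hyps T (?\<Delta> @ \<Gamma>) (bind_fm (weaken 2) ` \<Phi>)"
    using deriv_wf_hyps[OF f(2)] wf interp_weaken[of "sg T" \<Gamma> ?\<Delta>]
    by (auto simp: wf_hyps_def has_sort_iffs numeral_2_eq_2 intro: wf_fm_bind)
  then have ext: "extends T ?\<Delta> ?\<Phi> \<Gamma> \<Phi>"
    using wf_fm_inst[OF wf(3) vars(1)] wf_fm_inst[OF wf(6) vars(2)]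
    by (auto simp: extends_def wf_hyps_insert numeral_2_eq_2)
  have W: "has_sort (sg T) (?\<Delta> @ \<Gamma>) (?W f) (Hom (OCon A) (OCon B))"
    "has_sort (sg T) (?\<Delta> @ \<Gamma>) (?W g) (Hom (OCon B) (OCon C))"
    "deriv T (?\<Delta> @ \<Gamma>) ?\<Phi> (inst (?W f) P)" "deriv T (?\<Delta> @ \<Gamma>) ?\<Phi> (inst (?W g) Q)"
    using has_sort_bind[OF f(1) interp_weaken[of _ _ ?\<Delta>]] has_sort_bind[OF g(1) interp_weaken[of _ _ ?\<Delta>]]
      deriv_extends[OF f(2) ext] deriv_extends[OF g(2) ext]
    by (simp_all add: bind_fm_inst[OF wf(3)] bind_fm_inst[OF wf(6)] agree_on_iff numeral_2_eq_2)
  have hyps: "deriv T (?\<Delta> @ \<Gamma>) ?\<Phi> (inst (Var 1) P)" "deriv T (?\<Delta> @ \<Gamma>) ?\<Phi> (inst (Var 0) Q)"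
    by (rule deriv.Hyp[OF extends_wf_hyps[OF ext]], simp)+
  have "deriv T (?\<Delta> @ \<Gamma>) ?\<Phi> (FEq (Cmp (?W g) (?W f)) (Cmp (Var 0) (Var 1)))"
    using defines_arrow_unique[OF Q W(2,4) vars(2) hyps(2)] defines_arrow_unique[OF P W(1,3) vars(1) hyps(1)]
        has_sort_Cmp[OF W(1,2)]
    by (rule cmp_cong)
  then show ?thesis
    unfolding inst_composite_fm[OF wf(3,6)] deriv_alls_iff deriv_Imp_iff by (simp add: numeral_2_eq_2)
qed

lemma defined_arrows_elim:
  assumes P: "defines_arrow T A B P" and Q: "defines_arrow T B C Q" and hyps: "wf_hyps T \<Gamma> \<Phi>"
    and \<psi>: "wf_fm (sg T) \<Gamma> \<psi>"
    and step: "\<And>L \<Phi>' f g. extends T L \<Phi>' \<Gamma> \<Phi> \<Longrightarrow>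
      has_sort (sg T) (L @ \<Gamma>) f (Hom (OCon A) (OCon B)) \<Longrightarrow> deriv T (L @ \<Gamma>) \<Phi>' (inst f P) \<Longrightarrow>
      has_sort (sg T) (L @ \<Gamma>) g (Hom (OCon B) (OCon C)) \<Longrightarrow> deriv T (L @ \<Gamma>) \<Phi>' (inst g Q) \<Longrightarrow>
      deriv T (L @ \<Gamma>) \<Phi>' (bind_fm (weaken (length L)) \<psi>)"
  shows "deriv T \<Gamma> \<Phi> \<psi>"
proof (rule deriv_Ex_list_elim[OF \<psi> hyps, where xs = "[True, False]"])
  let ?s = "\<lambda>b. if b then Hom (OCon A) (OCon B) else Hom (OCon B) (OCon C) :: ('o, 'a) srt"
    and ?R = "\<lambda>b. if b then P else Q"
  show "deriv T \<Gamma> \<Phi> (FEx (?s b) (?R b))" for b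
    using defines_arrow_ex[OF P hyps] defines_arrow_ex[OF Q hyps] by simp
  fix L \<Phi>' t
  assume ext: "extends T L \<Phi>' \<Gamma> \<Phi>" and t: "\<And>b. b \<in> set [True, False] \<Longrightarrow>
      has_sort (sg T) (L @ \<Gamma>) (t b) (bind_srt (weaken (length L)) (?s b)) \<and>
      deriv T (L @ \<Gamma>) \<Phi>' (bind_fm (scons (t b) (weaken (length L))) (?R b))"
  have "bind_fm (scons u (weaken (length L))) P = inst u P"
    "bind_fm (scons u (weaken (length L))) Q = inst u Q" for u
    unfolding inst_bind by (rule bind_fm_cong[OF defines_arrow_wf(3)[OF P]]
        bind_fm_cong[OF defines_arrow_wf(3)[OF Q]]; simp add: agree_on_iff)+
  then show "deriv T (L @ \<Gamma>) \<Phi>' (bind_fm (weaken (length L)) \<psi>)"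
    using step[OF ext, of "t True" "t False"] t[of True] t[of False] by simp
qed

lemma defines_arrow_composite:
  assumes P: "defines_arrow T A B P" and Q: "defines_arrow T B C Q"
  shows "defines_arrow T A C (composite_fm A B C P Q)"
proof (rule defines_arrowI)
  let ?R = "composite_fm A B C P Q" and ?s = "Hom (OCon A) (OCon C) :: ('o, 'a) srt"
  note wf_P = defines_arrow_wf[OF P] and wf_Q = defines_arrow_wf[OF Q] and wf = wf_composite_fm[OF P Q]
  show "A \<in> ocons (sg T)" "C \<in> ocons (sg T)" "wf_fm (sg T) [?s] ?R" using wf_P wf_Q wf by simp_all
  then have ex: "sentence (sg T) (FEx ?s ?R)" by (simp add: has_sort_iffs)
  show "deriv T [] {} (FEx ?s ?R)"
  proof (rule defined_arrows_elim[OF P Q wf_hyps_Nil ex])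
    fix L \<Phi>' f g
    assume f: "has_sort (sg T) (L @ []) f (Hom (OCon A) (OCon B))" "deriv T (L @ []) \<Phi>' (inst f P)"
      and g: "has_sort (sg T) (L @ []) g (Hom (OCon B) (OCon C))" "deriv T (L @ []) \<Phi>' (inst g Q)"
    show "deriv T (L @ []) \<Phi>' (bind_fm (weaken (length L)) (FEx ?s ?R))"
      unfolding bind_fm_weaken_sentence[OF ex]
      by (rule deriv.ExI[OF sentence_wf_fm[OF ex] has_sort_Cmp[OF f(1) g(1)] composite_fm_intro[OF P Q f g]])
  qed
  fix \<Gamma> \<Phi> h k
  assume h: "has_sort (sg T) \<Gamma> h ?s" "deriv T \<Gamma> \<Phi> (inst h ?R)"
    and k: "has_sort (sg T) \<Gamma> k ?s" "deriv T \<Gamma> \<Phi> (inst k ?R)"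
  show "deriv T \<Gamma> \<Phi> (FEq h k)"
  proof (rule defined_arrows_elim[OF P Q deriv_wf_hyps[OF h(2)]])
    show "wf_fm (sg T) \<Gamma> (FEq h k)" using h(1) k(1) by auto
    fix L \<Phi>' f g assume ext: "extends T L \<Phi>' \<Gamma> \<Phi>"
      and f: "has_sort (sg T) (L @ \<Gamma>) f (Hom (OCon A) (OCon B))" "deriv T (L @ \<Gamma>) \<Phi>' (inst f P)"
      and g: "has_sort (sg T) (L @ \<Gamma>) g (Hom (OCon B) (OCon C))" "deriv T (L @ \<Gamma>) \<Phi>' (inst g Q)"
    have "deriv T (L @ \<Gamma>) \<Phi>' (FEq (bind_tm (weaken (length L)) t) (Cmp g f))" if "deriv T \<Gamma> \<Phi> (inst t ?R)"
      for t
      using deriv_extends[OF that ext] composite_fm_elim[OF wf_P(3) wf_Q(3) _ f g]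
      by (simp add: bind_fm_inst[OF wf] agree_on_iff)
    then have "deriv T (L @ \<Gamma>) \<Phi>' (FEq (bind_tm (weaken (length L)) h) (bind_tm (weaken (length L)) k))"
      using h(2) k(2) by (blast intro: eq_trans eq_sym)
    then show "deriv T (L @ \<Gamma>) \<Phi>' (bind_fm (weaken (length L)) (FEq h k))" by simp
  qed
qed

end

section \<open>The category of constants\<close>

context pure_theory
begin

lemma def_constant:
  assumes "defines_arrow T1 A B P"
  shows "Def A B P \<in> acons (sg T2)" "cdom (sg T2) (Def A B P) = A" "ccod (sg T2) (Def A B P) = B"
    "deriv T2 [] {} (inst (ACon (Def A B P)) (bind_fm (con_map id Old) P))"
proof -
  have "inst (ACon (Def A B P)) (map_fm id Old P) \<in> axms T2"
    using assms by (auto simp: thy2_eq_fragment fragment_simps arr_defs_def)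
  then show "deriv T2 [] {} (inst (ACon (Def A B P)) (bind_fm (con_map id Old) P))"
    using sentence_axms_thy2 wf_hyps_Nil by (auto simp: map_fm_bind intro: deriv.Axiom)
qed (use assms in \<open>auto simp: thy2_eq_fragment fragment_simps arr_defs_def\<close>)

lemma has_sort_acon: "a \<in> acons (sg U) \<Longrightarrow> has_sort (sg U) \<Gamma> (ACon a)
    (Hom (OCon (cdom (sg U) a)) (OCon (ccod (sg U) a)))"
  by (simp add: has_sort_iffs)

lemma acons_thy2_defined:
  assumes a: "a \<in> acons (sg T2)"
  obtains P where "defines_arrow T1 (cdom (sg T2) a) (ccod (sg T2) a) P"
    "deriv T2 [] {} (inst (ACon a) (bind_fm (con_map id Old) P))"
proof (cases a)
  case (Old c)
  then have c: "c \<in> acons (sg T1)" "cdom (sg T1) c = cdom (sg T2) a" "ccod (sg T1) c = ccod (sg T2) a"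
    using a by (auto simp: thy2_eq_fragment thy1_eq_cst_thy fragment_simps cst_thy_simps(3,4))
  then have "defines_arrow T1 (cdom (sg T2) a) (ccod (sg T2) a) (FEq (Var 0) (ACon c))"
    using t1.sig by (intro t1.defines_arrow_eq_tm) (auto simp: wf_sig_def has_sort_iffs)
  moreover have "deriv T2 [] {} (FEq (ACon a) (ACon a))"
    by (rule t2.eq_refl[OF wf_hyps_Nil has_sort_acon[OF a]])
  ultimately show thesis using that Old by (simp add: inst_bind)
next
  case (Def A B P)
  then have "defines_arrow T1 A B P" using a by (auto simp: thy2_eq_fragment fragment_simps arr_defs_def)
  then show thesis using that def_constant[of A B P] Def by simp
qed

lemma thy2_composite:
  assumes a: "a \<in> acons (sg T2)" and b: "b \<in> acons (sg T2)" and ab: "ccod (sg T2) a = cdom (sg T2) b"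
  obtains c where "c \<in> acons (sg T2)" "cdom (sg T2) c = cdom (sg T2) a" "ccod (sg T2) c = ccod (sg T2) b"
    "deriv T2 [] {} (FEq (Cmp (ACon b) (ACon a)) (ACon c))"
proof -
  let ?A = "cdom (sg T2) a" and ?B = "cdom (sg T2) b" and ?C = "ccod (sg T2) b"
  obtain P where P: "defines_arrow T1 ?A ?B P"
    and aP: "deriv T2 [] {} (inst (ACon a) (bind_fm (con_map id Old) P))"
    using acons_thy2_defined[OF a] unfolding ab by blast
  obtain Q where Q: "defines_arrow T1 ?B ?C Q"
    and bQ: "deriv T2 [] {} (inst (ACon b) (bind_fm (con_map id Old) Q))"
    using acons_thy2_defined[OF b] by blast
  note c = def_constant[OF t1.defines_arrow_composite[OF P Q], unfolded map_composite_fm]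
  have "wf_fm (sg T2) [Hom (OCon A) (OCon B)] (bind_fm (con_map id Old) R)" if "defines_arrow T1 A B R"
    for A B R
    using wf_fm_map_Old defines_arrow_wf(3)[OF that]
    by (simp add: thy2_eq_fragment thy1_eq_cst_thy flip: map_fm_bind)
  from t2.composite_fm_elim[OF this[OF P] this[OF Q] c(4) has_sort_acon[OF a, unfolded ab] aP
      has_sort_acon[OF b] bQ]
  show thesis using that c(1-3) t2.eq_sym by blast
qed

lemma thy2_identity:
  assumes A: "A \<in> ocons (sg T2)"
  obtains c where "c \<in> acons (sg T2)" "cdom (sg T2) c = A" "ccod (sg T2) c = A"
    "deriv T2 [] {} (FEq (Idn (OCon A)) (ACon c))"
proof -
  have "defines_arrow T1 A A (FEq (Var 0) (Idn (OCon A)))"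
    using A by (intro t1.defines_arrow_eq_tm)
       (simp_all add: thy2_eq_fragment thy1_eq_cst_thy fragment_simps has_sort_iffs)
  from def_constant[OF this] show thesis using that t2.eq_sym by (simp add: inst_bind)
qed

definition eq_class :: "acst \<Rightarrow> acst set" where "eq_class a = eq_acst Ax `` {a}"

definition representative :: "acst set \<Rightarrow> acst" where "representative u = (SOME a. a \<in> u)"

lemma equiv_eq_acst: "equiv (acons (sg T2)) (eq_acst Ax)"
proof (rule equivI)
  show "eq_acst Ax \<subseteq> acons (sg T2) \<times> acons (sg T2)" by (auto simp: eq_acst_def)
  show "refl_on (acons (sg T2)) (eq_acst Ax)"
    by (auto simp: refl_on_def eq_acst_def prov_def intro!: t2.eq_refl[OF wf_hyps_Nil has_sort_acon])
  show "sym (eq_acst Ax)" by (auto simp: sym_def eq_acst_def prov_def intro: t2.eq_sym)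
  show "trans (eq_acst Ax)"
  proof (rule transI)
    fix x y z assume "(x, y) \<in> eq_acst Ax" "(y, z) \<in> eq_acst Ax"
    then show "(x, z) \<in> eq_acst Ax"
      using t2.eq_trans[of "[]" "{}" "ACon x" "ACon y" "ACon z"] by (simp add: eq_acst_def prov_def)
  qed
qed

lemma thyc_simps:
  "ocons (sg Tc) = ocons (sg T2)" "acons (sg Tc) = acons (sg T2) // eq_acst Ax"
  "cdom (sg Tc) u = cdom (sg T2) (representative u)" "ccod (sg Tc) u = ccod (sg T2) (representative u)"
  "axms Tc = map_fm id eq_class ` axms T2"
  by (simp_all add: thyc_def eq_class_def[abs_def] representative_def)

lemma eq_acst_representative: "a \<in> acons (sg T2) \<Longrightarrow> (a, representative (eq_class a)) \<in> eq_acst Ax"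
  using someI[of "\<lambda>b. b \<in> eq_acst Ax `` {a}" a] equiv_class_self[OF equiv_eq_acst]
  by (simp add: representative_def eq_class_def)

lemma representative_acons:
  assumes "u \<in> acons (sg Tc)"
  shows "representative u \<in> acons (sg T2)" "eq_class (representative u) = u"
proof -
  obtain a where a: "a \<in> acons (sg T2)" "u = eq_class a"
    using assms by (auto simp: thyc_simps quotient_def eq_class_def)
  have related: "(a, representative u) \<in> eq_acst Ax" using eq_acst_representative[OF a(1)] a(2) by simp
  then show "representative u \<in> acons (sg T2)" by (simp add: eq_acst_def)
  show "eq_class (representative u) = u" using equiv_class_eq[OF equiv_eq_acst related] a(2)
    unfolding eq_class_def by simp
qed

lemma eq_class_acons:
  assumes "a \<in> acons (sg T2)"
  shows "eq_class a \<in> acons (sg Tc)" "cdom (sg Tc) (eq_class a) = cdom (sg T2) a"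
    "ccod (sg Tc) (eq_class a) = ccod (sg T2) a"
proof -
  show "eq_class a \<in> acons (sg Tc)" using assms by (simp add: thyc_simps quotientI eq_class_def)
  show "cdom (sg Tc) (eq_class a) = cdom (sg T2) a" "ccod (sg Tc) (eq_class a) = ccod (sg T2) a"
    using eq_acst_representative[OF assms] unfolding thyc_simps by (simp_all add: eq_acst_def)
qed

lemma wf_sig_thyc: "wf_sig (sg Tc)"
  using wf_sig_thy2 representative_acons(1) unfolding wf_sig_def by (simp add: thyc_simps(1,3,4))

lemma interp_eq_class: "interp (sg T2) [] (sg Tc) [] (con_map id eq_class)"
  by (rule interp_con_map_closed) (simp_all add: thyc_simps(1) eq_class_acons)

lemma interp_representative: "interp (sg Tc) [] (sg T2) [] (con_map id representative)"
  by (rule interp_con_map_closed) (simp_all add: thyc_simps(1,3,4) representative_acons)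

lemma sentence_axms_thyc: "\<alpha> \<in> axms Tc \<Longrightarrow> sentence (sg Tc) \<alpha>"
  unfolding thyc_simps map_fm_bind using wf_fm_bind[OF sentence_axms_thy2 interp_eq_class] by blast

sublocale tc: eq_theory "thyc Ax"
proof
  show "cat_eq_axioms \<subseteq> axms Tc" unfolding thyc_simps
    using cat_eq_axioms_map[of id eq_class] t2.cat_eq by blast
qed (rule wf_sig_thyc)

lemma deriv_eq_class:
  assumes "deriv T2 [] {} \<phi>" shows "deriv Tc [] {} (bind_fm (con_map id eq_class) \<phi>)"
proof (rule deriv_bind[OF assms interp_eq_class wf_hyps_Nil])
  fix \<alpha> assume "\<alpha> \<in> axms T2"
  then have "bind_fm (con_map id eq_class) \<alpha> \<in> axms Tc" unfolding thyc_simps map_fm_bind by blast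
  then show "deriv Tc [] {} (bind_fm (con_map id eq_class) \<alpha>)"
    using sentence_axms_thyc wf_hyps_Nil by (auto intro: deriv.Axiom)
qed simp

lemma deriv_representative:
  assumes "deriv Tc [] {} \<phi>" shows "deriv T2 [] {} (bind_fm (con_map id representative) \<phi>)"
proof (rule deriv_bind[OF assms interp_representative wf_hyps_Nil])
  fix \<alpha> assume "\<alpha> \<in> axms Tc"
  then obtain \<beta> where \<beta>: "\<beta> \<in> axms T2" "\<alpha> = bind_fm (con_map id eq_class) \<beta>"
    by (auto simp: thyc_simps map_fm_bind)
  note sentence = sentence_axms_thy2[OF \<beta>(1)]
  let ?J = "\<lambda>x. bind_tm (con_map id representative) (con_map id eq_class x)"
  have "deriv T2 [] {} (bind_fm ?J \<beta>)"
  proof (rule t2.deriv_bind_eq_arrows[OF wf_sig_thy2 _ sentence wf_hyps_Nil interp_id])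
    show "interp (sg T2) [] (sg T2) [] ?J" by (rule interp_comp[OF interp_eq_class interp_representative])
    show "deriv T2 [] {} (bind_fm atom_tm \<beta>)" using deriv.Axiom[OF wf_hyps_Nil \<beta>(1) sentence] by simp
    show "?J x = atom_tm x" if "has_sort (sg T2) [] (atom_tm x) Ob" for x
      using that by (cases x) (auto simp: has_sort_iffs)
    show "deriv T2 [] {} (FEq (atom_tm x) (?J x))" if "has_sort (sg T2) [] (atom_tm x) (Hom Y Z)" for x Y Z
      using that eq_acst_representative by (cases x) (auto simp: has_sort_iffs eq_acst_def prov_def)
  qed simp
  then show "deriv T2 [] {} (bind_fm (con_map id representative) \<alpha>)" by (simp add: \<beta>(2))
qed simp

lemma Tc_hom_eqI:
  assumes c: "c \<in> Tc_hom Ax A B" and c': "c' \<in> Tc_hom Ax A B" and eq: "prov Tc (FEq (ACon c) (ACon c'))"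
  shows "c = c'"
proof -
  have "deriv T2 [] {} (FEq (ACon (representative c)) (ACon (representative c')))"
    using deriv_representative[OF eq[unfolded prov_def]] by simp
  then have "(representative c, representative c') \<in> eq_acst Ax"
    using c c' representative_acons(1) by (auto simp: Tc_hom_def eq_acst_def prov_def thyc_simps(3,4))
  from equiv_class_eq[OF equiv_eq_acst this] show ?thesis
    using c c' representative_acons(2) by (auto simp: Tc_hom_def eq_class_def)
qed

lemma Tc_hom_ex1I:
  assumes "c \<in> Tc_hom Ax A B" "prov Tc (FEq t (ACon c))"
  shows "\<exists>!c. c \<in> Tc_hom Ax A B \<and> prov Tc (FEq t (ACon c))"
proof (rule ex1I[of _ c])
  fix c' assume c': "c' \<in> Tc_hom Ax A B \<and> prov Tc (FEq t (ACon c'))"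
  then have "prov Tc (FEq (ACon c') (ACon c))" using assms(2)
    unfolding prov_def by (blast intro: tc.eq_trans tc.eq_sym)
  then show "c' = c" using Tc_hom_eqI assms(1) c' by blast
qed (use assms in simp)

lemma Tc_comp_Cmp:
  assumes a: "a \<in> Tc_hom Ax A B" and b: "b \<in> Tc_hom Ax B C"
  shows "Tc_comp Ax b a \<in> Tc_hom Ax A C \<and> prov Tc (FEq (Cmp (ACon b) (ACon a)) (ACon (Tc_comp Ax b a)))"
proof -
  have ab: "a \<in> acons (sg Tc)" "cdom (sg Tc) a = A" "ccod (sg Tc) a = B" "b \<in> acons (sg Tc)"
    "cdom (sg Tc) b = B" "ccod (sg Tc) b = C"
    using a b by (auto simp: Tc_hom_def)
  obtain c where c: "c \<in> acons (sg T2)" "cdom (sg T2) c = A" "ccod (sg T2) c = C"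
    and eq: "deriv T2 [] {} (FEq (Cmp (ACon (representative b)) (ACon (representative a))) (ACon c))"
    using thy2_composite[of "representative a" "representative b"] ab representative_acons(1)
    unfolding thyc_simps(3,4) by metis
  have "prov Tc (FEq (Cmp (ACon b) (ACon a)) (ACon (eq_class c)))"
    using deriv_eq_class[OF eq] ab representative_acons(2) by (simp add: prov_def)
  moreover have "eq_class c \<in> Tc_hom Ax A C" using c eq_class_acons by (simp add: Tc_hom_def)
  ultimately show ?thesis unfolding Tc_comp_def ab using theI'[OF Tc_hom_ex1I] by blast
qed

lemma Tc_id_Idn:
  assumes "A \<in> ocons (sg Tc)"
  shows "Tc_id Ax A \<in> Tc_hom Ax A A \<and> prov Tc (FEq (Idn (OCon A)) (ACon (Tc_id Ax A)))"
proof -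
  obtain c where c: "c \<in> acons (sg T2)" "cdom (sg T2) c = A" "ccod (sg T2) c = A"
    and eq: "deriv T2 [] {} (FEq (Idn (OCon A)) (ACon c))"
    using thy2_identity assms unfolding thyc_simps(1) by blast
  have "prov Tc (FEq (Idn (OCon A)) (ACon (eq_class c)))" using deriv_eq_class[OF eq] by (simp add: prov_def)
  moreover have "eq_class c \<in> Tc_hom Ax A A" using c eq_class_acons by (simp add: Tc_hom_def)
  ultimately show ?thesis unfolding Tc_id_def using theI'[OF Tc_hom_ex1I] by blast
qed

end

section \<open>The predicate \<open>FP\<close>\<close>

locale comma_theory = pure_theory Ax for Ax :: "pfm set" +
  fixes Tiny :: "'u setcat" and one :: cst and gl :: "cst \<Rightarrow> acst set \<Rightarrow> 'u"
begin

abbreviation Tstar :: "('u fobj, 'u farr) sig" where "Tstar \<equiv> Tstar_sig Ax Tiny one gl"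
abbreviation fp :: "('u fobj, 'u farr) fm \<Rightarrow> bool" where "fp \<equiv> FP_star Ax Tiny one gl"
abbreviation minus :: "('u fobj, 'u farr) atom \<Rightarrow> (cst, acst set) tm"
  where "minus \<equiv> con_map obj_minus arr_minus"

lemma F_obj_minus: "X \<in> ocons Tstar \<Longrightarrow> obj_minus X \<in> ocons (sg Tc)"
  by (auto simp: Tstar_sig_def F_obj_def obj_minus_def)

lemma F_arr_minus: "a \<in> acons Tstar \<Longrightarrow> arr_minus a \<in> Tc_hom Ax (obj_minus (cdom Tstar a))
    (obj_minus (ccod Tstar a))"
  by (auto simp: Tstar_sig_def F_arr_def obj_minus_def arr_minus_def)

lemma wf_sig_Tstar: "wf_sig Tstar"
  by (auto simp: wf_sig_def Tstar_sig_def F_arr_def)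

lemma interp_minus: "interp Tstar [] (sg Tc) [] minus"
  by (rule interp_con_map_closed) (use F_obj_minus F_arr_minus in \<open>auto simp: Tc_hom_def\<close>)

lemma F_comp_minus: "arr_minus (F_comp Ax b a) = Tc_comp Ax (arr_minus b) (arr_minus a)"
  by (cases a; cases b) (auto simp: F_comp_def arr_minus_def)

lemma F_id_minus: "arr_minus (F_id Ax A) = Tc_id Ax (obj_minus A)"
  by (cases A) (auto simp: F_id_def arr_minus_def obj_minus_def)

lemma den_minus:
  "has_sort Tstar [] t (Hom (OCon A) (OCon B)) \<Longrightarrow>
      arr_minus (den Ax t) \<in> Tc_hom Ax (obj_minus A) (obj_minus B) \<and>
    prov Tc (FEq (bind_tm minus t) (ACon (arr_minus (den Ax t))))"
proof (induction t arbitrary: A B)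
  case (ACon a)
  then have "arr_minus a \<in> Tc_hom Ax (obj_minus A) (obj_minus B)"
    using F_arr_minus by (auto simp: has_sort_iffs)
  then show ?case using tc.eq_refl[OF wf_hyps_Nil has_sort_acon] by (simp add: Tc_hom_def prov_def)
next
  case (Idn X)
  then have X: "X = OCon A" "B = A" "A \<in> ocons Tstar" by (auto simp: has_sort_iffs)
  then show ?case using Tc_id_Idn[OF F_obj_minus[OF X(3)]] by (simp add: F_id_minus)
next
  case (Cmp g f)
  then obtain Y where f: "has_sort Tstar [] f (Hom (OCon A) Y)" and g: "has_sort Tstar [] g (Hom Y (OCon B))"
    by (auto simp: has_sort_iffs)
  then obtain C where Y: "Y = OCon C"
    using has_sort_dom_cod(2)[OF f wf_sig_Tstar] by (cases Y) (auto simp: has_sort_iffs)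
  note f' = Cmp.IH(2)[OF f[unfolded Y]] and g' = Cmp.IH(1)[OF g[unfolded Y]]
  have comp: "arr_minus (den Ax (Cmp g f)) \<in> Tc_hom Ax (obj_minus A) (obj_minus B)"
    "prov Tc (FEq (Cmp (ACon (arr_minus (den Ax g))) (ACon (arr_minus (den Ax f))))
        (ACon (arr_minus (den Ax (Cmp g f)))))"
    using Tc_comp_Cmp[of "arr_minus (den Ax f)" _ _ "arr_minus (den Ax g)"] f' g' by (auto simp: F_comp_minus)
  have "has_sort (sg Tc) [] (bind_tm minus (Cmp g f)) (bind_srt minus (Hom (OCon A) (OCon B)))"
    by (rule has_sort_bind[OF Cmp.prems interp_minus])
  then have "prov Tc (FEq (bind_tm minus (Cmp g f))
      (Cmp (ACon (arr_minus (den Ax g))) (ACon (arr_minus (den Ax f)))))"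
    using f' g' tc.cmp_cong by (simp add: prov_def)
  with comp show ?case unfolding prov_def by (blast intro: tc.eq_trans)
qed (simp_all add: has_sort_iffs)

lemma Tstar_prov_bind: "Tstar_prov Ax \<phi> \<longleftrightarrow> deriv Tc [] {} (bind_fm minus \<phi>)"
  by (simp add: Tstar_prov_def prov_def map_fm_bind)

lemma fp_simps:
  "fp (FEq s t) \<longleftrightarrow> FEq s t \<in> Tstar_M Ax Tiny one gl"
  "fp FTop" "\<not> fp FBot"
  "fp (FAnd P Q) \<longleftrightarrow> fp P \<and> fp Q"
  "fp (FOr P Q) \<longleftrightarrow> fp P \<or> fp Q"
  "fp (FImp P Q) \<longleftrightarrow> (fp P \<longrightarrow> fp Q) \<and> Tstar_prov Ax (FImp P Q)"
  "fp (FAll r P) \<longleftrightarrow> (\<forall>t. has_sort Tstar [] t r \<longrightarrow> fp (inst t P)) \<and> Tstar_prov Ax (FAll r P)"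
  "fp (FEx r P) \<longleftrightarrow> (\<exists>t. has_sort Tstar [] t r \<and> fp (inst t P))"
  by (simp_all add: FP_star_def)

lemma Tstar_M_prov:
  assumes "FEq s t \<in> Tstar_M Ax Tiny one gl"
  shows "Tstar_prov Ax (FEq s t)"
proof -
  obtain X Y where s: "has_sort Tstar [] s (Hom X Y)" and t: "has_sort Tstar [] t (Hom X Y)"
    and eq: "den Ax s = den Ax t"
    using assms by (auto simp: Tstar_M_def)
  obtain A B where "X = OCon A" "Y = OCon B"
    using has_sort_dom_cod[OF s wf_sig_Tstar] by (cases X; cases Y) (auto simp: has_sort_iffs)
  then have "prov Tc (FEq (bind_tm minus s) (ACon (arr_minus (den Ax s))))"
    "prov Tc (FEq (bind_tm minus t) (ACon (arr_minus (den Ax s))))"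
    using den_minus[of s A B] den_minus[of t A B] s t eq by simp_all
  then show ?thesis unfolding prov_def Tstar_prov_bind bind_fm.simps by (blast intro: tc.eq_trans tc.eq_sym)
qed

lemma Tstar_prov_Ex:
  assumes P: "sentence Tstar (FEx r P)" and t: "has_sort Tstar [] t r" and prov: "Tstar_prov Ax (inst t P)"
  shows "Tstar_prov Ax (FEx r P)"
proof -
  have "deriv Tc [] {} (inst (bind_tm minus t) (bind_fm minus P))"
    using prov by (simp add: Tstar_prov_bind bind_fm_con_map_inst)
  moreover have "sentence (sg Tc) (bind_fm minus (FEx r P))" by (rule wf_fm_bind[OF P interp_minus])
  ultimately show ?thesis using has_sort_bind[OF t interp_minus] by (simp add: Tstar_prov_bind deriv.ExI)
qed

lemma fp_prov: "sentence Tstar \<phi> \<Longrightarrow> fp \<phi> \<Longrightarrow> Tstar_prov Ax \<phi>"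
proof (induction "fm_depth \<phi>" arbitrary: \<phi> rule: less_induct)
  case less
  show ?case
  proof (cases \<phi>)
    case (FEq s t)
    then show ?thesis using less.prems(2) Tstar_M_prov by (simp add: fp_simps)
  next
    case (FAnd P Q)
    then show ?thesis using less by (simp add: fp_simps Tstar_prov_bind deriv_And_iff)
  next
    case (FOr P Q)
    then have "Tstar_prov Ax P \<or> Tstar_prov Ax Q" using less by (auto simp: fp_simps)
    then show ?thesis
      using wf_fm_bind[OF less.prems(1) interp_minus] FOr
      by (auto simp: Tstar_prov_bind intro: deriv.OrI1 deriv.OrI2)
  next
    case (FEx r P)
    then obtain t where t: "has_sort Tstar [] t r" "fp (inst t P)"
      using less.prems(2) by (auto simp: fp_simps)
    have "sentence Tstar (inst t P)" using less.prems(1) FEx t(1) by (auto intro: wf_fm_inst)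
    then have "Tstar_prov Ax (inst t P)" using less.hyps[of "inst t P"] t(2) FEx by simp
    then show ?thesis using Tstar_prov_Ex less.prems(1) t(1) unfolding FEx by blast
  qed (use less.prems in \<open>simp_all add: fp_simps Tstar_prov_bind deriv_Top_iff wf_hyps_Nil\<close>)
qed

lemma emb_axiom_thyc:
  assumes "\<alpha> \<in> Ax"
  shows "deriv Tc [] {} (emb \<alpha>)"
proof -
  have "(emb \<alpha> :: (cst, cst) fm) \<in> axms T1" using assms by (simp add: thy1_eq_cst_thy cst_thy_simps)
  then have "emb \<alpha> \<in> map_fm id Old ` axms T1"
    by (rule rev_image_eqI) (simp add: map_fm_bind bind_fm_emb[OF assms])
  then have "emb \<alpha> \<in> axms T2" by (simp add: thy2_eq_fragment fragment_simps thy1_eq_cst_thy)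
  then have "emb \<alpha> \<in> map_fm id eq_class ` axms T2"
    by (rule rev_image_eqI) (simp add: map_fm_bind bind_fm_emb[OF assms])
  then have "emb \<alpha> \<in> axms Tc" by (simp add: thyc_simps)
  then show ?thesis using sentence_axms_thyc wf_hyps_Nil by (auto intro: deriv.Axiom)
qed

lemma deriv_Tstar:
  assumes derivation: "deriv T \<Gamma> \<Phi> \<phi>" and I: "interp \<Sigma> \<Gamma> Tstar [] I" and hyps: "\<And>\<chi>. \<chi> \<in> \<Phi> \<Longrightarrow> fp (bind_fm I \<chi>)"
  shows "Tstar_prov Ax (bind_fm I \<phi>)"
proof -
  let ?J = "\<lambda>x. bind_tm minus (I x)"
  have "deriv Tc [] {} (bind_fm ?J \<phi>)"
  proof (rule deriv_bind[OF derivation interp_comp[OF I interp_minus] wf_hyps_Nil])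
    fix \<chi> assume \<chi>: "\<chi> \<in> \<Phi>"
    then have "sentence Tstar (bind_fm I \<chi>)"
      using deriv_wf_hyps[OF derivation] I by (auto simp: wf_hyps_def intro: wf_fm_bind)
    from fp_prov[OF this hyps[OF \<chi>]] show "deriv Tc [] {} (bind_fm ?J \<chi>)" by (simp add: Tstar_prov_bind)
  next
    fix \<alpha> assume "\<alpha> \<in> axms T" "sentence \<Sigma> \<alpha>"
    then show "deriv Tc [] {} (bind_fm ?J \<alpha>)" using emb_axiom_thyc by (simp add: bind_fm_pure_sentence)
  qed
  then show ?thesis by (simp add: Tstar_prov_bind)
qed

lemma fp_bind_All: "fp (bind_fm I (FAll s P)) \<longleftrightarrow>
    (\<forall>t. has_sort Tstar [] t (bind_srt I s) \<longrightarrow> fp (bind_fm (scons t I) P)) \<and>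
        Tstar_prov Ax (bind_fm I (FAll s P))"
  by (simp add: fp_simps inst_bind lift_def)

lemma fp_bind_Ex: "fp (bind_fm I (FEx s P)) \<longleftrightarrow>
    (\<exists>t. has_sort Tstar [] t (bind_srt I s) \<and> fp (bind_fm (scons t I) P))"
  by (simp add: fp_simps inst_bind lift_def)

theorem fp_sound:
  assumes axioms: "\<And>\<phi>. \<phi> \<in> Ax \<Longrightarrow> fp (emb \<phi>)"
  shows "deriv T \<Gamma> \<Phi> \<phi> \<Longrightarrow> interp \<Sigma> \<Gamma> Tstar [] I \<Longrightarrow> (\<And>\<chi>. \<chi> \<in> \<Phi> \<Longrightarrow> fp (bind_fm I \<chi>)) \<Longrightarrow> fp (bind_fm I \<phi>)"
proof (induction arbitrary: I rule: deriv.induct)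
  case (Axiom \<Gamma> \<Phi> \<phi>)
  then show ?case using axioms by (simp add: bind_fm_pure_sentence)
next
  case (BotE \<Gamma> \<Phi> \<phi>)
  then show ?case using BotE.IH[OF BotE.prems] by (simp add: fp_simps)
next
  case (AndE1 \<Gamma> \<Phi> \<phi> \<psi>)
  then show ?case using AndE1.IH[OF AndE1.prems] by (simp add: fp_simps)
next
  case (AndE2 \<Gamma> \<Phi> \<phi> \<psi>)
  then show ?case using AndE2.IH[OF AndE2.prems] by (simp add: fp_simps)
next
  case (OrE \<Gamma> \<Phi> \<phi> \<psi> \<chi>)
  consider "fp (bind_fm I \<phi>)" | "fp (bind_fm I \<psi>)" using OrE.IH(1)[OF OrE.prems] by (auto simp: fp_simps)
  then show ?case by cases (use OrE.IH(2,3) OrE.prems in auto)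
next
  case (ImpI \<Gamma> \<phi> \<Phi> \<psi>)
  have "Tstar_prov Ax (bind_fm I (FImp \<phi> \<psi>))" by (rule deriv_Tstar[OF deriv.ImpI[OF ImpI.hyps] ImpI.prems])
  moreover have "fp (bind_fm I \<psi>)" if "fp (bind_fm I \<phi>)" using ImpI.prems that by (intro ImpI.IH) auto
  ultimately show ?case by (simp add: fp_simps)
next
  case (ImpE \<Gamma> \<Phi> \<phi> \<psi>)
  then show ?case using ImpE.IH[OF ImpE.prems] by (simp add: fp_simps)
next
  case (AllI s \<Gamma> \<Phi> \<phi>)
  have "Tstar_prov Ax (bind_fm I (FAll s \<phi>))" by (rule deriv_Tstar[OF deriv.AllI[OF AllI.hyps] AllI.prems])
  moreover have "fp (bind_fm (scons t I) \<phi>)" if t: "has_sort Tstar [] t (bind_srt I s)" for t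
    by (rule AllI.IH[OF interp_scons[OF AllI.prems(1) t]]) (use AllI.prems(2) in \<open>auto simp: subst_fm_shift1\<close>)
  ultimately show ?case unfolding fp_bind_All by blast
next
  case (AllE \<Gamma> \<Phi> s \<phi> t)
  then have "fp (bind_fm (scons (bind_tm I t) I) \<phi>)"
    using AllE.IH[OF AllE.prems] has_sort_bind[OF AllE.hyps(2) AllE.prems(1)] unfolding fp_bind_All by blast
  then show ?case by (simp add: inst_bind)
next
  case (ExI \<Gamma> s \<phi> t \<Phi>)
  have "fp (bind_fm (scons (bind_tm I t) I) \<phi>)" using ExI.IH[OF ExI.prems] by (simp add: inst_bind)
  then show ?case using has_sort_bind[OF ExI.hyps(2) ExI.prems(1)] unfolding fp_bind_Ex by blast
next
  case (ExE \<Gamma> \<Phi> s \<phi> \<psi>)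
  obtain t where t: "has_sort Tstar [] t (bind_srt I s)" "fp (bind_fm (scons t I) \<phi>)"
    using ExE.IH(1)[OF ExE.prems] unfolding fp_bind_Ex by blast
  have "fp (bind_fm (scons t I) (subst_fm (shift 1) \<psi>))"
    by (rule ExE.IH(2)[OF interp_scons[OF ExE.prems(1) t(1)]])
       (use ExE.prems(2) t(2) in \<open>auto simp: subst_fm_shift1\<close>)
  then show ?case by (simp add: subst_fm_shift1)
qed (auto simp: fp_simps)

lemma fp_exsE:
  assumes "fp (bind_fm I (exs \<Theta> P))"
  obtains J where "interp \<Sigma> \<Theta> Tstar [] J" "fp (bind_fm J P)"
proof -
  have "\<exists>J. interp \<Sigma> \<Theta> Tstar [] J \<and> fp (bind_fm J P)"
    using assms
  proof (induction \<Theta> arbitrary: P)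
    case Nil
    then show ?case using interp_pure_closed by auto
  next
    case (Cons s \<Theta>)
    obtain J where J: "interp \<Sigma> \<Theta> Tstar [] J" "fp (bind_fm J (FEx s P))"
      using Cons.IH[of "FEx s P"] Cons.prems by auto
    then obtain t where t: "has_sort Tstar [] t (bind_srt J s)" "fp (bind_fm (scons t J) P)"
      unfolding fp_bind_Ex by blast
    then show ?case using interp_scons[OF J(1) t(1)] by blast
  qed
  then show thesis using that by blast
qed

lemma fp_realization:
  assumes \<Theta>: "wf_ctx \<Sigma> \<Theta>" and P: "wf_fm \<Sigma> \<Theta> P" and J: "interp \<Sigma> \<Theta> Tstar [] J" and fp: "fp (bind_fm J P)"
  obtains \<Delta> Q v where "uniquely_exists Ax \<Delta> Q" "witness \<Delta> {Q} \<Theta> P v"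
proof -
  have "deriv Tc [] {} (bind_fm minus (bind_fm J P))"
    using fp_prov[OF wf_fm_bind[OF P J] fp] by (simp add: Tstar_prov_bind)
  from deriv_representative[OF this]
  have "deriv T2 [] {} (bind_fm (\<lambda>x. bind_tm (con_map id representative) (bind_tm minus (J x))) P)" by simp
  from thy2_realization[OF \<Theta> P interp_comp[OF interp_comp[OF J interp_minus] interp_representative] this]
  show thesis using that by blast
qed

lemma fp_sentence_prov:
  assumes \<phi>: "sentence \<Sigma> \<phi>" and fp: "fp (emb \<phi>)"
  shows "prov T \<phi>"
proof -
  have "fp (bind_fm undefined \<phi>)" using fp by (simp add: bind_fm_pure_sentence[OF \<phi>])
  with \<phi> obtain \<Delta> Q v where u: "uniquely_exists Ax \<Delta> Q" and v: "witness \<Delta> {Q} [] \<phi> v"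
    by (rule fp_realization[OF _ _ interp_pure_closed, rotated]) simp_all
  have "deriv T \<Delta> {Q} \<phi>" using witnessD(2)[OF v] by (simp add: bind_fm_var_subst_sentence[OF \<phi>])
  then show ?thesis
    unfolding prov_def using \<phi>
    by (intro deriv_exsE[OF uniquely_existsD(3)[OF u]]) (simp_all add: bind_fm_weaken_sentence[OF \<phi>])
qed

lemma fp_prov_emb:
  assumes axioms: "\<And>\<phi>. \<phi> \<in> Ax \<Longrightarrow> fp (emb \<phi>)" and \<phi>: "prov T \<phi>"
  shows "fp (emb \<phi>)"
proof -
  have "sentence \<Sigma> \<phi>" using \<phi> deriv_wf_fm by (auto simp: prov_def)
  then show ?thesis
    using fp_sound[OF axioms \<phi>[unfolded prov_def] interp_pure_closed, of undefined]
    by (simp add: bind_fm_pure_sentence)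
qed

lemma consistent_pure:
  assumes "\<And>\<phi>. \<phi> \<in> Ax \<Longrightarrow> fp (emb \<phi>)"
  shows "consistent T"
  unfolding consistent_def using fp_prov_emb[OF assms, of FBot] by (auto simp: emb_bind fp_simps)

lemma disjunction_property_pure:
  assumes "\<And>\<phi>. \<phi> \<in> Ax \<Longrightarrow> fp (emb \<phi>)"
  shows "disjunction_property T"
  unfolding disjunction_property_def
proof (intro allI impI, elim conjE)
  fix P Q assume P: "sentence \<Sigma> P" and Q: "sentence \<Sigma> Q" and disj: "prov T (FOr P Q)"
  have "fp (emb P) \<or> fp (emb Q)" using fp_prov_emb[OF assms disj] by (simp add: emb_bind fp_simps)
  then show "prov T P \<or> prov T Q" using fp_sentence_prov P Q by blast
qed

lemma existence_property_pure:
  assumes "\<And>\<phi>. \<phi> \<in> Ax \<Longrightarrow> fp (emb \<phi>)"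
  shows "existence_property T"
  unfolding existence_property_def
proof (intro allI impI, elim conjE)
  fix \<Theta> P assume \<Theta>: "wf_ctx \<Sigma> \<Theta>" and P: "wf_fm \<Sigma> \<Theta> P" and ex: "prov T (exs \<Theta> P)"
  obtain J where J: "interp \<Sigma> \<Theta> Tstar [] J" "fp (bind_fm J P)"
    using fp_prov_emb[OF assms ex] unfolding emb_bind by (rule fp_exsE)
  obtain \<Delta> Q v where u: "uniquely_exists Ax \<Delta> Q"
    and v: "witness \<Delta> {Q} \<Theta> P v" by (rule fp_realization[OF \<Theta> P J])
  show "\<exists>\<Delta> c Q. wf_ctx \<Sigma> \<Delta> \<and> assignment \<Sigma> \<Theta> \<Delta> c \<and> wf_fm \<Sigma> \<Delta> Q \<and>
      prov T (ex_unique \<Delta> Q) \<and> prov T (exs \<Delta> (FAnd Q (subst_fm (\<lambda>i. c ! i) P)))"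
    using uniquely_existsD[OF u] witness_assignment[OF \<Theta> v] witness_prov_exs[OF u P v] by blast
qed

end

theorem mainTheorem7:
  fixes Ax :: "pfm set" and Tiny :: "'u setcat" and one :: cst and gl :: "cst \<Rightarrow> acst set \<Rightarrow> 'u"
  assumes "recursive_pure_theory Ax"
    and "\<forall>\<phi>\<in>cwp_heyting_pretopos_axioms. prov (pure_thy Ax) \<phi>"
    and "tiny_model Ax Tiny"
    and "provably_terminal Ax one"
    and "Gl_into Ax Tiny one gl"
    and "\<forall>\<phi>\<in>Ax. FP_star Ax Tiny one gl (emb \<phi>)"
  shows "consistent (pure_thy Ax) \<and> existence_property (pure_thy Ax) \<and> disjunction_property (pure_thy Ax)"
proof -
  interpret comma_theory Ax Tiny one gl
    by standard (use assms(1) in \<open>auto simp: recursive_pure_theory_def\<close>)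
  have "FP_star Ax Tiny one gl (emb \<phi>)" if "\<phi> \<in> Ax" for \<phi> using assms(6) that by blast
  then show ?thesis using consistent_pure existence_property_pure disjunction_property_pure by blast
qed

end
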